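(* Let $\mathfrak g$ be of type $A$, $B$, $C$ or $\mathrm G_2$, and let $B_\epsilon=B_{\epsilon_1}\otimes\cdots\otimes B_{\epsilon_m}$ be a tensor word in the fundamental crystals whose labels $\epsilon_1,\dots,\epsilon_m$ are weakly increasing or weakly decreasing. Then $$j_\epsilon=\prod_{k=1}^{m-1}j_{k,k+1},$$ where $j_{k,k+1}=\mathrm{id}\otimes j_{(\epsilon_k,\epsilon_{k+1})}\otimes\mathrm{id}$ is the Jones--Wenzl projector applied to the adjacent strands $k,k+1$. Equivalently, one has the recursive formula $$j_m=(j_{m-1}\otimes\mathrm{id})\circ(\mathrm{id}\otimes j_2)=(\mathrm{id}\otimes j_2)\circ(j_{m-1}\otimes\mathrm{id}),$$ where $j_m$ and $j_{m-1}$ denote the Jones--Wenzl projectors on the first $m$ and the first $m-1$ strands, and $j_2$ is the Jones--Wenzl projector on the last two strands $m-1,m$.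
   Context: $\mathfrak g$ is a simple complex Lie algebra with fundamental weights $\omega_1,\dots,\omega_n$ indexed by the usual (standard) labeling of the vertices of the Dynkin diagram (so $\omega_n$ is the spin weight in type $B_n$), and $B_i=B(\omega_i)$ is the crystal of the $i$th fundamental representation, with Kashiwara operators $e_i,f_i:B\to B\sqcup\{0\}$, $\varepsilon_i(b)=\max\{m:e_i^mb\ne0\}$, $\varphi_i(b)=\max\{m:f_i^mb\ne0\}$. Tensor products of crystals use the convention $e_i(b\otimes c)=e_ib\otimes c$ if $\varphi_i(b)\ge\varepsilon_i(c)$ and $b\otimes e_ic$ otherwise; $f_i(b\otimes c)=f_ib\otimes c$ if $\varphi_i(b)>\varepsilon_i(c)$ and $b\otimes f_ic$ otherwise. A (strict) crystal morphism is a map $B\sqcup\{0\}\to C\sqcup\{0\}$ with $0\mapsto 0$, preserving weights of elements not sent to $0$, and commuting with all $e_i,f_i$; morphisms in $\mathfrak g$-Crys are linear combinations (over a field $\Bbbk$) of these. The top component of a tensor word $B_\epsilon$ is its unique connected component of highest weight $\sum_k\omega_{\epsilon_k}$. The Jones--Wenzl projector $j_\epsilon\in\mathrm{End}(B_\epsilon)$ is the identity on the top component and zero on all other components. Products denote composition. *)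

theory Defs
  imports
    "HOL-Computational_Algebra.Computational_Algebra"
    "HOL-Library.Poly_Mapping"
begin

section \<open>Cartan data of types A, B, C and G2\<close>

datatype cartan_type = TypeA nat | TypeB nat | TypeC nat | TypeG2

fun rank :: "cartan_type \<Rightarrow> nat" where
  "rank (TypeA n) = n"
| "rank (TypeB n) = n"
| "rank (TypeC n) = n"
| "rank TypeG2 = 2"

fun valid_type :: "cartan_type \<Rightarrow> bool" where
  "valid_type (TypeA n) \<longleftrightarrow> n \<ge> 1"
| "valid_type (TypeB n) \<longleftrightarrow> n \<ge> 2"
| "valid_type (TypeC n) \<longleftrightarrow> n \<ge> 2"
| "valid_type TypeG2 \<longleftrightarrow> True"

definition nodes :: "cartan_type \<Rightarrow> nat set" where
  "nodes T = {1..rank T}"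

text \<open>
  Bourbaki labelling. The entries are \<open>a\<^sub>i\<^sub>j = \<langle>h\<^sub>i, \<alpha>\<^sub>j\<rangle> = 2(\<alpha>\<^sub>i,\<alpha>\<^sub>j)/(\<alpha>\<^sub>i,\<alpha>\<^sub>i)\<close>. The root \<open>\<alpha>\<^sub>n\<close> is
  short in type B and long in type C; \<open>\<alpha>\<^sub>1\<close> is the short simple root of G2.
\<close>

fun short_long_entry :: "cartan_type \<Rightarrow> nat \<Rightarrow> nat \<Rightarrow> int" where
  "short_long_entry (TypeA n) i j = -1"
| "short_long_entry (TypeB n) i j = (if i = n then -2 else -1)"
| "short_long_entry (TypeC n) i j = (if j = n then -2 else -1)"
| "short_long_entry TypeG2 i j = (if i = 1 then -3 else -1)"

definition cartan :: "cartan_type \<Rightarrow> nat \<Rightarrow> nat \<Rightarrow> int" where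
  "cartan T i j =
     (if i = j then 2
      else if i = Suc j \<or> j = Suc i then short_long_entry T i j
      else 0)"

text \<open>The integers \<open>d\<^sub>i = (\<alpha>\<^sub>i,\<alpha>\<^sub>i)/2\<close>, with short roots normalised to \<open>d\<^sub>i = 1\<close>.\<close>

fun symmetrizer :: "cartan_type \<Rightarrow> nat \<Rightarrow> nat" where
  "symmetrizer (TypeA n) i = 1"
| "symmetrizer (TypeB n) i = (if i = n then 1 else 2)"
| "symmetrizer (TypeC n) i = (if i = n then 2 else 1)"
| "symmetrizer TypeG2 i = (if i = 1 then 1 else 3)"

text \<open>An integral weight \<open>\<mu>\<close> is given by the numbers \<open>\<mu> i = \<langle>h\<^sub>i, \<mu>\<rangle>\<close>.\<close>

type_synonym weight = "nat \<Rightarrow> int"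

definition weights :: "cartan_type \<Rightarrow> weight set" where
  "weights T = {\<mu>. \<forall>i. i \<notin> nodes T \<longrightarrow> \<mu> i = 0}"

definition fund_weight :: "nat \<Rightarrow> weight" where
  "fund_weight i = (\<lambda>j. if j = i then 1 else 0)"


section \<open>Modules over the quantised enveloping algebra\<close>

text \<open>The field \<open>\<rat>(q)\<close> and its subring of rational functions that are regular at \<open>q = 0\<close>.\<close>

type_synonym ratfun = "rat poly fract"

definition qvar :: ratfun where
  "qvar = Fract [:0, 1:] 1"

definition regular0 :: "ratfun set" where
  "regular0 = {Fract a b | a b. poly b 0 \<noteq> 0}"

definition qi :: "cartan_type \<Rightarrow> nat \<Rightarrow> ratfun" where
  "qi T i = qvar ^ symmetrizer T i"

definition qint :: "cartan_type \<Rightarrow> nat \<Rightarrow> nat \<Rightarrow> ratfun" where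
  "qint T i m = (qi T i ^ m - inverse (qi T i ^ m)) / (qi T i - inverse (qi T i))"

definition qfact :: "cartan_type \<Rightarrow> nat \<Rightarrow> nat \<Rightarrow> ratfun" where
  "qfact T i m = (\<Prod>k=1..m. qint T i k)"

text \<open>
  A vector space over \<open>\<rat>(q)\<close> on the additive group \<open>'v\<close>, with the action of the generators
  \<open>E\<^sub>i, F\<^sub>i, K\<^sub>i, K\<^sub>i\<^sup>-\<^sup>1\<close> of \<open>U\<^sub>q(\<gg>)\<close>, where \<open>K\<^sub>i\<close> is \<open>q\<close> to the power \<open>d\<^sub>i h\<^sub>i\<close>. The scalar
  multiplication is part of the record, so that modules of different dimensions can share one type:
  all nonzero \<open>\<rat>(q)\<close>-spaces of at most countable dimension have isomorphic additive groups, hence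
  all irreducible highest weight modules are realised on a single \<open>'v\<close>.
\<close>

record 'v uq_rep =
  smul :: "ratfun \<Rightarrow> 'v \<Rightarrow> 'v"
  opE :: "nat \<Rightarrow> 'v \<Rightarrow> 'v"
  opF :: "nat \<Rightarrow> 'v \<Rightarrow> 'v"
  opK :: "nat \<Rightarrow> 'v \<Rightarrow> 'v"
  opKinv :: "nat \<Rightarrow> 'v \<Rightarrow> 'v"

definition dpowE ::
  "cartan_type \<Rightarrow> 'v uq_rep \<Rightarrow> nat \<Rightarrow> nat \<Rightarrow> 'v \<Rightarrow> 'v" where
  "dpowE T M i m v = smul M (inverse (qfact T i m)) ((opE M i ^^ m) v)"

definition dpowF ::
  "cartan_type \<Rightarrow> 'v uq_rep \<Rightarrow> nat \<Rightarrow> nat \<Rightarrow> 'v \<Rightarrow> 'v" where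
  "dpowF T M i m v = smul M (inverse (qfact T i m)) ((opF M i ^^ m) v)"

definition uq_module :: "cartan_type \<Rightarrow> 'v::ab_group_add uq_rep \<Rightarrow> bool" where
  "uq_module T M \<longleftrightarrow>
     vector_space (smul M) \<and>
     (\<forall>i\<in>nodes T.
        Vector_Spaces.linear (smul M) (smul M) (opE M i) \<and>
        Vector_Spaces.linear (smul M) (smul M) (opF M i) \<and>
        Vector_Spaces.linear (smul M) (smul M) (opK M i) \<and>
        Vector_Spaces.linear (smul M) (smul M) (opKinv M i)) \<and>
     (\<forall>i\<in>nodes T. \<forall>v. opK M i (opKinv M i v) = v \<and> opKinv M i (opK M i v) = v) \<and>
     (\<forall>i\<in>nodes T. \<forall>j\<in>nodes T. \<forall>v.
        opK M i (opK M j v) = opK M j (opK M i v) \<and>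
        opK M i (opE M j v) = smul M (qi T i powi cartan T i j) (opE M j (opK M i v)) \<and>
        opK M i (opF M j v) = smul M (qi T i powi (- cartan T i j)) (opF M j (opK M i v)) \<and>
        opE M i (opF M j v) - opF M j (opE M i v) =
          (if i = j
           then smul M (inverse (qi T i - inverse (qi T i))) (opK M i v - opKinv M i v)
           else 0)) \<and>
     (\<forall>i\<in>nodes T. \<forall>j\<in>nodes T. \<forall>v. i \<noteq> j \<longrightarrow>
        (let r = nat (1 - cartan T i j) in
           (\<Sum>k\<le>r. smul M ((-1) ^ k) (dpowE T M i (r - k) (opE M j (dpowE T M i k v)))) = 0 \<and>
           (\<Sum>k\<le>r. smul M ((-1) ^ k) (dpowF T M i (r - k) (opF M j (dpowF T M i k v)))) = 0))"

definition weight_space :: "cartan_type \<Rightarrow> 'v uq_rep \<Rightarrow> weight \<Rightarrow> 'v set" where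
  "weight_space T M \<mu> = {v. \<forall>i\<in>nodes T. opK M i v = smul M (qi T i powi \<mu> i) v}"

definition integrable_module :: "cartan_type \<Rightarrow> 'v::ab_group_add uq_rep \<Rightarrow> bool" where
  "integrable_module T M \<longleftrightarrow>
     uq_module T M \<and>
     module.span (smul M) (\<Union>\<mu>\<in>weights T. weight_space T M \<mu>) = UNIV \<and>
     (\<forall>i\<in>nodes T. \<forall>v. (\<exists>m. (opE M i ^^ m) v = 0) \<and> (\<exists>m. (opF M i ^^ m) v = 0))"

text \<open>\<open>M\<close> is the irreducible module \<open>V(\<Lambda>)\<close>, with highest weight vector \<open>u\<close>.\<close>

definition irreducible_hw_module ::
  "cartan_type \<Rightarrow> 'v::ab_group_add uq_rep \<Rightarrow> weight \<Rightarrow> 'v \<Rightarrow> bool" where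
  "irreducible_hw_module T M \<Lambda> u \<longleftrightarrow>
     uq_module T M \<and>
     u \<noteq> 0 \<and> u \<in> weight_space T M \<Lambda> \<and> (\<forall>i\<in>nodes T. opE M i u = 0) \<and>
     (\<forall>W. module.subspace (smul M) W \<and>
          (\<forall>i\<in>nodes T. \<forall>w\<in>W. opE M i w \<in> W \<and> opF M i w \<in> W \<and>
                               opK M i w \<in> W \<and> opKinv M i w \<in> W)
          \<longrightarrow> W = {0} \<or> W = UNIV)"


section \<open>Kashiwara operators and crystal bases\<close>

text \<open>
  \<open>x\<close> is the sum of the vectors \<open>F\<^sub>i\<^sup>(\<^sup>n\<^sup>) c (\<mu>, n)\<close>, where \<open>c (\<mu>, n)\<close> has weight \<open>\<mu>\<close>, is killed by
  \<open>E\<^sub>i\<close> and vanishes unless \<open>n \<le> \<langle>h\<^sub>i, \<mu>\<rangle>\<close>. On an integrable module such a decomposition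
  exists and is unique.
\<close>

definition string_decomp ::
  "cartan_type \<Rightarrow> 'v::ab_group_add uq_rep \<Rightarrow> nat \<Rightarrow> 'v \<Rightarrow> (weight \<times> nat \<Rightarrow> 'v) \<Rightarrow> bool" where
  "string_decomp T M i x c \<longleftrightarrow>
     finite {p. c p \<noteq> 0} \<and>
     (\<forall>\<mu> n. c (\<mu>, n) \<noteq> 0 \<longrightarrow>
        \<mu> \<in> weights T \<and> c (\<mu>, n) \<in> weight_space T M \<mu> \<and>
        opE M i (c (\<mu>, n)) = 0 \<and> int n \<le> \<mu> i) \<and>
     x = (\<Sum>p | c p \<noteq> 0. dpowF T M i (snd p) (c p))"

definition kashiwara_e ::
  "cartan_type \<Rightarrow> 'v::ab_group_add uq_rep \<Rightarrow> nat \<Rightarrow> 'v \<Rightarrow> 'v" where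
  "kashiwara_e T M i x =
     (THE y. \<exists>c. string_decomp T M i x c \<and>
        y = (\<Sum>p | c p \<noteq> 0. if snd p = 0 then 0 else dpowF T M i (snd p - 1) (c p)))"

definition kashiwara_f ::
  "cartan_type \<Rightarrow> 'v::ab_group_add uq_rep \<Rightarrow> nat \<Rightarrow> 'v \<Rightarrow> 'v" where
  "kashiwara_f T M i x =
     (THE y. \<exists>c. string_decomp T M i x c \<and>
        y = (\<Sum>p | c p \<noteq> 0. dpowF T M i (Suc (snd p)) (c p)))"

text \<open>The coset \<open>x + qL\<close>, as a set of vectors.\<close>

definition coset :: "'v::ab_group_add uq_rep \<Rightarrow> 'v set \<Rightarrow> 'v \<Rightarrow> 'v set" where
  "coset M L x = {y. \<exists>z\<in>L. y = x + smul M qvar z}"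

text \<open>The map on \<open>L/qL\<close> induced by a linear map that preserves \<open>L\<close>.\<close>

definition induced ::
  "'v::ab_group_add uq_rep \<Rightarrow> 'v set \<Rightarrow> ('v \<Rightarrow> 'v) \<Rightarrow> 'v set \<Rightarrow> 'v set" where
  "induced M L g b = (\<Union>x\<in>b. coset M L (g x))"

definition crystal_lattice ::
  "cartan_type \<Rightarrow> 'v::ab_group_add uq_rep \<Rightarrow> 'v set \<Rightarrow> bool" where
  "crystal_lattice T M L \<longleftrightarrow>
     (\<exists>S. \<not> module.dependent (smul M) S \<and> module.span (smul M) S = UNIV \<and>
          L = {\<Sum>s\<in>S'. smul M (a s) s | S' a. finite S' \<and> S' \<subseteq> S \<and> a ` S' \<subseteq> regular0}) \<and>
     (\<forall>x\<in>L. \<exists>P c. finite P \<and> P \<subseteq> weights T \<and>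
          (\<forall>\<mu>\<in>P. c \<mu> \<in> L \<inter> weight_space T M \<mu>) \<and> x = (\<Sum>\<mu>\<in>P. c \<mu>)) \<and>
     (\<forall>i\<in>nodes T. kashiwara_e T M i ` L \<subseteq> L \<and> kashiwara_f T M i ` L \<subseteq> L)"

text \<open>\<open>B\<close> is a \<open>\<rat>\<close>-basis of \<open>L/qL\<close>.\<close>

definition basis_mod_q ::
  "'v::ab_group_add uq_rep \<Rightarrow> 'v set \<Rightarrow> 'v set set \<Rightarrow> bool" where
  "basis_mod_q M L B \<longleftrightarrow>
     B \<subseteq> coset M L ` L \<and>
     (\<forall>r. (\<forall>b\<in>B. r b \<in> b) \<longrightarrow>
        (\<forall>x\<in>L. \<exists>!c :: 'v set \<Rightarrow> rat.
           finite {b. c b \<noteq> 0} \<and> {b. c b \<noteq> 0} \<subseteq> B \<and>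
           x \<in> coset M L (\<Sum>b | c b \<noteq> 0. smul M (Fract [:c b:] 1) (r b))))"

definition crystal_base ::
  "cartan_type \<Rightarrow> 'v::ab_group_add uq_rep \<Rightarrow> 'v set \<Rightarrow> 'v set set \<Rightarrow> bool" where
  "crystal_base T M L B \<longleftrightarrow>
     integrable_module T M \<and> crystal_lattice T M L \<and> basis_mod_q M L B \<and>
     (\<forall>b\<in>B. \<exists>\<mu>\<in>weights T. b \<inter> L \<inter> weight_space T M \<mu> \<noteq> {}) \<and>
     (\<forall>i\<in>nodes T. \<forall>b\<in>B.
        induced M L (kashiwara_e T M i) b \<in> insert (coset M L 0) B \<and>
        induced M L (kashiwara_f T M i) b \<in> insert (coset M L 0) B) \<and>
     (\<forall>i\<in>nodes T. \<forall>b\<in>B. \<forall>b'\<in>B.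
        b' = induced M L (kashiwara_f T M i) b \<longleftrightarrow> b = induced M L (kashiwara_e T M i) b')"

definition f_string :: "cartan_type \<Rightarrow> 'v::ab_group_add uq_rep \<Rightarrow> nat list \<Rightarrow> 'v \<Rightarrow> 'v" where
  "f_string T M is u = foldr (kashiwara_f T M) is u"

text \<open>
  Kashiwara's \<open>L(\<Lambda>)\<close> and \<open>B(\<Lambda>)\<close>: the span over the regular rational functions of all vectors
  obtained from \<open>u\<close> by Kashiwara operators \<open>f\<close>, and the nonzero images of these vectors modulo \<open>q\<close>.
\<close>

definition hw_lattice ::
  "cartan_type \<Rightarrow> 'v::ab_group_add uq_rep \<Rightarrow> 'v \<Rightarrow> 'v set" where
  "hw_lattice T M u =
     {\<Sum>is\<in>S. smul M (a is) (f_string T M is u) | S a.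
        finite S \<and> S \<subseteq> lists (nodes T) \<and> a ` S \<subseteq> regular0}"

definition hw_basis ::
  "cartan_type \<Rightarrow> 'v::ab_group_add uq_rep \<Rightarrow> 'v \<Rightarrow> 'v set set" where
  "hw_basis T M u =
     (\<lambda>is. coset M (hw_lattice T M u) (f_string T M is u)) ` lists (nodes T)
       - {coset M (hw_lattice T M u) 0}"


section \<open>Crystals\<close>

text \<open>The value \<open>None\<close> plays the role of the extra element \<open>0\<close>.\<close>

record 'b crystal =
  elems :: "'b set"
  wt :: "'b \<Rightarrow> weight"
  eop :: "nat \<Rightarrow> 'b \<Rightarrow> 'b option"
  fop :: "nat \<Rightarrow> 'b \<Rightarrow> 'b option"

definition crystal_of_base ::
  "cartan_type \<Rightarrow> 'v::ab_group_add uq_rep \<Rightarrow> 'v set \<Rightarrow> 'v set set \<Rightarrow> 'v set crystal" where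
  "crystal_of_base T M L B =
     (let to_opt = (\<lambda>b. if b = coset M L 0 then None else Some b) in
      \<lparr> elems = B,
        wt = (\<lambda>b. THE \<mu>. \<mu> \<in> weights T \<and> b \<inter> L \<inter> weight_space T M \<mu> \<noteq> {}),
        eop = (\<lambda>i b. if i \<in> nodes T then to_opt (induced M L (kashiwara_e T M i) b) else None),
        fop = (\<lambda>i b. if i \<in> nodes T then to_opt (induced M L (kashiwara_f T M i) b) else None) \<rparr>)"

text \<open>
  \<open>C\<close> is the crystal \<open>B(\<Lambda>)\<close> of the irreducible representation of highest weight \<open>\<Lambda>\<close>. That
  \<open>(L(\<Lambda>), B(\<Lambda>))\<close> is a crystal base holds for every dominant \<open>\<Lambda>\<close> by Kashiwara's existence theorem;
  it is what makes \<open>B(\<Lambda>)\<close> a crystal.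
\<close>

definition is_highest_weight_crystal ::
  "cartan_type \<Rightarrow> weight \<Rightarrow> 'v::ab_group_add set crystal \<Rightarrow> bool" where
  "is_highest_weight_crystal T \<Lambda> C \<longleftrightarrow>
     (\<exists>(M :: 'v uq_rep) u.
        irreducible_hw_module T M \<Lambda> u \<and>
        crystal_base T M (hw_lattice T M u) (hw_basis T M u) \<and>
        C = crystal_of_base T M (hw_lattice T M u) (hw_basis T M u))"

fun iter :: "('b \<Rightarrow> 'b option) \<Rightarrow> nat \<Rightarrow> 'b \<Rightarrow> 'b option" where
  "iter g 0 b = Some b"
| "iter g (Suc m) b = Option.bind (iter g m b) g"

definition eps :: "'b crystal \<Rightarrow> nat \<Rightarrow> 'b \<Rightarrow> nat" where
  "eps B i b = Max {m. iter (eop B i) m b \<noteq> None}"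

definition phi :: "'b crystal \<Rightarrow> nat \<Rightarrow> 'b \<Rightarrow> nat" where
  "phi B i b = Max {m. iter (fop B i) m b \<noteq> None}"

definition tensor :: "'b crystal \<Rightarrow> 'c crystal \<Rightarrow> ('b \<times> 'c) crystal" where
  "tensor B C =
     \<lparr> elems = elems B \<times> elems C,
       wt = (\<lambda>(b, c) i. wt B b i + wt C c i),
       eop = (\<lambda>i (b, c). if phi B i b \<ge> eps C i c
                         then map_option (\<lambda>b'. (b', c)) (eop B i b)
                         else map_option (\<lambda>c'. (b, c')) (eop C i c)),
       fop = (\<lambda>i (b, c). if phi B i b > eps C i c
                         then map_option (\<lambda>b'. (b', c)) (fop B i b)
                         else map_option (\<lambda>c'. (b, c')) (fop C i c)) \<rparr>"

text \<open>
  The tensor product of a list of crystals; the pure tensor of \<open>b\<^sub>1, \<dots>, b\<^sub>m\<close> is the list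
  \<open>[b\<^sub>1, \<dots>, b\<^sub>m]\<close>. The empty product is the one-element crystal, the unit for \<open>tensor\<close>.
\<close>

definition unit_crystal :: "'b list crystal" where
  "unit_crystal =
     \<lparr> elems = {[]}, wt = (\<lambda>_ _. 0), eop = (\<lambda>_ _. None), fop = (\<lambda>_ _. None) \<rparr>"

definition cons_crystal :: "('b \<times> 'b list) crystal \<Rightarrow> 'b list crystal" where
  "cons_crystal D =
     \<lparr> elems = (\<lambda>(x, xs). x # xs) ` elems D,
       wt = (\<lambda>w. wt D (hd w, tl w)),
       eop = (\<lambda>i w. map_option (\<lambda>(x, xs). x # xs) (eop D i (hd w, tl w))),
       fop = (\<lambda>i w. map_option (\<lambda>(x, xs). x # xs) (fop D i (hd w, tl w))) \<rparr>"

fun tensor_list :: "'b crystal list \<Rightarrow> 'b list crystal" where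
  "tensor_list [] = unit_crystal"
| "tensor_list (B # Bs) = cons_crystal (tensor B (tensor_list Bs))"

definition tensor_word :: "(nat \<Rightarrow> 'b crystal) \<Rightarrow> nat list \<Rightarrow> 'b list crystal" where
  "tensor_word B \<epsilon> = tensor_list (map B \<epsilon>)"

definition crystal_edge :: "'b crystal \<Rightarrow> 'b \<Rightarrow> 'b \<Rightarrow> bool" where
  "crystal_edge B x y \<longleftrightarrow> x \<in> elems B \<and> y \<in> elems B \<and>
     (\<exists>i. eop B i x = Some y \<or> fop B i x = Some y \<or> eop B i y = Some x \<or> fop B i y = Some x)"

definition same_component :: "'b crystal \<Rightarrow> 'b \<Rightarrow> 'b \<Rightarrow> bool" where
  "same_component B = (crystal_edge B)\<^sup>*\<^sup>*"

text \<open>The component generated by the highest weight element of weight \<open>\<Lambda>\<close>.\<close>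

definition hw_component :: "'b crystal \<Rightarrow> weight \<Rightarrow> 'b set" where
  "hw_component B \<Lambda> =
     {x. \<exists>h\<in>elems B. (\<forall>i. eop B i h = None) \<and> wt B h = \<Lambda> \<and> same_component B h x}"

definition top_component :: "(nat \<Rightarrow> 'b crystal) \<Rightarrow> nat list \<Rightarrow> 'b list set" where
  "top_component B \<epsilon> =
     hw_component (tensor_word B \<epsilon>) (\<lambda>j. \<Sum>k<length \<epsilon>. fund_weight (\<epsilon> ! k) j)"


section \<open>The linear category of crystals\<close>

definition strict_morphism :: "'b crystal \<Rightarrow> 'c crystal \<Rightarrow> ('b \<Rightarrow> 'c option) \<Rightarrow> bool" where
  "strict_morphism B C g \<longleftrightarrow>
     (\<forall>b\<in>elems B.
        (\<forall>c. g b = Some c \<longrightarrow> c \<in> elems C \<and> wt C c = wt B b) \<and>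
        (\<forall>i. Option.bind (eop B i b) g = Option.bind (g b) (eop C i) \<and>
             Option.bind (fop B i b) g = Option.bind (g b) (fop C i)))"

type_synonym ('b, 'k) lin_endo = "('b \<Rightarrow>\<^sub>0 'k) \<Rightarrow> ('b \<Rightarrow>\<^sub>0 'k)"

definition free_space :: "'b crystal \<Rightarrow> ('b \<Rightarrow>\<^sub>0 'k::field) set" where
  "free_space B = {x. Poly_Mapping.keys x \<subseteq> elems B}"

definition linearize :: "('b \<Rightarrow> 'c option) \<Rightarrow> ('b \<Rightarrow>\<^sub>0 'k::field) \<Rightarrow> ('c \<Rightarrow>\<^sub>0 'k)" where
  "linearize g x =
     (\<Sum>b\<in>Poly_Mapping.keys x.
        case g b of None \<Rightarrow> 0 | Some c \<Rightarrow> Poly_Mapping.single c (Poly_Mapping.lookup x b))"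

definition crys_hom ::
  "'b crystal \<Rightarrow> 'c crystal \<Rightarrow> (('b \<Rightarrow>\<^sub>0 'k::field) \<Rightarrow> ('c \<Rightarrow>\<^sub>0 'k)) set" where
  "crys_hom B C =
     {h. \<exists>S a. finite S \<and> (\<forall>g\<in>S. strict_morphism B C g) \<and>
           (\<forall>x\<in>free_space B. h x = (\<Sum>g\<in>S. Poly_Mapping.map ((*) (a g)) (linearize g x)))}"

definition same_on :: "'b crystal \<Rightarrow> ('b, 'k::field) lin_endo \<Rightarrow> ('b, 'k) lin_endo \<Rightarrow> bool" where
  "same_on B g h \<longleftrightarrow> (\<forall>x\<in>free_space B. g x = h x)"

definition tensor_vec ::
  "('b list \<Rightarrow>\<^sub>0 'k::field) \<Rightarrow> ('b list \<Rightarrow>\<^sub>0 'k) \<Rightarrow> ('b list \<Rightarrow>\<^sub>0 'k)" where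
  "tensor_vec x y =
     (\<Sum>v\<in>Poly_Mapping.keys x. \<Sum>w\<in>Poly_Mapping.keys y.
        Poly_Mapping.single (v @ w) (Poly_Mapping.lookup x v * Poly_Mapping.lookup y w))"

text \<open>\<open>tensor_hom p g h\<close> is \<open>g \<otimes> h\<close>, with \<open>g\<close> acting on the first \<open>p\<close> tensor factors.\<close>

definition tensor_hom ::
  "nat \<Rightarrow> ('b list, 'k::field) lin_endo \<Rightarrow> ('b list, 'k) lin_endo \<Rightarrow> ('b list, 'k) lin_endo" where
  "tensor_hom p g h x =
     (\<Sum>w\<in>Poly_Mapping.keys x.
        tensor_vec (g (Poly_Mapping.single (take p w) (Poly_Mapping.lookup x w)))
                   (h (Poly_Mapping.single (drop p w) 1)))"


section \<open>Jones--Wenzl projectors\<close>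

definition top_projection :: "(nat \<Rightarrow> 'b crystal) \<Rightarrow> nat list \<Rightarrow> 'b list \<Rightarrow> 'b list option" where
  "top_projection B \<epsilon> w = (if w \<in> top_component B \<epsilon> then Some w else None)"

definition jones_wenzl ::
  "(nat \<Rightarrow> 'b crystal) \<Rightarrow> nat list \<Rightarrow> ('b list, 'k::field) lin_endo" where
  "jones_wenzl B \<epsilon> = linearize (top_projection B \<epsilon>)"

text \<open>The strands are numbered \<open>1, \<dots>, m\<close>, whereas list positions start at \<open>0\<close>.\<close>

definition jones_wenzl_adj ::
  "(nat \<Rightarrow> 'b crystal) \<Rightarrow> nat list \<Rightarrow> nat \<Rightarrow> ('b list, 'k::field) lin_endo" where
  "jones_wenzl_adj B \<epsilon> k =
     tensor_hom (k - 1) id (tensor_hom 2 (jones_wenzl B [\<epsilon> ! (k - 1), \<epsilon> ! k]) id)"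

lemma hw_component_step:
  assumes "x \<in> elems B" "y \<in> elems B"
    and "eop B i x = Some y \<or> fop B i x = Some y"
  shows "x \<in> hw_component B \<Lambda> \<longleftrightarrow> y \<in> hw_component B \<Lambda>"
proof -
  have "crystal_edge B x y" "crystal_edge B y x"
    using assms by (auto simp: crystal_edge_def)
  then have "same_component B h x \<longleftrightarrow> same_component B h y" for h
    unfolding same_component_def by (metis rtranclp.rtrancl_into_rtrancl)
  then show ?thesis
    unfolding hw_component_def by simp
qed

lemma strict_morphism_top_projection:
  assumes "\<And>i x y. x \<in> elems (tensor_word B \<epsilon>) \<Longrightarrow>
      eop (tensor_word B \<epsilon>) i x = Some y \<or> fop (tensor_word B \<epsilon>) i x = Some y \<Longrightarrow>
      y \<in> elems (tensor_word B \<epsilon>)"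
  shows "strict_morphism (tensor_word B \<epsilon>) (tensor_word B \<epsilon>) (top_projection B \<epsilon>)"
proof -
  let ?W = "tensor_word B \<epsilon>"
  have "Option.bind (eop ?W i x) (top_projection B \<epsilon>) =
          Option.bind (top_projection B \<epsilon> x) (eop ?W i)" if x: "x \<in> elems ?W" for i x
  proof (cases "eop ?W i x")
    case (Some y)
    then have "x \<in> top_component B \<epsilon> \<longleftrightarrow> y \<in> top_component B \<epsilon>"
      unfolding top_component_def by (intro hw_component_step[of _ _ _ i]) (use assms x in auto)
    with Some show ?thesis by (auto simp: top_projection_def)
  qed (auto simp: top_projection_def)
  moreover have "Option.bind (fop ?W i x) (top_projection B \<epsilon>) =
          Option.bind (top_projection B \<epsilon> x) (fop ?W i)" if x: "x \<in> elems ?W" for i x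
  proof (cases "fop ?W i x")
    case (Some y)
    then have "x \<in> top_component B \<epsilon> \<longleftrightarrow> y \<in> top_component B \<epsilon>"
      unfolding top_component_def by (intro hw_component_step[of _ _ _ i]) (use assms x in auto)
    with Some show ?thesis by (auto simp: top_projection_def)
  qed (auto simp: top_projection_def)
  ultimately show ?thesis
    by (auto simp: strict_morphism_def top_projection_def split: if_splits)
qed

lemma jones_wenzl_in_crys_hom:
  assumes "strict_morphism (tensor_word B \<epsilon>) (tensor_word B \<epsilon>) (top_projection B \<epsilon>)"
  shows "(jones_wenzl B \<epsilon> :: ('b list, 'k::field) lin_endo)
           \<in> crys_hom (tensor_word B \<epsilon>) (tensor_word B \<epsilon>)"
proof -
  have "Poly_Mapping.map ((*) 1) x = x" for x :: "'b list \<Rightarrow>\<^sub>0 'k"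
    by (rule poly_mapping_eqI) (simp add: Poly_Mapping.map.rep_eq when_def)
  then show ?thesis
    unfolding crys_hom_def jones_wenzl_def mem_Collect_eq
    by (intro exI[of _ "{top_projection B \<epsilon>}"] exI[of _ "\<lambda>_. 1"]) (simp add: assms)
qed

end

theory Submission imports Defs "HOL-Library.Product_Plus"
begin

text \<open>
  Let \<open>S\<close> be the set of words all of whose adjacent pairs lie in the respective top component. It is
  closed under all \<open>e\<^sub>i\<close> and \<open>f\<^sub>i\<close>, so it equals the top component once its only highest weight
  word is the word of highest weight elements \<open>u\<close>. In a highest weight word of \<open>S\<close>, let \<open>y\<close> be the
  first letter other than \<open>u\<^sub>c\<close>, preceded by \<open>u\<^sub>a\<close>. Then \<open>e\<^sub>i y = 0\<close> unless \<open>i\<close> is a label before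
  \<open>y\<close>, whereas \<open>\<alpha>\<^sub>a\<close> does not occur in \<open>\<omega>\<^sub>c - wt y\<close> if \<open>u\<^sub>a \<otimes> y\<close> is in the top
  component. As the Dynkin diagram is a path and the labels are monotone, the vertex \<open>a\<close> separates the
  earlier labels from \<open>c\<close>, which forces \<open>y = u\<^sub>c\<close>.

  The statement about \<open>\<alpha>\<^sub>a\<close> is proved at the level of modules: a path of Kashiwara operators from
  \<open>u\<^sub>a \<otimes> y\<close> to \<open>u\<^sub>a \<otimes> u\<^sub>c\<close> is applied to the pair \<open>(u\<^sub>a \<otimes> y, q\<^sub>a\<^sup>n y \<otimes> u\<^sub>a)\<close>, where \<open>n\<close> is the
  coefficient of \<open>\<alpha>\<^sub>a\<close>. It stays in the submodule generated by all such pairs, whose highest weight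
  space is spanned by \<open>(u\<^sub>a \<otimes> u\<^sub>c, u\<^sub>c \<otimes> u\<^sub>a)\<close>, while by the tensor product rule for crystal lattices
  its second component remains divisible by \<open>q\<close> if \<open>n > 0\<close>.
\<close>

section \<open>Rational functions regular at zero\<close>

text \<open>The scalar in the pairs is dictated by the coproduct. Since E_i kills u_a, it sends u_a
  \<otimes> y to u_a \<otimes> E_i y, but y \<otimes> u_a to a multiple of E_i y \<otimes> u_a, with
  the factor by which K_i^(-1) acts on u_a: q_a^(-1) for i = a and 1 otherwise. Exactly for i = a
  the exponent n drops by one, so the pairs form a family stable under all E_i, and words in the F_i
  applied to it span a submodule. A path from u_a \<otimes> y to the top with n > 0 would end in a
  multiple c of (u_a \<otimes> u_c, u_c \<otimes> u_a), where c is 1 modulo q by the first component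
  and 0 by the second. To follow the path, Kashiwara operators must be computed modulo q on tensors
  F^(j) c \<otimes> F^(k) c' of divided powers, where they have no closed form. They are explicit on
  vectors congruent to these tensors: divided powers of F on highest weight vectors in one half of
  the grid, of E on lowest weight vectors in the other. Nakayama's lemma carries the result back to
  the tensors.\<close>

lemma regular0_Fract: "poly b 0 \<noteq> 0 \<Longrightarrow> Fract a b \<in> regular0"
  by (auto simp: regular0_def)

lemma regular0E:
  assumes "x \<in> regular0"
  obtains a b where "x = Fract a b" "poly b 0 \<noteq> 0" "b \<noteq> 0"
  using assms unfolding regular0_def by fastforce

lemma regular0_add [intro]: "x \<in> regular0 \<Longrightarrow> y \<in> regular0 \<Longrightarrow> x + y \<in> regular0"
  by (elim regular0E) (auto intro!: regular0_Fract)

lemma regular0_mult [intro]: "x \<in> regular0 \<Longrightarrow> y \<in> regular0 \<Longrightarrow> x * y \<in> regular0"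
  by (elim regular0E) (auto intro!: regular0_Fract)

lemma regular0_uminus [intro]: "x \<in> regular0 \<Longrightarrow> - x \<in> regular0"
  by (elim regular0E) (auto intro!: regular0_Fract)

lemma regular0_diff [intro]: "x \<in> regular0 \<Longrightarrow> y \<in> regular0 \<Longrightarrow> x - y \<in> regular0"
  by (elim regular0E) (auto intro!: regular0_Fract)

lemma regular0_0 [simp, intro]: "0 \<in> regular0"
  by (auto simp: Zero_fract_def intro!: regular0_Fract)

lemma regular0_1 [simp, intro]: "1 \<in> regular0"
  by (auto simp: One_fract_def intro!: regular0_Fract)

lemma regular0_qvar [simp, intro]: "qvar \<in> regular0"
  by (auto simp: qvar_def intro!: regular0_Fract)

lemma regular0_sum [intro]: "(\<And>i. i \<in> I \<Longrightarrow> f i \<in> regular0) \<Longrightarrow> sum f I \<in> regular0"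
  by (induction I rule: infinite_finite_induct) auto

lemma regular0_power [intro]: "x \<in> regular0 \<Longrightarrow> x ^ n \<in> regular0"
  by (induction n) auto

text \<open>The maximal ideal of the local ring \<open>regular0\<close>; divisibility by q in
  lattices is tested through it.\<close>

definition qideal :: "ratfun set" where
  "qideal = (\<lambda>x. qvar * x) ` regular0"

lemma qideal_regular0: "x \<in> qideal \<Longrightarrow> x \<in> regular0"
  by (auto simp: qideal_def)

lemma qideal_add [intro]: "x \<in> qideal \<Longrightarrow> y \<in> qideal \<Longrightarrow> x + y \<in> qideal"
  by (auto simp: qideal_def distrib_left[symmetric])

lemma qideal_uminus [intro]: "x \<in> qideal \<Longrightarrow> - x \<in> qideal"
  by (auto simp: qideal_def simp flip: mult_minus_right)

lemma qideal_diff [intro]: "x \<in> qideal \<Longrightarrow> y \<in> qideal \<Longrightarrow> x - y \<in> qideal"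
  using qideal_add[of x "- y"] qideal_uminus[of y] by simp

lemma qideal_0 [simp, intro]: "0 \<in> qideal"
  by (auto simp: qideal_def intro!: image_eqI[of _ _ 0])

lemma qideal_qvar [simp, intro]: "qvar \<in> qideal"
  by (auto simp: qideal_def intro!: image_eqI[of _ _ 1])

lemma qideal_mult [intro]: "x \<in> qideal \<Longrightarrow> y \<in> regular0 \<Longrightarrow> x * y \<in> qideal"
  by (auto simp: qideal_def mult.assoc)

lemma qideal_mult' [intro]: "y \<in> regular0 \<Longrightarrow> x \<in> qideal \<Longrightarrow> y * x \<in> qideal"
  using qideal_mult[of x y] by (simp add: mult.commute)

lemma one_notin_qideal: "1 \<notin> qideal"
proof
  assume "1 \<in> qideal"
  then obtain a b where ab: "1 = qvar * Fract a b" "poly b 0 \<noteq> 0" "b \<noteq> 0"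
    unfolding qideal_def by (auto elim!: regular0E)
  then have "b = [:0, 1:] * a"
    by (simp add: qvar_def One_fract_def eq_fract)
  then show False using ab(2) by simp
qed

text \<open>A numerator vanishing at 0 would split off a factor q, so outside \<open>qideal\<close>
  numerator and denominator are both nonzero at 0.\<close>

lemma regular0_unit:
  assumes "x \<in> regular0" "x \<notin> qideal"
  shows "x \<noteq> 0" "inverse x \<in> regular0"
proof -
  show "x \<noteq> 0" using assms(2) by auto
  obtain a b where ab: "x = Fract a b" "poly b 0 \<noteq> 0" "b \<noteq> 0"
    using assms(1) by (rule regular0E)
  have "poly a 0 \<noteq> 0"
  proof
    assume "poly a 0 = 0"
    then obtain a' where a': "a = [:0, 1:] * a'"
      by (metis dvd_def minus_zero poly_eq_0_iff_dvd)
    have "x = qvar * Fract a' b" using ab a' by (simp add: qvar_def)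
    then show False using assms(2) ab by (auto simp: qideal_def intro!: regular0_Fract)
  qed
  then show "inverse x \<in> regular0"
    using ab by (auto intro!: regular0_Fract)
qed

lemma one_plus_qideal_unit:
  assumes "x - 1 \<in> qideal"
  shows "x \<in> regular0" "x \<noteq> 0" "inverse x \<in> regular0" "inverse x - 1 \<in> qideal"
proof -
  show x: "x \<in> regular0"
    using regular0_add[OF qideal_regular0[OF assms] regular0_1] by simp
  have nq: "x \<notin> qideal"
    using qideal_diff[of x "x - 1"] assms one_notin_qideal by auto
  show nz: "x \<noteq> 0" and i: "inverse x \<in> regular0"
    using regular0_unit[OF x nq] by auto
  have "inverse x - 1 = - (inverse x * (x - 1))" using nz by (simp add: algebra_simps)
  then show "inverse x - 1 \<in> qideal" using i assms by auto
qed

lemma qvar_nonzero [simp]: "qvar \<noteq> 0"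
  by (simp add: qvar_def Zero_fract_def eq_fract)

lemma qideal_div: "x \<in> qideal \<Longrightarrow> inverse qvar * x \<in> regular0"
  by (auto simp: qideal_def mult.assoc[symmetric])

lemma qvar_power_qideal: "k > 0 \<Longrightarrow> qvar ^ k \<in> qideal"
  by (cases k) auto

lemma symmetrizer_pos: "symmetrizer T i > 0"
  by (cases T) auto

lemma qi_qideal: "qi T i \<in> qideal"
  unfolding qi_def by (intro qvar_power_qideal symmetrizer_pos)

lemma qi_regular0 [simp, intro]: "qi T i \<in> regular0"
  by (intro qideal_regular0 qi_qideal)

lemma qi_nonzero [simp]: "qi T i \<noteq> 0"
  by (simp add: qi_def)

lemma qi_power_qideal: "k > 0 \<Longrightarrow> qi T i ^ k \<in> qideal"
  using qi_qideal[of T i] by (cases k) auto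

text \<open>In other words, q_i is not a root of unity: its positive powers lie in
  \<open>qideal\<close>, which does not contain 1. This makes nonzero quantum integers invertible
  and lets the K_i separate weights.\<close>

lemma qi_powi_eq_1_iff: "qi T i powi k = 1 \<longleftrightarrow> k = 0"
proof
  assume k: "qi T i powi k = 1"
  have "qi T i ^ nat \<bar>k\<bar> = 1"
    using k by (auto simp: power_int_def abs_if power_inverse split: if_splits)
  then show "k = 0"
    using qi_power_qideal[of "nat \<bar>k\<bar>" T i] one_notin_qideal by (cases "k = 0") auto
qed auto

lemma qi_powi_inj: "qi T i powi k = qi T i powi l \<longleftrightarrow> k = l"
proof
  assume "qi T i powi k = qi T i powi l"
  then have "qi T i powi (k - l) = 1" by (simp add: power_int_diff)
  then show "k = l" by (simp add: qi_powi_eq_1_iff)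
qed auto

section \<open>Quantum integers\<close>

definition qnum :: "cartan_type \<Rightarrow> nat \<Rightarrow> int \<Rightarrow> ratfun" where
  "qnum T i k = (qi T i powi k - qi T i powi (- k)) / (qi T i - inverse (qi T i))"

lemma qi_neq_inverse [simp]: "qi T i \<noteq> inverse (qi T i)"
proof
  assume "qi T i = inverse (qi T i)"
  then have "qi T i powi 1 = qi T i powi (- 1)" by (simp add: power_int_minus)
  then show False unfolding qi_powi_inj by simp
qed

lemma qint_qnum: "qint T i m = qnum T i (int m)"
  by (simp add: qint_def qnum_def power_int_minus)

lemma qnum_0 [simp]: "qnum T i 0 = 0"
  by (simp add: qnum_def)

lemma qnum_1 [simp]: "qnum T i 1 = 1"
  by (simp add: qnum_def power_int_minus)

lemma qnum_minus: "qnum T i (- k) = - qnum T i k"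
  by (simp add: qnum_def minus_divide_left)

lemma qnum_eq_0_iff [simp]: "qnum T i k = 0 \<longleftrightarrow> k = 0"
  by (auto simp: qnum_def qi_powi_inj)

text \<open>The quantum form of a(b + c) = (a + b)c + b(a - c). The commutation formulas for powers
  of E and F below reduce to instances with b = 1.\<close>

lemma qnum_identity: "qnum T i a * qnum T i (b + c) = qnum T i (a + b) * qnum T i c + qnum T i b * qnum T i (a - c)"
proof -
  define Q where "Q = qi T i"
  define A B C where "A = Q powi a" "B = Q powi b" "C = Q powi c"
  have nz: "Q \<noteq> 0" "A \<noteq> 0" "B \<noteq> 0" "C \<noteq> 0" by (simp_all add: Q_def A_B_C_def)
  define D where "D = inverse (Q - inverse Q)"
  have qn: "qnum T i k = (Q powi k - Q powi (-k)) * D" for k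
    by (simp add: qnum_def Q_def D_def divide_inverse)
  have "(A - inverse A) * (B * C - inverse (B * C)) =
        (A * B - inverse (A * B)) * (C - inverse C) + (B - inverse B) * (A * inverse C - inverse A * C)"
    using nz by (simp add: field_simps)
  then have "((A - inverse A) * (B * C - inverse (B * C))) * (D * D) =
        ((A * B - inverse (A * B)) * (C - inverse C) + (B - inverse B) * (A * inverse C - inverse A * C)) * (D * D)"
    by simp
  then show ?thesis
    unfolding qn using nz
    by (simp add: power_int_add power_int_diff power_int_minus A_B_C_def[symmetric] algebra_simps divide_inverse)
qed

text \<open>The quantum integer [k] has a pole of order k - 1 in q_i with leading coefficient 1. The
  induction rests on [k + 1] = q_i^(-k) + q_i [k].\<close>

lemma qnum_leading:
  assumes "k > 0"
  shows "qi T i ^ (k - 1) * qnum T i (int k) - 1 \<in> qideal"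
proof -
  define Q where "Q = qi T i"
  have Q: "Q \<noteq> 0" "Q \<in> qideal" "Q - inverse Q \<noteq> 0" by (auto simp: Q_def qi_qideal)
  have "\<exists>z\<in>regular0. Q ^ (k - 1) * qnum T i (int k) = 1 + Q * z"
    using assms
  proof (induction k rule: nat_induct_non_zero)
    case 1
    then show ?case by (intro bexI[of _ 0]) auto
  next
    case (Suc k)
    then obtain z where z: "z \<in> regular0" "Q ^ (k - 1) * qnum T i (int k) = 1 + Q * z" by auto
    have "qnum T i (int k + 1) = Q powi (- int k) + Q * qnum T i (int k)"
    proof -
      have "Q powi (- 1 - int k) = inverse Q * inverse (Q ^ k)"
        using Q(1) by (simp add: power_int_diff power_int_minus divide_inverse)
      then show ?thesis
        using Q by (simp add: qnum_def Q_def[symmetric] power_int_add power_int_minus field_simps)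
    qed
    then have "Q ^ k * qnum T i (int k + 1) = 1 + Q * Q * (Q ^ (k - 1) * qnum T i (int k))"
      using Suc.hyps Q(1) by (simp add: algebra_simps power_int_minus flip: power_Suc)
    also have "\<dots> = 1 + Q * (Q * (1 + Q * z))" by (simp only: z(2) mult.assoc)
    finally show ?case using z Q(2)
      by (intro bexI[of _ "Q * (1 + Q * z)"]) (auto simp: add.commute intro: qideal_regular0)
  qed
  then show ?thesis using Q by (auto simp: Q_def)
qed

lemma qfact_Suc: "qfact T i (Suc m) = qnum T i (1 + int m) * qfact T i m"
  by (simp add: qfact_def qint_qnum mult.commute)

lemma qfact_0 [simp]: "qfact T i 0 = 1"
  by (simp add: qfact_def)

lemma qfact_nonzero [simp]: "qfact T i m \<noteq> 0"
  by (auto simp: qfact_def qint_qnum)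

section \<open>Kashiwara operators on integrable weight modules\<close>

definition sroot :: "cartan_type \<Rightarrow> nat \<Rightarrow> weight" where
  "sroot T i = (\<lambda>j. if j \<in> nodes T then cartan T j i else 0)"

definition wshift :: "cartan_type \<Rightarrow> nat \<Rightarrow> int \<Rightarrow> weight \<Rightarrow> weight" where
  "wshift T i k \<mu> = (\<lambda>j. \<mu> j + k * sroot T i j)"

lemma wshift_wshift [simp]: "wshift T i k (wshift T i l \<mu>) = wshift T i (k + l) \<mu>"
  by (auto simp: wshift_def algebra_simps)

lemma wshift_0 [simp]: "wshift T i 0 \<mu> = \<mu>"
  by (auto simp: wshift_def)

lemma wshift_same: "i \<in> nodes T \<Longrightarrow> wshift T i k \<mu> i = \<mu> i + 2 * k"
  by (auto simp: wshift_def sroot_def cartan_def)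

lemma wshift_weights [simp]: "wshift T i k \<mu> \<in> weights T \<longleftrightarrow> \<mu> \<in> weights T"
  by (auto simp: wshift_def sroot_def weights_def)

lemma wshift_eq_iff: "wshift T i k \<mu> = \<nu> \<longleftrightarrow> \<mu> = wshift T i (- k) \<nu>"
proof
  assume "wshift T i k \<mu> = \<nu>"
  then have "wshift T i (- k) (wshift T i k \<mu>) = wshift T i (- k) \<nu>" by simp
  then show "\<mu> = wshift T i (- k) \<nu>" by simp
qed auto

text \<open>
  The Serre relations play no role for the Kashiwara operators, and dropping them spares us
  their verification on tensor products.
\<close>

locale qrep =
  fixes T :: cartan_type and M :: "'w::ab_group_add uq_rep"
  assumes vs: "vector_space (smul M)"
    and linE: "i \<in> nodes T \<Longrightarrow> Vector_Spaces.linear (smul M) (smul M) (opE M i)"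
    and linF: "i \<in> nodes T \<Longrightarrow> Vector_Spaces.linear (smul M) (smul M) (opF M i)"
    and linK: "i \<in> nodes T \<Longrightarrow> Vector_Spaces.linear (smul M) (smul M) (opK M i)"
    and linKinv: "i \<in> nodes T \<Longrightarrow> Vector_Spaces.linear (smul M) (smul M) (opKinv M i)"
    and K_Kinv: "i \<in> nodes T \<Longrightarrow> opK M i (opKinv M i v) = v"
    and Kinv_K: "i \<in> nodes T \<Longrightarrow> opKinv M i (opK M i v) = v"
    and K_E: "i \<in> nodes T \<Longrightarrow> j \<in> nodes T \<Longrightarrow>
      opK M i (opE M j v) = smul M (qi T i powi cartan T i j) (opE M j (opK M i v))"
    and K_F: "i \<in> nodes T \<Longrightarrow> j \<in> nodes T \<Longrightarrow>
      opK M i (opF M j v) = smul M (qi T i powi (- cartan T i j)) (opF M j (opK M i v))"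
    and E_F: "i \<in> nodes T \<Longrightarrow> j \<in> nodes T \<Longrightarrow>
      opE M i (opF M j v) - opF M j (opE M i v) =
        (if i = j then smul M (inverse (qi T i - inverse (qi T i))) (opK M i v - opKinv M i v) else 0)"
    and span_weights: "module.span (smul M) (\<Union>\<mu>\<in>weights T. weight_space T M \<mu>) = UNIV"
    and nilE: "i \<in> nodes T \<Longrightarrow> \<exists>m. (opE M i ^^ m) v = 0"
    and nilF: "i \<in> nodes T \<Longrightarrow> \<exists>m. (opF M i ^^ m) v = 0"
begin

sublocale V: vector_space "smul M" by (fact vs)

abbreviation lin :: "('w \<Rightarrow> 'w) \<Rightarrow> bool" where
  "lin \<equiv> Vector_Spaces.linear (smul M) (smul M)"

abbreviation Wt :: "weight \<Rightarrow> 'w set" where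
  "Wt \<equiv> weight_space T M"

abbreviation dF :: "nat \<Rightarrow> nat \<Rightarrow> 'w \<Rightarrow> 'w" where
  "dF \<equiv> dpowF T M"

lemma lin_add: "lin f \<Longrightarrow> f (x + y) = f x + f y"
  and lin_scale: "lin f \<Longrightarrow> f (smul M a x) = smul M a (f x)"
  by (simp_all add: linear_iff_module_hom module_hom_iff)

lemma lin_zero: "lin f \<Longrightarrow> f 0 = 0"
  by (metis lin_scale V.scale_zero_left)

lemma lin_sum: "lin f \<Longrightarrow> f (sum g S) = (\<Sum>a\<in>S. f (g a))"
  by (induction S rule: infinite_finite_induct) (auto simp: lin_add lin_zero)

lemma lin_diff: "lin f \<Longrightarrow> f (x - y) = f x - f y"
  by (metis lin_add add_diff_cancel diff_add_cancel)

lemma linI: "(\<And>x y. f (x + y) = f x + f y) \<Longrightarrow> (\<And>a x. f (smul M a x) = smul M a (f x)) \<Longrightarrow> lin f"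
  by (simp add: Vector_Spaces.linear_iff vs)

lemma lin_pow: "lin f \<Longrightarrow> lin (f ^^ n)"
  by (induction n) (auto intro!: linI simp: lin_add lin_scale)

lemma lin_dF: "i \<in> nodes T \<Longrightarrow> lin (dF i n)"
  unfolding dpowF_def
  by (auto intro!: linI simp: lin_add[OF lin_pow[OF linF]] lin_scale[OF lin_pow[OF linF]]
      V.scale_right_distrib mult.commute)

lemma lin_0: "lin (\<lambda>_. 0)"
  by (auto intro!: linI)

lemma dF_0 [simp]: "dF i 0 v = v"
  by (simp add: dpowF_def)

lemma dF_zero [simp]: "i \<in> nodes T \<Longrightarrow> dF i n 0 = 0"
  by (simp add: lin_zero[OF lin_dF])

lemma subspace_Wt: "V.subspace (Wt \<mu>)"
  unfolding V.subspace_def weight_space_def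
  by (auto simp: lin_zero[OF linK] lin_add[OF linK] lin_scale[OF linK] V.scale_right_distrib mult.commute)

lemmas Wt_0 = V.subspace_0[OF subspace_Wt]
  and Wt_add = V.subspace_add[OF subspace_Wt]
  and Wt_scale = V.subspace_scale[OF subspace_Wt]
  and Wt_diff = V.subspace_diff[OF subspace_Wt]
  and Wt_sum = V.subspace_sum[OF subspace_Wt]

lemma K_Wt: "v \<in> Wt \<mu> \<Longrightarrow> i \<in> nodes T \<Longrightarrow> opK M i v = smul M (qi T i powi \<mu> i) v"
  by (simp add: weight_space_def)

lemma Kinv_Wt:
  assumes "v \<in> Wt \<mu>" "i \<in> nodes T"
  shows "opKinv M i v = smul M (qi T i powi (- \<mu> i)) v"
proof -
  have "v = opKinv M i (opK M i v)" using assms by (simp add: Kinv_K)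
  also have "\<dots> = smul M (qi T i powi \<mu> i) (opKinv M i v)"
    using assms by (simp add: K_Wt lin_scale[OF linKinv])
  finally show ?thesis
    using assms by (metis (no_types) V.scale_scale V.scale_one qi_nonzero power_int_minus
        left_inverse power_int_not_zero)
qed

lemma E_Wt: "v \<in> Wt \<mu> \<Longrightarrow> j \<in> nodes T \<Longrightarrow> opE M j v \<in> Wt (wshift T j 1 \<mu>)"
  by (auto simp: weight_space_def K_E lin_scale[OF linE] wshift_def sroot_def power_int_add mult.commute)

lemma F_Wt: "v \<in> Wt \<mu> \<Longrightarrow> j \<in> nodes T \<Longrightarrow> opF M j v \<in> Wt (wshift T j (-1) \<mu>)"
  by (auto simp: weight_space_def K_F lin_scale[OF linF] wshift_def sroot_def power_int_add
      power_int_diff power_int_minus divide_inverse mult.commute)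

lemma Epow_Wt: "v \<in> Wt \<mu> \<Longrightarrow> j \<in> nodes T \<Longrightarrow> (opE M j ^^ n) v \<in> Wt (wshift T j (int n) \<mu>)"
proof (induction n)
  case (Suc n)
  then show ?case using E_Wt[of "(opE M j ^^ n) v" "wshift T j (int n) \<mu>" j] by simp
qed simp

lemma Fpow_Wt: "v \<in> Wt \<mu> \<Longrightarrow> j \<in> nodes T \<Longrightarrow> (opF M j ^^ n) v \<in> Wt (wshift T j (- int n) \<mu>)"
proof (induction n)
  case (Suc n)
  then show ?case using F_Wt[of "(opF M j ^^ n) v" "wshift T j (- int n) \<mu>" j] by simp
qed simp

lemma dF_Wt: "v \<in> Wt \<mu> \<Longrightarrow> j \<in> nodes T \<Longrightarrow> dF j n v \<in> Wt (wshift T j (- int n) \<mu>)"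
  unfolding dpowF_def by (intro Wt_scale Fpow_Wt)

section \<open>Commutation relations in rank one\<close>

lemma E_F_Wt:
  assumes "v \<in> Wt \<mu>" "i \<in> nodes T"
  shows "opE M i (opF M i v) = opF M i (opE M i v) + smul M (qnum T i (\<mu> i)) v"
proof -
  have "opE M i (opF M i v) - opF M i (opE M i v) =
      smul M (inverse (qi T i - inverse (qi T i))) (smul M (qi T i powi \<mu> i) v - smul M (qi T i powi (- \<mu> i)) v)"
    using assms by (simp add: E_F K_Wt[OF assms] Kinv_Wt[OF assms])
  also have "\<dots> = smul M (qnum T i (\<mu> i)) v"
    by (simp add: qnum_def divide_inverse mult.commute flip: V.scale_left_diff_distrib)
  finally show ?thesis by (simp add: algebra_simps)
qed

lemma E_F_neq: "i \<in> nodes T \<Longrightarrow> j \<in> nodes T \<Longrightarrow> i \<noteq> j \<Longrightarrow> opE M i (opF M j v) = opF M j (opE M i v)"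
  using E_F[of i j v] by simp

lemma F_dF: "i \<in> nodes T \<Longrightarrow> opF M i (dF i n v) = smul M (qnum T i (1 + int n)) (dF i (Suc n) v)"
  by (simp add: dpowF_def lin_scale[OF linF] qfact_Suc)

text \<open>Here \<open>v\<close> is any weight vector. In \<open>string_exists\<close> the formula
  is applied to vectors of negative weight, which E_i does not kill.\<close>

lemma Epow_F:
  assumes "v \<in> Wt \<mu>" "i \<in> nodes T"
  shows "(opE M i ^^ Suc s) (opF M i v) =
    opF M i ((opE M i ^^ Suc s) v) + smul M (qnum T i (1 + int s) * qnum T i (\<mu> i + int s)) ((opE M i ^^ s) v)"
proof (induction s)
  case 0
  then show ?case using assms by (simp add: E_F_Wt)
next
  case (Suc s)
  have id: "qnum T i (\<mu> i + int s + 1) * qnum T i (2 + int s) =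
      qnum T i (\<mu> i + int s) * qnum T i (1 + int s) + qnum T i (\<mu> i + 2 * int s + 2)"
    using qnum_identity[of T i "\<mu> i + int s" 1 "- (int s + 2)"]
      qnum_minus[of T i "int s + 2"] qnum_minus[of T i "int s + 1"]
    by (simp add: algebra_simps)
  have w: "(opE M i ^^ Suc s) v \<in> Wt (wshift T i (int (Suc s)) \<mu>)"
    by (rule Epow_Wt) fact+
  have "(opE M i ^^ Suc (Suc s)) (opF M i v) = opE M i ((opE M i ^^ Suc s) (opF M i v))" by simp
  also have "\<dots> = opE M i (opF M i ((opE M i ^^ Suc s) v)) +
      smul M (qnum T i (1 + int s) * qnum T i (\<mu> i + int s)) ((opE M i ^^ Suc s) v)"
    unfolding Suc using assms by (simp add: lin_add[OF linE] lin_scale[OF linE])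
  also have "\<dots> = opF M i ((opE M i ^^ Suc (Suc s)) v) +
      smul M (qnum T i (\<mu> i + 2 * int s + 2) + qnum T i (1 + int s) * qnum T i (\<mu> i + int s)) ((opE M i ^^ Suc s) v)"
    unfolding E_F_Wt[OF w assms(2)] using assms
    by (simp add: wshift_same V.scale_left_distrib algebra_simps)
  finally show ?case using id by (simp add: algebra_simps)
qed

lemma E_dF:
  assumes "v \<in> Wt \<mu>" "i \<in> nodes T" "opE M i v = 0"
  shows "opE M i (dF i (Suc n) v) = smul M (qnum T i (\<mu> i - int n)) (dF i n v)"
proof (induction n)
  case 0
  then show ?case using assms by (simp add: dpowF_def qfact_def qint_qnum E_F_Wt lin_zero[OF linF])
next
  case (Suc n)
  have id: "qnum T i (\<mu> i - int n - 1) * qnum T i (1 + int (Suc n)) =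
      qnum T i (\<mu> i - int n) * qnum T i (int n + 1) + qnum T i (\<mu> i - 2 * int n - 2)"
    using qnum_identity[of T i "\<mu> i - int n - 1" 1 "int n + 1"] by (simp add: algebra_simps)
  let ?a = "qnum T i (1 + int (Suc n))"
  have a: "?a \<noteq> 0" by simp
  have eq: "\<mu> i - int n - 1 = \<mu> i - int (Suc n)" by simp
  have w: "dF i (Suc n) v \<in> Wt (wshift T i (- int (Suc n)) \<mu>)" by (rule dF_Wt) fact+
  have "smul M ?a (opE M i (dF i (Suc (Suc n)) v)) = opE M i (opF M i (dF i (Suc n) v))"
    using assms by (simp only: F_dF lin_scale[OF linE])
  also have "\<dots> = opF M i (opE M i (dF i (Suc n) v)) + smul M (qnum T i (\<mu> i - 2 * int n - 2)) (dF i (Suc n) v)"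
    using assms by (simp add: E_F_Wt[OF w] wshift_same algebra_simps)
  also have "\<dots> = smul M (qnum T i (\<mu> i - int n) * qnum T i (int n + 1) + qnum T i (\<mu> i - 2 * int n - 2)) (dF i (Suc n) v)"
    using assms unfolding Suc by (simp add: lin_scale[OF linF] F_dF V.scale_left_distrib add.commute)
  also have "\<dots> = smul M ?a (smul M (qnum T i (\<mu> i - int (Suc n))) (dF i (Suc n) v))"
    unfolding id[symmetric] eq by (simp only: V.scale_scale mult.commute)
  finally show ?case using a by (simp only: V.scale_cancel_left) simp
qed

lemma Epow_dF:
  assumes "v \<in> Wt \<mu>" "i \<in> nodes T" "opE M i v = 0"
  shows "(opE M i ^^ n) (dF i n v) = smul M (\<Prod>t<n. qnum T i (\<mu> i - int t)) v"
proof (induction n)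
  case (Suc n)
  have "(opE M i ^^ Suc n) (dF i (Suc n) v) = (opE M i ^^ n) (opE M i (dF i (Suc n) v))"
    by (simp add: funpow_swap1)
  also have "\<dots> = smul M (qnum T i (\<mu> i - int n)) ((opE M i ^^ n) (dF i n v))"
    by (simp add: E_dF[OF assms] lin_scale[OF lin_pow[OF linE[OF assms(2)]]])
  finally show ?case unfolding Suc by (simp add: mult.commute)
qed simp

lemma Epow_dF_0:
  assumes "v \<in> Wt \<mu>" "i \<in> nodes T" "opE M i v = 0" "n < m"
  shows "(opE M i ^^ m) (dF i n v) = 0"
proof -
  have "(opE M i ^^ m) (dF i n v) = (opE M i ^^ (m - Suc n)) (opE M i ((opE M i ^^ n) (dF i n v)))"
    using assms(4) by (metis add.commute comp_apply funpow.simps(2) funpow_add less_imp_add_positive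
        add_diff_inverse_nat le_add_diff_inverse2 Suc_leI)
  also have "opE M i ((opE M i ^^ n) (dF i n v)) = 0"
    unfolding Epow_dF[OF assms(1-3)] using assms by (simp add: lin_scale[OF linE])
  finally show ?thesis by (simp add: lin_zero[OF lin_pow[OF linE[OF assms(2)]]])
qed

text \<open>Apply E_i to the first vanishing divided power F_i^(s+1) v: the result [\<mu> i - s]
  F_i^(s) v is zero although F_i^(s) v is not, so \<mu> i = s.\<close>

lemma hw_nilpotent:
  assumes "v \<in> Wt \<mu>" "i \<in> nodes T" "opE M i v = 0" "v \<noteq> 0"
  shows "\<mu> i \<ge> 0" "dF i (Suc (nat (\<mu> i))) v = 0"
proof -
  obtain m where m: "(opF M i ^^ m) v = 0" using nilF[OF assms(2)] by blast
  define r where "r = (LEAST m. (opF M i ^^ m) v = 0)"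
  have r: "(opF M i ^^ r) v = 0" unfolding r_def by (rule LeastI) fact
  then obtain s where s: "r = Suc s" using assms(4) by (cases r) auto
  have "(opF M i ^^ s) v \<noteq> 0" using not_less_Least[of s "\<lambda>m. (opF M i ^^ m) v = 0"] s r_def by auto
  then have nz: "dF i s v \<noteq> 0" by (simp add: dpowF_def)
  have z: "dF i (Suc s) v = 0" using r s by (simp add: dpowF_def)
  have "smul M (qnum T i (\<mu> i - int s)) (dF i s v) = 0"
    using E_dF[OF assms(1-3), of s] assms(2) by (simp add: z lin_zero[OF linE])
  then have "\<mu> i = int s" using nz by simp
  then show "\<mu> i \<ge> 0" "dF i (Suc (nat (\<mu> i))) v = 0" using z by auto
qed

lemma dF_vanish:
  assumes "v \<in> Wt \<mu>" "i \<in> nodes T" "opE M i v = 0" "int n > \<mu> i"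
  shows "dF i n v = 0"
proof (cases "v = 0")
  case False
  note h = hw_nilpotent[OF assms(1-3) False]
  obtain d where d: "n = d + Suc (nat (\<mu> i))"
    using assms(4) h(1) by (metis add.commute le_Suc_ex less_eq_Suc_le zless_nat_conj nat_less_iff)
  have "(opF M i ^^ Suc (nat (\<mu> i))) v = 0" using h(2) by (simp add: dpowF_def)
  then have "(opF M i ^^ n) v = 0"
    unfolding d funpow_add by (simp add: lin_zero[OF lin_pow[OF linF[OF assms(2)]]] del: funpow.simps)
  then show ?thesis by (simp add: dpowF_def)
qed (simp add: assms)

section \<open>Independence of weights and existence of strings\<close>

lemma weight_independent:
  assumes "finite S" "S \<subseteq> weights T" "\<And>\<mu>. \<mu> \<in> S \<Longrightarrow> v \<mu> \<in> Wt \<mu>" "(\<Sum>\<mu>\<in>S. v \<mu>) = 0" "\<mu> \<in> S"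
  shows "v \<mu> = 0"
  using assms
proof (induction S arbitrary: v \<mu> rule: finite_induct)
  case (insert \<nu> S)
  have vS: "v \<kappa> = 0" if "\<kappa> \<in> S" for \<kappa>
  proof -
    have "\<kappa> \<noteq> \<nu>" "\<kappa> \<in> weights T" "\<nu> \<in> weights T" using that insert by auto
    then obtain i where i: "i \<in> nodes T" "\<kappa> i \<noteq> \<nu> i" by (fastforce simp: weights_def)
    \<comment> \<open>The operator K_i - q_i^(\<nu> i) kills the summand of weight \<nu> and
      rescales each of the others; the factor at \<kappa> is nonzero by the choice of i.\<close>
    define w where "w = (\<lambda>\<mu>. smul M (qi T i powi \<mu> i - qi T i powi \<nu> i) (v \<mu>))"
    have "(\<Sum>\<mu>\<in>insert \<nu> S. w \<mu>) = (\<Sum>\<mu>\<in>insert \<nu> S. opK M i (v \<mu>) - smul M (qi T i powi \<nu> i) (v \<mu>))"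
      unfolding w_def using insert.prems(2) i
      by (intro sum.cong refl) (simp add: V.scale_left_diff_distrib K_Wt[OF insert.prems(2)])
    also have "\<dots> = opK M i (\<Sum>\<mu>\<in>insert \<nu> S. v \<mu>) - smul M (qi T i powi \<nu> i) (\<Sum>\<mu>\<in>insert \<nu> S. v \<mu>)"
      by (simp only: lin_sum[OF linK[OF i(1)]] V.scale_sum_right sum_subtractf)
    also have "\<dots> = 0" unfolding insert.prems(3) using i by (simp add: lin_zero[OF linK])
    finally have "(\<Sum>\<mu>\<in>S. w \<mu>) = 0" using insert.hyps by (simp add: w_def)
    then have "w \<kappa> = 0"
      using insert.IH[of w \<kappa>] insert.prems that unfolding w_def by (auto intro: Wt_scale)
    then show ?thesis using i by (simp add: w_def qi_powi_inj)
  qed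
  then show ?case using insert by (cases "\<mu> = \<nu>") auto
qed auto

text \<open>Grouping the summands by weight reduces this to distinct weights. The index map
  \<open>w\<close> lets several vectors share a weight; later proofs add indices for isolated
  vectors of an equation.\<close>

lemma weight_component_zero:
  assumes "finite P" "\<And>p. p \<in> P \<Longrightarrow> w p \<in> weights T" "\<And>p. p \<in> P \<Longrightarrow> v p \<in> Wt (w p)" "(\<Sum>p\<in>P. v p) = 0"
  shows "(\<Sum>p\<in>{p\<in>P. w p = \<nu>}. v p) = 0"
proof (cases "\<nu> \<in> w ` P")
  case True
  have "(\<Sum>\<mu>\<in>w ` P. (\<Sum>p\<in>{p\<in>P. w p = \<mu>}. v p)) = 0"
    using assms(1,4) sum.group[of P "w ` P" w v] by simp
  then show ?thesis
    using assms True
    by (intro weight_independent[of "w ` P" "\<lambda>\<mu>. \<Sum>p\<in>{p\<in>P. w p = \<mu>}. v p" \<nu>] Wt_sum) auto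
next
  case False
  then have "{p\<in>P. w p = \<nu>} = {}" by auto
  then show ?thesis by (metis sum.empty)
qed

text \<open>If E_i^(k+1) kills x, then y = E_i^k x is a highest weight vector, and subtracting a
  multiple of F_i^(k) y from x lowers k. All of this happens inside \<open>G\<close>, which later
  keeps the Kashiwara operators inside a submodule. The inequality 0 \<le> \<mu> i + n says that n
  is at most the weight \<mu> i + 2n of \<open>c n\<close>.\<close>

lemma string_exists:
  assumes "V.subspace G" "\<And>v. v \<in> G \<Longrightarrow> opE M i v \<in> G" "\<And>v. v \<in> G \<Longrightarrow> opF M i v \<in> G"
    and "i \<in> nodes T" "x \<in> G" "x \<in> Wt \<mu>" "(opE M i ^^ k) x = 0"
  shows "\<exists>c. (\<forall>n. c n \<in> G \<and> c n \<in> Wt (wshift T i (int n) \<mu>) \<and> opE M i (c n) = 0 \<and>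
      (c n \<noteq> 0 \<longrightarrow> 0 \<le> \<mu> i + int n) \<and> (n \<ge> k \<longrightarrow> c n = 0)) \<and> x = (\<Sum>n<k. dF i n (c n))"
  using assms(5-7)
proof (induction k arbitrary: x)
  case 0
  then show ?case using V.subspace_0[OF assms(1)]
    by (intro exI[of _ "\<lambda>_. 0"]) (auto simp: Wt_0 lin_zero[OF linE[OF assms(4)]])
next
  case (Suc k)
  note i = assms(4)
  note E0 = lin_zero[OF linE[OF i]] and F0 = lin_zero[OF linF[OF i]]
  have Gpow: "(opE M i ^^ n) v \<in> G" "(opF M i ^^ n) v \<in> G" if "v \<in> G" for n v
    using that by (induction n) (auto simp: assms)
  define y where "y = (opE M i ^^ k) x"
  have yG: "y \<in> G" unfolding y_def by (rule Gpow) fact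
  have yW: "y \<in> Wt (wshift T i (int k) \<mu>)" unfolding y_def by (rule Epow_Wt) fact+
  have Ey: "opE M i y = 0" using Suc.prems by (simp add: y_def)
  have GdF: "dF i n v \<in> G" if "v \<in> G" for n v
    unfolding dpowF_def using Gpow that V.subspace_scale[OF assms(1)] by blast
  show ?case
  proof (cases "y = 0")
    case True
    then obtain c where c: "\<forall>n. c n \<in> G \<and> c n \<in> Wt (wshift T i (int n) \<mu>) \<and> opE M i (c n) = 0 \<and>
      (c n \<noteq> 0 \<longrightarrow> 0 \<le> \<mu> i + int n) \<and> (n \<ge> k \<longrightarrow> c n = 0)" "x = (\<Sum>n<k. dF i n (c n))"
      using Suc.IH[OF Suc.prems(1,2)] y_def by auto
    then have "c k = 0" by simp
    then show ?thesis using c i by (intro exI[of _ c]) auto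
  next
    case False
    define N where "N = \<mu> i + 2 * int k"
    have Nw: "wshift T i (int k) \<mu> i = N" using i by (simp add: wshift_same N_def)
    have N0: "N \<ge> 0" using hw_nilpotent(1)[OF yW i Ey False] Nw by simp
    have kN: "int k \<le> N"
    proof (rule ccontr)
      assume "\<not> int k \<le> N"
      then have kN: "nat N + 1 \<le> k" using N0 by auto
      \<comment> \<open>\<open>z\<close> has weight \<open>-N-2\<close>; the image of \<open>F\<^sup>r z\<close> under \<open>E\<^sup>N\<^sup>+\<^sup>1\<^sup>+\<^sup>r\<close> is a nonzero multiple of
          \<open>y\<close>, so \<open>F\<close> is not nilpotent on \<open>z\<close>.\<close>
      define z where "z = (opE M i ^^ (k - nat N - 1)) x"
      have zW: "z \<in> Wt (wshift T i (int (k - nat N - 1)) \<mu>)"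
        unfolding z_def by (rule Epow_Wt) fact+
      have zi: "wshift T i (int (k - nat N - 1)) \<mu> i = - N - 2"
      proof -
        have "int (k - nat N - 1) = int k - N - 1" using kN N0 by linarith
        then show ?thesis using i by (simp add: wshift_same N_def)
      qed
      have Ez: "(opE M i ^^ (nat N + 1)) z = y"
      proof -
        have "k = nat N + 1 + (k - nat N - 1)" using kN by linarith
        then show ?thesis unfolding z_def y_def by (metis comp_apply funpow_add)
      qed
      have claim: "\<exists>a. a \<noteq> 0 \<and> (opE M i ^^ (nat N + 1 + r)) ((opF M i ^^ r) z) = smul M a y" for r
      proof (induction r)
        case 0
        then show ?case using Ez by (intro exI[of _ 1]) simp
      next
        case (Suc r)
        then obtain a where a: "a \<noteq> 0" "(opE M i ^^ (nat N + 1 + r)) ((opF M i ^^ r) z) = smul M a y"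
          by blast
        define v where "v = (opF M i ^^ r) z"
        have vW: "v \<in> Wt (wshift T i (- int r) (wshift T i (int (k - nat N - 1)) \<mu>))"
          unfolding v_def by (rule Fpow_Wt) fact+
        have vi: "wshift T i (- int r) (wshift T i (int (k - nat N - 1)) \<mu>) i = - N - 2 - 2 * int r"
          using zi i wshift_same[of i T "- int r" "wshift T i (int (k - nat N - 1)) \<mu>"] by linarith
        let ?s = "nat N + 1 + r"
        have "(opE M i ^^ (nat N + 1 + Suc r)) ((opF M i ^^ Suc r) z) = (opE M i ^^ Suc ?s) (opF M i v)"
          by (simp add: v_def)
        also have "\<dots> = opF M i ((opE M i ^^ Suc ?s) v) +
            smul M (qnum T i (1 + int ?s) * qnum T i (- N - 2 - 2 * int r + int ?s)) ((opE M i ^^ ?s) v)"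
          by (subst Epow_F[OF vW i]) (simp only: vi)
        also have "(opE M i ^^ Suc ?s) v = 0"
          using a(2) i Ey by (simp add: v_def lin_scale[OF linE])
        also have "qnum T i (1 + int ?s) * qnum T i (- N - 2 - 2 * int r + int ?s) =
            qnum T i (N + 2 + int r) * qnum T i (- 1 - int r)"
          using N0 by (simp add: algebra_simps)
        finally show ?case
          using a N0 F0 by (intro exI[of _ "qnum T i (N + 2 + int r) * qnum T i (- 1 - int r) * a"])
            (auto simp: v_def)
      qed
      obtain r where "(opF M i ^^ r) z = 0" using nilF[OF i] by blast
      then show False using claim[of r] False i by (auto simp: lin_zero[OF lin_pow[OF linE]] lin_zero[OF linE])
    qed
    \<comment> \<open>By \<open>Epow_dF\<close>, E_i^k sends F_i^(k) y to \<zeta> y; by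
      \<open>kN\<close> no factor of \<zeta> vanishes.\<close>
    define \<zeta> where "\<zeta> = (\<Prod>t<k. qnum T i (N - int t))"
    have \<zeta>0: "\<zeta> \<noteq> 0" using kN by (auto simp: \<zeta>_def)
    define x' where "x' = x - dF i k (smul M (inverse \<zeta>) y)"
    have "(opE M i ^^ k) x' = 0"
      unfolding x'_def lin_diff[OF lin_pow[OF linE[OF i]]] lin_scale[OF lin_dF[OF i]]
        lin_scale[OF lin_pow[OF linE[OF i]]] Epow_dF[OF yW i Ey] Nw
      using \<zeta>0 by (simp add: y_def \<zeta>_def)
    moreover have "x' \<in> G"
      unfolding x'_def by (intro V.subspace_diff[OF assms(1)] Suc.prems GdF V.subspace_scale[OF assms(1)] yG)
    moreover have "x' \<in> Wt \<mu>"
      unfolding x'_def using dF_Wt[OF Wt_scale[OF yW] i, of k] Suc.prems by (intro Wt_diff) auto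
    ultimately obtain c where c: "\<forall>n. c n \<in> G \<and> c n \<in> Wt (wshift T i (int n) \<mu>) \<and> opE M i (c n) = 0 \<and>
      (c n \<noteq> 0 \<longrightarrow> 0 \<le> \<mu> i + int n) \<and> (n \<ge> k \<longrightarrow> c n = 0)" "x' = (\<Sum>n<k. dF i n (c n))"
      using Suc.IH by blast
    let ?c = "c(k := smul M (inverse \<zeta>) y)"
    have "x = (\<Sum>n<k. dF i n (?c n)) + dF i k (?c k)"
      using c(2) by (simp add: x'_def algebra_simps)
    then have "x = (\<Sum>n<Suc k. dF i n (?c n))" by (simp add: add.commute)
    moreover have "0 \<le> \<mu> i + int k" using kN by (simp add: N_def)
    ultimately show ?thesis
      using c(1) yG yW Ey i
      by (intro exI[of _ ?c]) (auto simp: V.subspace_scale[OF assms(1)] Wt_scale lin_scale[OF linE])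
  qed
qed

end

context qrep
begin

section \<open>Uniqueness of string decompositions and the operators they define\<close>

definition hwv :: "nat \<Rightarrow> weight \<Rightarrow> 'w \<Rightarrow> bool" where
  "hwv i \<mu> c \<longleftrightarrow> \<mu> \<in> weights T \<and> c \<in> Wt \<mu> \<and> opE M i c = 0"

definition strings :: "nat \<Rightarrow> (weight \<times> nat \<Rightarrow> 'w) \<Rightarrow> bool" where
  "strings i c \<longleftrightarrow> finite {p. c p \<noteq> 0} \<and> (\<forall>\<mu> n. c (\<mu>, n) \<noteq> 0 \<longrightarrow> hwv i \<mu> (c (\<mu>, n)) \<and> int n \<le> \<mu> i)"

text \<open>One expression for three sums: \<open>g\<close> is \<open>dF i\<close> for the vector
  itself, \<open>lowF i\<close> for its image under \<open>ke\<close>, and the shifted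
  \<open>dF\<close> for its image under \<open>kf\<close>.\<close>

definition evs :: "(nat \<Rightarrow> 'w \<Rightarrow> 'w) \<Rightarrow> (weight \<times> nat \<Rightarrow> 'w) \<Rightarrow> 'w" where
  "evs g c = (\<Sum>p | c p \<noteq> 0. g (snd p) (c p))"

lemma string_decomp_iff: "string_decomp T M i x c \<longleftrightarrow> strings i c \<and> x = evs (dF i) c"
  by (auto simp: string_decomp_def strings_def evs_def hwv_def)

lemma evs_superset:
  assumes "finite P" "{p. c p \<noteq> 0} \<subseteq> P" "\<And>n. lin (g n)"
  shows "evs g c = (\<Sum>p\<in>P. g (snd p) (c p))"
  unfolding evs_def using assms by (intro sum.mono_neutral_left) (auto simp: lin_zero)

lemma strings_add: "i \<in> nodes T \<Longrightarrow> strings i c \<Longrightarrow> strings i d \<Longrightarrow> strings i (\<lambda>p. c p + d p)"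
proof -
  assume i: "i \<in> nodes T" and c: "strings i c" and d: "strings i d"
  have "{p. c p + d p \<noteq> 0} \<subseteq> {p. c p \<noteq> 0} \<union> {p. d p \<noteq> 0}" by auto
  then have "finite {p. c p + d p \<noteq> 0}"
    using c d by (auto simp: strings_def intro: finite_subset)
  moreover have "hwv i \<mu> (c (\<mu>, n) + d (\<mu>, n)) \<and> int n \<le> \<mu> i" if nz: "c (\<mu>, n) + d (\<mu>, n) \<noteq> 0" for \<mu> n
  proof -
    have "c (\<mu>, n) \<noteq> 0 \<or> d (\<mu>, n) \<noteq> 0" using nz by auto
    then have 1: "\<mu> \<in> weights T" "int n \<le> \<mu> i" using c d by (auto simp: strings_def hwv_def)
    have "c (\<mu>, n) \<in> Wt \<mu>" "opE M i (c (\<mu>, n)) = 0" "d (\<mu>, n) \<in> Wt \<mu>" "opE M i (d (\<mu>, n)) = 0"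
      using c d i by (cases "c (\<mu>, n) = 0"; auto simp: strings_def hwv_def Wt_0 lin_zero[OF linE];
          cases "d (\<mu>, n) = 0"; auto simp: strings_def hwv_def Wt_0 lin_zero[OF linE])+
    then show ?thesis using 1 i by (auto simp: hwv_def Wt_add lin_add[OF linE])
  qed
  ultimately show ?thesis by (auto simp: strings_def)
qed

lemma strings_scale: "i \<in> nodes T \<Longrightarrow> strings i c \<Longrightarrow> strings i (\<lambda>p. smul M a (c p))"
proof -
  assume i: "i \<in> nodes T" and c: "strings i c"
  have "{p. smul M a (c p) \<noteq> 0} \<subseteq> {p. c p \<noteq> 0}" by auto
  then have "finite {p. smul M a (c p) \<noteq> 0}"
    using c by (auto simp: strings_def intro: finite_subset)
  then show ?thesis
    using c i by (auto simp: strings_def hwv_def Wt_scale lin_scale[OF linE])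
qed

lemma evs_add:
  assumes "strings i c" "strings i d" "\<And>n. lin (g n)"
  shows "evs g (\<lambda>p. c p + d p) = evs g c + evs g d"
proof -
  let ?P = "{p. c p \<noteq> 0} \<union> {p. d p \<noteq> 0}"
  have "finite ?P" using assms by (auto simp: strings_def)
  then show ?thesis
    using assms(3) by (subst (1 2 3) evs_superset[of ?P]) (auto simp: lin_add sum.distrib)
qed

lemma evs_scale:
  assumes "strings i c" "\<And>n. lin (g n)"
  shows "evs g (\<lambda>p. smul M a (c p)) = smul M a (evs g c)"
proof -
  let ?P = "{p. c p \<noteq> 0}"
  have "finite ?P" using assms by (auto simp: strings_def)
  then show ?thesis
    using assms(2) by (subst (1 2) evs_superset[of ?P]) (auto simp: lin_scale V.scale_sum_right)
qed

text \<open>Within one weight, the term with the largest index n is isolated: E_i^n kills all other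
  terms and sends this one to a nonzero multiple of its highest weight vector.\<close>

lemma strings_independent:
  assumes i: "i \<in> nodes T" and c: "strings i c" and z: "evs (dF i) c = 0"
  shows "c p = 0"
proof (rule ccontr)
  assume nz: "c p \<noteq> 0"
  define P where "P = {p. c p \<noteq> 0}"
  define w where "w = (\<lambda>p :: weight \<times> nat. wshift T i (- int (snd p)) (fst p))"
  define P' where "P' = {p'\<in>P. w p' = w p}"
  have fin: "finite P" using c by (auto simp: P_def strings_def)
  then have fin': "finite P'" by (auto simp: P'_def)
  have cP: "hwv i (fst p) (c p)" "int (snd p) \<le> fst p i" if "p \<in> P" for p
    using that c by (cases p; auto simp: P_def strings_def)+
  have "(\<Sum>p\<in>P'. dF i (snd p) (c p)) = 0"
    unfolding P'_def
  proof (rule weight_component_zero[OF fin])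
    show "dF i (snd p) (c p) \<in> Wt (w p)" if "p \<in> P" for p
      using cP[OF that] i unfolding w_def hwv_def by (intro dF_Wt) auto
    show "(\<Sum>p\<in>P. dF i (snd p) (c p)) = 0" using z by (simp add: evs_def P_def)
  qed (use cP in \<open>auto simp: w_def hwv_def\<close>)
  then have 0: "(\<Sum>p\<in>P'. (opE M i ^^ n) (dF i (snd p) (c p))) = 0" for n
    using lin_sum[OF lin_pow[OF linE[OF i]], of n "\<lambda>p. dF i (snd p) (c p)" P']
      lin_zero[OF lin_pow[OF linE[OF i]], of n] by simp
  have "p \<in> P'" using nz by (simp add: P'_def P_def)
  define n where "n = Max (snd ` P')"
  have "n \<in> snd ` P'" unfolding n_def using fin' \<open>p \<in> P'\<close> by (intro Max_in) auto
  then obtain p1 where p1: "p1 \<in> P'" "snd p1 = n" by auto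
  have le: "snd p \<le> n" if "p \<in> P'" for p using that fin' by (auto simp: n_def)
  \<comment> \<open>Equal weight and equal index force equal highest weights, so the maximal index
    occurs only once.\<close>
  have lt: "snd p2 < n" if "p2 \<in> P' - {p1}" for p2
  proof (rule ccontr)
    assume "\<not> snd p2 < n"
    then have eq: "snd p2 = snd p1" using le[of p2] that p1 by auto
    have "w p2 = w p1" using that p1 by (auto simp: P'_def)
    then have "fst p2 = fst p1" using eq by (simp add: w_def wshift_eq_iff)
    then show False using eq that by (auto simp: prod_eq_iff)
  qed
  have p1P: "p1 \<in> P" using p1 by (auto simp: P'_def)
  have "(\<Sum>p\<in>P'. (opE M i ^^ n) (dF i (snd p) (c p))) = (opE M i ^^ n) (dF i n (c p1))"
  proof (subst sum.remove[OF fin' p1(1)], subst sum.neutral)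
    show "\<forall>p\<in>P' - {p1}. (opE M i ^^ n) (dF i (snd p) (c p)) = 0"
      using cP lt i by (auto simp: hwv_def P'_def intro!: Epow_dF_0)
  qed (simp add: p1)
  also have "\<dots> = smul M (\<Prod>t<n. qnum T i (fst p1 i - int t)) (c p1)"
    using cP[OF p1P] i by (intro Epow_dF) (auto simp: hwv_def)
  finally have "(\<Prod>t<n. qnum T i (fst p1 i - int t)) = 0"
    using 0[of n] p1P by (auto simp: P_def)
  then show False using cP(2)[OF p1P] p1(2) by auto
qed

lemma string_decomp_unique:
  assumes i: "i \<in> nodes T" and "string_decomp T M i x c" "string_decomp T M i x d"
  shows "c = d"
proof
  fix p
  have s: "strings i c" "strings i d" "evs (dF i) c = evs (dF i) d"
    using assms by (auto simp: string_decomp_iff)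
  have s': "strings i (\<lambda>p. smul M (- 1) (d p))" by (rule strings_scale[OF i s(2)])
  have "evs (dF i) (\<lambda>p. c p + smul M (- 1) (d p)) = evs (dF i) c + smul M (- 1) (evs (dF i) d)"
    using evs_add[OF s(1) s' lin_dF[OF i]] evs_scale[OF s(2) lin_dF[OF i], where a = "- 1"] by simp
  also have "\<dots> = 0" using s(3) by simp
  finally have "c p + smul M (- 1) (d p) = 0"
    by (rule strings_independent[OF i strings_add[OF i s(1) s']])
  then show "c p = d p" by simp
qed

abbreviation "ke \<equiv> kashiwara_e T M"
abbreviation "kf \<equiv> kashiwara_f T M"

definition lowF :: "nat \<Rightarrow> nat \<Rightarrow> 'w \<Rightarrow> 'w" where
  "lowF i n v = (if n = 0 then 0 else dF i (n - 1) v)"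

lemma lin_lowF: "i \<in> nodes T \<Longrightarrow> lin (lowF i n)"
  unfolding lowF_def using lin_dF[of i "n - 1"] lin_0 by (cases "n = 0") auto

lemma ke_eq: "i \<in> nodes T \<Longrightarrow> strings i c \<Longrightarrow> ke i (evs (dF i) c) = evs (lowF i) c"
  unfolding kashiwara_e_def evs_def[of "lowF i"] lowF_def
  by (rule the_equality) (use string_decomp_unique string_decomp_iff in blast)+

lemma kf_eq: "i \<in> nodes T \<Longrightarrow> strings i c \<Longrightarrow> kf i (evs (dF i) c) = evs (\<lambda>n. dF i (Suc n)) c"
  unfolding kashiwara_f_def evs_def[of "\<lambda>n. dF i (Suc n)"]
  by (rule the_equality) (use string_decomp_unique string_decomp_iff in blast)+

lemma weight_strings:
  assumes "V.subspace G" "\<And>v. v \<in> G \<Longrightarrow> opE M i v \<in> G" "\<And>v. v \<in> G \<Longrightarrow> opF M i v \<in> G"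
    and i: "i \<in> nodes T" and x: "x \<in> G" "x \<in> Wt \<mu>" "\<mu> \<in> weights T"
  obtains k c where "\<And>n. c n \<in> G" "\<And>n. hwv i (wshift T i (int n) \<mu>) (c n)"
    "\<And>n. c n \<noteq> 0 \<Longrightarrow> int n \<le> wshift T i (int n) \<mu> i" "x = (\<Sum>n<k. dF i n (c n))"
proof -
  obtain k where "(opE M i ^^ k) x = 0" using nilE[OF i] by blast
  from string_exists[OF assms(1-3) i x(1,2) this]
  obtain c where c: "\<And>n. c n \<in> G \<and> c n \<in> Wt (wshift T i (int n) \<mu>) \<and> opE M i (c n) = 0 \<and>
      (c n \<noteq> 0 \<longrightarrow> 0 \<le> \<mu> i + int n)" "x = (\<Sum>n<k. dF i n (c n))" by auto
  show thesis
  proof (rule that[of c k])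
    show "int n \<le> wshift T i (int n) \<mu> i" if "c n \<noteq> 0" for n
      using c(1)[of n] that i by (simp add: wshift_same)
  qed (use c x(3) in \<open>auto simp: hwv_def\<close>)
qed

lemma strings_exist:
  assumes i: "i \<in> nodes T"
  shows "\<exists>c. strings i c \<and> x = evs (dF i) c"
proof -
  have "x \<in> V.span (\<Union>\<mu>\<in>weights T. Wt \<mu>)" by (simp add: span_weights)
  then show ?thesis
  proof (induction rule: V.span_induct_alt)
    case base
    then show ?case by (intro exI[of _ "\<lambda>_. 0"]) (auto simp: strings_def evs_def)
  next
    case (step a y z)
    then obtain d where d: "strings i d" "z = evs (dF i) d" by blast
    obtain \<mu> where \<mu>: "\<mu> \<in> weights T" "y \<in> Wt \<mu>" using step by auto
    obtain k c where c: "\<And>n. hwv i (wshift T i (int n) \<mu>) (c n)"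
      "\<And>n. c n \<noteq> 0 \<Longrightarrow> int n \<le> wshift T i (int n) \<mu> i" "y = (\<Sum>n<k. dF i n (c n))"
      using weight_strings[OF V.subspace_UNIV UNIV_I UNIV_I i UNIV_I \<mu>(2,1)] by metis
    define c' where "c' = (\<lambda>(\<kappa>, n). if \<kappa> = wshift T i (int n) \<mu> \<and> n < k then c n else 0)"
    let ?P = "(\<lambda>n. (wshift T i (int n) \<mu>, n)) ` {..<k}"
    have sub: "{p. c' p \<noteq> 0} \<subseteq> ?P" by (auto simp: c'_def split: if_splits)
    have s: "strings i c'"
      using finite_subset[OF sub] c by (auto simp: strings_def c'_def split: if_splits)
    have "evs (dF i) c' = (\<Sum>p\<in>?P. dF i (snd p) (c' p))"
      using sub lin_dF[OF i] by (intro evs_superset) auto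
    also have "\<dots> = y" unfolding c(3)
      by (subst sum.reindex) (auto simp: inj_on_def c'_def)
    finally have "smul M a y + z = evs (dF i) (\<lambda>p. smul M a (c' p) + d p)"
      using evs_add[OF strings_scale[OF i s] d(1) lin_dF[OF i]] evs_scale[OF s lin_dF[OF i]] d(2) by simp
    then show ?case using strings_add[OF i strings_scale[OF i s] d(1)] by blast
  qed
qed

lemma lin_ke: assumes i: "i \<in> nodes T" shows "lin (ke i)"
proof (rule linI)
  fix x y a
  obtain c d where cd: "strings i c" "x = evs (dF i) c" "strings i d" "y = evs (dF i) d"
    using strings_exist[OF i] by metis
  show "ke i (x + y) = ke i x + ke i y"
    using ke_eq[OF i strings_add[OF i cd(1,3)]] i cd
    by (simp add: evs_add[OF cd(1,3)] lin_dF lin_lowF ke_eq)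
  show "ke i (smul M a x) = smul M a (ke i x)"
    using ke_eq[OF i strings_scale[OF i cd(1), of a]] i cd
    by (simp add: evs_scale[OF cd(1)] lin_dF lin_lowF ke_eq)
qed

lemma lin_kf: assumes i: "i \<in> nodes T" shows "lin (kf i)"
proof (rule linI)
  fix x y a
  obtain c d where cd: "strings i c" "x = evs (dF i) c" "strings i d" "y = evs (dF i) d"
    using strings_exist[OF i] by metis
  show "kf i (x + y) = kf i x + kf i y"
    using kf_eq[OF i strings_add[OF i cd(1,3)]] i cd
    by (simp add: evs_add[OF cd(1,3)] lin_dF kf_eq)
  show "kf i (smul M a x) = smul M a (kf i x)"
    using kf_eq[OF i strings_scale[OF i cd(1), of a]] i cd
    by (simp add: evs_scale[OF cd(1)] lin_dF kf_eq)
qed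

lemma single_string:
  assumes "hwv i \<mu> c" "c \<noteq> 0" "int n \<le> \<mu> i"
  shows "strings i (\<lambda>p. if p = (\<mu>, n) then c else 0)" "evs g (\<lambda>p. if p = (\<mu>, n) then c else 0) = g n c"
proof -
  have "{p. (if p = (\<mu>, n) then c else 0) \<noteq> 0} = {(\<mu>, n)}" using assms by auto
  then show "strings i (\<lambda>p. if p = (\<mu>, n) then c else 0)" "evs g (\<lambda>p. if p = (\<mu>, n) then c else 0) = g n c"
    using assms by (auto simp: strings_def evs_def)
qed

lemma ke_dF:
  assumes i: "i \<in> nodes T" and c: "hwv i \<mu> c" "c \<noteq> 0 \<Longrightarrow> int n \<le> \<mu> i"
  shows "ke i (dF i n c) = (if n = 0 then 0 else dF i (n - 1) c)"
proof (cases "c = 0")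
  case True
  then show ?thesis using i by (simp add: lin_zero[OF lin_ke])
next
  case False
  note s = single_string[OF c(1) False c(2)[OF False]]
  show ?thesis using ke_eq[OF i s(1)] by (simp add: s(2) lowF_def)
qed

lemma kf_dF:
  assumes i: "i \<in> nodes T" and c: "hwv i \<mu> c"
  shows "kf i (dF i n c) = dF i (Suc n) c"
proof (cases "c = 0 \<or> \<mu> i < int n")
  case True
  then have "dF i n c = 0" "dF i (Suc n) c = 0"
    using i c dF_vanish[of c \<mu> i n] dF_vanish[of c \<mu> i "Suc n"] by (auto simp: hwv_def)
  then show ?thesis using i by (simp add: lin_zero[OF lin_kf])
next
  case False
  then have False': "c \<noteq> 0" "int n \<le> \<mu> i" by auto
  note s = single_string[OF c(1) False']
  show ?thesis using kf_eq[OF i s(1)] by (simp add: s(2))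
qed

lemma ke_dF_pow:
  assumes i: "i \<in> nodes T" and c: "hwv i \<mu> c" "c \<noteq> 0 \<Longrightarrow> int n \<le> \<mu> i"
  shows "(ke i ^^ k) (dF i n c) = (if k \<le> n then dF i (n - k) c else 0)"
proof (induction k)
  case (Suc k)
  show ?case
  proof (cases "k \<le> n")
    case True
    have "c \<noteq> 0 \<Longrightarrow> int (n - k) \<le> \<mu> i" using c(2) by fastforce
    from ke_dF[OF i c(1) this] show ?thesis using Suc True by auto
  qed (use Suc i in \<open>auto simp: lin_zero[OF lin_ke]\<close>)
qed simp

lemma kf_dF_pow:
  assumes i: "i \<in> nodes T" and c: "hwv i \<mu> c"
  shows "(kf i ^^ k) (dF i n c) = dF i (n + k) c"
  by (induction k) (simp_all add: kf_dF[OF i c])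

text \<open>The string components of x can be chosen in \<open>G\<close>, and the Kashiwara
  operators only change the divided powers in front of them.\<close>

lemma ke_closed:
  assumes "V.subspace G" "\<And>v. v \<in> G \<Longrightarrow> opE M i v \<in> G" "\<And>v. v \<in> G \<Longrightarrow> opF M i v \<in> G"
    and i: "i \<in> nodes T" and x: "x \<in> G" "x \<in> Wt \<mu>" "\<mu> \<in> weights T"
  shows "ke i x \<in> G" "ke i x \<in> Wt (wshift T i 1 \<mu>)" "kf i x \<in> G" "kf i x \<in> Wt (wshift T i (- 1) \<mu>)"
proof -
  obtain k c where c: "\<And>n. c n \<in> G" "\<And>n. hwv i (wshift T i (int n) \<mu>) (c n)"
    "\<And>n. c n \<noteq> 0 \<Longrightarrow> int n \<le> wshift T i (int n) \<mu> i" "x = (\<Sum>n<k. dF i n (c n))"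
    using weight_strings[OF assms] by metis
  have GdF: "dF i n v \<in> G" if "v \<in> G" for n v
  proof -
    have "(opF M i ^^ n) v \<in> G" using that by (induction n) (auto simp: assms(3))
    then show ?thesis unfolding dpowF_def by (rule V.subspace_scale[OF assms(1)])
  qed
  have WdF: "dF i m (c n) \<in> Wt (wshift T i (int n - int m) \<mu>)" for m n
    using c(2)[of n] dF_Wt[of "c n" "wshift T i (int n) \<mu>" i m] i by (simp add: hwv_def)
  have ke: "ke i x = (\<Sum>n<k. if n = 0 then 0 else dF i (n - 1) (c n))"
    using c(4) by (simp add: lin_sum[OF lin_ke[OF i]] ke_dF[OF i c(2) c(3)])
  have kf: "kf i x = (\<Sum>n<k. dF i (Suc n) (c n))"
    using c(4) by (simp add: lin_sum[OF lin_kf[OF i]] kf_dF[OF i c(2)])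
  show "ke i x \<in> G" unfolding ke
    by (intro V.subspace_sum[OF assms(1)]) (auto intro: GdF c V.subspace_0[OF assms(1)])
  show "kf i x \<in> G" unfolding kf
    by (intro V.subspace_sum[OF assms(1)]) (auto intro: GdF c)
  show "ke i x \<in> Wt (wshift T i 1 \<mu>)" unfolding ke
  proof (intro Wt_sum)
    fix n show "(if n = 0 then 0 else dF i (n - 1) (c n)) \<in> Wt (wshift T i 1 \<mu>)"
      using WdF[of "n - 1" n] by (auto simp: Wt_0 of_nat_diff)
  qed
  show "kf i x \<in> Wt (wshift T i (- 1) \<mu>)" unfolding kf
  proof (intro Wt_sum)
    fix n show "dF i (Suc n) (c n) \<in> Wt (wshift T i (- 1) \<mu>)"
      using WdF[of "Suc n" n] by simp
  qed
qed

lemmas ke_Wt = ke_closed(2)[OF V.subspace_UNIV UNIV_I UNIV_I _ UNIV_I]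
  and kf_Wt = ke_closed(4)[OF V.subspace_UNIV UNIV_I UNIV_I _ UNIV_I]

text \<open>The power \<open>ke i ^^ k\<close> isolates the component of the last index k. Lowering
  it back and subtracting shortens the sum.\<close>

lemma string_components:
  assumes i: "i \<in> nodes T"
    and L: "\<And>x y. x \<in> L \<Longrightarrow> y \<in> L \<Longrightarrow> x - y \<in> L" "ke i ` L \<subseteq> L" "kf i ` L \<subseteq> L"
    and c: "\<And>n. hwv i (w n) (c n)" "\<And>n. c n \<noteq> 0 \<Longrightarrow> int n \<le> w n i"
    and x: "(\<Sum>n<k. dF i n (c n)) \<in> L" and n: "n < k"
  shows "c n \<in> L"
  using x n
proof (induction k)
  case (Suc k)
  have pow: "(ke i ^^ j) y \<in> L" "(kf i ^^ j) y \<in> L" if "y \<in> L" for j y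
    using that L by (induction j) auto
  have "(ke i ^^ k) (\<Sum>n<Suc k. dF i n (c n)) = (\<Sum>n<Suc k. if n = k then c n else 0)"
    unfolding lin_sum[OF lin_pow[OF lin_ke[OF i]]]
    by (intro sum.cong) (auto simp: ke_dF_pow[OF i c])
  then have ck: "c k \<in> L" using pow(1)[OF Suc.prems(1), of k] by simp
  then have "dF i k (c k) \<in> L" using pow(2)[OF ck, of k] kf_dF_pow[OF i c(1), of k 0 k] by simp
  then have "(\<Sum>n<k. dF i n (c n)) \<in> L" using L(1)[OF Suc.prems(1)] by force
  then show ?case using Suc ck by (cases "n = k") auto
qed simp

end

subsection \<open>Exchanging raising and lowering operators\<close>

text \<open>The twist by the Chevalley involution. It negates weights and makes lowest weight
  vectors highest weight vectors.\<close>

definition mirror_rep :: "'w uq_rep \<Rightarrow> 'w uq_rep" where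
  "mirror_rep M = \<lparr>smul = smul M, opE = opF M, opF = opE M, opK = opKinv M, opKinv = opK M\<rparr>"

lemma mirror_rep_sel [simp]:
  "smul (mirror_rep M) = smul M" "opE (mirror_rep M) = opF M" "opF (mirror_rep M) = opE M"
  "opK (mirror_rep M) = opKinv M" "opKinv (mirror_rep M) = opK M"
  by (simp_all add: mirror_rep_def)

lemma dpowF_mirror [simp]: "dpowF T (mirror_rep M) = dpowE T M"
  by (simp add: dpowF_def dpowE_def fun_eq_iff)

context qrep
begin

lemma weight_space_mirror: "weight_space T (mirror_rep M) \<mu> = Wt (\<lambda>i. - \<mu> i)"
proof -
  have "v \<in> weight_space T (mirror_rep M) \<mu>" if "v \<in> Wt (\<lambda>i. - \<mu> i)" for v
    using Kinv_Wt[OF that] by (simp add: weight_space_def)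
  moreover have "v \<in> Wt (\<lambda>i. - \<mu> i)" if "v \<in> weight_space T (mirror_rep M) \<mu>" for v
    unfolding weight_space_def mem_Collect_eq
  proof
    fix i assume i: "i \<in> nodes T"
    then have "opKinv M i v = smul M (qi T i powi \<mu> i) v" using that by (simp add: weight_space_def)
    then have "v = smul M (qi T i powi \<mu> i) (opK M i v)"
      using K_Kinv[OF i, of v] by (simp add: lin_scale[OF linK[OF i]])
    then show "opK M i v = smul M (qi T i powi - \<mu> i) v"
      by (metis (no_types) V.scale_scale V.scale_one qi_nonzero power_int_minus left_inverse power_int_not_zero)
  qed
  ultimately show ?thesis by blast
qed

lemma qrep_mirror: "qrep T (mirror_rep M)"
proof (rule qrep.intro)
  fix i j v assume i: "i \<in> nodes T" and j: "j \<in> nodes T"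
  have "opKinv M i (opF M j v) = opKinv M i (opF M j (opK M i (opKinv M i v)))"
    using i by (simp add: K_Kinv)
  also have "opF M j (opK M i (opKinv M i v)) = smul M (qi T i powi cartan T i j) (opK M i (opF M j (opKinv M i v)))"
    using K_F[OF i j, of "opKinv M i v"] by (simp add: power_int_minus)
  finally show "opK (mirror_rep M) i (opE (mirror_rep M) j v) =
      smul (mirror_rep M) (qi T i powi cartan T i j) (opE (mirror_rep M) j (opK (mirror_rep M) i v))"
    using i by (simp add: lin_scale[OF linKinv] Kinv_K)
next
  fix i j v assume i: "i \<in> nodes T" and j: "j \<in> nodes T"
  have "opKinv M i (opE M j v) = opKinv M i (opE M j (opK M i (opKinv M i v)))"
    using i by (simp add: K_Kinv)
  also have "opE M j (opK M i (opKinv M i v)) = smul M (qi T i powi - cartan T i j) (opK M i (opE M j (opKinv M i v)))"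
    using K_E[OF i j, of "opKinv M i v"] by (simp add: power_int_minus)
  finally show "opK (mirror_rep M) i (opF (mirror_rep M) j v) =
      smul (mirror_rep M) (qi T i powi - cartan T i j) (opF (mirror_rep M) j (opK (mirror_rep M) i v))"
    using i by (simp add: lin_scale[OF linKinv] Kinv_K)
next
  fix i j v assume i: "i \<in> nodes T" and j: "j \<in> nodes T"
  have "smul M a (x - y) = - smul M a (y - x)" for a x y by (simp add: V.scale_right_diff_distrib)
  then show "opE (mirror_rep M) i (opF (mirror_rep M) j v) - opF (mirror_rep M) j (opE (mirror_rep M) i v) =
      (if i = j then smul (mirror_rep M) (inverse (qi T i - inverse (qi T i)))
         (opK (mirror_rep M) i v - opKinv (mirror_rep M) i v) else 0)"
    using E_F[OF j i, of v] by (auto simp: algebra_simps)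
next
  have w: "\<mu> \<in> weights T \<Longrightarrow> (\<lambda>i. - \<mu> i) \<in> weights T" for \<mu> by (auto simp: weights_def)
  have "(\<Union>\<mu>\<in>weights T. weight_space T (mirror_rep M) \<mu>) = (\<Union>\<mu>\<in>weights T. Wt \<mu>)"
  proof (intro equalityI UN_least subsetI)
    fix \<mu> v assume "\<mu> \<in> weights T" "v \<in> Wt \<mu>"
    then show "v \<in> (\<Union>\<mu>\<in>weights T. weight_space T (mirror_rep M) \<mu>)"
      using w[of \<mu>] by (intro UN_I[of "\<lambda>i. - \<mu> i"]) (auto simp: weight_space_mirror)
  qed (use w in \<open>auto simp: weight_space_mirror\<close>)
  then show "module.span (smul (mirror_rep M)) (\<Union>\<mu>\<in>weights T. weight_space T (mirror_rep M) \<mu>) = UNIV"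
    using span_weights by simp
qed (simp_all add: vs linE linF linK linKinv K_Kinv Kinv_K nilE nilF)

text \<open>Let N be the length of the string and z = E_i^(N) l. Then z is a highest weight vector
  and F_i^(t) z = E_i^(N-t) l with coefficient exactly 1, so divided powers from below and from
  above run through the same vectors.\<close>

lemma lowest_string:
  assumes i: "i \<in> nodes T" and l: "\<nu> \<in> weights T" "l \<in> Wt \<nu>" "opF M i l = 0" and s: "int s \<le> - \<nu> i"
  shows "ke i (dpowE T M i s l) = dpowE T M i (Suc s) l"
    and "kf i (dpowE T M i s l) = (if s = 0 then 0 else dpowE T M i (s - 1) l)"
proof -
  interpret m: qrep T "mirror_rep M" by (rule qrep_mirror)
  define N where "N = nat (- \<nu> i)"
  have N: "- \<nu> i = int N" "s \<le> N" using s by (auto simp: N_def)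
  let ?l = "\<lambda>i. - \<nu> i"
  have lw: "l \<in> m.Wt ?l" "opE (mirror_rep M) i l = 0" using l by (auto simp: weight_space_mirror)
  have dE: "opF M i (dpowE T M i (Suc n) l) = smul M (qnum T i (int N - int n)) (dpowE T M i n l)" for n
    using m.E_dF[OF lw(1) i lw(2), of n] N by simp
  define z where "z = dpowE T M i N l"
  have van: "dpowE T M i (Suc N) l = 0"
    using m.dF_vanish[OF lw(1) i lw(2), of "Suc N"] N by simp
  have Ez: "opE M i z = 0"
    using m.F_dF[OF i, of N l] van by (simp add: z_def)
  have "(opE M i ^^ N) l \<in> Wt (wshift T i (int N) \<nu>)" by (intro Epow_Wt l i)
  then have zW: "z \<in> Wt (wshift T i (int N) \<nu>)" unfolding z_def dpowE_def by (rule Wt_scale)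
  have zh: "hwv i (wshift T i (int N) \<nu>) z" using l zW Ez by (simp add: hwv_def)
  have zi: "wshift T i (int N) \<nu> i = int N" using i N by (simp add: wshift_same)
  have dFz: "dF i t z = dpowE T M i (N - t) l" if "t \<le> N" for t
    using that
  proof (induction t)
    case (Suc t)
    have e: "N - t = Suc (N - Suc t)" using Suc by simp
    have "smul M (qnum T i (1 + int t)) (dF i (Suc t) z) = opF M i (dpowE T M i (N - t) l)"
      using Suc i by (simp flip: F_dF)
    also have "\<dots> = smul M (qnum T i (1 + int t)) (dpowE T M i (N - Suc t) l)"
      unfolding e dE using Suc.prems by (simp add: of_nat_diff algebra_simps)
    finally show ?case by simp
  qed (simp add: z_def)
  have es: "dpowE T M i s l = dF i (N - s) z" using dFz[of "N - s"] N by simp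
  show "ke i (dpowE T M i s l) = dpowE T M i (Suc s) l"
    unfolding es using ke_dF[OF i zh, of "N - s"] zi N dFz[of "N - s - 1"] van
    by (cases "s = N") (auto simp: Suc_diff_le)
  show "kf i (dpowE T M i s l) = (if s = 0 then 0 else dpowE T M i (s - 1) l)"
  proof (cases "s = 0")
    case True
    then show ?thesis unfolding es using kf_dF[OF i zh, of N] dF_vanish[OF zW i Ez, of "Suc N"] zi
      by simp
  next
    case False
    then have "Suc (N - s) = N - (s - 1)" using N by simp
    then show ?thesis unfolding es using False kf_dF[OF i zh, of "N - s"] dFz[of "N - (s - 1)"] N by simp
  qed
qed

end

section \<open>Tensor products of modules\<close>

lemma symmetrizable:
  assumes "i \<in> nodes T" "j \<in> nodes T"
  shows "int (symmetrizer T i) * cartan T i j = int (symmetrizer T j) * cartan T j i"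
  using assms by (cases T) (auto simp: cartan_def nodes_def)

text \<open>Both sides are q to the power (\<alpha>_i, \<alpha>_j). The mixed terms of the
  commutator on a tensor product cancel by this symmetry.\<close>

lemma qi_powi_symmetric:
  assumes "i \<in> nodes T" "j \<in> nodes T"
  shows "qi T i powi cartan T i j = qi T j powi cartan T j i"
proof -
  have "qi T i powi k = qvar powi (int (symmetrizer T i) * k)" for i k
    by (simp add: qi_def power_int_mult)
  then show ?thesis using symmetrizable[OF assms] by simp
qed

text \<open>The two powers of q_i are the eigenvalues of K_i^(-1) on the second factor and of K_i on
  the first, as they enter the commutator of E_i and F_i on a tensor product.\<close>

lemma qnum_coproduct: "qi T i powi (- l) * qnum T i k + qi T i powi k * qnum T i l = qnum T i (k + l)"
proof -
  define D where "D = inverse (qi T i - inverse (qi T i))"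
  show ?thesis unfolding qnum_def divide_inverse D_def[symmetric]
    by (simp add: power_int_add power_int_diff algebra_simps) (simp add: power_int_minus divide_inverse)
qed

section \<open>Finitely supported functions and their linear maps\<close>

abbreviation psmul :: "ratfun \<Rightarrow> ('p \<Rightarrow>\<^sub>0 ratfun) \<Rightarrow> ('p \<Rightarrow>\<^sub>0 ratfun)" where
  "psmul a \<equiv> Poly_Mapping.map ((*) a)"

lemma lookup_psmul [simp]: "Poly_Mapping.lookup (psmul a f) p = a * Poly_Mapping.lookup f p"
  by (simp add: Poly_Mapping.map.rep_eq when_def)

lemma vector_space_psmul: "vector_space (psmul :: ratfun \<Rightarrow> ('p \<Rightarrow>\<^sub>0 ratfun) \<Rightarrow> _)"
  by unfold_locales (auto intro!: poly_mapping_eqI simp: lookup_add algebra_simps)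

interpretation PV: vector_space "psmul :: ratfun \<Rightarrow> ('p \<Rightarrow>\<^sub>0 ratfun) \<Rightarrow> _"
  by (rule vector_space_psmul)

definition lext :: "('p \<Rightarrow> ('r \<Rightarrow>\<^sub>0 ratfun)) \<Rightarrow> ('p \<Rightarrow>\<^sub>0 ratfun) \<Rightarrow> ('r \<Rightarrow>\<^sub>0 ratfun)" where
  "lext g f = (\<Sum>p\<in>Poly_Mapping.keys f. psmul (Poly_Mapping.lookup f p) (g p))"

lemma lext_superset:
  assumes "finite P" "Poly_Mapping.keys f \<subseteq> P"
  shows "lext g f = (\<Sum>p\<in>P. psmul (Poly_Mapping.lookup f p) (g p))"
  unfolding lext_def using assms by (intro sum.mono_neutral_left) (auto simp: in_keys_iff)

lemma lext_single [simp]: "lext g (Poly_Mapping.single p a) = psmul a (g p)"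
  by (cases "a = 0") (auto simp: lext_def)

lemma lext_linear: "Vector_Spaces.linear psmul psmul (lext g)"
  unfolding Vector_Spaces.linear_iff
proof (intro conjI allI vector_space_psmul)
  fix x y :: "'a \<Rightarrow>\<^sub>0 ratfun" and a
  let ?P = "Poly_Mapping.keys x \<union> Poly_Mapping.keys y"
  have "Poly_Mapping.keys (x + y) \<subseteq> ?P" by (rule Poly_Mapping.keys_add)
  then show "lext g (x + y) = lext g x + lext g y"
    by (subst (1 2 3) lext_superset[of ?P]) (auto simp: lookup_add PV.scale_left_distrib sum.distrib)
  have "Poly_Mapping.keys (psmul a x) \<subseteq> Poly_Mapping.keys x" by (auto simp: in_keys_iff)
  then show "lext g (psmul a x) = psmul a (lext g x)"
    by (subst (1 2) lext_superset[of "Poly_Mapping.keys x"]) (auto simp: PV.scale_sum_right)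
qed

lemma poly_mapping_sum_single: "f = (\<Sum>p\<in>Poly_Mapping.keys f. psmul (Poly_Mapping.lookup f p) (Poly_Mapping.single p 1))"
  by (rule poly_mapping_eqI)
    (auto simp: lookup_sum lookup_single when_def in_keys_iff if_distrib cong: if_cong)

text \<open>The tensor product is encoded by coordinates with respect to bases of the factors. If
  these are bases of crystal lattices, the tensor lattice consists of the functions with regular
  values.\<close>

locale tensor_pair = A: qrep T M + B: qrep T N
  for T and M :: "'a::ab_group_add uq_rep" and N :: "'b::ab_group_add uq_rep" +
  fixes S :: "'a set" and S' :: "'b set"
  assumes indep: "\<not> A.V.dependent S" "\<not> B.V.dependent S'"
    and span: "A.V.span S = UNIV" "B.V.span S' = UNIV"
begin

definition pure :: "'a \<Rightarrow> 'b \<Rightarrow> ('a \<times> 'b \<Rightarrow>\<^sub>0 ratfun)" where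
  "pure x y = Abs_poly_mapping (\<lambda>(s, s'). A.V.representation S x s * B.V.representation S' y s')"

lemma lookup_pure: "Poly_Mapping.lookup (pure x y) (s, s') = A.V.representation S x s * B.V.representation S' y s'"
proof -
  have "{p. (case p of (s, s') \<Rightarrow> A.V.representation S x s * B.V.representation S' y s') \<noteq> 0}
      \<subseteq> {s. A.V.representation S x s \<noteq> 0} \<times> {s'. B.V.representation S' y s' \<noteq> 0}" by auto
  then have "finite {p. (case p of (s, s') \<Rightarrow> A.V.representation S x s * B.V.representation S' y s') \<noteq> 0}"
    by (rule finite_subset) (intro finite_cartesian_product A.V.finite_representation B.V.finite_representation)
  then show ?thesis by (simp add: pure_def)
qed

lemma pure_add1: "pure (x + x') y = pure x y + pure x' y"
  by (rule poly_mapping_eqI)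
    (auto simp: lookup_pure lookup_add A.V.representation_add indep span algebra_simps split: prod.splits)

lemma pure_add2: "pure x (y + y') = pure x y + pure x y'"
  by (rule poly_mapping_eqI)
    (auto simp: lookup_pure lookup_add B.V.representation_add indep span algebra_simps split: prod.splits)

lemma pure_scale1: "pure (smul M a x) y = psmul a (pure x y)"
  by (rule poly_mapping_eqI)
    (auto simp: lookup_pure A.V.representation_scale indep span algebra_simps split: prod.splits)

lemma pure_scale2: "pure x (smul N a y) = psmul a (pure x y)"
  by (rule poly_mapping_eqI)
    (auto simp: lookup_pure B.V.representation_scale indep span algebra_simps split: prod.splits)

lemma pure_0 [simp]: "pure 0 y = 0" "pure x 0 = 0"
  using pure_scale1[of 0 0 y] pure_scale2[of x 0 0] by simp_all

lemma pure_basis: "s \<in> S \<Longrightarrow> s' \<in> S' \<Longrightarrow> pure s s' = Poly_Mapping.single (s, s') 1"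
  by (rule poly_mapping_eqI)
    (auto simp: lookup_pure A.V.representation_basis B.V.representation_basis indep lookup_single when_def
      split: prod.splits if_splits)

definition bilinear :: "('a \<Rightarrow> 'b \<Rightarrow> ('p \<Rightarrow>\<^sub>0 ratfun)) \<Rightarrow> bool" where
  "bilinear h \<longleftrightarrow> (\<forall>x x' y. h (x + x') y = h x y + h x' y) \<and> (\<forall>x y y'. h x (y + y') = h x y + h x y')
    \<and> (\<forall>a x y. h (smul M a x) y = psmul a (h x y)) \<and> (\<forall>a x y. h x (smul N a y) = psmul a (h x y))"

lemma bilinear_pure: "bilinear pure"
  by (simp add: bilinear_def pure_add1 pure_add2 pure_scale1 pure_scale2)

lemma bilinear_in_subspace:
  assumes "bilinear h" "PV.subspace G" "A.V.span X = UNIV" "B.V.span Y = UNIV"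
    and "\<And>x y. x \<in> X \<Longrightarrow> y \<in> Y \<Longrightarrow> h x y \<in> G"
  shows "h x y \<in> G"
proof -
  have 0: "h 0 y = 0" "h x 0 = 0" for x y
    using assms(1) unfolding bilinear_def by (metis A.V.scale_zero_left PV.scale_zero_left,
      metis B.V.scale_zero_left PV.scale_zero_left)
  have 1: "h x y \<in> G" if "y \<in> Y" for x y
  proof -
    have "x \<in> A.V.span X" by (simp add: assms)
    then show ?thesis
    proof (induction rule: A.V.span_induct_alt)
      case base
      then show ?case by (simp add: 0 PV.subspace_0[OF assms(2)])
    next
      case (step c x z)
      then show ?case using assms(1,5) that
        by (auto simp: bilinear_def intro!: PV.subspace_add[OF assms(2)] PV.subspace_scale[OF assms(2)])
    qed
  qed
  have "y \<in> B.V.span Y" by (simp add: assms)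
  then show ?thesis
  proof (induction rule: B.V.span_induct_alt)
    case base
    then show ?case by (simp add: 0 PV.subspace_0[OF assms(2)])
  next
    case (step c y z)
    then show ?case using assms(1) 1
      by (auto simp: bilinear_def intro!: PV.subspace_add[OF assms(2)] PV.subspace_scale[OF assms(2)])
  qed
qed

lemma bilinear_eq:
  fixes h h' :: "'a \<Rightarrow> 'b \<Rightarrow> ('p \<Rightarrow>\<^sub>0 ratfun)"
  assumes "bilinear h" "bilinear h'" "A.V.span X = UNIV" "B.V.span Y = UNIV"
    and "\<And>x y. x \<in> X \<Longrightarrow> y \<in> Y \<Longrightarrow> h x y = h' x y"
  shows "h x y = h' x y"
proof -
  have "bilinear (\<lambda>x y. h x y - h' x y)"
    using assms(1,2) by (auto simp: bilinear_def PV.scale_right_diff_distrib)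
  from bilinear_in_subspace[OF this PV.subspace_single_0 assms(3,4), of x y] show ?thesis
    using assms(5) by simp
qed

text \<open>Operators are prescribed on pairs of basis vectors only; bilinearity carries the formula
  to all pure tensors.\<close>

lemma lext_pure:
  assumes "bilinear h" "\<And>s s'. s \<in> S \<Longrightarrow> s' \<in> S' \<Longrightarrow> g (s, s') = h s s'"
  shows "lext g (pure x y) = h x y"
proof (rule bilinear_eq[OF _ assms(1) span])
  note l = lext_linear[of g, unfolded Vector_Spaces.linear_iff]
  show "bilinear (\<lambda>x y. lext g (pure x y))"
    using l by (simp add: bilinear_def pure_add1 pure_add2 pure_scale1 pure_scale2)
qed (simp add: pure_basis assms(2))

text \<open>The coordinates outside \<open>S \<times> S'\<close> carry copies of the trivial module.\<close>

definition trep :: "('a \<times> 'b \<Rightarrow>\<^sub>0 ratfun) uq_rep" where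
  "trep = \<lparr>smul = psmul,
     opE = (\<lambda>i. lext (\<lambda>(s, s'). if s \<in> S \<and> s' \<in> S'
        then pure (opE M i s) (opKinv N i s') + pure s (opE N i s') else 0)),
     opF = (\<lambda>i. lext (\<lambda>(s, s'). if s \<in> S \<and> s' \<in> S'
        then pure (opF M i s) s' + pure (opK M i s) (opF N i s') else 0)),
     opK = (\<lambda>i. lext (\<lambda>(s, s'). if s \<in> S \<and> s' \<in> S'
        then pure (opK M i s) (opK N i s') else Poly_Mapping.single (s, s') 1)),
     opKinv = (\<lambda>i. lext (\<lambda>(s, s'). if s \<in> S \<and> s' \<in> S'
        then pure (opKinv M i s) (opKinv N i s') else Poly_Mapping.single (s, s') 1))\<rparr>"

lemma smul_trep [simp]: "smul trep = psmul"
  by (simp add: trep_def)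

context
  fixes i assumes i: "i \<in> nodes T"
begin

lemmas lins = A.lin_add[OF A.linE[OF i]] A.lin_scale[OF A.linE[OF i]] B.lin_add[OF B.linE[OF i]] B.lin_scale[OF B.linE[OF i]]
  A.lin_add[OF A.linF[OF i]] A.lin_scale[OF A.linF[OF i]] B.lin_add[OF B.linF[OF i]] B.lin_scale[OF B.linF[OF i]]
  A.lin_add[OF A.linK[OF i]] A.lin_scale[OF A.linK[OF i]] B.lin_add[OF B.linK[OF i]] B.lin_scale[OF B.linK[OF i]]
  A.lin_add[OF A.linKinv[OF i]] A.lin_scale[OF A.linKinv[OF i]] B.lin_add[OF B.linKinv[OF i]] B.lin_scale[OF B.linKinv[OF i]]

text \<open>This form of the coproduct is the one whose limit at q = 0 follows the convention of
  \<open>tensor\<close>.\<close>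

lemma E_pure: "opE trep i (pure x y) = pure (opE M i x) (opKinv N i y) + pure x (opE N i y)"
  unfolding trep_def uq_rep.simps
  by (rule lext_pure) (auto simp: bilinear_def lins pure_add1 pure_add2 pure_scale1 pure_scale2 PV.scale_right_distrib)

lemma F_pure: "opF trep i (pure x y) = pure (opF M i x) y + pure (opK M i x) (opF N i y)"
  unfolding trep_def uq_rep.simps
  by (rule lext_pure) (auto simp: bilinear_def lins pure_add1 pure_add2 pure_scale1 pure_scale2 PV.scale_right_distrib)

lemma K_pure: "opK trep i (pure x y) = pure (opK M i x) (opK N i y)"
  unfolding trep_def uq_rep.simps
  by (rule lext_pure) (auto simp: bilinear_def lins pure_add1 pure_add2 pure_scale1 pure_scale2 PV.scale_right_distrib)

lemma Kinv_pure: "opKinv trep i (pure x y) = pure (opKinv M i x) (opKinv N i y)"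
  unfolding trep_def uq_rep.simps
  by (rule lext_pure) (auto simp: bilinear_def lins pure_add1 pure_add2 pure_scale1 pure_scale2 PV.scale_right_distrib)

end

lemma trep_linear:
  "Vector_Spaces.linear psmul psmul (opE trep i)" "Vector_Spaces.linear psmul psmul (opF trep i)"
  "Vector_Spaces.linear psmul psmul (opK trep i)" "Vector_Spaces.linear psmul psmul (opKinv trep i)"
  unfolding trep_def uq_rep.simps by (rule lext_linear)+

lemma trep_zero [simp]: "opE trep i 0 = 0" "opF trep i 0 = 0" "opK trep i 0 = 0" "opKinv trep i 0 = 0"
  using trep_linear[unfolded Vector_Spaces.linear_iff] by (metis PV.scale_zero_left)+

lemma trep_outside:
  assumes "\<not> (s \<in> S \<and> s' \<in> S')"
  shows "opE trep i (Poly_Mapping.single (s, s') a) = 0" "opF trep i (Poly_Mapping.single (s, s') a) = 0"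
    "opK trep i (Poly_Mapping.single (s, s') a) = Poly_Mapping.single (s, s') a"
    "opKinv trep i (Poly_Mapping.single (s, s') a) = Poly_Mapping.single (s, s') a"
  using assms by (auto simp: trep_def)

definition outside :: "('a \<times> 'b \<Rightarrow>\<^sub>0 ratfun) set" where
  "outside = {Poly_Mapping.single (s, s') 1 | s s'. \<not> (s \<in> S \<and> s' \<in> S')}"

lemma span_pure_weights:
  assumes "PV.subspace G" "\<And>x y \<mu> \<nu>. \<mu> \<in> weights T \<Longrightarrow> \<nu> \<in> weights T \<Longrightarrow> x \<in> A.Wt \<mu> \<Longrightarrow> y \<in> B.Wt \<nu> \<Longrightarrow> pure x y \<in> G"
    and "outside \<subseteq> G"
  shows "G = UNIV"
proof -
  have 1: "pure x y \<in> G" for x y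
    by (rule bilinear_in_subspace[OF bilinear_pure assms(1) A.span_weights B.span_weights]) (use assms(2) in auto)
  have 2: "Poly_Mapping.single p 1 \<in> G" for p
  proof (cases "fst p \<in> S \<and> snd p \<in> S'")
    case True
    then show ?thesis using 1[of "fst p" "snd p"] by (simp add: pure_basis)
  next
    case False
    then show ?thesis using assms(3) unfolding outside_def by (cases p) auto
  qed
  have "f \<in> G" for f
    by (subst poly_mapping_sum_single)
      (intro PV.subspace_sum[OF assms(1)] PV.subspace_scale[OF assms(1)] 2)
  then show ?thesis by auto
qed

lemma trep_eqI:
  assumes f: "Vector_Spaces.linear psmul psmul f" and g: "Vector_Spaces.linear psmul psmul g"
    and "\<And>x y \<mu> \<nu>. x \<in> A.Wt \<mu> \<Longrightarrow> y \<in> B.Wt \<nu> \<Longrightarrow> f (pure x y) = g (pure x y)"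
    and "\<And>z. z \<in> outside \<Longrightarrow> f z = g z"
  shows "f v = g v"
proof -
  note l = f[unfolded Vector_Spaces.linear_iff] g[unfolded Vector_Spaces.linear_iff]
  have "f 0 = 0" "g 0 = 0" using l by (metis PV.scale_zero_left)+
  then have "PV.subspace {v. f v = g v}" using l by (auto simp: PV.subspace_def)
  from span_pure_weights[OF this] show ?thesis using assms(3,4) by blast
qed

lemma pure_weight:
  assumes "x \<in> A.Wt \<mu>" "y \<in> B.Wt \<nu>"
  shows "pure x y \<in> weight_space T trep (\<lambda>i. \<mu> i + \<nu> i)"
  using assms by (auto simp: weight_space_def K_pure pure_scale1 pure_scale2 power_int_add)

lemma outside_weight: "z \<in> outside \<Longrightarrow> z \<in> weight_space T trep (\<lambda>_. 0)"
  by (auto simp: weight_space_def outside_def trep_outside)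

text \<open>On tensors of weight vectors the K-factors are scalars, so D^n (x \<otimes> y) lies in
  the span of the D1^p x \<otimes> D2^r y with p + r = n. For n = m1 + m2 all of these vanish. The
  form with \<open>D1\<close> and \<open>D2\<close> serves E and F alike.\<close>

lemma trep_nilpotent:
  assumes D: "Vector_Spaces.linear psmul psmul D"
    and D1: "\<And>x \<mu>. x \<in> A.Wt \<mu> \<Longrightarrow> \<exists>\<nu>. D1 x \<in> A.Wt \<nu>" and D2: "\<And>x \<mu>. x \<in> B.Wt \<mu> \<Longrightarrow> \<exists>\<nu>. D2 x \<in> B.Wt \<nu>"
    and Dp: "\<And>x y \<mu> \<nu>. x \<in> A.Wt \<mu> \<Longrightarrow> y \<in> B.Wt \<nu> \<Longrightarrow> D (pure x y) \<in> PV.span {pure (D1 x) y, pure x (D2 y)}"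
    and D0: "D1 0 = 0" "D2 0 = 0"
    and nil: "\<And>x. \<exists>m. (D1 ^^ m) x = 0" "\<And>y. \<exists>m. (D2 ^^ m) y = 0"
    and out: "\<And>z. z \<in> outside \<Longrightarrow> D z = 0"
  shows "\<exists>m. (D ^^ m) v = 0"
proof -
  note l = D[unfolded Vector_Spaces.linear_iff]
  have Dz: "D 0 = 0" using l by (metis PV.scale_zero_left)
  have lp: "(D ^^ m) (x + y) = (D ^^ m) x + (D ^^ m) y" "(D ^^ m) (psmul a x) = psmul a ((D ^^ m) x)" "(D ^^ m) 0 = 0" for m x y a
    using l Dz by (induction m) auto
  have mono: "(D ^^ m) x = 0 \<Longrightarrow> m \<le> m' \<Longrightarrow> (D ^^ m') x = 0" for m m' x
    using lp(3)[of "m' - m"] by (metis comp_apply funpow_add le_add_diff_inverse2)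
  have mono1: "(D1 ^^ m) x = 0 \<Longrightarrow> m \<le> m' \<Longrightarrow> (D1 ^^ m') x = 0" for m m' x
  proof -
    have "(D1 ^^ k) 0 = 0" for k by (induction k) (auto simp: D0)
    then show "(D1 ^^ m) x = 0 \<Longrightarrow> m \<le> m' \<Longrightarrow> (D1 ^^ m') x = 0"
      by (metis comp_apply funpow_add le_add_diff_inverse2)
  qed
  have mono2: "(D2 ^^ m) x = 0 \<Longrightarrow> m \<le> m' \<Longrightarrow> (D2 ^^ m') x = 0" for m m' x
  proof -
    have "(D2 ^^ k) 0 = 0" for k by (induction k) (auto simp: D0)
    then show "(D2 ^^ m) x = 0 \<Longrightarrow> m \<le> m' \<Longrightarrow> (D2 ^^ m') x = 0"
      by (metis comp_apply funpow_add le_add_diff_inverse2)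
  qed
  have sub: "PV.subspace {v. \<exists>m. (D ^^ m) v = 0}"
    unfolding PV.subspace_def
  proof (intro conjI ballI allI)
    fix x y assume "x \<in> {v. \<exists>m. (D ^^ m) v = 0}" "y \<in> {v. \<exists>m. (D ^^ m) v = 0}"
    then obtain m m' where "(D ^^ m) x = 0" "(D ^^ m') y = 0" by auto
    then have "(D ^^ max m m') x = 0" "(D ^^ max m m') y = 0" using mono by auto
    then show "x + y \<in> {v. \<exists>m. (D ^^ m) v = 0}" using lp by (auto intro!: exI[of _ "max m m'"])
  qed (use lp in auto)
  have "{v. \<exists>m. (D ^^ m) v = 0} = UNIV"
  proof (rule span_pure_weights[OF sub])
    fix x y \<mu> \<nu> assume xy: "x \<in> A.Wt \<mu>" "y \<in> B.Wt \<nu>"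
    have w1: "\<exists>\<nu>. (D1 ^^ p) x \<in> A.Wt \<nu>" for p using xy D1 by (induction p) auto
    have w2: "\<exists>\<nu>. (D2 ^^ p) y \<in> B.Wt \<nu>" for p using xy D2 by (induction p) auto
    have *: "(D ^^ n) (pure x y) \<in> PV.span {pure ((D1 ^^ p) x) ((D2 ^^ r) y) | p r. p + r = n}" for n
    proof (induction n)
      case 0
      then show ?case by (auto intro: PV.span_base)
    next
      case (Suc n)
      let ?S = "\<lambda>n. {pure ((D1 ^^ p) x) ((D2 ^^ r) y) | p r. p + r = n}"
      have "D v \<in> PV.span (?S (Suc n))" if "v \<in> PV.span (?S n)" for v
        using that
      proof (induction rule: PV.span_induct_alt)
        case base
        then show ?case by (simp add: Dz PV.span_zero)
      next
        case (step c v z)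
        then obtain p r where pr: "v = pure ((D1 ^^ p) x) ((D2 ^^ r) y)" "p + r = n" by auto
        obtain \<nu>1 \<nu>2 where "(D1 ^^ p) x \<in> A.Wt \<nu>1" "(D2 ^^ r) y \<in> B.Wt \<nu>2" using w1 w2 by blast
        from Dp[OF this]
        have "D v \<in> PV.span {pure ((D1 ^^ Suc p) x) ((D2 ^^ r) y), pure ((D1 ^^ p) x) ((D2 ^^ Suc r) y)}"
          using pr by simp
        moreover have "{pure ((D1 ^^ Suc p) x) ((D2 ^^ r) y), pure ((D1 ^^ p) x) ((D2 ^^ Suc r) y)} \<subseteq> ?S (Suc n)"
          using pr(2) by (simp only: insert_subset, auto) (metis add_Suc funpow.simps(2) comp_apply, metis add_Suc_right funpow.simps(2) comp_apply)
        ultimately have "D v \<in> PV.span (?S (Suc n))" using PV.span_mono by blast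
        then show ?case using step l by (auto intro!: PV.span_add PV.span_scale)
      qed
      then show ?case using Suc by simp
    qed
    obtain m1 m2 where m: "(D1 ^^ m1) x = 0" "(D2 ^^ m2) y = 0" using nil by blast
    have "pure ((D1 ^^ p) x) ((D2 ^^ r) y) = 0" if "p + r = m1 + m2" for p r
    proof (cases "m1 \<le> p")
      case True
      then show ?thesis using mono1[OF m(1), of p] by simp
    next
      case False
      then have "m2 \<le> r" using that by simp
      then show ?thesis using mono2[OF m(2), of r] by simp
    qed
    then have "{pure ((D1 ^^ p) x) ((D2 ^^ r) y) | p r. p + r = m1 + m2} \<subseteq> {0}" by auto
    then have "PV.span {pure ((D1 ^^ p) x) ((D2 ^^ r) y) | p r. p + r = m1 + m2} \<subseteq> {0}"
      by (intro PV.span_minimal) auto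
    then show "pure x y \<in> {v. \<exists>m. (D ^^ m) v = 0}" using *[of "m1 + m2"] by auto
  next
    show "outside \<subseteq> {v. \<exists>m. (D ^^ m) v = 0}" using out by (auto intro!: exI[of _ 1])
  qed
  then show ?thesis by auto
qed

lemma linear_compose_diff:
  assumes "Vector_Spaces.linear psmul psmul f" "Vector_Spaces.linear psmul psmul g"
  shows "Vector_Spaces.linear psmul psmul (\<lambda>v. f (g v))"
    "Vector_Spaces.linear psmul psmul (\<lambda>v. psmul a (f v))"
    "Vector_Spaces.linear psmul psmul (\<lambda>v. f v - g v)"
  using assms unfolding Vector_Spaces.linear_iff
  by (auto simp: PV.scale_right_distrib PV.scale_right_diff_distrib mult.commute)

lemma linear_id: "Vector_Spaces.linear psmul psmul (\<lambda>v. v)"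
  and linear_0: "Vector_Spaces.linear psmul psmul (\<lambda>v. 0)"
  unfolding Vector_Spaces.linear_iff by (auto intro: vector_space_psmul)

theorem qrep_trep: "qrep T trep"
proof (rule qrep.intro, unfold smul_trep)
  show "vector_space psmul" by (rule vector_space_psmul)
next
  fix i v assume i: "i \<in> nodes T"
  note l = trep_linear[of i]
  show "opK trep i (opKinv trep i v) = v"
    by (rule trep_eqI[OF linear_compose_diff(1)[OF l(3,4)] linear_id])
      (auto simp: outside_def trep_outside K_pure[OF i] Kinv_pure[OF i] A.K_Kinv[OF i] B.K_Kinv[OF i])
  show "opKinv trep i (opK trep i v) = v"
    by (rule trep_eqI[OF linear_compose_diff(1)[OF l(4,3)] linear_id])
      (auto simp: outside_def trep_outside K_pure[OF i] Kinv_pure[OF i] A.Kinv_K[OF i] B.Kinv_K[OF i])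
  show "\<exists>m. (opE trep i ^^ m) v = 0"
  proof (rule trep_nilpotent[where ?D1.0 = "opE M i" and ?D2.0 = "opE N i"])
    fix x y \<mu> \<nu> assume "x \<in> A.Wt \<mu>" "y \<in> B.Wt \<nu>"
    then show "opE trep i (pure x y) \<in> PV.span {pure (opE M i x) y, pure x (opE N i y)}"
      unfolding E_pure[OF i] using i
      by (auto simp: B.Kinv_Wt pure_scale2 intro!: PV.span_add PV.span_scale intro: PV.span_base)
  qed (use i in \<open>auto simp: l A.lin_zero[OF A.linE] B.lin_zero[OF B.linE] A.nilE B.nilE outside_def trep_outside
      intro: A.E_Wt B.E_Wt\<close>)
  show "\<exists>m. (opF trep i ^^ m) v = 0"
  proof (rule trep_nilpotent[where ?D1.0 = "opF M i" and ?D2.0 = "opF N i"])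
    fix x y \<mu> \<nu> assume "x \<in> A.Wt \<mu>" "y \<in> B.Wt \<nu>"
    then show "opF trep i (pure x y) \<in> PV.span {pure (opF M i x) y, pure x (opF N i y)}"
      unfolding F_pure[OF i] using i
      by (auto simp: A.K_Wt pure_scale1 intro!: PV.span_add PV.span_scale intro: PV.span_base)
  qed (use i in \<open>auto simp: l A.lin_zero[OF A.linF] B.lin_zero[OF B.linF] A.nilF B.nilF outside_def trep_outside
      intro: A.F_Wt B.F_Wt\<close>)
next
  fix i j v assume i: "i \<in> nodes T" and j: "j \<in> nodes T"
  note l = trep_linear
  show "opK trep i (opE trep j v) = psmul (qi T i powi cartan T i j) (opE trep j (opK trep i v))"
  proof (rule trep_eqI[OF linear_compose_diff(1)[OF l(3,1)] linear_compose_diff(2)[OF linear_compose_diff(1)[OF l(1,3)] linear_id]])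
    fix x y \<mu> \<nu> assume x: "x \<in> A.Wt \<mu>" and y: "y \<in> B.Wt \<nu>"
    show "opK trep i (opE trep j (pure x y)) = psmul (qi T i powi cartan T i j) (opE trep j (opK trep i (pure x y)))"
      using A.lin_add B.lin_add
      by (simp add: E_pure[OF j] K_pure[OF i] A.K_Wt[OF x i] B.K_Wt[OF y i] B.Kinv_Wt[OF y j] A.K_E[OF i j] B.K_E[OF i j]
          pure_scale1 pure_scale2 l[of i, unfolded Vector_Spaces.linear_iff] l[of j, unfolded Vector_Spaces.linear_iff]
          A.lin_scale[OF A.linE[OF j]] B.lin_scale[OF B.linE[OF j]]
          PV.scale_right_distrib mult_ac)
  qed (auto simp: outside_def trep_outside)
  show "opK trep i (opF trep j v) = psmul (qi T i powi - cartan T i j) (opF trep j (opK trep i v))"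
  proof (rule trep_eqI[OF linear_compose_diff(1)[OF l(3,2)] linear_compose_diff(2)[OF linear_compose_diff(1)[OF l(2,3)] linear_id]])
    fix x y \<mu> \<nu> assume x: "x \<in> A.Wt \<mu>" and y: "y \<in> B.Wt \<nu>"
    show "opK trep i (opF trep j (pure x y)) = psmul (qi T i powi - cartan T i j) (opF trep j (opK trep i (pure x y)))"
      by (simp add: F_pure[OF j] K_pure[OF i] A.K_Wt[OF x i] B.K_Wt[OF y i] A.K_Wt[OF x j] A.K_F[OF i j] B.K_F[OF i j]
          pure_scale1 pure_scale2 l[of i, unfolded Vector_Spaces.linear_iff] l[of j, unfolded Vector_Spaces.linear_iff]
          A.lin_scale[OF A.linF[OF j]] B.lin_scale[OF B.linF[OF j]]
          PV.scale_right_distrib mult_ac)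
  qed (auto simp: outside_def trep_outside)
  let ?R = "\<lambda>v. if i = j then psmul (inverse (qi T i - inverse (qi T i))) (opK trep i v - opKinv trep i v) else 0"
  show "opE trep i (opF trep j v) - opF trep j (opE trep i v) = ?R v"
  proof (rule trep_eqI[where g = ?R])
    show "Vector_Spaces.linear psmul psmul (\<lambda>v. opE trep i (opF trep j v) - opF trep j (opE trep i v))"
      by (rule linear_compose_diff(3)[OF linear_compose_diff(1)[OF l(1,2)] linear_compose_diff(1)[OF l(2,1)]])
    show "Vector_Spaces.linear psmul psmul ?R"
      using linear_compose_diff(2)[OF linear_compose_diff(3)[OF l(3,4)] linear_id] linear_0 by (cases "i = j") auto
  next
    fix x y \<mu> \<nu> assume x: "x \<in> A.Wt \<mu>" and y: "y \<in> B.Wt \<nu>"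
    define a b where "a = qi T i powi (- \<nu> i)" and "b = qi T j powi \<mu> j"
    define c d where "c = qi T i powi (- (\<nu> i - cartan T i j))" and "d = qi T j powi (\<mu> j + cartan T j i)"
    \<comment> \<open>The mixed term E_i x \<otimes> F_j y receives the coefficient b c in one order
      of the operators and a d in the other.\<close>
    have cross: "b * c = a * d"
      using qi_powi_symmetric[OF i j] by (simp add: a_def b_def c_def d_def power_int_add power_int_diff power_int_minus divide_inverse)
    have Ky: "opKinv N i (opF N j y) = smul N c (opF N j y)"
      using B.Kinv_Wt[OF B.F_Wt[OF y j] i] i by (simp add: wshift_def sroot_def c_def)
    have Kx: "opK M j (opE M i x) = smul M d (opE M i x)"
      using A.K_Wt[OF A.E_Wt[OF x i] j] j by (simp add: wshift_def sroot_def d_def)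
    have K1: "opK M j x = smul M b x" and K2: "opKinv N i y = smul N a y"
      using A.K_Wt[OF x j] B.Kinv_Wt[OF y i] by (simp_all add: a_def b_def)
    have lin: "opE trep i (v + w) = opE trep i v + opE trep i w" "opE trep i (psmul r v) = psmul r (opE trep i v)"
      "opF trep j (v + w) = opF trep j v + opF trep j w" "opF trep j (psmul r v) = psmul r (opF trep j v)" for v w r
      using l unfolding Vector_Spaces.linear_iff by blast+
    have d1: "opE trep i (opF trep j (pure x y)) = (psmul a (pure (opE M i (opF M j x)) y) + pure (opF M j x) (opE N i y))
        + (psmul (b * c) (pure (opE M i x) (opF N j y)) + psmul b (pure x (opE N i (opF N j y))))"
      by (simp only: F_pure[OF j] E_pure[OF i] K1 K2 Ky lin pure_scale1 pure_scale2 PV.scale_right_distrib PV.scale_scale)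
    have d2: "opF trep j (opE trep i (pure x y)) = psmul a (pure (opF M j (opE M i x)) y) +
        psmul (a * d) (pure (opE M i x) (opF N j y)) + (pure (opF M j x) (opE N i y) + psmul b (pure x (opF N j (opE N i y))))"
      by (simp only: F_pure[OF j] E_pure[OF i] K1 K2 Kx lin pure_scale1 pure_scale2 PV.scale_right_distrib PV.scale_scale)
    show "opE trep i (opF trep j (pure x y)) - opF trep j (opE trep i (pure x y)) = ?R (pure x y)"
    proof (cases "i = j")
      case False
      then show ?thesis unfolding d1 d2 cross by (simp add: A.E_F_neq[OF i j] B.E_F_neq[OF i j])
    next
      case True
      have "opE trep i (opF trep j (pure x y)) - opF trep j (opE trep i (pure x y)) =
          psmul (a * qnum T i (\<mu> i) + b * qnum T i (\<nu> i)) (pure x y)"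
        unfolding d1 d2 cross unfolding True[symmetric] A.E_F_Wt[OF x i] B.E_F_Wt[OF y i]
        by (simp add: pure_add1 pure_add2 pure_scale1 pure_scale2 algebra_simps)
      also have "a * qnum T i (\<mu> i) + b * qnum T i (\<nu> i) = qnum T i (\<mu> i + \<nu> i)"
        unfolding a_def b_def True[symmetric] by (rule qnum_coproduct)
      also have "psmul (qnum T i (\<mu> i + \<nu> i)) (pure x y) = ?R (pure x y)"
      proof -
        have "opK trep i (pure x y) - opKinv trep i (pure x y) =
            psmul (qi T i powi (\<mu> i + \<nu> i) - qi T i powi (- (\<mu> i + \<nu> i))) (pure x y)"
          by (simp add: K_pure[OF i] Kinv_pure[OF i] A.K_Wt[OF x i] B.K_Wt[OF y i] A.Kinv_Wt[OF x i] B.Kinv_Wt[OF y i]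
              pure_scale1 pure_scale2 power_int_add power_int_diff power_int_minus divide_inverse mult_ac PV.scale_left_diff_distrib)
        then show ?thesis using True by (simp add: qnum_def divide_inverse mult.commute)
      qed
      finally show ?thesis .
    qed
  qed (auto simp: outside_def trep_outside)
next
  have w: "(\<lambda>i. \<mu> i + \<nu> i) \<in> weights T" if "\<mu> \<in> weights T" "\<nu> \<in> weights T" for \<mu> \<nu> using that by (auto simp: weights_def)
  have 0: "(\<lambda>i. 0) \<in> weights T" by (auto simp: weights_def)
  show "PV.span (\<Union>\<mu>\<in>weights T. weight_space T trep \<mu>) = UNIV"
  proof (rule span_pure_weights[OF PV.subspace_span])
    fix x y \<mu> \<nu> assume "\<mu> \<in> weights T" "\<nu> \<in> weights T" "x \<in> A.Wt \<mu>" "y \<in> B.Wt \<nu>"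
    then show "pure x y \<in> PV.span (\<Union>\<mu>\<in>weights T. weight_space T trep \<mu>)"
      using w[of \<mu> \<nu>] pure_weight[of x \<mu> y \<nu>]
      by (intro PV.span_base UN_I[of "\<lambda>i. \<mu> i + \<nu> i"]) auto
  qed (use outside_weight 0 in \<open>auto intro!: PV.span_base\<close>)
qed (rule trep_linear)+

sublocale W: qrep T trep by (rule qrep_trep)

end

section \<open>The tensor product rule\<close>

text \<open>A valuation bound: x vanishes at q = 0 to order at least k, counted in powers of q_i. A
  negative k allows a pole.\<close>

definition qge :: "cartan_type \<Rightarrow> nat \<Rightarrow> int \<Rightarrow> ratfun \<Rightarrow> bool" where
  "qge T i k x \<longleftrightarrow> x * qi T i powi (- k) \<in> regular0"

lemma qge_add: "qge T i k x \<Longrightarrow> qge T i k y \<Longrightarrow> qge T i k (x + y)"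
  by (auto simp: qge_def distrib_right)

lemma qge_uminus: "qge T i k x \<Longrightarrow> qge T i k (- x)"
  by (auto simp: qge_def)

lemma qge_mult: "qge T i k x \<Longrightarrow> qge T i l y \<Longrightarrow> qge T i (k + l) (x * y)"
  using regular0_mult[of "x * qi T i powi (- k)" "y * qi T i powi (- l)"]
  by (simp add: qge_def power_int_diff power_int_minus divide_inverse mult_ac)

lemma qge_0 [simp]: "qge T i k 0"
  by (simp add: qge_def)

lemma qge_mono:
  assumes "qge T i k x" "l \<le> k"
  shows "qge T i l x"
proof -
  obtain d where d: "k = l + int d" using assms(2) by (metis zle_iff_zadd)
  have eq: "x * qi T i powi (- l) = x * qi T i powi (- k) * qi T i ^ d"
    by (simp add: d power_int_diff power_int_minus divide_inverse)
  have "x * qi T i powi (- k) \<in> regular0" using assms(1) by (simp add: qge_def)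
  then show ?thesis unfolding qge_def eq
    by (rule regular0_mult[OF _ regular0_power[OF qi_regular0]])
qed

lemma qge_powi: "qge T i k (qi T i powi k)"
  by (simp add: qge_def power_int_minus)

lemma qge_regular0: "qge T i 0 x \<longleftrightarrow> x \<in> regular0"
  by (simp add: qge_def)

lemma qge_qideal: "qge T i k x \<Longrightarrow> k \<ge> 1 \<Longrightarrow> x \<in> qideal"
proof -
  assume "qge T i k x" "k \<ge> 1"
  then have "qge T i 1 x" by (rule qge_mono)
  then have "x * inverse (qi T i) * qi T i \<in> qideal"
    using qi_qideal by (intro qideal_mult') (auto simp: qge_def power_int_minus)
  then show ?thesis by (simp add: mult.assoc)
qed

lemma qge_qnum: "n > 0 \<Longrightarrow> qge T i (1 - int n) (qnum T i (int n))"
proof -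
  assume "n > 0"
  then have "qi T i ^ (n - 1) * qnum T i (int n) \<in> regular0"
    using one_plus_qideal_unit(1)[OF qnum_leading[of n T i]] by simp
  moreover have "int n - 1 = int (n - 1)" using \<open>n > 0\<close> by simp
  ultimately show ?thesis by (simp add: qge_def mult.commute del: of_nat_diff)
qed

lemma qge_inverse_qnum: "n > 0 \<Longrightarrow> qge T i (int n - 1) (inverse (qnum T i (int n)))"
proof -
  assume "n > 0"
  then have "inverse (qi T i ^ (n - 1) * qnum T i (int n)) \<in> regular0"
    using one_plus_qideal_unit(3)[OF qnum_leading[of n T i]] by simp
  moreover have "int n - 1 = int (n - 1)" using \<open>n > 0\<close> by simp
  ultimately show ?thesis by (simp add: qge_def mult.commute power_int_minus del: of_nat_diff)
qed

text \<open>For k > 0 the quantum integer [k] has order 1 - k, so the orders subtract to n -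
  k.\<close>

lemma qge_ratio: "n > 0 \<Longrightarrow> qge T i (int n - int k) (qnum T i (int k) / qnum T i (int n))"
proof (cases "k = 0")
  case False
  assume "n > 0"
  then show ?thesis
    using qge_mult[OF qge_qnum[of k T i] qge_inverse_qnum[of n T i]] False by (simp add: divide_inverse)
qed simp

text \<open>The vector \<open>e j k\<close> stands for the tensor of the j-th and k-th divided
  powers on two strings of lengths m and n. Leaving it abstract allows a second interpretation with
  E and F exchanged.\<close>

locale sl2_grid = vector_space scale
  for scale :: "ratfun \<Rightarrow> 'w::ab_group_add \<Rightarrow> 'w" +
  fixes T :: cartan_type and i :: nat and E F :: "'w \<Rightarrow> 'w" and e :: "nat \<Rightarrow> nat \<Rightarrow> 'w" and m n :: nat
  assumes E_add: "E (x + y) = E x + E y" and E_scale: "E (scale a x) = scale a (E x)"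
    and F_add: "F (x + y) = F x + F y" and F_scale: "F (scale a x) = scale a (F x)"
    and F_e: "F (e j k) = scale (qnum T i (1 + int j)) (e (Suc j) k) +
        scale (qi T i powi (int m - 2 * int j) * qnum T i (1 + int k)) (e j (Suc k))"
    and E_e: "E (e j k) =
        (if j = 0 then 0 else scale (qi T i powi (2 * int k - int n) * qnum T i (int m - int j + 1)) (e (j - 1) k)) +
        (if k = 0 then 0 else scale (qnum T i (int n - int k + 1)) (e j (k - 1)))"
    and e_out: "m < j \<Longrightarrow> e j k = 0" "n < k \<Longrightarrow> e j k = 0"
begin

lemma E_sum: "E (sum g A) = (\<Sum>a\<in>A. E (g a))" and F_sum: "F (sum g A) = (\<Sum>a\<in>A. F (g a))"
proof -
  have "E 0 = 0" "F 0 = 0" using E_add[of 0 0] F_add[of 0 0] by simp_all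
  then show "E (sum g A) = (\<Sum>a\<in>A. E (g a))" "F (sum g A) = (\<Sum>a\<in>A. F (g a))"
    by (induction A rule: infinite_finite_induct) (auto simp: E_add F_add)
qed

text \<open>These coefficients are forced by E z = 0 for a combination z of the
  \<open>e j (r - j)\<close>, once the coefficient of \<open>e 0 r\<close> is 1: compare the
  coefficients of \<open>e j (r - j - 1)\<close>.\<close>

primrec hwc :: "nat \<Rightarrow> nat \<Rightarrow> ratfun" where
  "hwc r 0 = 1"
| "hwc r (Suc j) = - (hwc r j * qi T i powi (int n - 2 * int r + 2 * int j + 2) *
     (qnum T i (int n - int r + int j + 1) / qnum T i (int m - int j)))"

definition hwz :: "nat \<Rightarrow> 'w" where
  "hwz r = (\<Sum>j\<le>r. scale (hwc r j) (e j (r - j)))"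

text \<open>Every step of the recursion adds m - r + 1 to the order: n - 2r + 2j + 2 from the power
  of q_i and (m - j) - (n - r + j + 1) from the quotient. Hence \<open>hwz r\<close> is congruent to
  \<open>e 0 r\<close> modulo q.\<close>

lemma hwc_qge: "r \<le> m \<Longrightarrow> r \<le> n \<Longrightarrow> j \<le> r \<Longrightarrow> qge T i (int j * (int m - int r + 1)) (hwc r j)"
proof (induction j)
  case 0
  then show ?case by (simp add: qge_regular0)
next
  case (Suc j)
  have "qge T i ((int m - int j) - (int n - int r + int j + 1))
      (qnum T i (int n - int r + int j + 1) / qnum T i (int m - int j))"
    using qge_ratio[of "m - j" T i "n - r + j + 1"] Suc.prems by (simp add: of_nat_diff algebra_simps)
  from qge_mult[OF qge_mult[OF Suc.IH qge_powi[of T i "int n - 2 * int r + 2 * int j + 2"]] this] Suc.prems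
  have "qge T i (int j * (int m - int r + 1) + (int n - 2 * int r + 2 * int j + 2) +
      ((int m - int j) - (int n - int r + int j + 1))) (- hwc r (Suc j))" by simp
  from qge_uminus[OF this] show ?case by (simp add: algebra_simps)
qed

lemma E_hwz:
  assumes "r \<le> m" "r \<le> n"
  shows "E (hwz r) = 0"
proof (cases r)
  case 0
  then show ?thesis by (simp add: hwz_def E_scale E_e)
next
  case (Suc r')
  have "E (hwz r) = (\<Sum>j\<le>r. scale (hwc r j) (if j = 0 then 0 else
        scale (qi T i powi (2 * int (r - j) - int n) * qnum T i (int m - int j + 1)) (e (j - 1) (r - j)))) +
      (\<Sum>j\<le>r. scale (hwc r j) (if r - j = 0 then 0 else
        scale (qnum T i (int n - int (r - j) + 1)) (e j (r - j - 1))))"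
    unfolding hwz_def E_sum E_scale E_e by (simp add: scale_right_distrib sum.distrib)
  also have "(\<Sum>j\<le>r. scale (hwc r j) (if j = 0 then 0 else
        scale (qi T i powi (2 * int (r - j) - int n) * qnum T i (int m - int j + 1)) (e (j - 1) (r - j)))) =
      (\<Sum>j\<le>r'. scale (hwc r (Suc j) * (qi T i powi (2 * int (r' - j) - int n) * qnum T i (int m - int j))) (e j (r' - j)))"
    unfolding Suc by (subst sum.atMost_Suc_shift) simp
  also have "(\<Sum>j\<le>r. scale (hwc r j) (if r - j = 0 then 0 else
        scale (qnum T i (int n - int (r - j) + 1)) (e j (r - j - 1)))) =
      (\<Sum>j\<le>r'. scale (hwc r j * qnum T i (int n - int (r - j) + 1)) (e j (r' - j)))"
    unfolding Suc by (subst sum.atMost_Suc) (auto intro!: sum.cong)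
  also have "(\<Sum>j\<le>r'. scale (hwc r (Suc j) * (qi T i powi (2 * int (r' - j) - int n) * qnum T i (int m - int j))) (e j (r' - j)))
      + (\<Sum>j\<le>r'. scale (hwc r j * qnum T i (int n - int (r - j) + 1)) (e j (r' - j))) = 0"
    unfolding sum.distrib[symmetric] scale_left_distrib[symmetric]
  proof (intro sum.neutral ballI)
    fix j assume j: "j \<in> {..r'}"
    have nz: "qnum T i (int m - int j) \<noteq> 0" using j assms Suc by auto
    define k where "k = 2 * int (r' - j) - int n"
    have e1: "int n - 2 * int r + 2 * int j + 2 = - k"
      "int n - int r + int j + 1 = int n - int (r - j) + 1" using j Suc by (auto simp: k_def)
    have "hwc r (Suc j) * (qi T i powi (2 * int (r' - j) - int n) * qnum T i (int m - int j)) +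
        hwc r j * qnum T i (int n - int (r - j) + 1) = 0"
      unfolding hwc.simps e1 k_def[symmetric] using nz by (simp add: power_int_minus)
    then show "scale (hwc r (Suc j) * (qi T i powi (2 * int (r' - j) - int n) * qnum T i (int m - int j)) +
        hwc r j * qnum T i (int n - int (r - j) + 1)) (e j (r' - j)) = 0" by simp
  qed
  finally show ?thesis .
qed

text \<open>
  The recursion for the coefficients of \<open>F\<^sup>(\<^sup>s\<^sup>) z\<close> preserves these bounds only as long as
  \<open>s + r \<le> m\<close>; the other half of the grid is reached by exchanging \<open>E\<close> and \<open>F\<close>.
\<close>

definition dF :: "nat \<Rightarrow> 'w \<Rightarrow> 'w" where
  "dF s x = scale (inverse (qfact T i s)) ((F ^^ s) x)"

lemma F_dF: "F (dF s x) = scale (qnum T i (1 + int s)) (dF (Suc s) x)"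
  by (simp add: dF_def F_scale qfact_Suc)

text \<open>The new coefficient at j is [j]/[s+1] times the old one at j - 1 plus q_i^(m-2j)
  [s+r-j+1]/[s+1] times the old one at j. The orders of these factors are s + 1 - j and m - r - j.
  The leading 1 moves from s to s + 1 with factor 1; the quadratic bound for j > s absorbs the
  factors of negative order.\<close>

lemma dF_hwz_coeffs:
  assumes r: "r \<le> m" "r \<le> n" and s: "s \<le> m - r"
  shows "\<exists>x. dF s (hwz r) = (\<Sum>j\<le>s + r. scale (x j) (e j (s + r - j))) \<and> x s - 1 \<in> qideal \<and>
    (\<forall>j<s. qge T i 1 (x j)) \<and> (\<forall>j>s. qge T i ((int j - int s) * (int m - int r + 1 - int s)) (x j)) \<and>
    (\<forall>j>s + r. x j = 0)"
  using s
proof (induction s)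
  case 0
  show ?case
  proof (intro exI[of _ "\<lambda>j. if j \<le> r then hwc r j else 0"] conjI allI impI)
    show "qge T i ((int j - int 0) * (int m - int r + 1 - int 0)) (if j \<le> r then hwc r j else 0)" for j
      using hwc_qge[OF r, of j] by auto
  qed (auto simp: dF_def hwz_def)
next
  case (Suc s)
  then obtain x where x: "dF s (hwz r) = (\<Sum>j\<le>s + r. scale (x j) (e j (s + r - j)))" "x s - 1 \<in> qideal"
    "\<And>j. j < s \<Longrightarrow> qge T i 1 (x j)" "\<And>j. s < j \<Longrightarrow> qge T i ((int j - int s) * (int m - int r + 1 - int s)) (x j)"
    "\<And>j. j > s + r \<Longrightarrow> x j = 0" by auto
  let ?N = "qnum T i (1 + int s)"
  have sp: "int s < int m - int r" using Suc.prems r by linarith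
  \<comment> \<open>The parts of the recursion in which F acts on the first and on the second
    factor.\<close>
  define up where "up = (\<lambda>j. if j = 0 then 0 else (qnum T i (int j) / ?N) * x (j - 1))"
  define st where "st = (\<lambda>j. qi T i powi (int m - 2 * int j) * (qnum T i (1 + int (s + r - j)) / ?N) * x j)"
  define x' where "x' = (\<lambda>j. up j + st j)"
  have "scale ?N (dF (Suc s) (hwz r)) = F (dF s (hwz r))" by (simp add: F_dF)
  also have "\<dots> = (\<Sum>j\<le>s + r. scale (x j * qnum T i (1 + int j)) (e (Suc j) (s + r - j))) +
      (\<Sum>j\<le>s + r. scale (x j * (qi T i powi (int m - 2 * int j) * qnum T i (1 + int (s + r - j)))) (e j (Suc (s + r - j))))"
    unfolding x(1) F_sum F_scale F_e by (simp add: scale_right_distrib sum.distrib)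
  also have "(\<Sum>j\<le>s + r. scale (x j * qnum T i (1 + int j)) (e (Suc j) (s + r - j))) =
      (\<Sum>j\<le>Suc s + r. scale (?N * up j) (e j (Suc s + r - j)))"
    unfolding add_Suc by (subst sum.atMost_Suc_shift) (simp add: up_def mult.commute)
  also have "(\<Sum>j\<le>s + r. scale (x j * (qi T i powi (int m - 2 * int j) * qnum T i (1 + int (s + r - j)))) (e j (Suc (s + r - j)))) =
      (\<Sum>j\<le>Suc s + r. scale (?N * st j) (e j (Suc s + r - j)))"
    unfolding add_Suc by (simp add: x(5) st_def, intro sum.cong) (auto simp: Suc_diff_le mult_ac)
  also have "(\<Sum>j\<le>Suc s + r. scale (?N * up j) (e j (Suc s + r - j))) + (\<Sum>j\<le>Suc s + r. scale (?N * st j) (e j (Suc s + r - j)))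
      = scale ?N (\<Sum>j\<le>Suc s + r. scale (x' j) (e j (Suc s + r - j)))"
    by (simp add: x'_def scale_sum_right sum.distrib[symmetric] scale_left_distrib scale_right_distrib del: sum.atMost_Suc)
  finally have 1: "dF (Suc s) (hwz r) = (\<Sum>j\<le>Suc s + r. scale (x' j) (e j (Suc s + r - j)))"
    by (simp only: scale_cancel_left) simp
  have up: "qge T i (int s + 1 - int j + k) (up j)" if "j > 0" "qge T i k (x (j - 1))" for j k
    using qge_mult[OF qge_ratio[of "Suc s" T i j] that(2)] that(1) by (simp add: up_def add_ac)
  have st: "qge T i (int m - int j - int r + k) (st j)" if "j \<le> s + r" "qge T i k (x j)" for j k
  proof -
    have "qge T i (int (Suc s) - int (Suc (s + r - j))) (qnum T i (1 + int (s + r - j)) / ?N)"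
      using qge_ratio[of "Suc s" T i "Suc (s + r - j)"] by simp
    from qge_mult[OF qge_mult[OF qge_powi this] that(2)]
    have "qge T i (int m - 2 * int j + (int (Suc s) - int (Suc (s + r - j))) + k) (st j)"
      unfolding st_def .
    moreover have "int m - 2 * int j + (int (Suc s) - int (Suc (s + r - j))) + k = int m - int j - int r + k"
      using that(1) by auto
    ultimately show ?thesis by (simp only:)
  qed
  have st0: "st j = 0" if "j > s + r" for j using x(5)[OF that] by (simp add: st_def)
  have xs: "qge T i 0 (x s)"
    using one_plus_qideal_unit(1)[OF x(2)] by (simp add: qge_regular0)
  show ?case
  proof (intro exI[of _ x'] conjI allI impI)
    show "dF (Suc s) (hwz r) = (\<Sum>j\<le>Suc s + r. scale (x' j) (e j (Suc s + r - j)))" by (rule 1)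
  next
    have "up (Suc s) = x s" by (simp add: up_def)
    moreover have "st (Suc s) \<in> qideal"
    proof (cases "Suc s \<le> s + r")
      case True
      from st[OF this x(4)] have "qge T i (int m - int (Suc s) - int r + ((int (Suc s) - int s) * (int m - int r + 1 - int s))) (st (Suc s))" by simp
      then show ?thesis by (rule qge_qideal) (use sp in simp)
    qed (simp add: st0)
    moreover have "x' (Suc s) - 1 = (up (Suc s) - 1) + st (Suc s)" by (simp add: x'_def)
    ultimately show "x' (Suc s) - 1 \<in> qideal"
      using qideal_add[of "x s - 1" "st (Suc s)"] x(2) by (simp only:)
  next
    fix j assume j: "j < Suc s"
    have "qge T i 1 (up j)"
    proof (cases "j = 0")
      case False
      from up[OF _ x(3)[of "j - 1"]] False j have "qge T i (int s + 1 - int j + 1) (up j)" by auto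
      then show ?thesis by (rule qge_mono) (use j in simp)
    qed (simp add: up_def)
    moreover have "qge T i 1 (st j)"
    proof (cases "j = s")
      case True
      from st[OF _ xs] show ?thesis unfolding True by (rule qge_mono) (use sp in auto)
    next
      case False
      then have "j < s" using j by simp
      from st[OF _ x(3)[OF this]] show ?thesis by (rule qge_mono) (use sp \<open>j < s\<close> in auto)
    qed
    ultimately show "qge T i 1 (x' j)" unfolding x'_def by (rule qge_add)
  next
    fix j assume j: "j > Suc s"
    let ?k = "(int j - int (Suc s)) * (int m - int r + 1 - int (Suc s))"
    have "qge T i (int s + 1 - int j + (int (j - 1) - int s) * (int m - int r + 1 - int s)) (up j)"
      using j by (intro up x(4)) auto
    then have "qge T i ?k (up j)" using j by (elim qge_mono) (simp add: of_nat_diff algebra_simps)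
    moreover have "qge T i ?k (st j)"
    proof (cases "j \<le> s + r")
      case True
      have "qge T i (int m - int j - int r + (int j - int s) * (int m - int r + 1 - int s)) (st j)"
        using j by (intro st[OF True] x(4)) auto
      \<comment> \<open>The available order exceeds the required one by 2(m - r - s), which is
        positive by \<open>sp\<close>.\<close>
      moreover have "?k \<le> int m - int j - int r + (int j - int s) * (int m - int r + 1 - int s)"
      proof -
        have "?k = int m - int j - int r + (int j - int s) * (int m - int r + 1 - int s) - 2 * (int m - int r - int s)"
          by (simp add: algebra_simps)
        then show ?thesis using sp by (simp only: diff_le_eq le_add_same_cancel1) simp
      qed
      ultimately show ?thesis by (rule qge_mono)
    qed (simp add: st0)
    ultimately show "qge T i ?k (x' j)" unfolding x'_def by (rule qge_add)
  next
    fix j assume "j > Suc s + r"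
    then show "x' j = 0" using x(5)[of j] x(5)[of "j - 1"] by (auto simp: x'_def up_def st_def)
  qed
qed

text \<open>Modulo q only the term \<open>e s r\<close> survives; the error is written in the form
  that Nakayama's lemma takes.\<close>

lemma dF_hwz:
  assumes r: "r \<le> m" "r \<le> n" and s: "s \<le> m - r"
  shows "\<exists>y. (\<forall>j. y j \<in> qideal) \<and> dF s (hwz r) = e s r + (\<Sum>j\<le>s + r. scale (y j) (e j (s + r - j)))"
proof -
  from dF_hwz_coeffs[OF assms] obtain x where x: "dF s (hwz r) = (\<Sum>j\<le>s + r. scale (x j) (e j (s + r - j)))" "x s - 1 \<in> qideal"
    "\<And>j. j < s \<Longrightarrow> qge T i 1 (x j)" "\<And>j. s < j \<Longrightarrow> qge T i ((int j - int s) * (int m - int r + 1 - int s)) (x j)" by blast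
  define y where "y = (\<lambda>j. if j = s then x s - 1 else x j)"
  have "x j \<in> qideal" if "j > s" for j
  proof -
    have "0 < (int j - int s) * (int m - int r + 1 - int s)" using that s r by (intro mult_pos_pos) auto
    then show ?thesis using x(4)[OF that] qge_qideal by fastforce
  qed
  then have "y j \<in> qideal" for j
    using x(2,3) qge_qideal[of T i 1 "x j"] by (cases "j = s"; cases "j < s") (auto simp: y_def)
  moreover have "dF s (hwz r) = e s r + (\<Sum>j\<le>s + r. scale (y j) (e j (s + r - j)))"
  proof -
    have "(\<Sum>j\<le>s + r. scale (x j) (e j (s + r - j))) =
        (\<Sum>j\<le>s + r. (if j = s then e s r else 0) + scale (y j) (e j (s + r - j)))"
      by (intro sum.cong) (auto simp: y_def scale_left_diff_distrib)
    then show ?thesis unfolding x(1) by (simp add: sum.distrib)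
  qed
  ultimately show ?thesis by blast
qed

text \<open>Reading both strings from the bottom and swapping the factors turns the formula for E
  into that for F with m and n exchanged. Outside the grid the value is set to 0, because truncated
  subtraction would otherwise return boundary vectors.\<close>

lemma mirror_grid: "sl2_grid scale T i F E (\<lambda>j k. if j \<le> n \<and> k \<le> m then e (m - k) (n - j) else 0) n m"
proof (unfold_locales, goal_cases)
  case (5 j k)
  have 0: "E 0 = 0" using E_add[of 0 0] by simp
  show ?case
  proof (cases "j \<le> n \<and> k \<le> m")
    case True
    then have "2 * int (n - j) - int n = int n - 2 * int j" "int m - int (m - k) + 1 = 1 + int k"
      "int n - int (n - j) + 1 = 1 + int j" by auto
    then show ?thesis using True by (auto simp: E_e add.commute)
  qed (auto simp: 0)
next
  case (6 j k)
  have 0: "F 0 = 0" using F_add[of 0 0] by simp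
  show ?case
  proof (cases "j \<le> n \<and> k \<le> m")
    case True
    then have e: "int m - 2 * int (m - k) = 2 * int k - int m" "1 + int (m - k) = int m - int k + 1"
      "1 + int (n - j) = int n - int j + 1" "Suc (m - k) = Suc m - k" "Suc (n - j) = Suc n - j" by auto
    have lhs: "F (e (m - k) (n - j)) = scale (qnum T i (int m - int k + 1)) (e (Suc m - k) (n - j)) +
        scale (qi T i powi (2 * int k - int m) * qnum T i (int n - int j + 1)) (e (m - k) (Suc n - j))"
      by (simp only: F_e e)
    have eqs: "e (Suc m - k) (n - j) = (if k = 0 then 0 else e (m - (k - 1)) (n - j))"
      "e (m - k) (Suc n - j) = (if j = 0 then 0 else e (m - k) (n - (j - 1)))"
      using True by (auto simp: e_out)
    have "k - Suc 0 \<le> m" "j - Suc 0 \<le> n" using True by auto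
    then show ?thesis using True by (simp add: lhs[unfolded eqs] add.commute)
  next
    case False
    then show ?thesis
      by (cases "j = Suc n"; cases "k = Suc m") (auto simp: 0)
  qed
qed (auto simp: E_add F_add E_scale F_scale)

end

text \<open>The coefficient matrix is 1 + Y with Y zero modulo q, hence invertible over the local
  ring \<open>regular0\<close>. It is inverted by elimination, one pivot at a time.\<close>

lemma nakayama:
  fixes scale :: "ratfun \<Rightarrow> 'w::ab_group_add \<Rightarrow> 'w"
  assumes "vector_space scale" "finite P"
    and N: "\<And>x y. x \<in> N \<Longrightarrow> y \<in> N \<Longrightarrow> x + y \<in> N" "\<And>a x. a \<in> regular0 \<Longrightarrow> x \<in> N \<Longrightarrow> scale a x \<in> N" "0 \<in> N"
    and "\<And>p p'. p \<in> P \<Longrightarrow> p' \<in> P \<Longrightarrow> y p p' \<in> qideal"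
    and "\<And>p. p \<in> P \<Longrightarrow> e p + (\<Sum>p'\<in>P. scale (y p p') (e p')) \<in> N"
  shows "\<forall>p\<in>P. e p \<in> N"
  using assms(2,6,7)
proof (induction P arbitrary: y rule: finite_induct)
  case (insert p0 P)
  interpret vector_space scale by fact
  have diff: "x - y \<in> N" if "x \<in> N" "y \<in> N" for x y
    using N(1)[OF that(1) N(2)[of "- 1" y]] that(2) by auto
  have sum: "sum f A \<in> N" if "\<And>a. a \<in> A \<Longrightarrow> f a \<in> N" for f and A :: "'b set"
    using that by (induction A rule: infinite_finite_induct) (auto simp: N)
  define u where "u = 1 + y p0 p0"
  have u: "u \<noteq> 0" "inverse u \<in> regular0"
    using one_plus_qideal_unit[of u] insert.prems(1) by (auto simp: u_def)
  define X0 where "X0 = e p0 + (\<Sum>p'\<in>P. scale (inverse u * y p0 p') (e p'))"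
  have "e p0 + (\<Sum>p'\<in>insert p0 P. scale (y p0 p') (e p')) = scale u X0"
  proof -
    have "scale u X0 = scale u (e p0) + (\<Sum>p'\<in>P. scale (y p0 p') (e p'))"
      using u by (simp add: X0_def scale_right_distrib scale_sum_right mult.assoc[symmetric])
    then show ?thesis using insert.hyps by (simp add: u_def scale_left_distrib add.assoc)
  qed
  then have "scale u X0 \<in> N" using insert.prems(2)[of p0] by simp
  from N(2)[OF u(2) this] have X0: "X0 \<in> N" using u by simp
  \<comment> \<open>The matrix left after eliminating \<open>e p0\<close>; its entries are again in
    \<open>qideal\<close>, since the pivot is a unit.\<close>
  define y' where "y' = (\<lambda>p p'. y p p' - y p p0 * (inverse u * y p0 p'))"
  have "\<forall>p\<in>P. e p \<in> N"
  proof (rule insert.IH[of y'])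
    fix p p' assume "p \<in> P" "p' \<in> P"
    then show "y' p p' \<in> qideal"
      unfolding y'_def using insert.prems(1) u by (intro qideal_diff qideal_mult) (auto intro: qideal_regular0)
  next
    fix p assume p: "p \<in> P"
    have "e p + (\<Sum>p'\<in>P. scale (y' p p') (e p')) = e p + (\<Sum>p'\<in>insert p0 P. scale (y p p') (e p')) - scale (y p p0) X0"
      using insert.hyps by (simp add: X0_def y'_def scale_right_distrib scale_sum_right scale_left_diff_distrib sum_subtractf)
    also have "\<dots> \<in> N" using insert.prems p X0 by (intro diff N(2)) (auto intro: qideal_regular0)
    finally show "e p + (\<Sum>p'\<in>P. scale (y' p p') (e p')) \<in> N" .
  qed
  moreover have "e p0 = X0 - (\<Sum>p'\<in>P. scale (inverse u * y p0 p') (e p'))" by (simp add: X0_def)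
  then have "e p0 \<in> N" using calculation X0 u insert.prems(1)
    by (auto intro!: diff sum N(2) qideal_regular0[OF qideal_mult'])
  ultimately show ?case by auto
qed auto

section \<open>Lattices in coordinates\<close>

definition qmul :: "('p \<Rightarrow>\<^sub>0 ratfun) set \<Rightarrow> ('p \<Rightarrow>\<^sub>0 ratfun) set" where
  "qmul L = psmul qvar ` L"

locale plattice =
  fixes L :: "('p \<Rightarrow>\<^sub>0 ratfun) set"
  assumes L_add: "x \<in> L \<Longrightarrow> y \<in> L \<Longrightarrow> x + y \<in> L"
    and L_scale: "a \<in> regular0 \<Longrightarrow> x \<in> L \<Longrightarrow> psmul a x \<in> L"
    and L_0: "0 \<in> L"
begin

lemma L_uminus: "x \<in> L \<Longrightarrow> - x \<in> L"
  using L_scale[of "- 1" x] by auto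

lemma L_sum: "(\<And>a. a \<in> A \<Longrightarrow> f a \<in> L) \<Longrightarrow> sum f A \<in> L"
  by (induction A rule: infinite_finite_induct) (auto simp: L_add L_0)

lemma qmul_L: "x \<in> qmul L \<Longrightarrow> x \<in> L"
  by (auto simp: qmul_def L_scale)

lemma qmul_0: "0 \<in> qmul L"
  using L_0 by (auto simp: qmul_def image_iff intro!: bexI[of _ 0])

lemma qmul_add: "x \<in> qmul L \<Longrightarrow> y \<in> qmul L \<Longrightarrow> x + y \<in> qmul L"
  by (auto simp: qmul_def L_add simp flip: PV.scale_right_distrib)

lemma qmul_uminus: "x \<in> qmul L \<Longrightarrow> - x \<in> qmul L"
  by (auto simp: qmul_def L_uminus simp flip: PV.scale_minus_right)

lemma qmul_diff: "x \<in> qmul L \<Longrightarrow> y \<in> qmul L \<Longrightarrow> x - y \<in> qmul L"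
  using qmul_add[OF _ qmul_uminus] by (metis add_uminus_conv_diff)

lemma qmul_sum: "(\<And>a. a \<in> A \<Longrightarrow> f a \<in> qmul L) \<Longrightarrow> sum f A \<in> qmul L"
  by (induction A rule: infinite_finite_induct) (auto simp: qmul_add qmul_0)

lemma qideal_qmul:
  assumes "a \<in> qideal" "x \<in> L"
  shows "psmul a x \<in> qmul L"
proof -
  obtain b where "a = qvar * b" "b \<in> regular0" using assms(1) by (auto simp: qideal_def)
  then show ?thesis using L_scale[of b x] assms(2) unfolding qmul_def by force
qed

text \<open>
  A congruence \<open>D X\<^sub>p \<equiv> t\<close> modulo \<open>q\<close> passes from vectors \<open>X\<^sub>p \<equiv> e\<^sub>p\<close> to the \<open>e\<^sub>p\<close> themselves, as
  the \<open>e\<^sub>p\<close> lie in the submodule of all \<open>v\<close> with \<open>D v \<in> L\<close> by Nakayama.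
\<close>

lemma congruence_transfer:
  assumes D: "\<And>x y. D (x + y) = D x + D y" "\<And>a x. D (psmul a x) = psmul a (D x)"
    and P: "finite P" "p \<in> P"
    and X: "\<And>p. p \<in> P \<Longrightarrow> \<exists>y. (\<forall>p'. y p' \<in> qideal) \<and> X p = e p + (\<Sum>p'\<in>P. psmul (y p') (e p'))"
    and DX: "\<And>p. p \<in> P \<Longrightarrow> D (X p) \<in> L" and t: "D (X p) - t \<in> qmul L"
  shows "D (e p) - t \<in> qmul L"
proof -
  obtain y where y: "\<And>p p'. p \<in> P \<Longrightarrow> y p p' \<in> qideal" "\<And>p. p \<in> P \<Longrightarrow> X p = e p + (\<Sum>p'\<in>P. psmul (y p p') (e p'))"
    using X by metis
  have D0: "D 0 = 0" using D(2)[of 0 0] by simp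
  have Dsum: "D (sum f A) = (\<Sum>a\<in>A. D (f a))" for f and A :: "'b set"
    by (induction A rule: infinite_finite_induct) (auto simp: D D0)
  have "\<forall>p\<in>P. e p \<in> {v. D v \<in> L}"
    using y DX by (intro nakayama[OF vector_space_psmul P(1), where y = y])
      (auto simp: D D0 L_add L_scale L_0)
  then have "(\<Sum>p'\<in>P. psmul (y p p') (D (e p'))) \<in> qmul L"
    using y(1)[OF P(2)] by (intro qmul_sum qideal_qmul) auto
  moreover have "D (e p) - t = (D (X p) - t) - (\<Sum>p'\<in>P. psmul (y p p') (D (e p')))"
    by (simp add: y(2)[OF P(2)] D Dsum)
  ultimately show ?thesis using t by (simp only: qmul_diff)
qed

end

context tensor_pair
begin

text \<open>Fix the line j + k = d in the grid of strings of lengths m and n. For d \<le> m the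
  vectors F^(p) z_(d-p), with z_r of highest weight, are congruent to the grid vectors; for d \<ge>
  m divided powers of E on lowest weight vectors are. Both families are strings, on which the
  Kashiwara operators are explicit: in the first they change p, in the second d - p. This is the
  dichotomy of the rule.\<close>

lemma tensor_rule:
  fixes LW :: "('a \<times> 'b \<Rightarrow>\<^sub>0 ratfun) set"
  assumes i: "i \<in> nodes T" and c: "A.hwv i \<kappa> c" "c \<noteq> 0" and c': "B.hwv i \<kappa>' c'" "c' \<noteq> 0"
    and "plattice LW" and eL: "\<And>j k. pure (A.dF i j c) (B.dF i k c') \<in> LW"
    and jk: "int j \<le> \<kappa> i" "int k \<le> \<kappa>' i"
  shows "W.ke i (pure (A.dF i j c) (B.dF i k c')) -
      (if int (j + k) \<le> \<kappa> i then (if j = 0 then 0 else pure (A.dF i (j - 1) c) (B.dF i k c'))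
       else pure (A.dF i j c) (B.dF i (k - 1) c')) \<in> qmul LW" (is ?ke)
    and "W.kf i (pure (A.dF i j c) (B.dF i k c')) -
      (if int (j + k) < \<kappa> i then pure (A.dF i (Suc j) c) (B.dF i k c')
       else pure (A.dF i j c) (B.dF i (Suc k) c')) \<in> qmul LW" (is ?kf)
proof -
  interpret LW: plattice LW by fact
  have cW: "c \<in> A.Wt \<kappa>" "opE M i c = 0" "\<kappa> \<in> weights T" and c'W: "c' \<in> B.Wt \<kappa>'" "opE N i c' = 0" "\<kappa>' \<in> weights T"
    using c c' by (auto simp: A.hwv_def B.hwv_def)
  define m n where "m = nat (\<kappa> i)" and "n = nat (\<kappa>' i)"
  have mn: "\<kappa> i = int m" "\<kappa>' i = int n"
    using A.hw_nilpotent(1)[OF cW(1) i cW(2) c(2)] B.hw_nilpotent(1)[OF c'W(1) i c'W(2) c'(2)]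
    by (auto simp: m_def n_def)
  define ee where "ee = (\<lambda>j k. pure (A.dF i j c) (B.dF i k c'))"
  have jm: "j \<le> m" "k \<le> n" using jk mn by auto
  have eeL: "ee j k \<in> LW" for j k using eL by (simp add: ee_def)
  have e_out: "m < j \<Longrightarrow> ee j k = 0" "n < k \<Longrightarrow> ee j k = 0" for j k
    using A.dF_vanish[OF cW(1) i cW(2), of j] B.dF_vanish[OF c'W(1) i c'W(2), of k] mn by (auto simp: ee_def)
  have Kd: "opK M i (A.dF i j c) = smul M (qi T i powi (int m - 2 * int j)) (A.dF i j c)" for j
    using A.K_Wt[OF A.dF_Wt[OF cW(1) i, of j] i] i mn by (simp add: wshift_same)
  have Kd': "opKinv N i (B.dF i k c') = smul N (qi T i powi (2 * int k - int n)) (B.dF i k c')" for k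
    using B.Kinv_Wt[OF B.dF_Wt[OF c'W(1) i, of k] i] i mn by (simp add: wshift_same)
  have Ed: "opE M i (A.dF i j c) = (if j = 0 then 0 else smul M (qnum T i (int m - int j + 1)) (A.dF i (j - 1) c))" for j
    using A.E_dF[OF cW(1) i cW(2), of "j - 1"] mn cW(2) by (cases j) (auto simp: algebra_simps)
  have Ed': "opE N i (B.dF i k c') = (if k = 0 then 0 else smul N (qnum T i (int n - int k + 1)) (B.dF i (k - 1) c'))" for k
    using B.E_dF[OF c'W(1) i c'W(2), of "k - 1"] mn c'W(2) by (cases k) (auto simp: algebra_simps)
  interpret G: sl2_grid psmul T i "opE trep i" "opF trep i" ee m n
  proof
    fix j k
    show "opF trep i (ee j k) = psmul (qnum T i (1 + int j)) (ee (Suc j) k) +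
        psmul (qi T i powi (int m - 2 * int j) * qnum T i (1 + int k)) (ee j (Suc k))"
      unfolding ee_def by (simp add: F_pure[OF i] A.F_dF[OF i] B.F_dF[OF i] Kd pure_scale1 pure_scale2)
    show "opE trep i (ee j k) =
        (if j = 0 then 0 else psmul (qi T i powi (2 * int k - int n) * qnum T i (int m - int j + 1)) (ee (j - 1) k)) +
        (if k = 0 then 0 else psmul (qnum T i (int n - int k + 1)) (ee j (k - 1)))"
      unfolding ee_def by (simp add: E_pure[OF i] Ed Ed' Kd' pure_scale1 pure_scale2)
  qed (use i e_out in \<open>auto simp: W.lin_add[OF W.linE, unfolded smul_trep] W.lin_add[OF W.linF]
      W.lin_scale[OF W.linE, unfolded smul_trep] W.lin_scale[OF W.linF, unfolded smul_trep]\<close>)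
  define e' where "e' = (\<lambda>j k. if j \<le> n \<and> k \<le> m then ee (m - k) (n - j) else 0)"
  interpret H: sl2_grid psmul T i "opF trep i" "opE trep i" e' n m
    unfolding e'_def by (rule G.mirror_grid)
  have e'L: "e' j k \<in> LW" for j k by (simp add: e'_def eeL LW.L_0)
  have GdF: "G.dF s x = W.dF i s x" for s x by (simp add: G.dF_def dpowF_def)
  have HdF: "H.dF s x = dpowE T trep i s x" for s x by (simp add: H.dF_def dpowE_def)
  define \<Lambda> where "\<Lambda> = (\<lambda>j. \<kappa> j + \<kappa>' j)"
  have \<Lambda>: "\<Lambda> \<in> weights T" "\<Lambda> i = int m + int n" using cW(3) c'W(3) mn by (auto simp: \<Lambda>_def weights_def)
  have eeW: "ee j k \<in> W.Wt (wshift T i (- int (j + k)) \<Lambda>)" for j k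
  proof -
    have "(\<lambda>l. wshift T i (- int j) \<kappa> l + wshift T i (- int k) \<kappa>' l) = wshift T i (- int (j + k)) \<Lambda>"
      by (auto simp: wshift_def \<Lambda>_def algebra_simps)
    then show ?thesis
      using pure_weight[OF A.dF_Wt[OF cW(1) i, of j] B.dF_Wt[OF c'W(1) i, of k]] by (simp add: ee_def)
  qed
  have zW: "W.hwv i (wshift T i (- int r) \<Lambda>) (G.hwz r)" if "r \<le> m" "r \<le> n" for r
  proof -
    have "G.hwz r \<in> W.Wt (wshift T i (- int r) \<Lambda>)"
      unfolding G.hwz_def using eeW by (intro W.Wt_sum W.Wt_scale[unfolded smul_trep]) (metis atMost_iff le_add_diff_inverse)
    then show ?thesis using G.E_hwz[OF that] \<Lambda> by (simp add: W.hwv_def)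
  qed
  have lW: "H.hwz r \<in> W.Wt (wshift T i (- int (m + n - r)) \<Lambda>)" if "r \<le> m" "r \<le> n" for r
    unfolding H.hwz_def
  proof (intro W.Wt_sum W.Wt_scale[unfolded smul_trep])
    fix j assume "j \<in> {..r}"
    then have "e' j (r - j) = ee (m - (r - j)) (n - j)" "m + n - r = (m - (r - j)) + (n - j)"
      using that by (auto simp: e'_def)
    then show "e' j (r - j) \<in> W.Wt (wshift T i (- int (m + n - r)) \<Lambda>)" using eeW by metis
  qed
  have qL: "(\<Sum>j\<in>A. psmul (y j) (f j)) \<in> qmul LW" if "\<And>j. y j \<in> qideal" "\<And>j. f j \<in> LW" for y f and A :: "nat set"
    using that by (intro LW.qmul_sum LW.qideal_qmul)
  have G1: "W.dF i s (G.hwz r) - ee s r \<in> qmul LW" if "r \<le> m" "r \<le> n" "s \<le> m - r" for r s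
    using G.dF_hwz[OF that] qL[of _ "\<lambda>j. ee j (s + r - j)"] eeL unfolding GdF by force
  have H1: "dpowE T trep i s (H.hwz r) - e' s r \<in> qmul LW" if "r \<le> m" "r \<le> n" "s \<le> n - r" for r s
    using H.dF_hwz[OF that(2,1,3)] qL[of _ "\<lambda>j. e' j (s + r - j)"] e'L unfolding HdF by force
  have mem: "x \<in> LW" if "x - y \<in> qmul LW" "y \<in> LW" for x y
    using LW.L_add[OF LW.qmul_L[OF that(1)] that(2)] by simp
  define d where "d = j + k"
  have d: "j \<in> {..d}" "k = d - j" by (auto simp: d_def)
  \<comment> \<open>Outside the grid the value 0 agrees with the vanishing
    \<open>ee p (d - p)\<close>, so the congruence covers the whole line. No condition p \<le> m
    appears, as this family is used for d \<le> m.\<close>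
  define XG where "XG = (\<lambda>p. if d - p \<le> n then W.dF i p (G.hwz (d - p)) else 0)"
  \<comment> \<open>The indices solve e' (n - (d - p)) (m - p) = ee p (d - p), the vector to which
    this one is congruent.\<close>
  define XH where "XH = (\<lambda>p. if p \<le> m \<and> d - p \<le> n then dpowE T trep i (n - (d - p)) (H.hwz (m - p)) else 0)"
  have XG: "\<exists>y. (\<forall>p'. y p' \<in> qideal) \<and> XG p = ee p (d - p) + (\<Sum>p'\<in>{..d}. psmul (y p') (ee p' (d - p')))"
    if "d \<le> m" "p \<in> {..d}" for p
  proof (cases "d - p \<le> n")
    case True
    have "d - p \<le> m" "p \<le> m - (d - p)" "p + (d - p) = d" using that by auto
    then show ?thesis using G.dF_hwz[of "d - p" p] True by (simp add: XG_def GdF)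
  next
    case False
    then show ?thesis by (intro exI[of _ "\<lambda>_. 0"]) (auto simp: XG_def e_out)
  qed
  have XH: "\<exists>y. (\<forall>p'. y p' \<in> qideal) \<and> XH p = ee p (d - p) + (\<Sum>p'\<in>{..d}. psmul (y p') (ee p' (d - p')))"
    if dm: "m \<le> d" and p: "p \<in> {..d}" for p
  proof (cases "p \<le> m \<and> d - p \<le> n")
    case True
    define s r where "s = n - (d - p)" and "r = m - p"
    have sr: "r \<le> n" "r \<le> m" "s \<le> n - r" "s + r = n + m - d" "e' s r = ee p (d - p)" "d \<le> n + m"
      using True dm p by (auto simp: s_def r_def e'_def)
    from H.dF_hwz[OF sr(1-3)] obtain y where y: "\<And>j. y j \<in> qideal"
      "XH p = ee p (d - p) + (\<Sum>j\<le>n + m - d. psmul (y j) (e' j (n + m - d - j)))"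
      unfolding HdF sr(4,5) using True by (auto simp: XH_def s_def r_def)
    let ?J = "{j\<in>{..n + m - d}. j \<le> n \<and> n + m - d - j \<le> m}" and ?P = "{p'\<in>{..d}. p' \<le> m \<and> d - p' \<le> n}"
    have "(\<Sum>j\<le>n + m - d. psmul (y j) (e' j (n + m - d - j))) = (\<Sum>j\<in>?J. psmul (y j) (e' j (n + m - d - j)))"
      by (rule sum.mono_neutral_right) (auto simp: e'_def)
    also have "\<dots> = (\<Sum>p'\<in>?P. psmul (y (n - (d - p'))) (ee p' (d - p')))"
    \<comment> \<open>The error sum runs over a line of the mirrored grid; it is rewritten as a sum
      over the same line of the original grid.\<close>
    proof (rule sum.reindex_bij_witness[where j = "\<lambda>j. m - (n + m - d - j)" and i = "\<lambda>p'. n - (d - p')"])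
      fix j assume j: "j \<in> ?J"
      then show "n - (d - (m - (n + m - d - j))) = j" using sr(6) by auto
      show "m - (n + m - d - j) \<in> ?P" using j sr(6) by auto
      have "d - (m - (n + m - d - j)) = n - j" using j sr(6) by auto
      then show "psmul (y (n - (d - (m - (n + m - d - j))))) (ee (m - (n + m - d - j)) (d - (m - (n + m - d - j)))) =
          psmul (y j) (e' j (n + m - d - j))" using j by (auto simp: e'_def)
    next
      fix p' assume p': "p' \<in> ?P"
      then show "m - (n + m - d - (n - (d - p'))) = p'" using sr(6) dm by auto
      show "n - (d - p') \<in> ?J" using p' sr(6) dm by auto
    qed
    also have "\<dots> = (\<Sum>p'\<in>{..d}. psmul (if p' \<in> ?P then y (n - (d - p')) else 0) (ee p' (d - p')))"
      by (rule sum.mono_neutral_cong_left) auto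
    finally show ?thesis using y
      by (intro exI[of _ "\<lambda>p'. if p' \<in> ?P then y (n - (d - p')) else 0"]) auto
  next
    case False
    then show ?thesis by (intro exI[of _ "\<lambda>_. 0"]) (auto simp: XH_def e_out)
  qed
  note ke_lin = W.lin_add[OF W.lin_ke[OF i]] W.lin_scale[OF W.lin_ke[OF i], unfolded smul_trep]
  note kf_lin = W.lin_add[OF W.lin_kf[OF i]] W.lin_scale[OF W.lin_kf[OF i], unfolded smul_trep]
  have k0: "W.ke i 0 = 0" "W.kf i 0 = 0" using W.lin_zero[OF W.lin_ke[OF i]] W.lin_zero[OF W.lin_kf[OF i]] by auto
  have nuH: "int s \<le> - wshift T i (- int (m + n - r)) \<Lambda> i" if "r \<le> m" "r \<le> n" "s \<le> n - r" for s r
    using that i \<Lambda> by (simp add: wshift_same of_nat_diff)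
  have low: "W.ke i (dpowE T trep i s (H.hwz r)) = dpowE T trep i (Suc s) (H.hwz r)"
    "W.kf i (dpowE T trep i s (H.hwz r)) = (if s = 0 then 0 else dpowE T trep i (s - 1) (H.hwz r))"
    if "r \<le> m" "r \<le> n" "s \<le> n - r" for r s
    using W.lowest_string[OF i _ lW[OF that(1,2)] H.E_hwz[OF that(2,1)] nuH[OF that]] \<Lambda> by auto
  have ke1: "W.ke i (XG p) - (if p = 0 then 0 else ee (p - 1) (d - p)) \<in> qmul LW"
    if "d \<le> m" "p \<le> d" for p
  proof (cases "d - p \<le> n")
    case True
    have r: "d - p \<le> m" "p \<le> m - (d - p)" using that by auto
    have wi: "int p \<le> wshift T i (- int (d - p)) \<Lambda> i" using that True i \<Lambda> by (simp add: wshift_same of_nat_diff)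
    show ?thesis
      using W.ke_dF[OF i zW[OF r(1) True] wi] G1[OF r(1) True, of "p - 1"] r True LW.qmul_0
      by (auto simp: XG_def)
  qed (auto simp: XG_def k0 e_out LW.qmul_0)
  have kf1: "W.kf i (XG p) - ee (Suc p) (d - p) \<in> qmul LW" if "d < m" "p \<le> d" for p
  proof (cases "d - p \<le> n")
    case True
    have r: "d - p \<le> m" "Suc p \<le> m - (d - p)" using that by auto
    show ?thesis
      using W.kf_dF[OF i zW[OF r(1) True], of p] G1[OF r(1) True r(2)] True by (simp add: XG_def)
  qed (auto simp: XG_def k0 e_out LW.qmul_0)
  have ke2: "W.ke i (XH p) - ee p (d - p - 1) \<in> qmul LW" if "m < d" "p \<le> d" "p \<le> m" "d - p \<le> n" for p
  proof -
    have r: "m - p \<le> m" "m - p \<le> n" "n - (d - p) \<le> n - (m - p)" "Suc (n - (d - p)) \<le> n - (m - p)"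
      using that by auto
    have "e' (Suc (n - (d - p))) (m - p) = ee p (d - p - 1)" using that by (auto simp: e'_def intro!: arg_cong2[where f = ee])
    then show ?thesis using low(1)[OF r(1-3)] H1[OF r(1,2,4)] that by (simp add: XH_def)
  qed
  have kf2: "W.kf i (XH p) - ee p (Suc (d - p)) \<in> qmul LW" if "m \<le> d" "p \<le> d" "p \<le> m" "d - p \<le> n" for p
  proof (cases "d - p = n")
    case True
    have r: "m - p \<le> m" "m - p \<le> n" "0 \<le> n - (m - p)" using that by auto
    show ?thesis using low(2)[OF r] True that LW.qmul_0 by (simp add: XH_def e_out)
  next
    case False
    have r: "m - p \<le> m" "m - p \<le> n" "n - (d - p) \<le> n - (m - p)" "n - (d - p) - 1 \<le> n - (m - p)"
      using that by auto
    have "e' (n - (d - p) - 1) (m - p) = ee p (Suc (d - p))" using that False by (auto simp: e'_def intro!: arg_cong2[where f = ee])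
    moreover have "\<not> n + p \<le> d" using that False by arith
    ultimately show ?thesis using low(2)[OF r(1-3)] H1[OF r(1,2,4)] that False by (simp add: XH_def)
  qed
  \<comment> \<open>On the boundary line d = m the raising operator is read off from
    \<open>XG\<close> and the lowering operator from \<open>XH\<close>: in the other family the
    image would leave the range in which the congruence holds.\<close>
  have "W.ke i (ee j k) - (if d \<le> m then (if j = 0 then 0 else ee (j - 1) k) else ee j (k - 1)) \<in> qmul LW"
  proof (cases "d \<le> m")
    case True
    have "W.ke i (ee j (d - j)) - (if j = 0 then 0 else ee (j - 1) k) \<in> qmul LW"
    proof (rule LW.congruence_transfer[OF ke_lin _ d(1) XG[OF True]])
      show "W.ke i (XG p) \<in> LW" if "p \<in> {..d}" for p
        using mem[OF ke1[OF True]] that eeL LW.L_0 by simp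
    qed (use ke1[OF True, of j] d in auto)
    then show ?thesis using True d by simp
  next
    case False
    then have dm: "m < d" by simp
    have "W.ke i (ee j (d - j)) - ee j (k - 1) \<in> qmul LW"
    proof (rule LW.congruence_transfer[OF ke_lin _ d(1) XH])
      show "W.ke i (XH p) \<in> LW" if "p \<in> {..d}" for p
      proof (cases "p \<le> m \<and> d - p \<le> n")
        case True
        then show ?thesis using mem[OF ke2[OF dm]] that eeL by simp
      qed (auto simp: XH_def k0 LW.L_0)
    qed (use ke2[OF dm, of j] d jm dm in auto)
    then show ?thesis using False d by simp
  qed
  then show ?ke using mn unfolding ee_def d_def by auto
  have "W.kf i (ee j k) - (if d < m then ee (Suc j) k else ee j (Suc k)) \<in> qmul LW"
  proof (cases "d < m")
    case True
    have "W.kf i (ee j (d - j)) - ee (Suc j) k \<in> qmul LW"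
    proof (rule LW.congruence_transfer[OF kf_lin _ d(1) XG])
      show "W.kf i (XG p) \<in> LW" if "p \<in> {..d}" for p
        using mem[OF kf1[OF True]] that eeL by simp
    qed (use kf1[OF True, of j] d True in auto)
    then show ?thesis using True d by simp
  next
    case False
    then have dm: "m \<le> d" by simp
    have "W.kf i (ee j (d - j)) - ee j (Suc k) \<in> qmul LW"
    proof (rule LW.congruence_transfer[OF kf_lin _ d(1) XH[OF dm]])
      show "W.kf i (XH p) \<in> LW" if "p \<in> {..d}" for p
      proof (cases "p \<le> m \<and> d - p \<le> n")
        case True
        then show ?thesis using mem[OF kf2[OF dm]] that eeL by simp
      qed (auto simp: XH_def k0 LW.L_0)
    qed (use kf2[OF dm, of j] d jm in auto)
    then show ?thesis using False d by simp
  qed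
  then show ?kf using mn unfolding ee_def d_def by auto
qed

end

section \<open>Weights and direct sums\<close>

text \<open>A kernel vector satisfies a three-term recursion along the path. Starting from m 0 = 0
  it is linear, m k = k m 1, as long as the off-diagonal entries are -1; the equations at the right
  end force m 1 = 0.\<close>

lemma cartan_nonsingular:
  fixes n :: "nat \<Rightarrow> int"
  assumes "valid_type T" "\<And>i. i \<in> nodes T \<Longrightarrow> (\<Sum>j\<in>nodes T. n j * cartan T i j) = 0" "j \<in> nodes T"
  shows "n j = 0"
proof -
  define r where "r = rank T"
  have nodes: "nodes T = {1..r}" by (simp add: nodes_def r_def)
  define m where "m = (\<lambda>k. if k \<in> nodes T then n k else 0)"
  have row: "m (i - 1) * cartan T i (i - 1) + 2 * m i + m (Suc i) * cartan T i (Suc i) = 0" if i: "1 \<le> i" "i \<le> r" for i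
  proof -
    have "0 = (\<Sum>j\<in>nodes T. n j * cartan T i j)" using assms(2) i nodes by simp
    also have "\<dots> = (\<Sum>j\<in>{i - 1, i, Suc i}. m j * cartan T i j)"
      by (rule sum.mono_neutral_cong) (use i in \<open>auto simp: nodes m_def cartan_def\<close>)
    also have "\<dots> = m (i - 1) * cartan T i (i - 1) + 2 * m i + m (Suc i) * cartan T i (Suc i)"
      using i by (simp add: cartan_def)
    finally show ?thesis by simp
  qed
  have m0: "m 0 = 0" "m (Suc r) = 0" by (auto simp: m_def nodes)
  have chain: "m k = int k * m 1" if "k \<le> b"
    "\<And>i. 1 \<le> i \<Longrightarrow> i < b \<Longrightarrow> m (i - 1) * (-1) + 2 * m i + m (Suc i) * (-1) = 0" for b k
    using that(1)
  proof (induction k rule: less_induct)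
    case (less k)
    show ?case
    proof (cases "k \<le> 1")
      case True
      then show ?thesis using m0 by (cases "k = 0") (auto simp: le_Suc_eq)
    next
      case False
      then obtain i where i: "k = Suc (Suc i)" by (cases k; cases "k - 1") auto
      then show ?thesis using that(2)[of "Suc i"] less.IH[of i] less.IH[of "Suc i"] less.prems
        by (simp add: algebra_simps)
    qed
  qed
  have "m k = 0" if "1 \<le> k" "k \<le> r" for k
  proof (cases T)
    case (TypeA N)
    have "m k = int k * m 1" if "k \<le> Suc r" for k
    proof (rule chain[OF that])
      fix i assume i: "1 \<le> i" "i < Suc r"
      then show "m (i - 1) * (-1) + 2 * m i + m (Suc i) * (-1) = 0"
        using row[of i] by (cases i) (simp_all add: TypeA cartan_def)
    qed
    from this[of "Suc r"] this[of k] that show ?thesis using m0 by simp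
  next
    case (TypeB N)
    have r: "r = N" "r \<ge> 2" using assms(1) TypeB by (auto simp: r_def)
    have c: "m k = int k * m 1" if "k \<le> r" for k
    proof (rule chain[OF that])
      fix i assume i: "1 \<le> i" "i < r"
      then show "m (i - 1) * (-1) + 2 * m i + m (Suc i) * (-1) = 0"
        using row[of i] r by (cases i) (simp_all add: TypeB cartan_def)
    qed
    have "m (r - 1) * (-2) + 2 * m r = 0" using row[of r] r m0 by (cases N) (simp_all add: TypeB cartan_def)
    then have "m 1 = 0" using c[of r] c[of "r - 1"] r by (simp add: of_nat_diff algebra_simps)
    then show ?thesis using c[of k] that by simp
  next
    case (TypeC N)
    have r: "r = N" "r \<ge> 2" using assms(1) TypeC by (auto simp: r_def)
    \<comment> \<open>Row r - 1 contains the entry -2, so the linear regime stops at r - 1 and the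
      last two rows are treated separately.\<close>
    have c: "m k = int k * m 1" if "k \<le> r - 1" for k
    proof (rule chain[OF that])
      fix i assume i: "1 \<le> i" "i < r - 1"
      then obtain i' where i': "i = Suc i'" by (cases i) auto
      have ca: "cartan T i (i - 1) = -1" "cartan T i (Suc i) = -1"
        using i r unfolding i' by (simp_all add: TypeC cartan_def)
      have "m (i - 1) * cartan T i (i - 1) + 2 * m i + m (Suc i) * cartan T i (Suc i) = 0"
        by (rule row) (use i in auto)
      then show "m (i - 1) * (-1) + 2 * m i + m (Suc i) * (-1) = 0" unfolding ca .
    qed
    define k' where "k' = r - 2"
    have k': "r = Suc (Suc k')" using r(2) by (simp add: k'_def)
    have "m (r - 2) * (-1) + 2 * m (r - 1) + m r * (-2) = 0"
      using row[of "Suc k'"] k' r(1) by (simp add: TypeC cartan_def)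
    moreover have c': "m (r - 1) = (int r - 1) * m 1" "m (r - 2) = (int r - 2) * m 1"
      using c[of "r - 1"] c[of "r - 2"] r(2) by (simp_all add: of_nat_diff)
    ultimately have 1: "2 * m r = int r * m 1" by (simp add: algebra_simps)
    have "m (r - 1) * (-1) + 2 * m r = 0" using row[of r] r m0 by (cases N) (simp_all add: TypeC cartan_def)
    then have "m 1 = 0" using 1 c'(1) by (simp add: algebra_simps)
    then show ?thesis using c[of k] 1 that by (cases "k = r") auto
  next
    case TypeG2
    have r: "r = 2" by (simp add: TypeG2 r_def)
    have "2 * m 1 - 3 * m 2 = 0" "2 * m 2 - m 1 = 0"
      using row[of 1] row[of 2] m0 by (simp_all add: r TypeG2 cartan_def numeral_eq_Suc)
    then have "m 1 = 0" "m 2 = 0" by auto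
    then show ?thesis using that r by (cases "k = 1") (auto simp: le_Suc_eq numeral_eq_Suc)
  qed
  then show ?thesis using assms(3) by (auto simp: m_def nodes split: if_splits)
qed

section \<open>Weights below a given weight\<close>

definition wsub :: "cartan_type \<Rightarrow> weight \<Rightarrow> (nat \<Rightarrow> int) \<Rightarrow> weight" where
  "wsub T \<Lambda> n = (\<lambda>j. \<Lambda> j - (\<Sum>i\<in>nodes T. n i * sroot T i j))"

lemma finite_nodes [simp]: "finite (nodes T)"
  by (simp add: nodes_def)

lemma wsub_weights [simp]: "wsub T \<Lambda> n \<in> weights T \<longleftrightarrow> \<Lambda> \<in> weights T"
  by (auto simp: wsub_def weights_def sroot_def)

lemma wshift_wsub: "i \<in> nodes T \<Longrightarrow> wshift T i k (wsub T \<Lambda> n) = wsub T \<Lambda> (n(i := n i - k))"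
proof -
  assume i: "i \<in> nodes T"
  have "(\<Sum>l\<in>nodes T. (n(i := n i - k)) l * sroot T l j) = (\<Sum>l\<in>nodes T. n l * sroot T l j) - k * sroot T i j" for j
    using i by (simp add: sum.remove[of _ i] left_diff_distrib)
  then show ?thesis by (auto simp: wshift_def wsub_def fun_eq_iff)
qed

lemma wsub_0 [simp]: "wsub T \<Lambda> (\<lambda>_. 0) = \<Lambda>"
  by (simp add: wsub_def)

text \<open>The simple roots are linearly independent because the Cartan matrix is
  nonsingular.\<close>

lemma wsub_inj:
  assumes "valid_type T" "wsub T \<Lambda> n = wsub T \<Lambda> n'" "i \<in> nodes T"
  shows "n i = n' i"
proof -
  have "(\<Sum>j\<in>nodes T. (n j - n' j) * cartan T i j) = 0" if "i \<in> nodes T" for i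
    using fun_cong[OF assms(2), of i] that
    by (simp add: wsub_def sroot_def left_diff_distrib sum_subtractf)
  from cartan_nonsingular[OF assms(1) this assms(3)] show ?thesis by simp
qed

context qrep
begin

text \<open>Compare the components of weight \<nu> on both sides of an expansion of v in elements of
  X.\<close>

lemma span_weight_component:
  assumes "v \<in> V.span X" "\<And>x. x \<in> X \<Longrightarrow> w x \<in> weights T \<and> x \<in> Wt (w x)" "v \<in> Wt \<nu>" "\<nu> \<in> weights T"
  shows "v \<in> V.span {x \<in> X. w x = \<nu>}"
proof -
  obtain t r where t: "finite t" "t \<subseteq> X" "v = (\<Sum>x\<in>t. smul M (r x) x)"
    using assms(1) unfolding V.span_explicit by blast
  \<comment> \<open>The index None carries -v, so that the expansion becomes a vanishing sum of
    weight vectors.\<close>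
  define P where "P = insert None (Some ` t)"
  define f where "f = (\<lambda>p. case p of None \<Rightarrow> - v | Some x \<Rightarrow> smul M (r x) x)"
  define w' where "w' = (\<lambda>p. case p of None \<Rightarrow> \<nu> | Some x \<Rightarrow> w x)"
  have "(\<Sum>p\<in>{p\<in>P. w' p = \<nu>}. f p) = 0"
  proof (rule weight_component_zero)
    show "(\<Sum>p\<in>P. f p) = 0" using t by (simp add: P_def f_def sum.reindex)
    fix p assume "p \<in> P"
    then have "p = None \<or> (\<exists>x\<in>X. p = Some x)" using t(2) by (auto simp: P_def)
    moreover have "w x \<in> weights T" "smul M a x \<in> Wt (w x)" if "x \<in> X" for x a
      using assms(2)[OF that] Wt_scale by auto
    ultimately show "w' p \<in> weights T" "f p \<in> Wt (w' p)"
      using assms(3,4) V.subspace_neg[OF subspace_Wt] by (auto simp: f_def w'_def)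
  qed (use t in \<open>simp add: P_def\<close>)
  moreover have "{p\<in>P. w' p = \<nu>} = insert None (Some ` {x\<in>t. w x = \<nu>})"
    by (auto simp: P_def w'_def)
  ultimately have "v = (\<Sum>x\<in>{x\<in>t. w x = \<nu>}. smul M (r x) x)"
    using t(1) by (simp add: f_def sum.reindex)
  also have "\<dots> \<in> V.span {x \<in> X. w x = \<nu>}"
    using t(2) by (intro V.span_sum V.span_scale V.span_base) auto
  finally show ?thesis .
qed

end

text \<open>A homomorphism maps a string decomposition term by term. Images of components may
  vanish, so the original index set is kept and the operators are evaluated on each term.\<close>

lemma kashiwara_intertwine:
  assumes "qrep T M" "qrep T N" and lin: "Vector_Spaces.linear (smul M) (smul N) f"
    and i: "i \<in> nodes T" and E: "\<And>x. f (opE M i x) = opE N i (f x)" and F: "\<And>x. f (opF M i x) = opF N i (f x)"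
    and K: "\<And>j x. j \<in> nodes T \<Longrightarrow> f (opK M j x) = opK N j (f x)"
  shows "f (kashiwara_e T M i x) = kashiwara_e T N i (f x)" "f (kashiwara_f T M i x) = kashiwara_f T N i (f x)"
proof -
  interpret A: qrep T M by fact
  interpret B: qrep T N by fact
  have f: "f (x + y) = f x + f y" "f (smul M a x) = smul N a (f x)" for x y a
    using lin by (auto simp: Vector_Spaces.linear_iff)
  have f0: "f 0 = 0" using f(2)[of 0 0] by simp
  have fsum: "f (sum g A) = (\<Sum>a\<in>A. f (g a))" for g and A :: "(weight \<times> nat) set"
    by (induction A rule: infinite_finite_induct) (auto simp: f f0)
  have fdF: "f (A.dF i n y) = B.dF i n (f y)" for n y
  proof -
    have "f ((opF M i ^^ n) y) = (opF N i ^^ n) (f y)" by (induction n) (auto simp: F)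
    then show ?thesis by (simp add: dpowF_def f)
  qed
  have fhw: "B.hwv i \<mu> (f y)" if "A.hwv i \<mu> y" for \<mu> y
    using that K f(2) E[of y] f0 by (auto simp: A.hwv_def B.hwv_def weight_space_def simp flip: K)
  obtain c where c: "A.strings i c" "x = A.evs (A.dF i) c" using A.strings_exist[OF i] by blast
  have cp: "B.hwv i (fst p) (f (c p))" "int (snd p) \<le> fst p i" if "c p \<noteq> 0" for p
    using c(1) that fhw by (cases p; auto simp: A.strings_def)+
  have fx: "f x = (\<Sum>p | c p \<noteq> 0. B.dF i (snd p) (f (c p)))"
    by (simp add: c(2) A.evs_def fsum fdF)
  have "f (A.ke i x) = (\<Sum>p | c p \<noteq> 0. f (A.lowF i (snd p) (c p)))"
    unfolding c(2) A.ke_eq[OF i c(1)] by (simp add: A.evs_def fsum)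
  also have "\<dots> = (\<Sum>p | c p \<noteq> 0. B.ke i (B.dF i (snd p) (f (c p))))"
    by (intro sum.cong refl) (auto simp: A.lowF_def f0 fdF B.ke_dF[OF i cp])
  finally show "f (A.ke i x) = B.ke i (f x)" unfolding fx B.lin_sum[OF B.lin_ke[OF i]] .
  have "f (A.kf i x) = (\<Sum>p | c p \<noteq> 0. f (A.dF i (Suc (snd p)) (c p)))"
    unfolding c(2) A.kf_eq[OF i c(1)] by (simp add: A.evs_def fsum)
  also have "\<dots> = (\<Sum>p | c p \<noteq> 0. B.kf i (B.dF i (snd p) (f (c p))))"
    by (intro sum.cong refl) (auto simp: fdF B.kf_dF[OF i cp(1)])
  finally show "f (A.kf i x) = B.kf i (f x)" unfolding fx B.lin_sum[OF B.lin_kf[OF i]] .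
qed

section \<open>Direct sums of modules\<close>

definition prod_rep :: "'a uq_rep \<Rightarrow> 'b uq_rep \<Rightarrow> ('a \<times> 'b) uq_rep" where
  "prod_rep M N = \<lparr>smul = (\<lambda>a. map_prod (smul M a) (smul N a)),
     opE = (\<lambda>i. map_prod (opE M i) (opE N i)), opF = (\<lambda>i. map_prod (opF M i) (opF N i)),
     opK = (\<lambda>i. map_prod (opK M i) (opK N i)), opKinv = (\<lambda>i. map_prod (opKinv M i) (opKinv N i))\<rparr>"

lemma prod_rep_sel [simp]:
  "smul (prod_rep M N) a = map_prod (smul M a) (smul N a)"
  "opE (prod_rep M N) i = map_prod (opE M i) (opE N i)"
  "opF (prod_rep M N) i = map_prod (opF M i) (opF N i)"
  "opK (prod_rep M N) i = map_prod (opK M i) (opK N i)"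
  "opKinv (prod_rep M N) i = map_prod (opKinv M i) (opKinv N i)"
  by (simp_all add: prod_rep_def)

lemma weight_space_prod_rep:
  "weight_space T (prod_rep M N) \<mu> = weight_space T M \<mu> \<times> weight_space T N \<mu>"
  by (auto simp: weight_space_def)

lemma qrep_prod_rep:
  assumes "qrep T M" "qrep T N"
  shows "qrep T (prod_rep M N)"
proof -
  interpret A: qrep T M by fact
  interpret B: qrep T N by fact
  have vs: "vector_space (smul (prod_rep M N))"
    by unfold_locales (auto simp: prod_eq_iff A.V.scale_right_distrib A.V.scale_left_distrib
        B.V.scale_right_distrib B.V.scale_left_distrib)
  then interpret V: vector_space "smul (prod_rep M N)" .
  have lin: "Vector_Spaces.linear (smul (prod_rep M N)) (smul (prod_rep M N)) (map_prod f g)" if "A.lin f" "B.lin g" for f g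
    using vs that by (auto simp: Vector_Spaces.linear_iff)
  have pow: "(map_prod f g ^^ m) v = ((f ^^ m) (fst v), (g ^^ m) (snd v))" for f :: "'a \<Rightarrow> 'a" and g :: "'b \<Rightarrow> 'b" and m v
    by (induction m) auto
  have nil: "\<exists>m. (map_prod f g ^^ m) v = 0"
    if h: "A.lin f" "B.lin g" "\<exists>m. (f ^^ m) (fst v) = 0" "\<exists>m. (g ^^ m) (snd v) = 0" for f g v
  proof -
    obtain m n where mn: "(f ^^ m) (fst v) = 0" "(g ^^ n) (snd v) = 0" using h(3,4) by blast
    have "(f ^^ (n + m)) (fst v) = 0" "(g ^^ (m + n)) (snd v) = 0"
      unfolding funpow_add using mn A.lin_zero[OF A.lin_pow[OF h(1)]] B.lin_zero[OF B.lin_pow[OF h(2)]] by auto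
    then show ?thesis by (intro exI[of _ "m + n"]) (auto simp: pow add.commute zero_prod_def)
  qed
  show ?thesis
  proof (rule qrep.intro)
    let ?X = "\<Union>\<mu>\<in>weights T. weight_space T (prod_rep M N) \<mu>"
    have 1: "(x, 0) \<in> V.span ?X" for x
    proof -
      have "x \<in> A.V.span (\<Union>\<mu>\<in>weights T. A.Wt \<mu>)" by (simp add: A.span_weights)
      then show ?thesis
      proof (induction rule: A.V.span_induct_alt)
        case base
        then show ?case by (metis V.span_zero zero_prod_def)
      next
        case (step c x y)
        then have "(x, 0) \<in> ?X" by (auto simp: weight_space_prod_rep B.Wt_0)
        note * = V.span_add[OF V.span_scale[OF V.span_base[OF this], of c] step(2)]
        have "smul (prod_rep M N) c (x, 0) + (y, 0) = (smul M c x + y, 0)" by simp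
        then show ?case using * by (simp only:)
      qed
    qed
    have 2: "(0, x) \<in> V.span ?X" for x
    proof -
      have "x \<in> B.V.span (\<Union>\<mu>\<in>weights T. B.Wt \<mu>)" by (simp add: B.span_weights)
      then show ?thesis
      proof (induction rule: B.V.span_induct_alt)
        case base
        then show ?case by (metis V.span_zero zero_prod_def)
      next
        case (step c x y)
        then have "(0, x) \<in> ?X" by (auto simp: weight_space_prod_rep A.Wt_0)
        note * = V.span_add[OF V.span_scale[OF V.span_base[OF this], of c] step(2)]
        have "smul (prod_rep M N) c (0, x) + (0, y) = (0, smul N c x + y)" by simp
        then show ?case using * by (simp only:)
      qed
    qed
    have "(x, y) \<in> V.span ?X" for x y
    proof -
      have "(x, 0) + (0, y) = (x, y)" by simp
      then show ?thesis using V.span_add[OF 1[of x] 2[of y]] by (simp only:)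
    qed
    then show "V.span ?X = UNIV" by auto
    fix i v assume i: "i \<in> nodes T"
    show "\<exists>m. (opE (prod_rep M N) i ^^ m) v = 0" "\<exists>m. (opF (prod_rep M N) i ^^ m) v = 0"
      using nil[OF A.linE[OF i] B.linE[OF i] A.nilE[OF i] B.nilE[OF i], of v]
        nil[OF A.linF[OF i] B.linF[OF i] A.nilF[OF i] B.nilF[OF i], of v] by simp_all
  qed (auto simp: vs lin A.linE A.linF A.linK A.linKinv B.linE B.linF B.linK B.linKinv
      A.K_Kinv A.Kinv_K B.K_Kinv B.Kinv_K A.K_E A.K_F B.K_E B.K_F A.E_F B.E_F
      prod_eq_iff)
qed

lemma kashiwara_prod_rep:
  assumes "qrep T M" "qrep T N" "i \<in> nodes T"
  shows "kashiwara_e T (prod_rep M N) i v = (kashiwara_e T M i (fst v), kashiwara_e T N i (snd v))"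
    "kashiwara_f T (prod_rep M N) i v = (kashiwara_f T M i (fst v), kashiwara_f T N i (snd v))"
proof -
  interpret A: qrep T M by fact
  interpret B: qrep T N by fact
  interpret C: qrep T "prod_rep M N" by (rule qrep_prod_rep) fact+
  have 1: "Vector_Spaces.linear (smul (prod_rep M N)) (smul M) fst"
    and 2: "Vector_Spaces.linear (smul (prod_rep M N)) (smul N) snd"
    by (simp_all add: Vector_Spaces.linear_iff A.vs B.vs C.vs)
  show "kashiwara_e T (prod_rep M N) i v = (kashiwara_e T M i (fst v), kashiwara_e T N i (snd v))"
    "kashiwara_f T (prod_rep M N) i v = (kashiwara_f T M i (fst v), kashiwara_f T N i (snd v))"
    using kashiwara_intertwine[OF C.qrep_axioms assms(1) 1 assms(3), of v]
      kashiwara_intertwine[OF C.qrep_axioms assms(2) 2 assms(3), of v]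
    by (auto simp: prod_eq_iff)
qed

section \<open>Seminormal crystals\<close>

text \<open>The string lengths are arguments here, instead of the maxima \<open>eps\<close> and
  \<open>phi\<close>: explicit candidates, as for a tensor product, can be checked against the
  axioms, and \<open>Max_iter\<close> then identifies them with the maxima.\<close>

definition crystal_with :: "'b crystal \<Rightarrow> (nat \<Rightarrow> 'b \<Rightarrow> nat) \<Rightarrow> (nat \<Rightarrow> 'b \<Rightarrow> nat) \<Rightarrow> bool" where
  "crystal_with C \<epsilon> \<phi> \<longleftrightarrow> (\<forall>b\<in>elems C. \<forall>i.
     (eop C i b = None \<longleftrightarrow> \<epsilon> i b = 0) \<and> (fop C i b = None \<longleftrightarrow> \<phi> i b = 0) \<and>
     (\<forall>b'. eop C i b = Some b' \<longrightarrow> b' \<in> elems C \<and> fop C i b' = Some b \<and> \<epsilon> i b = Suc (\<epsilon> i b')) \<and>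
     (\<forall>b'. fop C i b = Some b' \<longrightarrow> b' \<in> elems C \<and> eop C i b' = Some b \<and> \<phi> i b = Suc (\<phi> i b')) \<and>
     wt C b i = int (\<phi> i b) - int (\<epsilon> i b) \<and>
     (\<forall>b'. eop C i b = Some b' \<longrightarrow> \<phi> i b' = Suc (\<phi> i b)))"

definition seminormal :: "'b crystal \<Rightarrow> bool" where
  "seminormal C \<longleftrightarrow> crystal_with C (eps C) (phi C)"

lemma Max_iter:
  fixes d :: "'b \<Rightarrow> nat"
  assumes "b \<in> A" "\<And>b. b \<in> A \<Longrightarrow> g b = None \<longleftrightarrow> d b = 0"
    "\<And>b b'. b \<in> A \<Longrightarrow> g b = Some b' \<Longrightarrow> b' \<in> A \<and> d b = Suc (d b')"
  shows "Max {m. iter g m b \<noteq> None} = d b"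
proof -
  have *: "case iter g m b of None \<Rightarrow> d b < m | Some b' \<Rightarrow> b' \<in> A \<and> d b = m + d b'" for m
  proof (induction m)
    case (Suc m)
    show ?case
    proof (cases "iter g m b")
      case (Some c)
      then have c: "c \<in> A" "d b = m + d c" using Suc by auto
      then show ?thesis using assms(2)[OF c(1)] assms(3)[OF c(1)] Some by (cases "g c") auto
    qed (use Suc in auto)
  qed (use assms(1) in auto)
  have "iter g m b \<noteq> None \<longleftrightarrow> m \<le> d b" for m
  proof
    assume "iter g m b \<noteq> None"
    then show "m \<le> d b" using *[of m] by (auto split: option.splits)
  next
    assume "m \<le> d b"
    then show "iter g m b \<noteq> None" using *[of m] by (auto split: option.splits)
  qed
  then have set: "{m. iter g m b \<noteq> None} = {..d b}" by auto
  show ?thesis unfolding set by (rule Max_eqI) auto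
qed

lemma crystal_with_eps_phi:
  assumes "crystal_with C \<epsilon> \<phi>" "b \<in> elems C"
  shows "eps C i b = \<epsilon> i b" "phi C i b = \<phi> i b"
proof -
  have c: "(eop C i b = None \<longleftrightarrow> \<epsilon> i b = 0) \<and> (fop C i b = None \<longleftrightarrow> \<phi> i b = 0)"
    "eop C i b = Some b' \<Longrightarrow> b' \<in> elems C \<and> \<epsilon> i b = Suc (\<epsilon> i b')"
    "fop C i b = Some b' \<Longrightarrow> b' \<in> elems C \<and> \<phi> i b = Suc (\<phi> i b')" if "b \<in> elems C" for b b'
    using assms(1) that unfolding crystal_with_def by blast+
  show "eps C i b = \<epsilon> i b"
    unfolding eps_def by (rule Max_iter[where A = "elems C" and d = "\<epsilon> i"]) (use c assms(2) in blast)+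
  show "phi C i b = \<phi> i b"
    unfolding phi_def by (rule Max_iter[where A = "elems C" and d = "\<phi> i"]) (use c assms(2) in blast)+
qed

lemma crystal_with_seminormal:
  assumes "crystal_with C \<epsilon> \<phi>"
  shows "seminormal C"
  unfolding seminormal_def crystal_with_def[of C "eps C"]
proof (intro ballI allI)
  fix b i assume b: "b \<in> elems C"
  have h: "(eop C i b = None \<longleftrightarrow> \<epsilon> i b = 0) \<and> (fop C i b = None \<longleftrightarrow> \<phi> i b = 0) \<and>
     (\<forall>b'. eop C i b = Some b' \<longrightarrow> b' \<in> elems C \<and> fop C i b' = Some b \<and> \<epsilon> i b = Suc (\<epsilon> i b')) \<and>
     (\<forall>b'. fop C i b = Some b' \<longrightarrow> b' \<in> elems C \<and> eop C i b' = Some b \<and> \<phi> i b = Suc (\<phi> i b')) \<and>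
     wt C b i = int (\<phi> i b) - int (\<epsilon> i b) \<and>
     (\<forall>b'. eop C i b = Some b' \<longrightarrow> \<phi> i b' = Suc (\<phi> i b))"
    using assms b unfolding crystal_with_def by blast
  have e: "eps C i b' = \<epsilon> i b' \<and> phi C i b' = \<phi> i b'" if "eop C i b = Some b' \<or> fop C i b = Some b'" for b'
    using h that crystal_with_eps_phi[OF assms] by blast
  show "(eop C i b = None \<longleftrightarrow> eps C i b = 0) \<and> (fop C i b = None \<longleftrightarrow> phi C i b = 0) \<and>
     (\<forall>b'. eop C i b = Some b' \<longrightarrow> b' \<in> elems C \<and> fop C i b' = Some b \<and> eps C i b = Suc (eps C i b')) \<and>
     (\<forall>b'. fop C i b = Some b' \<longrightarrow> b' \<in> elems C \<and> eop C i b' = Some b \<and> phi C i b = Suc (phi C i b')) \<and>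
     wt C b i = int (phi C i b) - int (eps C i b) \<and>
     (\<forall>b'. eop C i b = Some b' \<longrightarrow> phi C i b' = Suc (phi C i b))"
    unfolding crystal_with_eps_phi[OF assms b]
  proof (intro conjI allI impI)
    fix b' assume b': "eop C i b = Some b'"
    note e' = e[OF disjI1[OF b']]
    show "b' \<in> elems C" "fop C i b' = Some b" using h b' by blast+
    show "\<epsilon> i b = Suc (eps C i b')" "phi C i b' = Suc (\<phi> i b)" using h b' e' by simp_all
  next
    fix b' assume b': "fop C i b = Some b'"
    note e' = e[OF disjI2[OF b']]
    show "b' \<in> elems C" "eop C i b' = Some b" using h b' by blast+
    show "\<phi> i b = Suc (phi C i b')" using h b' e' by simp
  qed (use h in blast)+
qed

lemma seminormalD:
  assumes "seminormal C" "b \<in> elems C"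
  shows "eop C i b = None \<longleftrightarrow> eps C i b = 0" "fop C i b = None \<longleftrightarrow> phi C i b = 0"
    "eop C i b = Some b' \<Longrightarrow> b' \<in> elems C" "eop C i b = Some b' \<Longrightarrow> fop C i b' = Some b"
    "eop C i b = Some b' \<Longrightarrow> eps C i b = Suc (eps C i b')" "eop C i b = Some b' \<Longrightarrow> phi C i b' = Suc (phi C i b)"
    "fop C i b = Some b' \<Longrightarrow> b' \<in> elems C" "fop C i b = Some b' \<Longrightarrow> eop C i b' = Some b"
    "fop C i b = Some b' \<Longrightarrow> phi C i b = Suc (phi C i b')" "fop C i b = Some b' \<Longrightarrow> eps C i b' = Suc (eps C i b)"
    "wt C b i = int (phi C i b) - int (eps C i b)"
proof -
  have c: "crystal_with C (eps C) (phi C)" using assms(1) by (simp add: seminormal_def)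
  show e: "eop C i b = Some b' \<Longrightarrow> b' \<in> elems C" "eop C i b = Some b' \<Longrightarrow> fop C i b' = Some b"
    "eop C i b = Some b' \<Longrightarrow> eps C i b = Suc (eps C i b')" "eop C i b = Some b' \<Longrightarrow> phi C i b' = Suc (phi C i b)"
    "eop C i b = None \<longleftrightarrow> eps C i b = 0" "fop C i b = None \<longleftrightarrow> phi C i b = 0"
    "fop C i b = Some b' \<Longrightarrow> b' \<in> elems C" "fop C i b = Some b' \<Longrightarrow> eop C i b' = Some b"
    "fop C i b = Some b' \<Longrightarrow> phi C i b = Suc (phi C i b')"
    "wt C b i = int (phi C i b) - int (eps C i b)"
    using c assms(2) unfolding crystal_with_def by blast+
  assume f: "fop C i b = Some b'"
  then have "b' \<in> elems C" "eop C i b' = Some b" using c assms(2) unfolding crystal_with_def by blast+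
  then show "eps C i b' = Suc (eps C i b)" using c unfolding crystal_with_def by blast
qed

text \<open>The combinatorial data of B(\<Lambda>) on which the argument about words rests; the
  module has disappeared.\<close>

definition generated_crystal :: "cartan_type \<Rightarrow> weight \<Rightarrow> 'b crystal \<Rightarrow> 'b \<Rightarrow> bool" where
  "generated_crystal T \<Lambda> C u \<longleftrightarrow> seminormal C \<and> u \<in> elems C \<and>
     (\<forall>b\<in>elems C. \<exists>is\<in>lists (nodes T). foldr (\<lambda>i x. Option.bind x (fop C i)) is (Some u) = Some b) \<and>
     (\<forall>b\<in>elems C. \<forall>i b'. fop C i b = Some b' \<longrightarrow> i \<in> nodes T \<and> wt C b' = wshift T i (- 1) (wt C b)) \<and>
     wt C u = \<Lambda> \<and> \<Lambda> \<in> weights T"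

section \<open>The crystal of an irreducible highest weight module\<close>

locale hw_crystal =
  fixes T :: cartan_type and M :: "'v::ab_group_add uq_rep" and \<Lambda> :: weight and u :: 'v
  assumes irr: "irreducible_hw_module T M \<Lambda> u"
    and base: "crystal_base T M (hw_lattice T M u) (hw_basis T M u)"
    and \<Lambda>_weight: "\<Lambda> \<in> weights T" and valid: "valid_type T"
begin

sublocale qrep T M
proof -
  have m: "uq_module T M" and sp: "module.span (smul M) (\<Union>\<mu>\<in>weights T. weight_space T M \<mu>) = UNIV"
    and nil: "\<forall>i\<in>nodes T. \<forall>v. (\<exists>m. (opE M i ^^ m) v = 0) \<and> (\<exists>m. (opF M i ^^ m) v = 0)"
    using base[unfolded crystal_base_def, THEN conjunct1, unfolded integrable_module_def] by - (elim conjE, assumption)+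
  have 1: "vector_space (smul M)"
    and 2: "\<forall>i\<in>nodes T.
        Vector_Spaces.linear (smul M) (smul M) (opE M i) \<and>
        Vector_Spaces.linear (smul M) (smul M) (opF M i) \<and>
        Vector_Spaces.linear (smul M) (smul M) (opK M i) \<and>
        Vector_Spaces.linear (smul M) (smul M) (opKinv M i)"
    and 3: "\<forall>i\<in>nodes T. \<forall>v. opK M i (opKinv M i v) = v \<and> opKinv M i (opK M i v) = v"
    and 4: "\<forall>i\<in>nodes T. \<forall>j\<in>nodes T. \<forall>v.
        opK M i (opK M j v) = opK M j (opK M i v) \<and>
        opK M i (opE M j v) = smul M (qi T i powi cartan T i j) (opE M j (opK M i v)) \<and>
        opK M i (opF M j v) = smul M (qi T i powi (- cartan T i j)) (opF M j (opK M i v)) \<and>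
        opE M i (opF M j v) - opF M j (opE M i v) =
          (if i = j
           then smul M (inverse (qi T i - inverse (qi T i))) (opK M i v - opKinv M i v)
           else 0)"
    using m[unfolded uq_module_def, THEN conjunct1]
      m[unfolded uq_module_def, THEN conjunct2, THEN conjunct1]
      m[unfolded uq_module_def, THEN conjunct2, THEN conjunct2, THEN conjunct1]
      m[unfolded uq_module_def, THEN conjunct2, THEN conjunct2, THEN conjunct2, THEN conjunct1]
    by - (assumption+)
  show "qrep T M"
  proof (rule qrep.intro)
    fix i j v assume i: "i \<in> nodes T" and j: "j \<in> nodes T"
    note rel = bspec[OF bspec[OF 4 i] j, THEN spec, of v, THEN conjunct2]
    show "opK M i (opE M j v) = smul M (qi T i powi cartan T i j) (opE M j (opK M i v))"
      by (rule rel[THEN conjunct1])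
    show "opK M i (opF M j v) = smul M (qi T i powi (- cartan T i j)) (opF M j (opK M i v))"
      by (rule rel[THEN conjunct2, THEN conjunct1])
    show "opE M i (opF M j v) - opF M j (opE M i v) =
        (if i = j then smul M (inverse (qi T i - inverse (qi T i))) (opK M i v - opKinv M i v) else 0)"
      by (rule rel[THEN conjunct2, THEN conjunct2])
  qed (simp_all add: 1 2 3 sp nil)
qed

section \<open>The crystal lattice and reduction modulo q\<close>

definition L :: "'v set" where "L = hw_lattice T M u"
definition B :: "'v set set" where "B = hw_basis T M u"
definition C :: "'v set crystal" where "C = crystal_of_base T M (hw_lattice T M u) (hw_basis T M u)"
abbreviation cls :: "'v \<Rightarrow> 'v set" where "cls \<equiv> coset M L"
definition qL :: "'v set" where "qL = smul M qvar ` L"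

lemma u_hw: "u \<noteq> 0" "u \<in> Wt \<Lambda>" "i \<in> nodes T \<Longrightarrow> opE M i u = 0"
  using irr by (auto simp: irreducible_hw_module_def)

lemma lattice: "crystal_lattice T M L"
  using base by (simp add: crystal_base_def L_def)

text \<open>A lattice basis that is also a basis of the module. Fixing one gives coordinates in
  which the lattice is regularity, and it is the basis used for tensor products.\<close>

definition S :: "'v set" where
  "S = (SOME S. \<not> V.dependent S \<and> V.span S = UNIV \<and>
     L = {\<Sum>s\<in>S'. smul M (a s) s | S' a. finite S' \<and> S' \<subseteq> S \<and> a ` S' \<subseteq> regular0})"

lemma S: "\<not> V.dependent S" "V.span S = UNIV"
  "L = {\<Sum>s\<in>S'. smul M (a s) s | S' a. finite S' \<and> S' \<subseteq> S \<and> a ` S' \<subseteq> regular0}"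
proof -
  have "\<exists>S. \<not> V.dependent S \<and> V.span S = UNIV \<and>
     L = {\<Sum>s\<in>S'. smul M (a s) s | S' a. finite S' \<and> S' \<subseteq> S \<and> a ` S' \<subseteq> regular0}"
    using lattice unfolding crystal_lattice_def by blast
  from someI_ex[OF this, folded S_def]
  show "\<not> V.dependent S" "V.span S = UNIV"
    "L = {\<Sum>s\<in>S'. smul M (a s) s | S' a. finite S' \<and> S' \<subseteq> S \<and> a ` S' \<subseteq> regular0}" by blast+
qed

abbreviation rep where "rep \<equiv> V.representation S"

lemma L_iff: "x \<in> L \<longleftrightarrow> (\<forall>s. rep x s \<in> regular0)"
proof
  assume "x \<in> L"
  then obtain S' a where S': "finite S'" "S' \<subseteq> S" "a ` S' \<subseteq> regular0" "x = (\<Sum>s\<in>S'. smul M (a s) s)"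
    unfolding S(3) by blast
  have "rep x s = (\<Sum>s'\<in>S'. a s' * rep s' s)" for s
    unfolding S'(4) using S(1,2) by (simp add: V.representation_sum V.representation_scale)
  also have "\<dots> s \<in> regular0" for s
    using S' S(1,2) by (intro regular0_sum regular0_mult) (auto simp: V.representation_basis)
  finally show "\<forall>s. rep x s \<in> regular0" by blast
next
  assume "\<forall>s. rep x s \<in> regular0"
  then show "x \<in> L" unfolding S(3) mem_Collect_eq
    using V.sum_nonzero_representation_eq[OF S(1), of x] S(2) V.finite_representation[of S x]
      V.representation_ne_zero[of S x]
    by (intro exI[of _ "{s. rep x s \<noteq> 0}"] exI[of _ "rep x"]) auto
qed

lemma L_0: "0 \<in> L" and L_add: "x \<in> L \<Longrightarrow> y \<in> L \<Longrightarrow> x + y \<in> L"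
  and L_scale: "a \<in> regular0 \<Longrightarrow> x \<in> L \<Longrightarrow> smul M a x \<in> L" and L_diff: "x \<in> L \<Longrightarrow> y \<in> L \<Longrightarrow> x - y \<in> L"
  using S(1,2) by (auto simp: L_iff V.representation_zero V.representation_add V.representation_scale V.representation_diff)

lemma qL_rep: "x \<in> qL \<Longrightarrow> rep x s \<in> qideal"
  using S(1,2) by (auto simp: qL_def L_iff V.representation_scale qideal_def)

lemma qL_0: "0 \<in> qL" and qL_add: "x \<in> qL \<Longrightarrow> y \<in> qL \<Longrightarrow> x + y \<in> qL"
  and qL_scale: "a \<in> regular0 \<Longrightarrow> x \<in> qL \<Longrightarrow> smul M a x \<in> qL" and qL_L: "x \<in> qL \<Longrightarrow> x \<in> L"
proof -
  show "0 \<in> qL" unfolding qL_def using L_0 by (intro image_eqI[of _ _ 0]) auto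
  show "x \<in> qL \<Longrightarrow> y \<in> qL \<Longrightarrow> x + y \<in> qL"
    by (auto simp: qL_def V.scale_right_distrib[symmetric] intro: L_add)
  show "a \<in> regular0 \<Longrightarrow> x \<in> qL \<Longrightarrow> smul M a x \<in> qL"
    unfolding qL_def using V.scale_left_commute[of a qvar] L_scale by force
  show "x \<in> qL \<Longrightarrow> x \<in> L" by (auto simp: qL_def intro: L_scale)
qed

lemma qL_uminus: "x \<in> qL \<Longrightarrow> - x \<in> qL"
  using qL_scale[of "- 1" x] by auto

lemma qL_diff: "x \<in> qL \<Longrightarrow> y \<in> qL \<Longrightarrow> x - y \<in> qL"
  using qL_add[OF _ qL_uminus] by (metis add_uminus_conv_diff)

lemma lattice_k: "\<forall>i\<in>nodes T. ke i ` L \<subseteq> L \<and> kf i ` L \<subseteq> L"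
  by (rule lattice[unfolded crystal_lattice_def, THEN conjunct2, THEN conjunct2])

lemma lattice_weights: "\<forall>x\<in>L. \<exists>P c. finite P \<and> P \<subseteq> weights T \<and>
    (\<forall>\<mu>\<in>P. c \<mu> \<in> L \<inter> Wt \<mu>) \<and> x = (\<Sum>\<mu>\<in>P. c \<mu>)"
  by (rule lattice[unfolded crystal_lattice_def, THEN conjunct2, THEN conjunct1])

lemma kL: "i \<in> nodes T \<Longrightarrow> x \<in> L \<Longrightarrow> ke i x \<in> L" "i \<in> nodes T \<Longrightarrow> x \<in> L \<Longrightarrow> kf i x \<in> L"
  using lattice_k by blast+

lemma kqL: "i \<in> nodes T \<Longrightarrow> x \<in> qL \<Longrightarrow> ke i x \<in> qL" "i \<in> nodes T \<Longrightarrow> x \<in> qL \<Longrightarrow> kf i x \<in> qL"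
  by (auto simp: qL_def lin_scale[OF lin_ke] lin_scale[OF lin_kf] kL)

lemma in_cls: "y \<in> cls x \<longleftrightarrow> y - x \<in> qL"
  unfolding coset_def qL_def by (auto simp: image_iff algebra_simps)

lemma cls_eq_iff: "cls x = cls y \<longleftrightarrow> x - y \<in> qL"
proof
  assume "cls x = cls y"
  then have "x \<in> cls y" using qL_0 by (auto simp: in_cls)
  then show "x - y \<in> qL" by (simp add: in_cls)
next
  assume xy: "x - y \<in> qL"
  have "z - x \<in> qL \<longleftrightarrow> z - y \<in> qL" for z
    using qL_add[OF _ xy, of "z - x"] qL_diff[OF _ xy, of "z - y"] by auto
  then show "cls x = cls y" by (auto simp: in_cls)
qed

lemma induced_cls:
  assumes "lin g" "\<And>x. x \<in> qL \<Longrightarrow> g x \<in> qL"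
  shows "induced M L g (cls x) = cls (g x)"
proof -
  have "cls (g y) = cls (g x)" if "y \<in> cls x" for y
    using assms that by (simp add: cls_eq_iff in_cls flip: lin_diff)
  then have "induced M L g (cls x) = (\<Union>y\<in>cls x. cls (g x))"
    unfolding induced_def by (intro SUP_cong) auto
  moreover have "x \<in> cls x" using qL_0 by (simp add: in_cls)
  ultimately show ?thesis by auto
qed

lemma induced_k: "i \<in> nodes T \<Longrightarrow> induced M L (ke i) (cls x) = cls (ke i x)"
  "i \<in> nodes T \<Longrightarrow> induced M L (kf i) (cls x) = cls (kf i x)"
  by (rule induced_cls; simp add: lin_ke lin_kf kqL)+

lemma f_string_L: "is \<in> lists (nodes T) \<Longrightarrow> f_string T M is u \<in> L"
proof -
  assume "is \<in> lists (nodes T)"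
  then show ?thesis unfolding L_def hw_lattice_def mem_Collect_eq
    by (intro exI[of _ "{is}"] exI[of _ "\<lambda>_. 1"]) auto
qed

text \<open>Otherwise all vectors \<open>f_string T M is u\<close> would lie in \<open>qL\<close>,
  hence all of the lattice they generate. But a basis vector in \<open>S\<close> has a coordinate
  1.\<close>

lemma u_notin_qL: "u \<notin> qL"
proof
  assume u: "u \<in> qL"
  have f: "f_string T M is u \<in> qL" if "is \<in> lists (nodes T)" for "is"
    using that by (induction "is") (auto simp: f_string_def u kqL)
  have "x \<in> qL" if "x \<in> L" for x
  proof -
    have "\<exists>X a. x = (\<Sum>is\<in>X. smul M (a is) (f_string T M is u)) \<and>
        finite X \<and> X \<subseteq> lists (nodes T) \<and> a ` X \<subseteq> regular0"
      using that unfolding L_def hw_lattice_def mem_Collect_eq .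
    then obtain X a where X: "finite X" "X \<subseteq> lists (nodes T)" "a ` X \<subseteq> regular0"
      "x = (\<Sum>is\<in>X. smul M (a is) (f_string T M is u))" by (elim exE conjE)
    have "(\<Sum>is\<in>X. smul M (a is) (f_string T M is u)) \<in> qL"
      using X(1-3) by (induction X rule: finite_induct) (auto simp: qL_0 intro!: qL_add qL_scale f)
    then show ?thesis using X by simp
  qed
  moreover have "S \<noteq> {}"
  proof
    assume "S = {}"
    then have "V.span S = {0}" by simp
    then show False using S(2) u_hw(1) by auto
  qed
  then obtain s where s: "s \<in> S" by blast
  then have "s \<in> L" using S(1,2) by (auto simp: L_iff V.representation_basis)
  ultimately have "rep s s \<in> qideal" using qL_rep by blast
  then show False using s S(1,2) one_notin_qideal by (simp add: V.representation_basis)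
qed

section \<open>Weight spaces of the irreducible module\<close>

lemma f_string_Wt:
  "is \<in> lists (nodes T) \<Longrightarrow> f_string T M is u \<in> Wt (wsub T \<Lambda> (\<lambda>i. int (count_list is i)))"
proof (induction "is")
  case Nil
  then show ?case by (simp add: f_string_def u_hw)
next
  case (Cons i "is")
  let ?n = "\<lambda>j. int (count_list is j)"
  have "kf i (f_string T M is u) \<in> Wt (wshift T i (- 1) (wsub T \<Lambda> ?n))"
    using Cons \<Lambda>_weight by (intro kf_Wt) auto
  moreover have "wshift T i (- 1) (wsub T \<Lambda> ?n) = wsub T \<Lambda> (\<lambda>j. int (count_list (i # is) j))"
  proof -
    have i: "i \<in> nodes T" using Cons.prems by simp
    show ?thesis unfolding wshift_wsub[OF i] by (rule arg_cong[where f = "wsub T \<Lambda>"]) auto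
  qed
  ultimately show ?case by (simp add: f_string_def)
qed

lemma F_string_Wt:
  "is \<in> lists (nodes T) \<Longrightarrow> foldr (opF M) is u \<in> Wt (wsub T \<Lambda> (\<lambda>i. int (count_list is i)))"
proof (induction "is")
  case (Cons i "is")
  let ?n = "\<lambda>j. int (count_list is j)"
  have "opF M i (foldr (opF M) is u) \<in> Wt (wshift T i (- 1) (wsub T \<Lambda> ?n))" using Cons by (intro F_Wt) auto
  moreover have "wshift T i (- 1) (wsub T \<Lambda> ?n) = wsub T \<Lambda> (\<lambda>j. int (count_list (i # is) j))"
  proof -
    have i: "i \<in> nodes T" using Cons.prems by simp
    show ?thesis unfolding wshift_wsub[OF i] by (rule arg_cong[where f = "wsub T \<Lambda>"]) auto
  qed
  ultimately show ?case by simp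
qed (simp add: u_hw)

text \<open>The span is a nonzero submodule, so irreducibility applies. Stability under E_i is shown
  on words by commuting E_i past the leading letter; the commutator acts by a scalar or is
  zero.\<close>

lemma span_F_strings: "V.span ((\<lambda>is. foldr (opF M) is u) ` lists (nodes T)) = UNIV" (is "V.span ?X = _")
proof -
  let ?F = "\<lambda>is. foldr (opF M) is u"
  note wtF = F_string_Wt
  have closed: "g x \<in> V.span ?X" if "lin g" "\<And>is. is \<in> lists (nodes T) \<Longrightarrow> g (?F is) \<in> V.span ?X" "x \<in> V.span ?X" for g x
    using that(3)
  proof (induction rule: V.span_induct_alt)
    case base
    then show ?case by (simp add: lin_zero[OF that(1)] V.span_zero)
  next
    case (step c x y)
    then show ?case using that(1,2) by (auto simp: lin_add lin_scale intro!: V.span_add V.span_scale)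
  qed
  have F: "opF M i (?F is) \<in> V.span ?X" if "i \<in> nodes T" "is \<in> lists (nodes T)" for i "is"
    using that by (intro V.span_base image_eqI[of _ _ "i # is"]) auto
  have E: "opE M i (?F is) \<in> V.span ?X" if "is \<in> lists (nodes T)" "i \<in> nodes T" for i "is"
    using that(1)
  proof (induction "is" rule: list.induct)
    case Nil
    then show ?case using that by (simp add: u_hw V.span_zero)
  next
    case (Cons j "is")
    then have is': "is \<in> lists (nodes T)" "j \<in> nodes T" by auto
    have FE: "opF M j (opE M i (?F is)) \<in> V.span ?X"
      by (rule closed[OF linF[OF is'(2)] F[OF is'(2)] Cons.IH[OF is'(1)]])
    show ?case
    proof (cases "i = j")
      case True
      have "?F is \<in> V.span ?X" using is' by (intro V.span_base imageI)
      then show ?thesis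
        using V.span_add[OF FE V.span_scale] E_F_Wt[OF wtF[OF is'(1)] that(2)] True by simp
    next
      case False
      then show ?thesis using FE E_F_neq[OF that(2) is'(2)] by simp
    qed
  qed
  have "V.subspace (V.span ?X) \<and> (\<forall>i\<in>nodes T. \<forall>w\<in>V.span ?X.
      opE M i w \<in> V.span ?X \<and> opF M i w \<in> V.span ?X \<and> opK M i w \<in> V.span ?X \<and> opKinv M i w \<in> V.span ?X)"
  proof (intro conjI ballI)
    fix i w assume i: "i \<in> nodes T" and w: "w \<in> V.span ?X"
    have X: "?F is \<in> V.span ?X" if "is \<in> lists (nodes T)" for "is" using that by (intro V.span_base imageI)
    show "opE M i w \<in> V.span ?X" by (rule closed[OF linE[OF i] E[OF _ i] w])
    show "opF M i w \<in> V.span ?X" by (rule closed[OF linF[OF i] F[OF i] w])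
    show "opK M i w \<in> V.span ?X"
      by (rule closed[OF linK[OF i] _ w]) (simp add: K_Wt[OF wtF i] V.span_scale X)
    show "opKinv M i w \<in> V.span ?X"
      by (rule closed[OF linKinv[OF i] _ w]) (simp add: Kinv_Wt[OF wtF i] V.span_scale X)
  qed simp
  then have "V.span ?X = {0} \<or> V.span ?X = UNIV"
    by (rule irr[unfolded irreducible_hw_module_def, THEN conjunct2, THEN conjunct2, THEN conjunct2,
        THEN conjunct2, THEN spec, THEN mp])
  moreover have "u \<in> V.span ?X" by (intro V.span_base image_eqI[of _ _ "[]"]) auto
  ultimately show ?thesis using u_hw(1) by auto
qed

text \<open>Only words of the given weight contribute, and \<open>wsub_inj\<close> turns equal
  weights into equal letter counts.\<close>

lemma weight_space_span:
  assumes "v \<in> Wt (wsub T \<Lambda> n)"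
  shows "v \<in> V.span {foldr (opF M) is u | is. is \<in> lists (nodes T) \<and> (\<forall>i\<in>nodes T. int (count_list is i) = n i)}"
proof -
  let ?X = "(\<lambda>is. foldr (opF M) is u) ` lists (nodes T)"
  have "\<forall>x\<in>?X. \<exists>is\<in>lists (nodes T). x = foldr (opF M) is u" by auto
  then obtain h where h: "\<And>x. x \<in> ?X \<Longrightarrow> h x \<in> lists (nodes T) \<and> x = foldr (opF M) (h x) u" by metis
  define w where "w = (\<lambda>x. wsub T \<Lambda> (\<lambda>i. int (count_list (h x) i)))"
  have "v \<in> V.span {x \<in> ?X. w x = wsub T \<Lambda> n}"
  proof (rule span_weight_component)
    show "v \<in> V.span ?X" by (simp add: span_F_strings)
    show "w x \<in> weights T \<and> x \<in> Wt (w x)" if "x \<in> ?X" for x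
      using h[OF that] F_string_Wt[of "h x"] \<Lambda>_weight by (simp add: w_def)
  qed (use assms \<Lambda>_weight in auto)
  moreover have "{x \<in> ?X. w x = wsub T \<Lambda> n} \<subseteq>
      {foldr (opF M) is u | is. is \<in> lists (nodes T) \<and> (\<forall>i\<in>nodes T. int (count_list is i) = n i)}"
    using h wsub_inj[OF valid] unfolding w_def by blast
  ultimately show ?thesis using V.span_mono by blast
qed

lemma weight_nonneg:
  assumes "v \<in> Wt (wsub T \<Lambda> n)" "v \<noteq> 0" "i \<in> nodes T"
  shows "n i \<ge> 0"
proof (rule ccontr)
  assume "\<not> n i \<ge> 0"
  then have "{foldr (opF M) is u | is. is \<in> lists (nodes T) \<and> (\<forall>i\<in>nodes T. int (count_list is i) = n i)} = {}"
    using assms(3) by force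
  then have "v \<in> V.span {}" using weight_space_span[OF assms(1)] by metis
  then show False using assms(2) by simp
qed

lemma weight_top:
  assumes "v \<in> Wt \<Lambda>"
  shows "\<exists>a. v = smul M a u"
proof -
  have v: "v \<in> V.span {foldr (opF M) is u | is. is \<in> lists (nodes T) \<and> (\<forall>i\<in>nodes T. int (count_list is i) = 0)}"
    using weight_space_span[of v "\<lambda>_. 0"] assms by simp
  have "is = []" if "is \<in> lists (nodes T)" "\<forall>i\<in>nodes T. int (count_list is i) = 0" for "is"
    using that by (cases "is") auto
  then have "{foldr (opF M) is u | is. is \<in> lists (nodes T) \<and> (\<forall>i\<in>nodes T. int (count_list is i) = 0)} \<subseteq> {u}"
    by fastforce
  then have "v \<in> V.span {u}" using v V.span_mono by blast
  then show ?thesis by (auto simp: V.span_singleton)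
qed

end

context hw_crystal
begin

section \<open>The crystal structure on classes modulo q\<close>

lemma elems_C [simp]: "elems C = B"
  by (simp add: C_def B_def crystal_of_base_def Let_def)

lemma B_iff: "b \<in> B \<longleftrightarrow> (\<exists>is\<in>lists (nodes T). b = cls (f_string T M is u)) \<and> b \<noteq> cls 0"
  by (auto simp: B_def hw_basis_def L_def)

lemma cls_B_notin_qL: "cls x \<in> B \<Longrightarrow> x \<notin> qL"
  by (auto simp: B_iff cls_eq_iff)

lemma cls_u_B: "cls u \<in> B"
  unfolding B_iff
proof (rule conjI)
  show "\<exists>is\<in>lists (nodes T). cls u = cls (f_string T M is u)"
    by (rule bexI[of _ "[]"]) (simp_all add: f_string_def)
  show "cls u \<noteq> cls 0" using u_notin_qL by (simp add: cls_eq_iff)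
qed

lemma base_k:
  assumes "i \<in> nodes T"
  shows "cls x \<in> B \<Longrightarrow> cls (ke i x) \<in> insert (cls 0) B" "cls x \<in> B \<Longrightarrow> cls (kf i x) \<in> insert (cls 0) B"
    "cls x \<in> B \<Longrightarrow> cls y \<in> B \<Longrightarrow> cls y = cls (kf i x) \<longleftrightarrow> cls x = cls (ke i y)"
proof -
  note b = base[folded L_def B_def, unfolded crystal_base_def, THEN conjunct2, THEN conjunct2, THEN conjunct2, THEN conjunct2]
  note b1 = bspec[OF b[THEN conjunct1] assms] and b2 = bspec[OF b[THEN conjunct2] assms]
  show "cls x \<in> B \<Longrightarrow> cls (ke i x) \<in> insert (cls 0) B" "cls x \<in> B \<Longrightarrow> cls (kf i x) \<in> insert (cls 0) B"
    using bspec[OF b1, of "cls x"] unfolding induced_k[OF assms] by blast+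
  show "cls x \<in> B \<Longrightarrow> cls y \<in> B \<Longrightarrow> cls y = cls (kf i x) \<longleftrightarrow> cls x = cls (ke i y)"
    using bspec[OF bspec[OF b2], of "cls x" "cls y"] unfolding induced_k[OF assms] by blast
qed

lemma C_ops:
  "i \<in> nodes T \<Longrightarrow> eop C i (cls x) = (if ke i x \<in> qL then None else Some (cls (ke i x)))"
  "i \<in> nodes T \<Longrightarrow> fop C i (cls x) = (if kf i x \<in> qL then None else Some (cls (kf i x)))"
  "i \<notin> nodes T \<Longrightarrow> eop C i b = None" "i \<notin> nodes T \<Longrightarrow> fop C i b = None"
  by (simp_all add: C_def crystal_of_base_def Let_def L_def[symmetric] induced_k cls_eq_iff)

lemma B_cases:
  assumes "b \<in> B"
  obtains "is" where "is \<in> lists (nodes T)" "b = cls (f_string T M is u)" "f_string T M is u \<notin> qL"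
proof -
  obtain "is" where 1: "is \<in> lists (nodes T)" "b = cls (f_string T M is u)"
    using assms unfolding B_iff by blast
  have "cls (f_string T M is u) \<noteq> cls 0" using assms 1(2) unfolding B_iff by simp
  then have "f_string T M is u \<notin> qL" by (simp add: cls_eq_iff)
  with 1 show thesis by (rule that)
qed

text \<open>The lattice is the sum of its weight parts. If the weights differed, the \<mu>-component
  of y - x would exhibit x as q times a lattice vector.\<close>

lemma weight_unique_mod_q:
  assumes "x \<in> Wt \<mu>" "y \<in> Wt \<nu>" "\<mu> \<in> weights T" "\<nu> \<in> weights T" "y - x \<in> qL" "x \<notin> qL"
  shows "\<mu> = \<nu>"
proof (rule ccontr)
  assume neq: "\<mu> \<noteq> \<nu>"
  obtain z where z: "z \<in> L" "y - x = smul M qvar z" using assms(5) by (auto simp: qL_def)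
  obtain P c where c: "finite P" "P \<subseteq> weights T" "\<forall>\<kappa>\<in>P. c \<kappa> \<in> L \<inter> Wt \<kappa>" "z = (\<Sum>\<kappa>\<in>P. c \<kappa>)"
    using bspec[OF lattice_weights z(1)] by (elim exE conjE)
  \<comment> \<open>The indices \<open>Inl True\<close> and \<open>Inl False\<close> carry x and -y,
    the remaining ones the weight components of q z.\<close>
  define P' where "P' = insert (Inl True) (insert (Inl False) (Inr ` P))"
  define f where "f = case_sum (\<lambda>t. if t then x else - y) (\<lambda>\<kappa>. smul M qvar (c \<kappa>))"
  define w where "w = case_sum (\<lambda>t. if t then \<mu> else \<nu>) (\<lambda>\<kappa>. \<kappa> :: weight)"
  have "(\<Sum>p\<in>{p\<in>P'. w p = \<mu>}. f p) = 0"
  proof (rule weight_component_zero)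
    have "(\<Sum>p\<in>P'. f p) = x - y + smul M qvar z"
      using c(1) by (simp add: P'_def f_def sum.reindex c(4) V.scale_sum_right image_iff)
    then show "(\<Sum>p\<in>P'. f p) = 0" by (simp flip: z(2))
    fix p assume p: "p \<in> P'"
    show "w p \<in> weights T" using p c(2) assms by (auto simp: P'_def w_def)
    have "smul M qvar (c \<kappa>) \<in> Wt \<kappa>" if "\<kappa> \<in> P" for \<kappa> using c(3) that Wt_scale by blast
    then show "f p \<in> Wt (w p)"
      using p assms(1,2) V.subspace_neg[OF subspace_Wt] by (auto simp: P'_def w_def f_def)
  qed (use c(1) in \<open>simp add: P'_def\<close>)
  moreover have "{p\<in>P'. w p = \<mu>} = insert (Inl True) (Inr ` {\<kappa>\<in>P. \<kappa> = \<mu>})"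
    using neq by (auto simp: P'_def w_def)
  ultimately have "x + (\<Sum>\<kappa>\<in>{\<kappa>\<in>P. \<kappa> = \<mu>}. smul M qvar (c \<kappa>)) = 0"
    using c(1) by (simp add: f_def sum.reindex image_iff)
  then have "x = - (\<Sum>\<kappa>\<in>{\<kappa>\<in>P. \<kappa> = \<mu>}. smul M qvar (c \<kappa>))" by (simp add: eq_neg_iff_add_eq_0)
  moreover have "(\<Sum>\<kappa>\<in>A. smul M qvar (c \<kappa>)) \<in> qL" if "A \<subseteq> P" "finite A" for A
  proof -
    have q: "smul M qvar (c \<kappa>) \<in> qL" if "\<kappa> \<in> P" for \<kappa> using c(3) that by (auto simp: qL_def)
    show ?thesis using that(2,1) q by (induction A rule: finite_induct) (auto simp: qL_0 intro!: qL_add)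
  qed
  moreover have "{\<kappa>\<in>P. \<kappa> = \<mu>} \<subseteq> P" "finite {\<kappa>\<in>P. \<kappa> = \<mu>}" using c(1) by auto
  ultimately have "x \<in> qL" using qL_uminus by metis
  then show False using assms(6) by simp
qed

lemma wt_C:
  assumes "x \<in> L" "x \<in> Wt \<mu>" "\<mu> \<in> weights T" "x \<notin> qL"
  shows "wt C (cls x) = \<mu>"
proof -
  have "wt C (cls x) = (THE \<mu>. \<mu> \<in> weights T \<and> cls x \<inter> L \<inter> Wt \<mu> \<noteq> {})"
    by (simp add: C_def crystal_of_base_def Let_def L_def)
  also have "\<dots> = \<mu>"
  proof (rule the_equality)
    show "\<mu> \<in> weights T \<and> cls x \<inter> L \<inter> Wt \<mu> \<noteq> {}" using assms qL_0 by (force simp: in_cls)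
    fix \<nu> assume "\<nu> \<in> weights T \<and> cls x \<inter> L \<inter> Wt \<nu> \<noteq> {}"
    then obtain y where "\<nu> \<in> weights T" "y - x \<in> qL" "y \<in> Wt \<nu>" by (auto simp: in_cls)
    then show "\<nu> = \<mu>" using weight_unique_mod_q[OF assms(2) _ assms(3)] assms(4) by metis
  qed
  finally show ?thesis .
qed

lemma pow_qL: "i \<in> nodes T \<Longrightarrow> x \<in> qL \<Longrightarrow> (ke i ^^ k) x \<in> qL" "i \<in> nodes T \<Longrightarrow> x \<in> qL \<Longrightarrow> (kf i ^^ k) x \<in> qL"
  "i \<in> nodes T \<Longrightarrow> x \<in> L \<Longrightarrow> (ke i ^^ k) x \<in> L" "i \<in> nodes T \<Longrightarrow> x \<in> L \<Longrightarrow> (kf i ^^ k) x \<in> L"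
  by (induction k) (auto simp: kqL kL)

lemma L_weight_strings:
  assumes i: "i \<in> nodes T" and x: "x \<in> L" "x \<in> Wt \<mu>" "\<mu> \<in> weights T"
  obtains k c where "\<And>n. hwv i (wshift T i (int n) \<mu>) (c n)" "\<And>n. c n \<noteq> 0 \<Longrightarrow> int n \<le> wshift T i (int n) \<mu> i"
    "x = (\<Sum>n<k. dF i n (c n))" "\<And>n. n < k \<Longrightarrow> c n \<in> L"
proof -
  obtain k c where c: "\<And>n. hwv i (wshift T i (int n) \<mu>) (c n)" "\<And>n. c n \<noteq> 0 \<Longrightarrow> int n \<le> wshift T i (int n) \<mu> i"
    "x = (\<Sum>n<k. dF i n (c n))"
    using weight_strings[OF V.subspace_UNIV UNIV_I UNIV_I i UNIV_I x(2,3)] by metis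
  have "c n \<in> L" if "n < k" for n
    by (rule string_components[OF i L_diff _ _ c(1,2) _ that]) (use lattice_k i x(1) c(3) in auto)
  then show thesis using that c by blast
qed

text \<open>Induction on the number of raising steps. If raising gives zero modulo q, x is congruent
  to its own component c 0. Otherwise the raised class has a representative F^(n) c, and lowering it
  back yields F^(n+1) c by the crystal base axiom.\<close>

lemma string_rep_exists:
  assumes i: "i \<in> nodes T" and x: "x \<in> L" "x \<in> Wt \<mu>" "\<mu> \<in> weights T" "cls x \<in> B" "(ke i ^^ N) x \<in> qL"
  shows "\<exists>\<kappa> c n. hwv i \<kappa> c \<and> c \<in> L \<and> int n \<le> \<kappa> i \<and> cls x = cls (dF i n c)"
  using x
proof (induction N arbitrary: x \<mu>)
  case 0
  then show ?case using cls_B_notin_qL by auto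
next
  case (Suc N)
  show ?case
  proof (cases "ke i x \<in> qL")
    case True
    obtain k c where c: "\<And>n. hwv i (wshift T i (int n) \<mu>) (c n)" "\<And>n. c n \<noteq> 0 \<Longrightarrow> int n \<le> wshift T i (int n) \<mu> i"
      "x = (\<Sum>n<k. dF i n (c n))" "\<And>n. n < k \<Longrightarrow> c n \<in> L"
      using L_weight_strings[OF i Suc.prems(1-3)] by blast
    have "k \<noteq> 0" using c(3) cls_B_notin_qL[OF Suc.prems(4)] qL_0 by (cases k) auto
    then obtain k' where k': "k = Suc k'" by (cases k) auto
    \<comment> \<open>Raising and then lowering removes exactly the component of index 0, so x - c 0
      inherits divisibility by q from the raised vector.\<close>
    have "kf i (ke i x) = (\<Sum>n<k. if n = 0 then 0 else dF i n (c n))"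
      unfolding c(3) lin_sum[OF lin_ke[OF i]] lin_sum[OF lin_kf[OF i]]
    proof (rule sum.cong[OF refl])
      fix n show "kf i (ke i (dF i n (c n))) = (if n = 0 then 0 else dF i n (c n))"
        using ke_dF[OF i c(1) c(2), of n] kf_dF[OF i c(1), of "n - 1" n] i by (auto simp: lin_zero[OF lin_kf])
    qed
    also have "\<dots> = x - c 0" unfolding c(3) k' sum.lessThan_Suc_shift by simp
    finally have d: "x - c 0 \<in> qL" using kqL(2)[OF i True] by simp
    then have "cls x = cls (dF i 0 (c 0))" by (simp add: cls_eq_iff)
    moreover have "c 0 \<noteq> 0" using d cls_B_notin_qL[OF Suc.prems(4)] by auto
    ultimately show ?thesis using c(1)[of 0] c(2)[of 0] c(4)[of 0] k'
      by (intro exI[of _ \<mu>] exI[of _ "c 0"] exI[of _ 0]) auto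
  next
    case False
    have "cls (ke i x) \<in> B" using base_k(1)[OF i Suc.prems(4)] False by (auto simp: cls_eq_iff)
    moreover have "(ke i ^^ N) (ke i x) \<in> qL" using Suc.prems(5) by (simp add: funpow_swap1)
    moreover have "ke i x \<in> Wt (wshift T i 1 \<mu>)" by (rule ke_Wt[OF i Suc.prems(2,3)])
    ultimately obtain \<kappa> c n where h: "hwv i \<kappa> c" "c \<in> L" "int n \<le> \<kappa> i" "cls (ke i x) = cls (dF i n c)"
      using Suc.IH[of "ke i x" "wshift T i 1 \<mu>"] kL(1)[OF i Suc.prems(1)] Suc.prems(3) by auto
    have "cls x = cls (kf i (ke i x))"
      using base_k(3)[OF i \<open>cls (ke i x) \<in> B\<close> Suc.prems(4)] by simp
    also have "\<dots> = cls (kf i (dF i n c))"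
      using h(4) kqL(2)[OF i] by (simp add: cls_eq_iff flip: lin_diff[OF lin_kf[OF i]])
    also have "\<dots> = cls (dF i (Suc n) c)" by (simp add: kf_dF[OF i h(1)])
    finally have x: "cls x = cls (dF i (Suc n) c)" .
    have "int (Suc n) \<le> \<kappa> i"
    proof (rule ccontr)
      assume "\<not> ?thesis"
      then have "dF i (Suc n) c = 0" using h(1) i by (intro dF_vanish) (auto simp: hwv_def)
      then show False using x cls_B_notin_qL[OF Suc.prems(4)] by (simp add: cls_eq_iff)
    qed
    then show ?thesis using h x by blast
  qed
qed

text \<open>The whole string of c is recorded, so that e_i and f_i change only the position
  n.\<close>

definition string_rep :: "nat \<Rightarrow> 'v set \<Rightarrow> weight \<Rightarrow> 'v \<Rightarrow> nat \<Rightarrow> bool" where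
  "string_rep i b \<kappa> c n \<longleftrightarrow> hwv i \<kappa> c \<and> int n \<le> \<kappa> i \<and> b = cls (dF i n c) \<and>
     (\<forall>k. dF i k c \<in> L) \<and> (\<forall>k. int k \<le> \<kappa> i \<longrightarrow> dF i k c \<notin> qL)"

lemma string_rep_ex:
  assumes i: "i \<in> nodes T" and b: "b \<in> B"
  shows "\<exists>\<kappa> c n. string_rep i b \<kappa> c n"
proof -
  obtain "is" where "is": "is \<in> lists (nodes T)" "b = cls (f_string T M is u)" "f_string T M is u \<notin> qL"
    using b by (rule B_cases)
  let ?x = "f_string T M is u" let ?\<mu> = "wsub T \<Lambda> (\<lambda>i. int (count_list is i))"
  have x: "?x \<in> L" "?x \<in> Wt ?\<mu>" "?\<mu> \<in> weights T"
    using f_string_L f_string_Wt "is"(1) \<Lambda>_weight by auto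
  obtain k c where c: "\<And>n. hwv i (wshift T i (int n) ?\<mu>) (c n)" "\<And>n. c n \<noteq> 0 \<Longrightarrow> int n \<le> wshift T i (int n) ?\<mu> i"
    "?x = (\<Sum>n<k. dF i n (c n))"
    using L_weight_strings[OF i x] by metis
  have "(ke i ^^ k) ?x = 0"
    unfolding c(3) lin_sum[OF lin_pow[OF lin_ke[OF i]]]
    using ke_dF_pow[OF i c(1,2)] by (intro sum.neutral) auto
  then have "\<exists>\<kappa> c n. hwv i \<kappa> c \<and> c \<in> L \<and> int n \<le> \<kappa> i \<and> cls ?x = cls (dF i n c)"
    using b "is"(2) qL_0 by (intro string_rep_exists[OF i x, of k]) auto
  then obtain \<kappa> c n where h: "hwv i \<kappa> c" "c \<in> L" "int n \<le> \<kappa> i" "b = cls (dF i n c)"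
    using "is"(2) by auto
  have nz: "dF i n c \<notin> qL" using b h(4) cls_B_notin_qL by auto
  have "dF i k c \<in> L" for k
    using pow_qL(4)[OF i h(2), of k] kf_dF_pow[OF i h(1), of k 0] by simp
  moreover have "dF i k c \<notin> qL" if k: "int k \<le> \<kappa> i" for k
  proof
    assume q: "dF i k c \<in> qL"
    show False
    proof (cases "k \<le> n")
      case True
      then show ?thesis using pow_qL(2)[OF i q, of "n - k"] kf_dF_pow[OF i h(1), of "n - k" k] nz by simp
    next
      case False
      then show ?thesis using pow_qL(1)[OF i q, of "k - n"] ke_dF_pow[OF i h(1), of k "k - n"] nz k by simp
    qed
  qed
  ultimately show ?thesis using h by (auto simp: string_rep_def)
qed

lemma string_rep_ops:
  assumes i: "i \<in> nodes T" and r: "string_rep i b \<kappa> c n"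
  shows "eop C i b = (if n = 0 then None else Some (cls (dF i (n - 1) c)))"
    "fop C i b = (if int n < \<kappa> i then Some (cls (dF i (Suc n) c)) else None)"
    "n > 0 \<Longrightarrow> string_rep i (cls (dF i (n - 1) c)) \<kappa> c (n - 1)"
    "int n < \<kappa> i \<Longrightarrow> string_rep i (cls (dF i (Suc n) c)) \<kappa> c (Suc n)"
proof -
  have h: "hwv i \<kappa> c" "int n \<le> \<kappa> i" "b = cls (dF i n c)" "\<And>k. int k \<le> \<kappa> i \<Longrightarrow> dF i k c \<notin> qL"
    using r by (auto simp: string_rep_def)
  show "eop C i b = (if n = 0 then None else Some (cls (dF i (n - 1) c)))"
    using h(2) h(4)[of "n - 1"] qL_0 by (auto simp: h(3) C_ops(1)[OF i] ke_dF[OF i h(1)])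
  have "dF i (Suc n) c = 0" if "\<not> int n < \<kappa> i"
    using h(1) i that by (intro dF_vanish) (auto simp: hwv_def)
  then show "fop C i b = (if int n < \<kappa> i then Some (cls (dF i (Suc n) c)) else None)"
    using h(4)[of "Suc n"] qL_0 by (auto simp: h(3) C_ops(2)[OF i] kf_dF[OF i h(1)])
  show "n > 0 \<Longrightarrow> string_rep i (cls (dF i (n - 1) c)) \<kappa> c (n - 1)"
    "int n < \<kappa> i \<Longrightarrow> string_rep i (cls (dF i (Suc n) c)) \<kappa> c (Suc n)"
    using r by (auto simp: string_rep_def)
qed

lemma string_rep_eps_phi:
  assumes i: "i \<in> nodes T" and r: "string_rep i b \<kappa> c n"
  shows "eps C i b = n" "int (phi C i b) = \<kappa> i - int n"
proof -
  have 1: "iter (eop C i) m b = (if m \<le> n then Some (cls (dF i (n - m) c)) else None) \<and>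
      (m \<le> n \<longrightarrow> string_rep i (cls (dF i (n - m) c)) \<kappa> c (n - m))" for m
  proof (induction m)
    case 0
    then show ?case using r by (auto simp: string_rep_def)
  next
    case (Suc m)
    show ?case
    proof (cases "m \<le> n")
      case True
      then have s: "string_rep i (cls (dF i (n - m) c)) \<kappa> c (n - m)" using Suc by simp
      show ?thesis using string_rep_ops(1,3)[OF i s] Suc True by auto
    qed (use Suc in auto)
  qed
  have "{m. iter (eop C i) m b \<noteq> None} = {..n}" using 1 by (auto split: if_splits)
  then show "eps C i b = n" unfolding eps_def by (simp only:) (rule Max_eqI, auto)
  have nk: "int n \<le> \<kappa> i" using r by (simp add: string_rep_def)
  have 2: "iter (fop C i) m b = (if int (n + m) \<le> \<kappa> i then Some (cls (dF i (n + m) c)) else None) \<and>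
      (int (n + m) \<le> \<kappa> i \<longrightarrow> string_rep i (cls (dF i (n + m) c)) \<kappa> c (n + m))" for m
  proof (induction m)
    case 0
    then show ?case using r by (auto simp: string_rep_def)
  next
    case (Suc m)
    show ?case
    proof (cases "int (n + m) \<le> \<kappa> i")
      case True
      then have s: "string_rep i (cls (dF i (n + m) c)) \<kappa> c (n + m)" using Suc by simp
      show ?thesis using string_rep_ops(2,4)[OF i s] Suc True by auto
    qed (use Suc in auto)
  qed
  have "iter (fop C i) m b \<noteq> None \<longleftrightarrow> m \<le> nat (\<kappa> i) - n" for m using 2[of m] nk by auto
  then have "{m. iter (fop C i) m b \<noteq> None} = {..nat (\<kappa> i) - n}" by auto
  then have "phi C i b = nat (\<kappa> i) - n" unfolding phi_def by (simp only:) (rule Max_eqI, auto)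
  then show "int (phi C i b) = \<kappa> i - int n" using nk by auto
qed

lemma wt_C_weights: "b \<in> B \<Longrightarrow> wt C b \<in> weights T"
  using wt_C[OF f_string_L f_string_Wt] \<Lambda>_weight by (elim B_cases) auto

lemma C_B_closed:
  assumes "i \<in> nodes T" "b \<in> B"
  shows "eop C i b = Some b' \<Longrightarrow> b' \<in> B" "fop C i b = Some b' \<Longrightarrow> b' \<in> B"
  using assms base_k(1,2)[OF assms(1)] by (elim B_cases; auto simp: C_ops cls_eq_iff split: if_splits)+

lemma seminormal_C: "seminormal C"
  unfolding seminormal_def crystal_with_def elems_C
proof (intro ballI allI)
  fix b i assume b: "b \<in> B"
  show "(eop C i b = None \<longleftrightarrow> eps C i b = 0) \<and> (fop C i b = None \<longleftrightarrow> phi C i b = 0) \<and>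
     (\<forall>b'. eop C i b = Some b' \<longrightarrow> b' \<in> B \<and> fop C i b' = Some b \<and> eps C i b = Suc (eps C i b')) \<and>
     (\<forall>b'. fop C i b = Some b' \<longrightarrow> b' \<in> B \<and> eop C i b' = Some b \<and> phi C i b = Suc (phi C i b')) \<and>
     wt C b i = int (phi C i b) - int (eps C i b) \<and>
     (\<forall>b'. eop C i b = Some b' \<longrightarrow> phi C i b' = Suc (phi C i b))"
  proof (cases "i \<in> nodes T")
    case False
    have e: "iter (\<lambda>_. None) m b = (if m = 0 then Some b else None)" for m by (cases m) auto
    have "eop C i = (\<lambda>_. None)" "fop C i = (\<lambda>_. None)" using C_ops(3,4)[OF False] by auto
    then have "eps C i b = 0" "phi C i b = 0" by (simp_all add: eps_def phi_def e)
    then show ?thesis using C_ops(3,4)[OF False] wt_C_weights[OF b] False by (auto simp: weights_def)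
  next
    case i: True
    obtain \<kappa> c n where r: "string_rep i b \<kappa> c n" using string_rep_ex[OF i b] by blast
    note ops = string_rep_ops[OF i r] and ep = string_rep_eps_phi[OF i r]
    have h: "hwv i \<kappa> c" "int n \<le> \<kappa> i" "b = cls (dF i n c)" "dF i n c \<in> L" "dF i n c \<notin> qL"
      using r by (auto simp: string_rep_def)
    have "wt C b = wshift T i (- int n) \<kappa>"
      using h i dF_Wt by (auto simp: hwv_def intro!: wt_C)
    then have w: "wt C b i = \<kappa> i - 2 * int n" using i by (simp add: wshift_same)
    show ?thesis
    proof (intro conjI allI impI)
      show "wt C b i = int (phi C i b) - int (eps C i b)" using w ep by simp
      show "eop C i b = None \<longleftrightarrow> eps C i b = 0" using ops(1) ep by simp
      show "fop C i b = None \<longleftrightarrow> phi C i b = 0" using ops(2) ep h(2) by auto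
    next
      fix b' assume b': "eop C i b = Some b'"
      show "b' \<in> B" by (rule C_B_closed(1)[OF i b b'])
      have n: "n > 0" "b' = cls (dF i (n - 1) c)" using b' ops(1) by (auto split: if_splits)
      note r' = ops(3)[OF n(1), folded n(2)]
      show "fop C i b' = Some b" using string_rep_ops(2)[OF i r'] n h by auto
      show "eps C i b = Suc (eps C i b')" "phi C i b' = Suc (phi C i b)"
        using string_rep_eps_phi[OF i r'] ep n by auto
    next
      fix b' assume b': "fop C i b = Some b'"
      show "b' \<in> B" by (rule C_B_closed(2)[OF i b b'])
      have n: "int n < \<kappa> i" "b' = cls (dF i (Suc n) c)" using b' ops(2) by (auto split: if_splits)
      note r' = ops(4)[OF n(1), folded n(2)]
      show "eop C i b' = Some b" using string_rep_ops(1)[OF i r'] n h by auto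
      show "phi C i b = Suc (phi C i b')"
        using string_rep_eps_phi[OF i r'] ep n by auto
    qed
  qed
qed

lemma generated_C: "generated_crystal T \<Lambda> C (cls u)"
  unfolding generated_crystal_def elems_C
proof (intro conjI ballI allI impI)
  show "seminormal C" by (rule seminormal_C)
  show "cls u \<in> B" by (rule cls_u_B)
  show "wt C (cls u) = \<Lambda>"
    using f_string_L[of "[]"] u_hw \<Lambda>_weight u_notin_qL by (intro wt_C) (auto simp: f_string_def)
  show "\<Lambda> \<in> weights T" by (rule \<Lambda>_weight)
next
  fix b assume "b \<in> B"
  then obtain "is" where "is": "is \<in> lists (nodes T)" "b = cls (f_string T M is u)" "f_string T M is u \<notin> qL"
    by (rule B_cases)
  have "foldr (\<lambda>i x. Option.bind x (fop C i)) is (Some (cls u)) = Some (cls (f_string T M is u))"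
    using "is"(1,3)
  proof (induction "is" rule: list.induct)
    case (Cons i js)
    have "f_string T M js u \<notin> qL" using Cons.prems kqL(2)[of i] by (auto simp: f_string_def)
    then show ?case using Cons by (auto simp: f_string_def C_ops(2))
  qed (simp add: f_string_def)
  then show "\<exists>is\<in>lists (nodes T). foldr (\<lambda>i x. Option.bind x (fop C i)) is (Some (cls u)) = Some b"
    using "is" by blast
next
  fix b i b' assume b: "b \<in> B" "fop C i b = Some b'"
  show i: "i \<in> nodes T" using b(2) C_ops(4) by force
  obtain "is" where "is": "is \<in> lists (nodes T)" "b = cls (f_string T M is u)" "f_string T M is u \<notin> qL"
    using b(1) by (rule B_cases)
  let ?x = "f_string T M is u"
  have x: "?x \<in> L" "?x \<in> Wt (wsub T \<Lambda> (\<lambda>i. int (count_list is i)))" using f_string_L f_string_Wt "is"(1) by auto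
  have "wt C b = wsub T \<Lambda> (\<lambda>i. int (count_list is i))"
    unfolding "is"(2) by (rule wt_C[OF x _ "is"(3)]) (simp add: \<Lambda>_weight)
  moreover have "b' = cls (kf i ?x)" "kf i ?x \<notin> qL"
    using b(2) i "is"(2) by (auto simp: C_ops split: if_splits)
  moreover have "wt C (cls (kf i ?x)) = wshift T i (- 1) (wsub T \<Lambda> (\<lambda>i. int (count_list is i)))"
    using kL(2)[OF i x(1)] kf_Wt[OF i x(2)] \<Lambda>_weight calculation(3) by (intro wt_C) auto
  ultimately show "wt C b' = wshift T i (- 1) (wt C b)" by simp
qed

end

text \<open>Lattice vectors split into weight vectors of the lattice, and these into terms F_i^(n) c
  with c in the lattice, by \<open>string_components\<close>. Hence additive properties need only be
  checked on strings.\<close>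

lemma (in hw_crystal) L_induct [consumes 2, case_names zero add string]:
  assumes i: "i \<in> nodes T" and x: "x \<in> L"
    and P: "P 0" "\<And>x y. P x \<Longrightarrow> P y \<Longrightarrow> P (x + y)"
    "\<And>\<mu> c n. hwv i \<mu> c \<Longrightarrow> c \<noteq> 0 \<Longrightarrow> int n \<le> \<mu> i \<Longrightarrow> (\<And>k. dF i k c \<in> L) \<Longrightarrow> P (dF i n c)"
  shows "P x"
proof -
  have Psum: "P (sum f A)" if "\<And>a. a \<in> A \<Longrightarrow> P (f a)" for f and A :: "'b set"
    using that by (induction A rule: infinite_finite_induct) (auto simp: P)
  have w: "P x" if x: "x \<in> L" "x \<in> Wt \<mu>" "\<mu> \<in> weights T" for x \<mu>
  proof -
    obtain k c where c: "\<And>n. hwv i (wshift T i (int n) \<mu>) (c n)" "\<And>n. c n \<noteq> 0 \<Longrightarrow> int n \<le> wshift T i (int n) \<mu> i"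
      "x = (\<Sum>n<k. dF i n (c n))" "\<And>n. n < k \<Longrightarrow> c n \<in> L"
      using L_weight_strings[OF i x] by blast
    have "P (dF i n (c n))" if n: "n < k" for n
    proof (cases "c n = 0")
      case False
      have "dF i k (c n) \<in> L" for k
        using pow_qL(4)[OF i c(4)[OF n], of k] kf_dF_pow[OF i c(1), of k 0] by simp
      then show ?thesis using P(3)[OF c(1) False c(2)[OF False]] by blast
    qed (simp add: i P(1))
    then show ?thesis unfolding c(3)
      using that by (induction k) (auto simp: P)
  qed
  obtain Q c where c: "finite Q" "Q \<subseteq> weights T" "\<forall>\<kappa>\<in>Q. c \<kappa> \<in> L \<inter> Wt \<kappa>" "x = (\<Sum>\<kappa>\<in>Q. c \<kappa>)"
    using bspec[OF lattice_weights x] by (elim exE conjE)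
  have "P (c \<kappa>)" if "\<kappa> \<in> Q" for \<kappa> using w[of "c \<kappa>" \<kappa>] c(2,3) that by blast
  with c(1) show ?thesis unfolding c(4) by (induction Q rule: finite_induct) (auto simp: P)
qed

section \<open>The crystal of a tensor product\<close>

locale hw_pair = A: hw_crystal T M \<Lambda> u + B: hw_crystal T N \<Lambda>' v
  for T and M :: "'a::ab_group_add uq_rep" and \<Lambda> u and N :: "'b::ab_group_add uq_rep" and \<Lambda>' v
begin

sublocale tensor_pair T M N A.S B.S
  by unfold_locales (use A.S B.S in blast)+

text \<open>The tensor product of the two lattices, read in lattice bases, together with the regular
  functions on the coordinates outside \<open>A.S\<close> and \<open>B.S\<close>.\<close>

definition LW :: "('a \<times> 'b \<Rightarrow>\<^sub>0 ratfun) set" where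
  "LW = {f. \<forall>p. Poly_Mapping.lookup f p \<in> regular0}"

sublocale LW: plattice LW
  by unfold_locales (auto simp: LW_def lookup_add)

lemma qmul_LW: "f \<in> qmul LW \<longleftrightarrow> (\<forall>p. Poly_Mapping.lookup f p \<in> qideal)"
proof
  assume "\<forall>p. Poly_Mapping.lookup f p \<in> qideal"
  then have "inverse qvar * Poly_Mapping.lookup f p \<in> regular0" for p
    using qideal_div by blast
  then have "psmul (inverse qvar) f \<in> LW" by (simp add: LW_def)
  moreover have "f = psmul qvar (psmul (inverse qvar) f)" by simp
  ultimately show "f \<in> qmul LW" unfolding qmul_def by (rule rev_image_eqI)
qed (auto simp: qmul_def LW_def qideal_def)

lemma pure_LW: "x \<in> A.L \<Longrightarrow> y \<in> B.L \<Longrightarrow> pure x y \<in> LW"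
  by (auto simp: LW_def A.L_iff B.L_iff lookup_pure)

lemma pure_qL: "x \<in> A.qL \<Longrightarrow> y \<in> B.L \<Longrightarrow> pure x y \<in> qmul LW" "x \<in> A.L \<Longrightarrow> y \<in> B.qL \<Longrightarrow> pure x y \<in> qmul LW"
  by (auto simp: qmul_LW B.L_iff A.L_iff lookup_pure A.qL_rep B.qL_rep)

lemma pure_diff1: "pure (x - x') y = pure x y - pure x' y"
  using pure_add1[of "x - x'" x' y] by simp

lemma pure_diff2: "pure x (y - y') = pure x y - pure x y'"
  using pure_add2[of x "y - y'" y'] by simp

lemma pure_cong:
  assumes "x - x' \<in> A.qL" "y - y' \<in> B.qL" "x \<in> A.L" "x' \<in> A.L" "y \<in> B.L" "y' \<in> B.L"
  shows "pure x y - pure x' y' \<in> qmul LW"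
proof -
  have "pure x y - pure x' y' = pure (x - x') y + pure x' (y - y')" by (simp add: pure_diff1 pure_diff2)
  also have "\<dots> \<in> qmul LW" using assms by (intro LW.qmul_add pure_qL)
  finally show ?thesis .
qed

context
  fixes i assumes i: "i \<in> nodes T"
begin

lemma k_strings_LW:
  assumes "A.hwv i \<mu> c" "c \<noteq> 0" "int j \<le> \<mu> i" "\<And>k. A.dF i k c \<in> A.L"
    "B.hwv i \<nu> d" "d \<noteq> 0" "int k \<le> \<nu> i" "\<And>k. B.dF i k d \<in> B.L"
  shows "W.ke i (pure (A.dF i j c) (B.dF i k d)) \<in> LW" "W.kf i (pure (A.dF i j c) (B.dF i k d)) \<in> LW"
proof -
  have eL: "pure (A.dF i j c) (B.dF i k d) \<in> LW" for j k using assms by (intro pure_LW)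
  have mem: "x \<in> LW" if "x - y \<in> qmul LW" "y \<in> LW" for x y
    using LW.L_add[OF LW.qmul_L[OF that(1)] that(2)] by simp
  note r = tensor_rule[OF i assms(1,2,5,6) LW.plattice_axioms eL assms(3,7)]
  show "W.ke i (pure (A.dF i j c) (B.dF i k d)) \<in> LW" by (rule mem[OF r(1)]) (auto simp: eL LW.L_0)
  show "W.kf i (pure (A.dF i j c) (B.dF i k d)) \<in> LW" by (rule mem[OF r(2)]) (auto simp: eL LW.L_0)
qed

text \<open>Additivity in each factor and two uses of \<open>L_induct\<close> reduce this to a pair
  of strings, where \<open>tensor_rule\<close> gives the image up to a multiple of q.\<close>

lemma k_pure_LW:
  assumes "x \<in> A.L" "y \<in> B.L"
  shows "W.ke i (pure x y) \<in> LW \<and> W.kf i (pure x y) \<in> LW"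
  using i assms(1)
proof (induction x rule: A.L_induct)
  case zero
  then show ?case using W.lin_zero[OF W.lin_ke[OF i]] W.lin_zero[OF W.lin_kf[OF i]] by (simp add: LW.L_0)
next
  case (add x x')
  then show ?case by (simp add: pure_add1 W.lin_add[OF W.lin_ke[OF i]] W.lin_add[OF W.lin_kf[OF i]] LW.L_add)
next
  case c: (string \<mu> c n)
  show ?case using i assms(2)
  proof (induction y rule: B.L_induct)
    case zero
    then show ?case using W.lin_zero[OF W.lin_ke[OF i]] W.lin_zero[OF W.lin_kf[OF i]] by (simp add: LW.L_0)
  next
    case (add y y')
    then show ?case by (simp add: pure_add2 W.lin_add[OF W.lin_ke[OF i]] W.lin_add[OF W.lin_kf[OF i]] LW.L_add)
  next
    case d: (string \<nu> d k)
    show ?case using k_strings_LW[OF c(1-4) d(1-4)] by blast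
  qed
qed

lemma k_outside:
  assumes "z \<in> outside"
  shows "W.ke i z = 0" "W.kf i z = 0"
proof -
  have h: "W.hwv i (\<lambda>_. 0) z"
    using assms outside_weight by (auto simp: W.hwv_def weights_def outside_def trep_outside)
  show "W.ke i z = 0" using W.ke_dF[OF i h, of 0] by simp
  have "W.dF i (Suc 0) z = 0" using h i by (intro W.dF_vanish[of z "\<lambda>_. 0"]) (auto simp: W.hwv_def)
  then show "W.kf i z = 0" using W.kf_dF[OF i h, of 0] by simp
qed

lemma k_LW:
  assumes "f \<in> LW"
  shows "W.ke i f \<in> LW" "W.kf i f \<in> LW"
proof -
  have s: "W.ke i (Poly_Mapping.single p 1) \<in> LW \<and> W.kf i (Poly_Mapping.single p 1) \<in> LW" for p
  proof (cases "fst p \<in> A.S \<and> snd p \<in> B.S")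
    case True
    then have "fst p \<in> A.L" "snd p \<in> B.L"
      using A.S(1,2) B.S(1,2) by (auto simp: A.L_iff B.L_iff A.V.representation_basis B.V.representation_basis)
    then show ?thesis using k_pure_LW[of "fst p" "snd p"] True by (simp add: pure_basis)
  next
    case False
    then have "Poly_Mapping.single p 1 \<in> outside" unfolding outside_def by (cases p) auto
    then show ?thesis using k_outside LW.L_0 by simp
  qed
  have f: "f = (\<Sum>p\<in>Poly_Mapping.keys f. psmul (Poly_Mapping.lookup f p) (Poly_Mapping.single p 1))"
    by (rule poly_mapping_sum_single)
  note l = W.lin_sum[OF W.lin_ke[OF i]] W.lin_sum[OF W.lin_kf[OF i]]
    W.lin_scale[OF W.lin_ke[OF i], unfolded smul_trep] W.lin_scale[OF W.lin_kf[OF i], unfolded smul_trep]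
  have r: "Poly_Mapping.lookup f p \<in> regular0" for p using assms unfolding LW_def by blast
  show "W.ke i f \<in> LW" "W.kf i f \<in> LW"
    by (subst f, unfold l, intro LW.L_sum LW.L_scale r, use s in blast)+
qed

lemma k_qmul:
  assumes "f \<in> qmul LW"
  shows "W.ke i f \<in> qmul LW" "W.kf i f \<in> qmul LW"
  using assms k_LW by (auto simp: qmul_def W.lin_scale[OF W.lin_ke[OF i], unfolded smul_trep]
      W.lin_scale[OF W.lin_kf[OF i], unfolded smul_trep])

end

text \<open>X reduces modulo q to b \<otimes> b'. The choice of lattice representatives of the two
  classes is immaterial by \<open>pure_cong\<close>.\<close>

definition represents :: "('a \<times> 'b \<Rightarrow>\<^sub>0 ratfun) \<Rightarrow> 'a set \<times> 'b set \<Rightarrow> bool" where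
  "represents X p \<longleftrightarrow> fst p \<in> A.B \<and> snd p \<in> B.B \<and> (\<exists>x y. x \<in> A.L \<and> y \<in> B.L \<and>
     fst p = A.cls x \<and> snd p = B.cls y \<and> X - pure x y \<in> qmul LW)"

lemma representsI: "A.cls x \<in> A.B \<Longrightarrow> B.cls y \<in> B.B \<Longrightarrow> x \<in> A.L \<Longrightarrow> y \<in> B.L \<Longrightarrow> X - pure x y \<in> qmul LW \<Longrightarrow>
    represents X (A.cls x, B.cls y)"
  by (auto simp: represents_def)

lemma represents_any:
  assumes "represents X (A.cls x, B.cls y)" "x \<in> A.L" "y \<in> B.L"
  shows "X - pure x y \<in> qmul LW"
proof -
  obtain x' y' where h: "x' \<in> A.L" "y' \<in> B.L" "A.cls x = A.cls x'" "B.cls y = B.cls y'" "X - pure x' y' \<in> qmul LW"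
    using assms(1) by (auto simp: represents_def)
  have "pure x' y' - pure x y \<in> qmul LW"
    by (rule pure_cong) (use h(1,2) assms(2,3) h(3,4)[symmetric] in \<open>simp_all add: A.cls_eq_iff B.cls_eq_iff\<close>)
  from LW.qmul_add[OF h(5) this] show ?thesis by simp
qed

text \<open>If b and b' sit at positions j and k of their strings, then \<phi>(b) = \<kappa> i - j
  and \<epsilon>(b') = k, so the comparison in \<open>tensor\<close> is that of j + k with \<kappa>
  i in \<open>tensor_rule\<close>.\<close>

lemma represents_step:
  assumes i: "i \<in> nodes T" and X: "represents X (b, b')"
  shows "eop (tensor A.C B.C) i (b, b') = Some p \<Longrightarrow> represents (W.ke i X) p"
    and "fop (tensor A.C B.C) i (b, b') = Some p \<Longrightarrow> represents (W.kf i X) p"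
proof -
  have bB: "b \<in> A.B" "b' \<in> B.B" using X by (auto simp: represents_def)
  obtain \<kappa> c j where r: "A.string_rep i b \<kappa> c j" using A.string_rep_ex[OF i bB(1)] by blast
  obtain \<kappa>' c' k where r': "B.string_rep i b' \<kappa>' c' k" using B.string_rep_ex[OF i bB(2)] by blast
  have c: "A.hwv i \<kappa> c" "int j \<le> \<kappa> i" "b = A.cls (A.dF i j c)" "\<And>k. A.dF i k c \<in> A.L" "A.dF i j c \<notin> A.qL"
    using r by (auto simp: A.string_rep_def)
  have c': "B.hwv i \<kappa>' c'" "int k \<le> \<kappa>' i" "b' = B.cls (B.dF i k c')" "\<And>k. B.dF i k c' \<in> B.L" "B.dF i k c' \<notin> B.qL"
    using r' by (auto simp: B.string_rep_def)
  have nz: "c \<noteq> 0" "c' \<noteq> 0" using c(5) c'(5) A.qL_0 B.qL_0 i by auto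
  have eL: "pure (A.dF i j c) (B.dF i k c') \<in> LW" for j k using c c' by (intro pure_LW)
  note rule = tensor_rule[OF i c(1) nz(1) c'(1) nz(2) LW.plattice_axioms eL c(2) c'(2)]
  have Xq: "X - pure (A.dF i j c) (B.dF i k c') \<in> qmul LW"
    using represents_any[of X "A.dF i j c" "B.dF i k c'"] X c c' by simp
  have kX: "W.ke i X - t \<in> qmul LW" if "W.ke i (pure (A.dF i j c) (B.dF i k c')) - t \<in> qmul LW" for t
    using LW.qmul_add[OF k_qmul(1)[OF i Xq] that] by (simp add: W.lin_diff[OF W.lin_ke[OF i]])
  have kX': "W.kf i X - t \<in> qmul LW" if "W.kf i (pure (A.dF i j c) (B.dF i k c')) - t \<in> qmul LW" for t
    using LW.qmul_add[OF k_qmul(2)[OF i Xq] that] by (simp add: W.lin_diff[OF W.lin_kf[OF i]])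
  note ep = A.string_rep_eps_phi[OF i r] B.string_rep_eps_phi[OF i r']
  have cmp: "eps B.C i b' \<le> phi A.C i b \<longleftrightarrow> int (j + k) \<le> \<kappa> i" "eps B.C i b' < phi A.C i b \<longleftrightarrow> int (j + k) < \<kappa> i"
    using ep by auto
  note op = A.string_rep_ops(1,2)[OF i r] B.string_rep_ops(1,2)[OF i r']
  note cB = A.C_B_closed[OF i bB(1)] B.C_B_closed[OF i bB(2)]
  {
    assume e: "eop (tensor A.C B.C) i (b, b') = Some p"
    show "represents (W.ke i X) p"
    proof (cases "int (j + k) \<le> \<kappa> i")
      case True
      then have "eop A.C i b = Some (fst p)" "p = (fst p, b')" using e cmp by (auto simp: tensor_def)
      then have j: "j > 0" "p = (A.cls (A.dF i (j - 1) c), B.cls (B.dF i k c'))" "A.cls (A.dF i (j - 1) c) \<in> A.B"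
        using op(1) c'(3) cB(1) by (auto split: if_splits)
      show ?thesis unfolding j(2)
        using kX[OF rule(1)] True j(1) bB(2) c'(3) by (intro representsI j(3) c(4) c'(4)) auto
    next
      case False
      then have "eop B.C i b' = Some (snd p)" "p = (b, snd p)" using e cmp by (auto simp: tensor_def)
      then have j: "k > 0" "p = (A.cls (A.dF i j c), B.cls (B.dF i (k - 1) c'))" "B.cls (B.dF i (k - 1) c') \<in> B.B"
        using op(3) c(3) cB(3) by (auto split: if_splits)
      show ?thesis unfolding j(2)
        using kX[OF rule(1)] False j(1) bB(1) c(3) by (intro representsI j(3) c(4) c'(4)) auto
    qed
  next
    assume e: "fop (tensor A.C B.C) i (b, b') = Some p"
    show "represents (W.kf i X) p"
    proof (cases "int (j + k) < \<kappa> i")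
      case True
      then have "fop A.C i b = Some (fst p)" "p = (fst p, b')" using e cmp by (auto simp: tensor_def)
      then have j: "p = (A.cls (A.dF i (Suc j) c), B.cls (B.dF i k c'))" "A.cls (A.dF i (Suc j) c) \<in> A.B"
        using op(2) c'(3) cB(2) by (auto split: if_splits)
      show ?thesis unfolding j(1)
        using kX'[OF rule(2)] True bB(2) c'(3) by (intro representsI j(2) c(4) c'(4)) auto
    next
      case False
      then have "fop B.C i b' = Some (snd p)" "p = (b, snd p)" using e cmp by (auto simp: tensor_def)
      then have j: "p = (A.cls (A.dF i j c), B.cls (B.dF i (Suc k) c'))" "B.cls (B.dF i (Suc k) c') \<in> B.B"
        using op(4) c(3) cB(4) by (auto split: if_splits)
      show ?thesis unfolding j(1)
        using kX'[OF rule(2)] False bB(1) c(3) by (intro representsI j(2) c(4) c'(4)) auto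
    qed
  }
qed

text \<open>Both u and v have a coordinate that is a unit, since otherwise they would be divisible
  by q in their lattices. The product of these two coordinates occurs in u \<otimes> v.\<close>

lemma pure_top_coefficient:
  assumes "psmul a (pure u v) \<in> qmul LW"
  shows "a \<in> qideal"
proof -
  have "\<exists>s. A.rep u s \<in> regular0 \<and> A.rep u s \<notin> qideal"
  proof (rule ccontr)
    assume n: "\<not> ?thesis"
    have uL: "u \<in> A.L" using A.f_string_L[of "[]"] by (simp add: f_string_def)
    then have q: "A.rep u s \<in> qideal" for s using n by (auto simp: A.L_iff)
    have "smul M (inverse qvar) u \<in> A.L"
      using q A.S(1,2) unfolding A.L_iff by (simp add: A.V.representation_scale qideal_div)
    then have "smul M qvar (smul M (inverse qvar) u) \<in> A.qL" unfolding A.qL_def by (rule imageI)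
    then show False using A.u_notin_qL by simp
  qed
  then obtain s where s: "A.rep u s \<in> regular0" "A.rep u s \<notin> qideal" by blast
  have "\<exists>s. B.rep v s \<in> regular0 \<and> B.rep v s \<notin> qideal"
  proof (rule ccontr)
    assume n: "\<not> ?thesis"
    have uL: "v \<in> B.L" using B.f_string_L[of "[]"] by (simp add: f_string_def)
    then have q: "B.rep v s \<in> qideal" for s using n by (auto simp: B.L_iff)
    have "smul N (inverse qvar) v \<in> B.L"
      using q B.S(1,2) unfolding B.L_iff by (simp add: B.V.representation_scale qideal_div)
    then have "smul N qvar (smul N (inverse qvar) v) \<in> B.qL" unfolding B.qL_def by (rule imageI)
    then show False using B.u_notin_qL by simp
  qed
  then obtain s' where s': "B.rep v s' \<in> regular0" "B.rep v s' \<notin> qideal" by blast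
  have "a * (A.rep u s * B.rep v s') \<in> qideal" using assms by (auto simp: qmul_LW lookup_pure dest: spec[of _ "(s, s')"])
  moreover have "inverse (A.rep u s) \<in> regular0" "inverse (B.rep v s') \<in> regular0" "A.rep u s \<noteq> 0" "B.rep v s' \<noteq> 0"
    using regular0_unit s s' by auto
  ultimately have "a * (A.rep u s * B.rep v s') * (inverse (A.rep u s) * inverse (B.rep v s')) \<in> qideal" by blast
  then show ?thesis using \<open>A.rep u s \<noteq> 0\<close> \<open>B.rep v s' \<noteq> 0\<close> by (simp add: field_simps)
qed

end

lemma generated_crystal_wt:
  assumes "generated_crystal T \<Lambda> C u" "b \<in> elems C"
  shows "fop C i b = Some b' \<Longrightarrow> i \<in> nodes T \<and> wt C b' = wshift T i (- 1) (wt C b)"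
    "eop C i b = Some b' \<Longrightarrow> i \<in> nodes T \<and> wt C b' = wshift T i 1 (wt C b)"
proof -
  have s: "seminormal C" and f: "\<And>b i b'. b \<in> elems C \<Longrightarrow> fop C i b = Some b' \<Longrightarrow> i \<in> nodes T \<and> wt C b' = wshift T i (- 1) (wt C b)"
    using assms(1) unfolding generated_crystal_def by blast+
  show "fop C i b = Some b' \<Longrightarrow> i \<in> nodes T \<and> wt C b' = wshift T i (- 1) (wt C b)" using f assms(2) by blast
  assume e: "eop C i b = Some b'"
  have "i \<in> nodes T \<and> wt C b = wshift T i (- 1) (wt C b')"
    using f[OF seminormalD(3,4)[OF s assms(2) e]] .
  then show "i \<in> nodes T \<and> wt C b' = wshift T i 1 (wt C b)" by simp
qed

context hw_pair
begin

section \<open>The graph of the exchange of tensor factors\<close>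

interpretation Y: hw_pair T N \<Lambda>' v M \<Lambda> u by unfold_locales

text \<open>
  The submodule of \<open>(M \<otimes> N) \<oplus> (N \<otimes> M)\<close> generated by \<open>pairs a\<close>
  is the graph of a module homomorphism that maps \<open>u \<otimes> v\<close> to \<open>v \<otimes> u\<close>, but sends \<open>u \<otimes> y\<close> into
  \<open>q(N \<otimes> M)\<close> once \<open>\<alpha>\<^sub>a\<close> occurs in the difference of the weights of \<open>v\<close> and \<open>y\<close>. All we need of
  it is that its space of highest weight is one-dimensional.
\<close>

definition pairs :: "nat \<Rightarrow> (('a \<times> 'b \<Rightarrow>\<^sub>0 ratfun) \<times> ('b \<times> 'a \<Rightarrow>\<^sub>0 ratfun)) set" where
  "pairs a = {(pure u y, psmul (qi T a powi n a) (Y.pure y u)) | n y. y \<in> B.Wt (wsub T \<Lambda>' n) \<and> y \<noteq> 0}"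

abbreviation "R \<equiv> prod_rep trep Y.trep"

interpretation R: qrep T R by (intro qrep_prod_rep qrep_trep Y.qrep_trep)

definition gens :: "nat \<Rightarrow> (('a \<times> 'b \<Rightarrow>\<^sub>0 ratfun) \<times> ('b \<times> 'a \<Rightarrow>\<^sub>0 ratfun)) set" where
  "gens a = {foldr (opF R) is \<gamma> | is \<gamma>. is \<in> lists (nodes T) \<and> \<gamma> \<in> pairs a}"

definition graph :: "nat \<Rightarrow> (('a \<times> 'b \<Rightarrow>\<^sub>0 ratfun) \<times> ('b \<times> 'a \<Rightarrow>\<^sub>0 ratfun)) set" where
  "graph a = R.V.span (gens a)"

definition top :: weight where "top = (\<lambda>j. \<Lambda> j + \<Lambda>' j)"

lemma top_weights: "top \<in> weights T"
  using A.\<Lambda>_weight B.\<Lambda>_weight by (auto simp: top_def weights_def)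

lemma pair_weight:
  assumes "y \<in> B.Wt (wsub T \<Lambda>' n)"
  shows "(pure u y, psmul c (Y.pure y u)) \<in> R.Wt (wsub T top n)"
proof -
  have "(\<lambda>i. \<Lambda> i + wsub T \<Lambda>' n i) = wsub T top n" "(\<lambda>i. wsub T \<Lambda>' n i + \<Lambda> i) = wsub T top n"
    by (auto simp: wsub_def top_def)
  then show ?thesis
    using pure_weight[OF A.u_hw(2) assms] Y.W.Wt_scale[OF Y.pure_weight[OF assms A.u_hw(2)], unfolded Y.smul_trep]
    by (simp add: weight_space_prod_rep)
qed

lemma foldr_F_Wt:
  assumes "is \<in> lists (nodes T)" "\<gamma> \<in> R.Wt (wsub T \<mu> n)"
  shows "foldr (opF R) is \<gamma> \<in> R.Wt (wsub T \<mu> (\<lambda>i. n i + int (count_list is i)))"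
  using assms(1)
proof (induction "is" rule: list.induct)
  case (Cons i js)
  then have i: "i \<in> nodes T" by simp
  have "opF R i (foldr (opF R) js \<gamma>) \<in> R.Wt (wshift T i (- 1) (wsub T \<mu> (\<lambda>i. n i + int (count_list js i))))"
    using Cons.IH Cons.prems i by (intro R.F_Wt) (simp_all del: prod_rep_sel)
  moreover have "wshift T i (- 1) (wsub T \<mu> (\<lambda>i. n i + int (count_list js i))) =
      wsub T \<mu> (\<lambda>j. n j + int (count_list (i # js) j))"
    unfolding wshift_wsub[OF i] by (rule arg_cong[where f = "wsub T \<mu>"]) auto
  ultimately show ?case by (simp only: foldr.simps comp_apply)
qed (simp add: assms(2))

text \<open>The coefficients n of the pair and the letter counts of the word are both nonnegative. A
  generator of highest weight therefore has an empty word and n = 0, so its scalar is 1 and y is a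
  multiple of v.\<close>

lemma gens_cases:
  assumes "a \<in> nodes T" "x \<in> gens a"
  shows "\<exists>m. x \<in> R.Wt (wsub T top m) \<and> ((\<forall>i\<in>nodes T. m i = 0) \<longrightarrow> (\<exists>c. x = smul R c (pure u v, Y.pure v u)))"
proof -
  obtain "is" n y where x: "x = foldr (opF R) is (pure u y, psmul (qi T a powi n a) (Y.pure y u))"
    "is \<in> lists (nodes T)" "y \<in> B.Wt (wsub T \<Lambda>' n)" "y \<noteq> 0"
    using assms(2) by (auto simp: gens_def pairs_def simp del: prod_rep_sel)
  define m where "m = (\<lambda>i. n i + int (count_list is i))"
  have 1: "x \<in> R.Wt (wsub T top m)" unfolding x(1) m_def by (intro foldr_F_Wt x(2) pair_weight x(3))
  have "\<exists>c. x = smul R c (pure u v, Y.pure v u)" if z: "\<forall>i\<in>nodes T. m i = 0"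
  proof -
    have nn: "n i = 0 \<and> count_list is i = 0" if "i \<in> nodes T" for i
      using bspec[OF z that] B.weight_nonneg[OF x(3,4) that] by (auto simp: m_def)
    then have "is = []" using x(2) by (cases "is") force+
    moreover have "wsub T \<Lambda>' n = \<Lambda>'" using nn by (auto simp: wsub_def)
    then obtain c where "y = smul N c v" using B.weight_top x(3) by metis
    ultimately have "x = smul R c (pure u v, Y.pure v u)"
      using nn[OF assms(1)] by (simp add: x(1) pure_scale2 Y.pure_scale1)
    then show ?thesis by blast
  qed
  with 1 show ?thesis by blast
qed

lemma graph_top:
  assumes "a \<in> nodes T" "z \<in> graph a" "z \<in> R.Wt top"
  shows "\<exists>c. z = (psmul c (pure u v), psmul c (Y.pure v u))"
proof -
  obtain m where m: "\<And>x. x \<in> gens a \<Longrightarrow> x \<in> R.Wt (wsub T top (m x)) \<and>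
      ((\<forall>i\<in>nodes T. m x i = 0) \<longrightarrow> (\<exists>c. x = smul R c (pure u v, Y.pure v u)))"
    using gens_cases[OF assms(1)] by metis
  have "z \<in> R.V.span {x \<in> gens a. wsub T top (m x) = top}"
    by (rule R.span_weight_component) (use assms m top_weights in \<open>auto simp: graph_def\<close>)
  moreover have "{x \<in> gens a. wsub T top (m x) = top} \<subseteq> R.V.span {(pure u v, Y.pure v u)}"
  proof
    fix x assume "x \<in> {x \<in> gens a. wsub T top (m x) = top}"
    then have x: "x \<in> gens a" "wsub T top (m x) = wsub T top (\<lambda>_. 0)" by auto
    then have "\<forall>i\<in>nodes T. m x i = 0" using wsub_inj[OF A.valid x(2)] by simp
    then show "x \<in> R.V.span {(pure u v, Y.pure v u)}" using m[OF x(1)] by (auto simp: R.V.span_singleton)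
  qed
  then have "R.V.span {x \<in> gens a. wsub T top (m x) = top} \<subseteq> R.V.span {(pure u v, Y.pure v u)}"
    by (intro R.V.span_minimal R.V.subspace_span)
  ultimately show ?thesis unfolding R.V.span_singleton by auto
qed

lemma graph_linear_closed:
  assumes "R.lin g" "\<And>x. x \<in> gens a \<Longrightarrow> g x \<in> graph a" "z \<in> graph a"
  shows "g z \<in> graph a"
  using assms(3) unfolding graph_def
proof (induction rule: R.V.span_induct_alt)
  case base
  show ?case unfolding R.lin_zero[OF assms(1)] by (rule R.V.span_zero)
next
  case (step c x y)
  have "g (smul R c x + y) = smul R c (g x) + g y"
    by (simp only: R.lin_add[OF assms(1)] R.lin_scale[OF assms(1)])
  then show ?case
    using R.V.span_add[OF R.V.span_scale[OF assms(2)[OF step(1), unfolded graph_def]] step(2)] by (simp only:)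
qed

lemma gens_F: "i \<in> nodes T \<Longrightarrow> x \<in> gens a \<Longrightarrow> opF R i x \<in> gens a"
proof -
  assume i: "i \<in> nodes T" and "x \<in> gens a"
  then obtain "is" \<gamma> where x: "x = foldr (opF R) is \<gamma>" "is \<in> lists (nodes T)" "\<gamma> \<in> pairs a"
    unfolding gens_def by blast
  then have "opF R i x = foldr (opF R) (i # is) \<gamma>" "i # is \<in> lists (nodes T)" using i by auto
  then show ?thesis using x(3) unfolding gens_def by blast
qed

lemma graph_F: "i \<in> nodes T \<Longrightarrow> z \<in> graph a \<Longrightarrow> opF R i z \<in> graph a"
  by (rule graph_linear_closed[OF R.linF]) (auto simp: graph_def simp del: prod_rep_sel intro: R.V.span_base gens_F)

text \<open>On a pair, E_i acts through y alone and yields another pair or zero. On a longer word it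
  is commuted past the leading F_j, which adds at most a multiple of a shorter word.\<close>

lemma graph_E:
  assumes "a \<in> nodes T" "\<Lambda> = fund_weight a" "i \<in> nodes T" "z \<in> graph a"
  shows "opE R i z \<in> graph a"
proof (rule graph_linear_closed[OF R.linE[OF assms(3)] _ assms(4)])
  fix x assume "x \<in> gens a"
  then obtain "is" n y where x: "x = foldr (opF R) is (pure u y, psmul (qi T a powi n a) (Y.pure y u))"
    "is \<in> lists (nodes T)" and y: "y \<in> B.Wt (wsub T \<Lambda>' n)" "y \<noteq> 0"
    by (auto simp: gens_def pairs_def simp del: prod_rep_sel)
  let ?\<gamma> = "(pure u y, psmul (qi T a powi n a) (Y.pure y u))"
  have \<gamma>: "?\<gamma> \<in> pairs a" using y by (auto simp: pairs_def)
  have "opE R i (foldr (opF R) is ?\<gamma>) \<in> graph a" using x(2)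
  proof (induction "is" rule: list.induct)
    case Nil
    define n' where "n' = n(i := n i - 1)"
    have Ey: "opE N i y \<in> B.Wt (wsub T \<Lambda>' n')"
      using B.E_Wt[OF y(1) assms(3)] unfolding wshift_wsub[OF assms(3)] n'_def .
    have K: "opKinv M i u = smul M (qi T i powi (- \<Lambda> i)) u" by (rule A.Kinv_Wt[OF A.u_hw(2) assms(3)])
    \<comment> \<open>K_i^(-1) contributes q_a^(-1) when i = a and 1 otherwise, exactly the change
      from n to n'.\<close>
    have q: "qi T a powi n a * qi T i powi (- \<Lambda> i) = qi T a powi n' a"
      using assms(2) by (auto simp: n'_def fund_weight_def power_int_diff power_int_minus divide_inverse)
    have "opE R i ?\<gamma> = (pure u (opE N i y), psmul (qi T a powi n' a) (Y.pure (opE N i y) u))"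
      by (simp add: E_pure[OF assms(3)] Y.E_pure[OF assms(3)] A.u_hw(3)[OF assms(3)] K Y.pure_scale2
          Y.W.lin_scale[OF Y.W.linE[OF assms(3)], unfolded Y.smul_trep] flip: q)
    moreover have "(pure u (opE N i y), psmul (qi T a powi n' a) (Y.pure (opE N i y) u)) \<in> graph a"
    proof (cases "opE N i y = 0")
      case True
      then show ?thesis unfolding graph_def using R.V.span_zero by (simp add: zero_prod_def)
    next
      case False
      then have "(pure u (opE N i y), psmul (qi T a powi n' a) (Y.pure (opE N i y) u)) \<in> pairs a"
        using Ey by (auto simp: pairs_def)
      then have "foldr (opF R) [] (pure u (opE N i y), psmul (qi T a powi n' a) (Y.pure (opE N i y) u)) \<in> gens a"
        unfolding gens_def by blast
      then show ?thesis unfolding graph_def by (intro R.V.span_base) simp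
    qed
    ultimately show ?case by (simp only: foldr.simps id_apply)
  next
    case (Cons j js)
    then have js: "js \<in> lists (nodes T)" "j \<in> nodes T" by auto
    let ?x = "foldr (opF R) js ?\<gamma>"
    have FE: "opF R j (opE R i ?x) \<in> graph a" by (rule graph_F[OF js(2) Cons.IH[OF js(1)]])
    have xG: "?x \<in> graph a" using js \<gamma> unfolding graph_def gens_def by (intro R.V.span_base) blast
    have "opE R i (opF R j ?x) \<in> graph a"
    proof (cases "i = j")
      case True
      note w = foldr_F_Wt[OF js(1) pair_weight[OF y(1)]]
      show ?thesis unfolding True[symmetric] R.E_F_Wt[OF w assms(3)]
        using FE xG unfolding True[symmetric] graph_def by (intro R.V.span_add R.V.span_scale)
    next
      case False
      then show ?thesis using R.E_F_neq[OF assms(3) js(2)] FE by (simp del: prod_rep_sel)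
    qed
    then show ?case by (simp only: foldr.simps comp_apply)
  qed
  then show "opE R i x \<in> graph a" by (simp only: x(1))
qed

text \<open>The invariant carried along a path in the crystal: one vector whose first component
  follows the path and whose second component stays divisible by q.\<close>

definition reach :: "nat \<Rightarrow> 'a set \<times> 'b set \<Rightarrow> bool" where
  "reach a p \<longleftrightarrow> (\<exists>z\<in>graph a. z \<in> R.Wt (\<lambda>j. wt A.C (fst p) j + wt B.C (snd p) j) \<and>
     represents (fst z) p \<and> snd z \<in> qmul Y.LW)"

lemma reach_start:
  assumes "a \<in> nodes T" "b \<in> B.B" "wt B.C b = wsub T \<Lambda>' n" "n a \<ge> 1"
  shows "reach a (A.cls u, b)"
proof -
  obtain "is" where "is": "is \<in> lists (nodes T)" "b = B.cls (f_string T N is v)" "f_string T N is v \<notin> B.qL"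
    using assms(2) by (rule B.B_cases)
  let ?y = "f_string T N is v" let ?n = "\<lambda>i. int (count_list is i)"
  have y: "?y \<in> B.L" "?y \<in> B.Wt (wsub T \<Lambda>' ?n)" "?y \<noteq> 0"
    using B.f_string_L B.f_string_Wt "is" B.qL_0 by auto
  have uL: "u \<in> A.L" using A.f_string_L[of "[]"] by (simp add: f_string_def)
  have wtb: "wt B.C b = wsub T \<Lambda>' ?n"
    unfolding "is"(2) by (rule B.wt_C[OF y(1,2) _ "is"(3)]) (simp add: B.\<Lambda>_weight)
  have na: "int (count_list is a) \<ge> 1"
    using wsub_inj[OF A.valid, of \<Lambda>' n ?n a] assms wtb by simp
  let ?z = "(pure u ?y, psmul (qi T a powi ?n a) (Y.pure ?y u))"
  have "?z \<in> pairs a" unfolding pairs_def mem_Collect_eq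
    by (rule exI[of _ ?n], rule exI[of _ ?y]) (use y in simp)
  then have "foldr (opF R) [] ?z \<in> gens a" unfolding gens_def by blast
  then have "?z \<in> graph a" unfolding graph_def by (intro R.V.span_base) simp
  moreover have "?z \<in> R.Wt (\<lambda>j. wt A.C (A.cls u) j + wt B.C b j)"
  proof -
    have "wt A.C (A.cls u) = \<Lambda>" using A.generated_C by (simp add: generated_crystal_def)
    then have "(\<lambda>j. wt A.C (A.cls u) j + wt B.C b j) = wsub T top ?n"
      by (auto simp: wtb wsub_def top_def)
    then show ?thesis using pair_weight[OF y(2)] by simp
  qed
  moreover have "represents (pure u ?y) (A.cls u, b)"
    unfolding "is"(2) using assms(2) "is"(2) A.cls_u_B LW.qmul_0 by (intro representsI uL y(1)) auto
  \<comment> \<open>As \<alpha>_a occurs, the exponent is positive; this is where the divisibility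
    by q begins.\<close>
  moreover have "psmul (qi T a powi ?n a) (Y.pure ?y u) \<in> qmul Y.LW"
    using na by (intro Y.LW.qideal_qmul Y.pure_LW uL y(1)) (auto intro: qi_power_qideal)
  ultimately show ?thesis unfolding reach_def by (intro bexI[of _ ?z]) auto
qed

text \<open>Kashiwara operators of the direct sum act componentwise. They preserve the graph as a
  submodule, follow the crystal in the first component by \<open>represents_step\<close>, and
  preserve q times the lattice in the second.\<close>

lemma reach_step:
  assumes a: "a \<in> nodes T" "\<Lambda> = fund_weight a" and p: "reach a p"
    and s: "eop (tensor A.C B.C) i p = Some p' \<or> fop (tensor A.C B.C) i p = Some p'"
  shows "reach a p'"
proof -
  obtain z where z: "z \<in> graph a" "z \<in> R.Wt (\<lambda>j. wt A.C (fst p) j + wt B.C (snd p) j)"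
    "represents (fst z) p" "snd z \<in> qmul Y.LW"
    using p by (auto simp: reach_def)
  obtain b b' where bb: "p = (b, b')" by (cases p)
  have bB: "b \<in> elems A.C" "b' \<in> elems B.C" using z(3) bb by (auto simp: represents_def)
  note gA = generated_crystal_wt[OF A.generated_C bB(1)] and gB = generated_crystal_wt[OF B.generated_C bB(2)]
  let ?\<mu> = "\<lambda>p j. wt A.C (fst p) j + wt B.C (snd p) j"
  have e: "i \<in> nodes T \<and> ?\<mu> p' = wshift T i 1 (?\<mu> p)" if "eop (tensor A.C B.C) i p = Some p'"
    using that gA(2)[of i] gB(2)[of i] unfolding bb
    by (auto simp: tensor_def wshift_def split: if_splits)
  have f: "i \<in> nodes T \<and> ?\<mu> p' = wshift T i (- 1) (?\<mu> p)" if "fop (tensor A.C B.C) i p = Some p'"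
    using that gA(1)[of i] gB(1)[of i] unfolding bb
    by (auto simp: tensor_def wshift_def split: if_splits)
  have i: "i \<in> nodes T" using s e f by blast
  have w: "?\<mu> p \<in> weights T"
    using A.wt_C_weights[of b] B.wt_C_weights[of b'] bB by (auto simp: bb weights_def)
  note c = R.ke_closed[OF _ graph_E[OF a i] graph_F[OF i] i z(1,2) w]
  have sub: "R.V.subspace (graph a)" by (simp add: graph_def)
  note kp = kashiwara_prod_rep[OF qrep_trep Y.qrep_trep i, of z]
  show ?thesis
  proof (cases "eop (tensor A.C B.C) i p = Some p'")
    case True
    have "represents (fst (R.ke i z)) p'" using represents_step(1)[OF i] z(3) True by (simp add: bb kp)
    moreover have "snd (R.ke i z) \<in> qmul Y.LW" using Y.k_qmul(1)[OF i z(4)] by (simp add: kp)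
    ultimately show ?thesis unfolding reach_def
      using c(1,2)[OF sub] e[OF True] by (intro bexI[of _ "R.ke i z"]) auto
  next
    case False
    then have F: "fop (tensor A.C B.C) i p = Some p'" using s by blast
    have "represents (fst (R.kf i z)) p'" using represents_step(2)[OF i] z(3) F by (simp add: bb kp)
    moreover have "snd (R.kf i z) \<in> qmul Y.LW" using Y.k_qmul(2)[OF i z(4)] by (simp add: kp)
    ultimately show ?thesis unfolding reach_def
      using c(3,4)[OF sub] f[OF F] by (intro bexI[of _ "R.kf i z"]) auto
  qed
qed

text \<open>By \<open>graph_top\<close> one scalar c governs both components; the two conditions
  would put c - 1 and c into \<open>qideal\<close>.\<close>

lemma reach_top:
  assumes "a \<in> nodes T"
  shows "\<not> reach a (A.cls u, B.cls v)"
proof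
  assume "reach a (A.cls u, B.cls v)"
  then obtain z where z: "z \<in> graph a" "z \<in> R.Wt (\<lambda>j. wt A.C (A.cls u) j + wt B.C (B.cls v) j)"
    "represents (fst z) (A.cls u, B.cls v)" "snd z \<in> qmul Y.LW"
    by (auto simp: reach_def)
  have "(\<lambda>j. wt A.C (A.cls u) j + wt B.C (B.cls v) j) = top"
    using A.generated_C B.generated_C by (simp add: generated_crystal_def top_def)
  then obtain c where c: "z = (psmul c (pure u v), psmul c (Y.pure v u))"
    using graph_top[OF assms z(1)] z(2) by auto
  have uL: "u \<in> A.L" "v \<in> B.L" using A.f_string_L[of "[]"] B.f_string_L[of "[]"] by (simp_all add: f_string_def)
  have "c \<in> qideal" using Y.pure_top_coefficient z(4) c by simp
  moreover have "psmul (c - 1) (pure u v) \<in> qmul LW"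
    using represents_any[OF z(3) uL] c by (simp add: PV.scale_left_diff_distrib)
  then have "c - 1 \<in> qideal" by (rule pure_top_coefficient)
  ultimately show False using qideal_diff[of c "c - 1"] one_notin_qideal by simp
qed

end

section \<open>Tensor words\<close>

lemma tensor_sel: "elems (tensor C D) = elems C \<times> elems D" "wt (tensor C D) (b, c) i = wt C b i + wt D c i"
  "eop (tensor C D) i (b, c) = (if eps D i c \<le> phi C i b then map_option (\<lambda>b'. (b', c)) (eop C i b)
     else map_option (\<lambda>c'. (b, c')) (eop D i c))"
  "fop (tensor C D) i (b, c) = (if eps D i c < phi C i b then map_option (\<lambda>b'. (b', c)) (fop C i b)
     else map_option (\<lambda>c'. (b, c')) (fop D i c))"
  by (simp_all add: tensor_def)

text \<open>Subtraction truncates at 0, so these are the usual maxima: \<epsilon>(b \<otimes> c) is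
  the larger of \<epsilon>(b) and \<epsilon>(b) + \<epsilon>(c) - \<phi>(b), and dually for
  \<phi>.\<close>

lemma tensor_crystal_with:
  assumes C: "seminormal C" and D: "seminormal D"
  shows "crystal_with (tensor C D) (\<lambda>i (b, c). eps C i b + (eps D i c - phi C i b))
    (\<lambda>i (b, c). phi D i c + (phi C i b - eps D i c))"
  unfolding crystal_with_def
proof (intro ballI allI)
  fix p i assume "p \<in> elems (tensor C D)"
  then obtain b c where p: "p = (b, c)" "b \<in> elems C" "c \<in> elems D" by (auto simp: tensor_sel)
  note b = seminormalD[OF C p(2), of i] and c = seminormalD[OF D p(3), of i]
  show "(eop (tensor C D) i p = None \<longleftrightarrow> (case p of (b, c) \<Rightarrow> eps C i b + (eps D i c - phi C i b)) = 0) \<and>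
    (fop (tensor C D) i p = None \<longleftrightarrow> (case p of (b, c) \<Rightarrow> phi D i c + (phi C i b - eps D i c)) = 0) \<and>
    (\<forall>p'. eop (tensor C D) i p = Some p' \<longrightarrow> p' \<in> elems (tensor C D) \<and> fop (tensor C D) i p' = Some p \<and>
      (case p of (b, c) \<Rightarrow> eps C i b + (eps D i c - phi C i b)) = Suc (case p' of (b, c) \<Rightarrow> eps C i b + (eps D i c - phi C i b))) \<and>
    (\<forall>p'. fop (tensor C D) i p = Some p' \<longrightarrow> p' \<in> elems (tensor C D) \<and> eop (tensor C D) i p' = Some p \<and>
      (case p of (b, c) \<Rightarrow> phi D i c + (phi C i b - eps D i c)) = Suc (case p' of (b, c) \<Rightarrow> phi D i c + (phi C i b - eps D i c))) \<and>
    wt (tensor C D) p i = int (case p of (b, c) \<Rightarrow> phi D i c + (phi C i b - eps D i c)) -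
      int (case p of (b, c) \<Rightarrow> eps C i b + (eps D i c - phi C i b)) \<and>
    (\<forall>p'. eop (tensor C D) i p = Some p' \<longrightarrow> (case p' of (b, c) \<Rightarrow> phi D i c + (phi C i b - eps D i c)) =
      Suc (case p of (b, c) \<Rightarrow> phi D i c + (phi C i b - eps D i c)))"
  proof (intro conjI allI impI)
    show "eop (tensor C D) i p = None \<longleftrightarrow> (case p of (b, c) \<Rightarrow> eps C i b + (eps D i c - phi C i b)) = 0"
      using b(1) c(1) by (auto simp: p(1) tensor_sel)
    show "fop (tensor C D) i p = None \<longleftrightarrow> (case p of (b, c) \<Rightarrow> phi D i c + (phi C i b - eps D i c)) = 0"
      using b(2) c(2) by (auto simp: p(1) tensor_sel)
    show "wt (tensor C D) p i = int (case p of (b, c) \<Rightarrow> phi D i c + (phi C i b - eps D i c)) -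
      int (case p of (b, c) \<Rightarrow> eps C i b + (eps D i c - phi C i b))"
      using b(11) c(11) by (auto simp: p(1) tensor_sel)
  next
    fix p' assume e: "eop (tensor C D) i p = Some p'"
    have "p' \<in> elems (tensor C D) \<and> fop (tensor C D) i p' = Some p \<and>
      (case p of (b, c) \<Rightarrow> eps C i b + (eps D i c - phi C i b)) = Suc (case p' of (b, c) \<Rightarrow> eps C i b + (eps D i c - phi C i b)) \<and>
      (case p' of (b, c) \<Rightarrow> phi D i c + (phi C i b - eps D i c)) = Suc (case p of (b, c) \<Rightarrow> phi D i c + (phi C i b - eps D i c))"
    proof (cases "eps D i c \<le> phi C i b")
      case True
      then obtain b' where b': "eop C i b = Some b'" "p' = (b', c)" using e by (auto simp: p(1) tensor_sel)
      show ?thesis using True b(3-6)[OF b'(1)] p by (auto simp: b'(2) tensor_sel)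
    next
      case False
      then obtain c' where c': "eop D i c = Some c'" "p' = (b, c')" using e by (auto simp: p(1) tensor_sel)
      show ?thesis using False c(3-6)[OF c'(1)] p by (auto simp: c'(2) tensor_sel)
    qed
    then show "p' \<in> elems (tensor C D)" "fop (tensor C D) i p' = Some p"
      "(case p of (b, c) \<Rightarrow> eps C i b + (eps D i c - phi C i b)) = Suc (case p' of (b, c) \<Rightarrow> eps C i b + (eps D i c - phi C i b))"
      "(case p' of (b, c) \<Rightarrow> phi D i c + (phi C i b - eps D i c)) = Suc (case p of (b, c) \<Rightarrow> phi D i c + (phi C i b - eps D i c))"
      by blast+
  next
    fix p' assume e: "fop (tensor C D) i p = Some p'"
    have "p' \<in> elems (tensor C D) \<and> eop (tensor C D) i p' = Some p \<and>
      (case p of (b, c) \<Rightarrow> phi D i c + (phi C i b - eps D i c)) = Suc (case p' of (b, c) \<Rightarrow> phi D i c + (phi C i b - eps D i c))"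
    proof (cases "eps D i c < phi C i b")
      case True
      then obtain b' where b': "fop C i b = Some b'" "p' = (b', c)" using e by (auto simp: p(1) tensor_sel)
      show ?thesis using True b(7-10)[OF b'(1)] p by (auto simp: b'(2) tensor_sel)
    next
      case False
      then obtain c' where c': "fop D i c = Some c'" "p' = (b, c')" using e by (auto simp: p(1) tensor_sel)
      show ?thesis using False c(7-10)[OF c'(1)] p by (auto simp: c'(2) tensor_sel)
    qed
    then show "p' \<in> elems (tensor C D)" "eop (tensor C D) i p' = Some p"
      "(case p of (b, c) \<Rightarrow> phi D i c + (phi C i b - eps D i c)) = Suc (case p' of (b, c) \<Rightarrow> phi D i c + (phi C i b - eps D i c))"
      by blast+
  qed
qed

section \<open>Words as iterated tensor products\<close>

lemma cons_sel: "elems (cons_crystal D) = (\<lambda>(x, xs). x # xs) ` elems D"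
  "wt (cons_crystal D) (x # xs) = wt D (x, xs)"
  "eop (cons_crystal D) i (x # xs) = map_option (\<lambda>(x, xs). x # xs) (eop D i (x, xs))"
  "fop (cons_crystal D) i (x # xs) = map_option (\<lambda>(x, xs). x # xs) (fop D i (x, xs))"
  by (simp_all add: cons_crystal_def)

lemma cons_crystal_with:
  assumes "crystal_with D \<epsilon> \<phi>"
  shows "crystal_with (cons_crystal D) (\<lambda>i w. \<epsilon> i (hd w, tl w)) (\<lambda>i w. \<phi> i (hd w, tl w))"
  using assms unfolding crystal_with_def
  by (fastforce simp: cons_sel)

lemma unit_crystal_with: "crystal_with unit_crystal (\<lambda>_ _. 0) (\<lambda>_ _. 0)"
  by (simp add: crystal_with_def unit_crystal_def)

lemma seminormal_tensor_list: "\<forall>C\<in>set Cs. seminormal C \<Longrightarrow> seminormal (tensor_list Cs)"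
proof (induction Cs)
  case Nil
  then show ?case using crystal_with_seminormal[OF unit_crystal_with] by simp
next
  case (Cons C Cs)
  then show ?case
    using crystal_with_seminormal[OF cons_crystal_with[OF tensor_crystal_with[of C "tensor_list Cs"]]] by simp
qed

declare tensor_list.simps [simp del]

lemma tensor_list_Nil [simp]: "elems (tensor_list []) = {[]}" "wt (tensor_list []) w = (\<lambda>_. 0)"
  "eop (tensor_list []) i w = None" "fop (tensor_list []) i w = None"
  by (simp_all add: tensor_list.simps unit_crystal_def)

lemma eps_phi_Nil [simp]: "eps (tensor_list []) i [] = 0" "phi (tensor_list []) i [] = 0"
  using crystal_with_eps_phi[OF unit_crystal_with, of "[]" i] by (simp_all add: tensor_list.simps unit_crystal_def)

lemma tensor_list_Cons:
  assumes "seminormal C" "seminormal (tensor_list Cs)" "x \<in> elems C" "xs \<in> elems (tensor_list Cs)"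
  shows "eps (tensor_list (C # Cs)) i (x # xs) = eps C i x + (eps (tensor_list Cs) i xs - phi C i x)"
    "phi (tensor_list (C # Cs)) i (x # xs) = phi (tensor_list Cs) i xs + (phi C i x - eps (tensor_list Cs) i xs)"
  using crystal_with_eps_phi[OF cons_crystal_with[OF tensor_crystal_with[OF assms(1,2)]], of "x # xs" i] assms(3,4)
  by (auto simp: tensor_list.simps cons_sel tensor_sel)

lemma tensor_list_Cons_ops:
  "eop (tensor_list (C # Cs)) i (x # xs) = (if eps (tensor_list Cs) i xs \<le> phi C i x
     then map_option (\<lambda>x'. x' # xs) (eop C i x) else map_option (\<lambda>xs'. x # xs') (eop (tensor_list Cs) i xs))"
  "fop (tensor_list (C # Cs)) i (x # xs) = (if eps (tensor_list Cs) i xs < phi C i x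
     then map_option (\<lambda>x'. x' # xs) (fop C i x) else map_option (\<lambda>xs'. x # xs') (fop (tensor_list Cs) i xs))"
  "wt (tensor_list (C # Cs)) (x # xs) = (\<lambda>i. wt C x i + wt (tensor_list Cs) xs i)"
  by (auto simp: tensor_list.simps cons_sel tensor_sel option.map_comp comp_def fun_eq_iff)

lemma tensor_list_Cons_elems:
  "w \<in> elems (tensor_list (C # Cs)) \<longleftrightarrow> (\<exists>x xs. w = x # xs \<and> x \<in> elems C \<and> xs \<in> elems (tensor_list Cs))"
  by (auto simp: tensor_list.simps cons_sel tensor_sel)

lemma tensor_list_length: "w \<in> elems (tensor_list Cs) \<Longrightarrow> length w = length Cs"
  by (induction Cs arbitrary: w) (auto simp: tensor_list_Cons_elems)

lemma tensor_list_elems_iff: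
  "w \<in> elems (tensor_list Cs) \<longleftrightarrow> length w = length Cs \<and> (\<forall>k<length Cs. w ! k \<in> elems (Cs ! k))"
proof (induction Cs arbitrary: w)
  case (Cons C Cs)
  then show ?case
    unfolding tensor_list_Cons_elems by (cases w) (auto simp: All_less_Suc2)
qed auto

text \<open>Associativity of the tensor product: a word may be cut anywhere and the two parts
  treated as two factors.\<close>

lemma tensor_list_append:
  assumes "\<forall>C\<in>set (Cs @ Ds). seminormal C" "xs \<in> elems (tensor_list Cs)" "ys \<in> elems (tensor_list Ds)"
  shows "eps (tensor_list (Cs @ Ds)) i (xs @ ys) = eps (tensor_list Cs) i xs + (eps (tensor_list Ds) i ys - phi (tensor_list Cs) i xs)
    \<and> phi (tensor_list (Cs @ Ds)) i (xs @ ys) = phi (tensor_list Ds) i ys + (phi (tensor_list Cs) i xs - eps (tensor_list Ds) i ys)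
    \<and> eop (tensor_list (Cs @ Ds)) i (xs @ ys) = (if eps (tensor_list Ds) i ys \<le> phi (tensor_list Cs) i xs
        then map_option (\<lambda>xs'. xs' @ ys) (eop (tensor_list Cs) i xs) else map_option (\<lambda>ys'. xs @ ys') (eop (tensor_list Ds) i ys))
    \<and> fop (tensor_list (Cs @ Ds)) i (xs @ ys) = (if eps (tensor_list Ds) i ys < phi (tensor_list Cs) i xs
        then map_option (\<lambda>xs'. xs' @ ys) (fop (tensor_list Cs) i xs) else map_option (\<lambda>ys'. xs @ ys') (fop (tensor_list Ds) i ys))"
  using assms(1,2)
proof (induction Cs arbitrary: xs)
  case Nil
  then have xs: "xs = []" by simp
  \<comment> \<open>If \<epsilon>(ys) = 0, the rule selects the empty left factor and gives None,
    which is also the value of e_i on ys.\<close>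
  have "seminormal (tensor_list Ds)" using Nil by (auto intro: seminormal_tensor_list)
  then have "eop (tensor_list Ds) i ys = None \<longleftrightarrow> eps (tensor_list Ds) i ys = 0"
    by (rule seminormalD(1)[OF _ assms(3)])
  moreover have "map_option ((@) []) z = z" for z :: "'a list option" by (cases z) auto
  ultimately show ?case by (auto simp: xs)
next
  case (Cons C Cs)
  then obtain x xs' where x: "xs = x # xs'" "x \<in> elems C" "xs' \<in> elems (tensor_list Cs)"
    by (auto simp: tensor_list_Cons_elems)
  have s: "seminormal C" "seminormal (tensor_list Cs)" "seminormal (tensor_list (Cs @ Ds))"
    using Cons.prems by (auto intro: seminormal_tensor_list)
  have m: "xs' @ ys \<in> elems (tensor_list (Cs @ Ds))"
    using x(3) assms(3) by (auto simp: tensor_list_elems_iff nth_append)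
  have IH: "eps (tensor_list (Cs @ Ds)) i (xs' @ ys) = eps (tensor_list Cs) i xs' + (eps (tensor_list Ds) i ys - phi (tensor_list Cs) i xs')"
    "phi (tensor_list (Cs @ Ds)) i (xs' @ ys) = phi (tensor_list Ds) i ys + (phi (tensor_list Cs) i xs' - eps (tensor_list Ds) i ys)"
    "eop (tensor_list (Cs @ Ds)) i (xs' @ ys) = (if eps (tensor_list Ds) i ys \<le> phi (tensor_list Cs) i xs'
        then map_option (\<lambda>xs'. xs' @ ys) (eop (tensor_list Cs) i xs') else map_option (\<lambda>ys'. xs' @ ys') (eop (tensor_list Ds) i ys))"
    "fop (tensor_list (Cs @ Ds)) i (xs' @ ys) = (if eps (tensor_list Ds) i ys < phi (tensor_list Cs) i xs'
        then map_option (\<lambda>xs'. xs' @ ys) (fop (tensor_list Cs) i xs') else map_option (\<lambda>ys'. xs' @ ys') (fop (tensor_list Ds) i ys))"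
    using Cons.IH[OF _ x(3)] Cons.prems(1) by auto
  note T = tensor_list_Cons[OF s(1,2) x(2,3), of i] tensor_list_Cons[OF s(1,3) x(2) m, of i]
  show ?case
    unfolding x(1) append_Cons T tensor_list_Cons_ops IH
    by (intro conjI) (auto simp: option.map_comp comp_def)
qed

context
  fixes Cs Ds Es :: "'b crystal list"
  assumes s: "\<forall>C\<in>set (Cs @ Ds @ Es). seminormal C"
begin

text \<open>An operator changes one of the three blocks, so the middle block is either untouched or
  moved by its own operator.\<close>

lemma tensor_list_middle:
  assumes "xs \<in> elems (tensor_list Cs)" "ys \<in> elems (tensor_list Ds)" "zs \<in> elems (tensor_list Es)"
  shows "eop (tensor_list (Cs @ Ds @ Es)) i (xs @ ys @ zs) = Some w \<Longrightarrow>
      \<exists>xs' ys' zs'. w = xs' @ ys' @ zs' \<and> length xs' = length xs \<and> length ys' = length ys \<and>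
        (ys' = ys \<or> eop (tensor_list Ds) i ys = Some ys')"
    "fop (tensor_list (Cs @ Ds @ Es)) i (xs @ ys @ zs) = Some w \<Longrightarrow>
      \<exists>xs' ys' zs'. w = xs' @ ys' @ zs' \<and> length xs' = length xs \<and> length ys' = length ys \<and>
        (ys' = ys \<or> fop (tensor_list Ds) i ys = Some ys')"
proof -
  have sn: "seminormal (tensor_list Cs)" "seminormal (tensor_list Ds)" using s by (auto intro: seminormal_tensor_list)
  have m: "ys @ zs \<in> elems (tensor_list (Ds @ Es))"
    using assms(2,3) by (auto simp: tensor_list_elems_iff nth_append)
  have lx: "length xs' = length xs" if "eop (tensor_list Cs) i xs = Some xs' \<or> fop (tensor_list Cs) i xs = Some xs'" for xs'
    using that seminormalD(3,7)[OF sn(1) assms(1)] assms(1) by (metis tensor_list_length)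
  have ly: "length ys' = length ys" if "eop (tensor_list Ds) i ys = Some ys' \<or> fop (tensor_list Ds) i ys = Some ys'" for ys'
    using that seminormalD(3,7)[OF sn(2) assms(2)] assms(2) by (metis tensor_list_length)
  note A1 = tensor_list_append[OF s assms(1) m, of i]
  have "\<forall>C\<in>set (Ds @ Es). seminormal C" using s by auto
  note A2 = tensor_list_append[OF this assms(2,3), of i]
  {
    assume "eop (tensor_list (Cs @ Ds @ Es)) i (xs @ ys @ zs) = Some w"
    then have "(\<exists>xs'. w = xs' @ ys @ zs \<and> eop (tensor_list Cs) i xs = Some xs') \<or>
        (\<exists>ys'. w = xs @ ys' @ zs \<and> eop (tensor_list Ds) i ys = Some ys') \<or> (\<exists>zs'. w = xs @ ys @ zs')"
      using A1 A2 by (auto split: if_splits)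
    then show "\<exists>xs' ys' zs'. w = xs' @ ys' @ zs' \<and> length xs' = length xs \<and> length ys' = length ys \<and>
        (ys' = ys \<or> eop (tensor_list Ds) i ys = Some ys')" using lx ly by blast
  next
    assume "fop (tensor_list (Cs @ Ds @ Es)) i (xs @ ys @ zs) = Some w"
    then have "(\<exists>xs'. w = xs' @ ys @ zs \<and> fop (tensor_list Cs) i xs = Some xs') \<or>
        (\<exists>ys'. w = xs @ ys' @ zs \<and> fop (tensor_list Ds) i ys = Some ys') \<or> (\<exists>zs'. w = xs @ ys @ zs')"
      using A1 A2 by (auto split: if_splits)
    then show "\<exists>xs' ys' zs'. w = xs' @ ys' @ zs' \<and> length xs' = length xs \<and> length ys' = length ys \<and>
        (ys' = ys \<or> fop (tensor_list Ds) i ys = Some ys')" using lx ly by blast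
  }
qed

end

text \<open>The interface between the two halves of the proof: \<open>top_pair\<close> is the
  statement obtained from modules, everything below is combinatorics of crystals.\<close>

locale fundamental_words =
  fixes T :: cartan_type and B :: "nat \<Rightarrow> 'b crystal" and U :: "nat \<Rightarrow> 'b"
  assumes valid: "valid_type T"
    and generated: "c \<in> nodes T \<Longrightarrow> generated_crystal T (fund_weight c) (B c) (U c)"
    and top_pair: "a \<in> nodes T \<Longrightarrow> c \<in> nodes T \<Longrightarrow> y \<in> elems (B c) \<Longrightarrow> wt (B c) y = wsub T (fund_weight c) n \<Longrightarrow>
      same_component (tensor_word B [a, c]) [U a, y] [U a, U c] \<Longrightarrow> n a \<le> 0"
begin

lemma seminormal_B: "c \<in> nodes T \<Longrightarrow> seminormal (B c)" and U_elem: "c \<in> nodes T \<Longrightarrow> U c \<in> elems (B c)"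
  and U_wt: "c \<in> nodes T \<Longrightarrow> wt (B c) (U c) = fund_weight c"
  using generated by (auto simp: generated_crystal_def)

abbreviation fpath :: "nat \<Rightarrow> nat list \<Rightarrow> 'b option" where
  "fpath c is \<equiv> foldr (\<lambda>i x. Option.bind x (fop (B c) i)) is (Some (U c))"

lemma fpath_props:
  assumes "c \<in> nodes T" "is \<in> lists (nodes T)" "fpath c is = Some b"
  shows "b \<in> elems (B c) \<and> wt (B c) b = wsub T (fund_weight c) (\<lambda>i. int (count_list is i))"
  using assms(2,3)
proof (induction "is" arbitrary: b rule: list.induct)
  case Nil
  then show ?case using assms(1) U_elem U_wt by auto
next
  case (Cons i js)
  then obtain b' where b': "fpath c js = Some b'" "fop (B c) i b' = Some b" by (auto simp: bind_eq_Some_conv)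
  have i: "i \<in> nodes T" and js: "js \<in> lists (nodes T)" using Cons.prems by auto
  note IH = Cons.IH[OF js b'(1)]
  have "b \<in> elems (B c)" using seminormalD(7)[OF seminormal_B[OF assms(1)]] IH b'(2) by blast
  moreover have "wt (B c) b = wshift T i (- 1) (wt (B c) b')"
    using generated_crystal_wt(1)[OF generated[OF assms(1)]] IH b'(2) by blast
  then have "wt (B c) b = wsub T (fund_weight c) (\<lambda>j. int (count_list (i # js) j))"
    unfolding IH[THEN conjunct2] wshift_wsub[OF i]
    by (simp only:) (rule arg_cong[where f = "wsub T (fund_weight c)"], auto)
  ultimately show ?case by blast
qed

lemma fpath_exists:
  assumes "c \<in> nodes T" "b \<in> elems (B c)"
  obtains "is" where "is \<in> lists (nodes T)" "fpath c is = Some b"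
  using generated[OF assms(1)] assms(2) unfolding generated_crystal_def by blast

lemma content_nonneg:
  assumes "c \<in> nodes T" "b \<in> elems (B c)" "wt (B c) b = wsub T (fund_weight c) n" "i \<in> nodes T"
  shows "n i \<ge> 0"
proof -
  obtain "is" where "is \<in> lists (nodes T)" "fpath c is = Some b" using fpath_exists[OF assms(1,2)] .
  then have "wt (B c) b = wsub T (fund_weight c) (\<lambda>i. int (count_list is i))"
    using fpath_props[OF assms(1)] by blast
  then have "n i = int (count_list is i)" using wsub_inj[OF valid _ assms(4)] assms(3) by metis
  then show ?thesis by simp
qed

text \<open>A path of lowering operators from \<open>U c\<close> to y avoids a, and it never leaves
  the side P of a. If it is nonempty, its last letter i lies in P and \<epsilon>_i(y) > 0, a
  contradiction.\<close>

lemma levi_highest_weight: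
  assumes a: "a \<in> nodes T" and c: "c \<in> nodes T" and y: "y \<in> elems (B c)"
    and n: "wt (B c) y = wsub T (fund_weight c) n" "n a \<le> 0"
    and e: "a \<le> c \<and> (\<forall>i>a. eps (B c) i y = 0) \<or> c \<le> a \<and> (\<forall>i<a. eps (B c) i y = 0)"
  shows "y = U c"
proof -
  have "\<exists>P. ((a \<le> c \<and> P = (\<lambda>i. a < i)) \<or> (c \<le> a \<and> P = (\<lambda>i. i < a))) \<and> (\<forall>i. P i \<longrightarrow> eps (B c) i y = 0)"
    using e
  proof
    assume "a \<le> c \<and> (\<forall>i>a. eps (B c) i y = 0)"
    then show ?thesis by (intro exI[of _ "\<lambda>i. a < i"]) simp
  next
    assume "c \<le> a \<and> (\<forall>i<a. eps (B c) i y = 0)"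
    then show ?thesis by (intro exI[of _ "\<lambda>i. i < a"]) simp
  qed
  then obtain P where Pac: "(a \<le> c \<and> P = (\<lambda>i. a < i)) \<or> (c \<le> a \<and> P = (\<lambda>i. i < a))"
    and Pe: "\<And>i. P i \<Longrightarrow> eps (B c) i y = 0" by blast
  have sn: "seminormal (B c)" by (rule seminormal_B[OF c])
  have P: "\<forall>i\<in>set is. P i" if "is \<in> lists (nodes T)" "fpath c is = Some b" "a \<notin> set is" for "is" b
    using that
  proof (induction "is" arbitrary: b rule: list.induct)
    case (Cons i js)
    then obtain b' where b': "fpath c js = Some b'" "fop (B c) i b' = Some b" by (auto simp: bind_eq_Some_conv)
    have i: "i \<in> nodes T" "i \<noteq> a" and js: "js \<in> lists (nodes T)" "a \<notin> set js" using Cons.prems by auto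
    have IH: "\<forall>i\<in>set js. P i" by (rule Cons.IH[OF js(1) b'(1) js(2)])
    note b'p = fpath_props[OF c js(1) b'(1)]
    have "P i"
    proof (rule ccontr)
      assume nP: "\<not> P i"
      then have far: "cartan T i j = 0" if "P j" for j using that Pac i(2) by (auto simp: cartan_def)
      have ic: "fund_weight c i = 0" using nP Pac i(2) by (auto simp: fund_weight_def)
      have "(\<Sum>j\<in>nodes T. int (count_list js j) * sroot T j i) = 0"
      proof (rule sum.neutral, rule ballI)
        fix j assume "j \<in> nodes T"
        show "int (count_list js j) * sroot T j i = 0"
          using IH far[of j] by (cases "j \<in> set js") (auto simp: sroot_def count_list_0_iff)
      qed
      then have w: "wt (B c) b' i = 0" using b'p ic by (simp add: wsub_def)
      \<comment> \<open>The letter i has not occurred yet, so raising along i would make the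
        coefficient of \<alpha>_i negative.\<close>
      have "eop (B c) i b' = None"
      proof (rule ccontr)
        assume "eop (B c) i b' \<noteq> None"
        then obtain b'' where b'': "eop (B c) i b' = Some b''" by auto
        have "wt (B c) b'' = wshift T i 1 (wt (B c) b')"
          using generated_crystal_wt(2)[OF generated[OF c]] b'p b'' by blast
        then have "wt (B c) b'' = wsub T (fund_weight c) ((\<lambda>i. int (count_list js i))(i := int (count_list js i) - 1))"
          unfolding b'p[THEN conjunct2] wshift_wsub[OF i(1)] .
        moreover have "b'' \<in> elems (B c)" using seminormalD(3)[OF sn] b'p b'' by blast
        ultimately have "int (count_list js i) - 1 \<ge> 0" using content_nonneg[OF c _ _ i(1)] by fastforce
        then have "i \<in> set js" using count_list_0_iff[of js i] by (cases "i \<in> set js") auto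
        then show False using IH nP by blast
      qed
      then have "eps (B c) i b' = 0" using seminormalD(1)[OF sn] b'p by blast
      then have "phi (B c) i b' = 0" using w seminormalD(11)[OF sn, of b' i] b'p by auto
      then show False using b'(2) seminormalD(2)[OF sn, of b' i] b'p by auto
    qed
    then show ?case using IH by simp
  qed simp
  obtain "is" where "is": "is \<in> lists (nodes T)" "fpath c is = Some y" using fpath_exists[OF c y] .
  have "wt (B c) y = wsub T (fund_weight c) (\<lambda>i. int (count_list is i))" using fpath_props[OF c "is"] by blast
  then have "n a = int (count_list is a)" using wsub_inj[OF valid _ a] n(1) by metis
  then have "a \<notin> set is" using n(2) count_list_0_iff[of "is" a] by simp
  note Pis = P[OF "is" this]
  show ?thesis
  proof (cases "is")
    case Nil
    then show ?thesis using "is"(2) by simp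
  next
    case (Cons i js)
    then obtain b' where b': "fpath c js = Some b'" "fop (B c) i b' = Some y" using "is"(2) by (auto simp: bind_eq_Some_conv)
    have "b' \<in> elems (B c)" using fpath_props[OF c _ b'(1)] "is"(1) Cons by auto
    then have "eps (B c) i y = Suc (eps (B c) i b')" using seminormalD(10)[OF sn _ b'(2)] by blast
    then show ?thesis using Pe[of i] Pis Cons by simp
  qed
qed

section \<open>Weights and components of words\<close>

definition word_weight :: "nat list \<Rightarrow> weight" where
  "word_weight \<epsilon> = (\<lambda>j. \<Sum>k<length \<epsilon>. fund_weight (\<epsilon> ! k) j)"

lemma word_weight_simps [simp]: "word_weight [] = (\<lambda>_. 0)"
  "word_weight (c # \<epsilon>) = (\<lambda>j. fund_weight c j + word_weight \<epsilon> j)"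
  by (auto simp: word_weight_def sum.lessThan_Suc_shift simp del: sum.lessThan_Suc)

lemma word_weight_notin: "i \<notin> set \<epsilon> \<Longrightarrow> word_weight \<epsilon> i = 0"
  by (induction \<epsilon>) (auto simp: fund_weight_def)

lemma seminormal_word: "set \<epsilon> \<subseteq> nodes T \<Longrightarrow> seminormal (tensor_word B \<epsilon>)"
  unfolding tensor_word_def by (rule seminormal_tensor_list) (auto intro: seminormal_B)

lemma seminormal_letters: "set \<epsilon> \<subseteq> nodes T \<Longrightarrow> \<forall>C\<in>set (map B \<epsilon>). seminormal C"
  by (auto intro: seminormal_B)

lemma word_content:
  assumes "set \<epsilon> \<subseteq> nodes T" "w \<in> elems (tensor_word B \<epsilon>)"
  shows "\<exists>n. (\<forall>i\<in>nodes T. n i \<ge> 0) \<and> wt (tensor_word B \<epsilon>) w = wsub T (word_weight \<epsilon>) n \<and>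
    ((\<forall>i\<in>nodes T. n i = 0) \<longrightarrow> w = map U \<epsilon>)"
  using assms
proof (induction \<epsilon> arbitrary: w)
  case Nil
  then show ?case by (intro exI[of _ "\<lambda>_. 0"]) (auto simp: tensor_word_def)
next
  case (Cons c \<epsilon>)
  then obtain x xs where w: "w = x # xs" "x \<in> elems (B c)" "xs \<in> elems (tensor_word B \<epsilon>)"
    by (auto simp: tensor_word_def tensor_list_Cons_elems)
  have c: "c \<in> nodes T" using Cons.prems by simp
  obtain n where n: "\<forall>i\<in>nodes T. n i \<ge> 0" "wt (tensor_word B \<epsilon>) xs = wsub T (word_weight \<epsilon>) n"
    "(\<forall>i\<in>nodes T. n i = 0) \<longrightarrow> xs = map U \<epsilon>" using Cons.IH[OF _ w(3)] Cons.prems by auto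
  obtain "is" where "is": "is \<in> lists (nodes T)" "fpath c is = Some x" using fpath_exists[OF c w(2)] .
  have x: "wt (B c) x = wsub T (fund_weight c) (\<lambda>i. int (count_list is i))" using fpath_props[OF c "is"] by blast
  have "wt (tensor_word B (c # \<epsilon>)) w = wsub T (word_weight (c # \<epsilon>)) (\<lambda>i. int (count_list is i) + n i)"
    using n(2) by (auto simp: tensor_word_def w(1) tensor_list_Cons_ops x wsub_def distrib_right sum.distrib)
  moreover have "w = map U (c # \<epsilon>)" if z: "\<forall>i\<in>nodes T. int (count_list is i) + n i = 0"
  proof -
    have "int (count_list is i) = 0 \<and> n i = 0" if "i \<in> nodes T" for i using bspec[OF z that] bspec[OF n(1) that] by auto
    moreover have "is = []" using calculation "is"(1) by (cases "is") force+
    ultimately show ?thesis using n(3) "is"(2) w(1) by auto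
  qed
  ultimately show ?case using n(1) by (intro exI[of _ "\<lambda>i. int (count_list is i) + n i"]) auto
qed

lemma word_wt_step:
  assumes "set \<epsilon> \<subseteq> nodes T" "w \<in> elems (tensor_word B \<epsilon>)" "eop (tensor_word B \<epsilon>) i w = Some w'"
  shows "i \<in> nodes T \<and> wt (tensor_word B \<epsilon>) w' = wshift T i 1 (wt (tensor_word B \<epsilon>) w)"
  using assms
proof (induction \<epsilon> arbitrary: w w')
  case (Cons c \<epsilon>)
  then obtain x xs where w: "w = x # xs" "x \<in> elems (B c)" "xs \<in> elems (tensor_word B \<epsilon>)"
    by (auto simp: tensor_word_def tensor_list_Cons_elems)
  have c: "c \<in> nodes T" and \<epsilon>: "set \<epsilon> \<subseteq> nodes T" using Cons.prems by auto
  have "(\<exists>x'. eop (B c) i x = Some x' \<and> w' = x' # xs) \<or> (\<exists>xs'. eop (tensor_word B \<epsilon>) i xs = Some xs' \<and> w' = x # xs')"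
    using Cons.prems(3) by (auto simp: w(1) tensor_word_def tensor_list_Cons_ops split: if_splits)
  then show ?case
  proof (elim disjE exE conjE)
    fix x' assume x': "eop (B c) i x = Some x'" "w' = x' # xs"
    have "i \<in> nodes T \<and> wt (B c) x' = wshift T i 1 (wt (B c) x)"
      using generated_crystal_wt(2)[OF generated[OF c] w(2) x'(1)] .
    then show ?thesis by (simp add: x'(2) w(1) tensor_word_def tensor_list_Cons_ops wshift_def fun_eq_iff)
  next
    fix xs' assume x': "eop (tensor_word B \<epsilon>) i xs = Some xs'" "w' = x # xs'"
    have "i \<in> nodes T \<and> wt (tensor_word B \<epsilon>) xs' = wshift T i 1 (wt (tensor_word B \<epsilon>) xs)"
      by (rule Cons.IH[OF \<epsilon> w(3) x'(1)])
    then show ?thesis by (simp add: x'(2) w(1) tensor_word_def tensor_list_Cons_ops wshift_def fun_eq_iff)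
  qed
qed (simp add: tensor_word_def)

lemma map_U_elem: "set \<epsilon> \<subseteq> nodes T \<Longrightarrow> map U \<epsilon> \<in> elems (tensor_word B \<epsilon>)"
  by (auto simp: tensor_word_def tensor_list_elems_iff intro!: U_elem subsetD[OF _ nth_mem])

lemma map_U_wt: "set \<epsilon> \<subseteq> nodes T \<Longrightarrow> wt (tensor_word B \<epsilon>) (map U \<epsilon>) = word_weight \<epsilon>"
  by (induction \<epsilon>) (auto simp: tensor_word_def tensor_list_Cons_ops U_wt)

lemma eps_U: "c \<in> nodes T \<Longrightarrow> eps (B c) i (U c) = 0"
proof (rule ccontr)
  assume c: "c \<in> nodes T" and "eps (B c) i (U c) \<noteq> 0"
  then obtain b where b: "eop (B c) i (U c) = Some b"
    using seminormalD(1)[OF seminormal_B[OF c] U_elem[OF c], of i] by auto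
  have w: "i \<in> nodes T \<and> wt (B c) b = wshift T i 1 (wt (B c) (U c))"
    by (rule generated_crystal_wt(2)[OF generated[OF c] U_elem[OF c] b])
  then have "wt (B c) b = wshift T i 1 (wsub T (fund_weight c) (\<lambda>_. 0))" using U_wt[OF c] by simp
  then have "wt (B c) b = wsub T (fund_weight c) ((\<lambda>_. 0)(i := 0 - 1))"
    using wshift_wsub[of i T 1 "fund_weight c" "\<lambda>_. 0"] w by simp
  from content_nonneg[OF c seminormalD(3)[OF seminormal_B[OF c] U_elem[OF c] b] this, of i] show False
    using w by simp
qed

lemma eps_map_U: "set \<epsilon> \<subseteq> nodes T \<Longrightarrow> eps (tensor_word B \<epsilon>) i (map U \<epsilon>) = 0"
proof (induction \<epsilon>)
  case (Cons c \<epsilon>)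
  then show ?case
    using tensor_list_Cons[of "B c" "map B \<epsilon>" "U c" "map U \<epsilon>" i] seminormal_word[of \<epsilon>] map_U_elem[of \<epsilon>]
    by (simp add: tensor_word_def seminormal_B U_elem eps_U)
qed (simp add: tensor_word_def)

lemma map_U_top: "set \<epsilon> \<subseteq> nodes T \<Longrightarrow> map U \<epsilon> \<in> top_component B \<epsilon>"
  unfolding top_component_def hw_component_def mem_Collect_eq
  using seminormalD(1)[OF seminormal_word map_U_elem] eps_map_U map_U_wt[unfolded word_weight_def]
  by (intro bexI[of _ "map U \<epsilon>"]) (auto simp: same_component_def map_U_elem)

text \<open>The word \<open>map U \<epsilon>\<close> is the only element of its weight: all
  coefficients in \<open>word_content\<close> must vanish.\<close>

lemma top_component_iff:
  assumes "set \<epsilon> \<subseteq> nodes T"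
  shows "w \<in> top_component B \<epsilon> \<longleftrightarrow> same_component (tensor_word B \<epsilon>) (map U \<epsilon>) w"
proof
  assume "w \<in> top_component B \<epsilon>"
  then obtain h where h: "h \<in> elems (tensor_word B \<epsilon>)" "wt (tensor_word B \<epsilon>) h = word_weight \<epsilon>"
    "same_component (tensor_word B \<epsilon>) h w"
    unfolding top_component_def hw_component_def word_weight_def by blast
  obtain n where n: "wt (tensor_word B \<epsilon>) h = wsub T (word_weight \<epsilon>) n" "(\<forall>i\<in>nodes T. n i = 0) \<longrightarrow> h = map U \<epsilon>"
    using word_content[OF assms h(1)] by blast
  then have "wsub T (word_weight \<epsilon>) n = wsub T (word_weight \<epsilon>) (\<lambda>_. 0)" using h(2) by simp
  then have "h = map U \<epsilon>" using n(2) wsub_inj[OF valid] by blast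
  then show "same_component (tensor_word B \<epsilon>) (map U \<epsilon>) w" using h(3) by simp
next
  assume "same_component (tensor_word B \<epsilon>) (map U \<epsilon>) w"
  then show "w \<in> top_component B \<epsilon>"
    using map_U_top[OF assms] unfolding top_component_def hw_component_def same_component_def
    by (auto intro: rtranclp_trans)
qed

definition pairs_top :: "nat list \<Rightarrow> 'b list \<Rightarrow> bool" where
  "pairs_top \<epsilon> w \<longleftrightarrow> (\<forall>k. Suc k < length \<epsilon> \<longrightarrow> [w ! k, w ! Suc k] \<in> top_component B [\<epsilon> ! k, \<epsilon> ! Suc k])"

text \<open>Each adjacent pair is a middle block: it stays fixed or moves inside its own
  component.\<close>

lemma pairs_top_step:
  assumes \<epsilon>: "set \<epsilon> \<subseteq> nodes T" and w: "w \<in> elems (tensor_word B \<epsilon>)"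
    and s: "eop (tensor_word B \<epsilon>) i w = Some w' \<or> fop (tensor_word B \<epsilon>) i w = Some w'"
  shows "pairs_top \<epsilon> w \<longleftrightarrow> pairs_top \<epsilon> w'"
proof -
  have lw: "length w = length \<epsilon>" using w tensor_list_length by (fastforce simp: tensor_word_def)
  have "[w ! k, w ! Suc k] \<in> top_component B [\<epsilon> ! k, \<epsilon> ! Suc k] \<longleftrightarrow> [w' ! k, w' ! Suc k] \<in> top_component B [\<epsilon> ! k, \<epsilon> ! Suc k]"
    if k: "Suc k < length \<epsilon>" for k
  proof -
    let ?p = "[\<epsilon> ! k, \<epsilon> ! Suc k]" let ?q = "[w ! k, w ! Suc k]"
    have split: "xs = take k xs @ [xs ! k, xs ! Suc k] @ drop (Suc (Suc k)) xs" if "Suc k < length xs" for xs :: "'c list"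
      using that by (simp add: Cons_nth_drop_Suc)
    note E = split[OF k] and W = split[of w, unfolded lw, OF k]
    have el: "take k w \<in> elems (tensor_list (map B (take k \<epsilon>)))" "?q \<in> elems (tensor_list (map B ?p))"
      "drop (Suc (Suc k)) w \<in> elems (tensor_list (map B (drop (Suc (Suc k)) \<epsilon>)))"
      using w k lw unfolding tensor_word_def tensor_list_elems_iff by (auto simp: less_Suc_eq numeral_2_eq_2)
    have sn: "\<forall>C\<in>set (map B (take k \<epsilon>) @ map B ?p @ map B (drop (Suc (Suc k)) \<epsilon>)). seminormal C"
      using seminormal_letters[OF \<epsilon>] E by (metis map_append)
    have p: "set ?p \<subseteq> nodes T" using \<epsilon> k by (auto simp: subset_iff)
    have TW: "tensor_word B \<epsilon> = tensor_list (map B (take k \<epsilon>) @ map B ?p @ map B (drop (Suc (Suc k)) \<epsilon>))"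
      unfolding tensor_word_def map_append[symmetric] E[symmetric] by (rule refl)
    have "\<exists>xs' ys' zs'. w' = xs' @ ys' @ zs' \<and> length xs' = length (take k w) \<and> length ys' = length ?q \<and>
        (ys' = ?q \<or> eop (tensor_word B ?p) i ?q = Some ys' \<or> fop (tensor_word B ?p) i ?q = Some ys')"
      using s tensor_list_middle[OF sn el, of i w', folded TW W] unfolding tensor_word_def[of B ?p] by blast
    then obtain xs' ys' zs' where w'0: "w' = xs' @ ys' @ zs'" "length xs' = length (take k w)" "length ys' = length ?q"
      "ys' = ?q \<or> eop (tensor_word B ?p) i ?q = Some ys' \<or> fop (tensor_word B ?p) i ?q = Some ys'"
      by blast
    then have w': "w' = xs' @ ys' @ zs'" "length xs' = k" "length ys' = 2"
      "ys' = ?q \<or> eop (tensor_word B ?p) i ?q = Some ys' \<or> fop (tensor_word B ?p) i ?q = Some ys'"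
      using k lw by simp_all
    have "ys' = [w' ! k, w' ! Suc k]"
      using w'(1-3) by (cases ys'; cases "tl ys'") (auto simp: nth_append)
    moreover have "?q \<in> top_component B ?p \<longleftrightarrow> ys' \<in> top_component B ?p"
    proof (cases "ys' = ?q")
      case False
      have q: "?q \<in> elems (tensor_word B ?p)" using el(2) by (simp add: tensor_word_def)
      then have "ys' \<in> elems (tensor_word B ?p)"
        using False w'(4) seminormalD(3,7)[OF seminormal_word[OF p] q] by blast
      then show ?thesis unfolding top_component_def using False w'(4) by (intro hw_component_step[of _ _ _ i] q) auto
    qed simp
    ultimately show ?thesis by simp
  qed
  then show ?thesis unfolding pairs_top_def by blast
qed

lemma pairs_top_same_component:
  assumes "set \<epsilon> \<subseteq> nodes T" "same_component (tensor_word B \<epsilon>) w w'"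
  shows "pairs_top \<epsilon> w \<longleftrightarrow> pairs_top \<epsilon> w'"
  using assms(2) unfolding same_component_def
proof (induction rule: rtranclp_induct)
  case (step y z)
  then obtain i where "y \<in> elems (tensor_word B \<epsilon>)" "z \<in> elems (tensor_word B \<epsilon>)"
    "(eop (tensor_word B \<epsilon>) i y = Some z \<or> fop (tensor_word B \<epsilon>) i y = Some z) \<or>
     (eop (tensor_word B \<epsilon>) i z = Some y \<or> fop (tensor_word B \<epsilon>) i z = Some y)"
    unfolding crystal_edge_def by blast
  then have "pairs_top \<epsilon> y \<longleftrightarrow> pairs_top \<epsilon> z" using pairs_top_step[OF assms(1)] by blast
  then show ?case using step by simp
qed simp

lemma crystal_edge_sym: "crystal_edge C x y \<Longrightarrow> crystal_edge C y x"
  by (auto simp: crystal_edge_def)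

lemma same_component_sym: "same_component C x y \<Longrightarrow> same_component C y x"
  unfolding same_component_def
  by (induction rule: rtranclp_induct) (auto intro: converse_rtranclp_into_rtranclp crystal_edge_sym)

lemma highest_weight_word:
  assumes \<epsilon>: "set \<epsilon> \<subseteq> nodes T" and mono: "sorted_wrt (\<le>) \<epsilon> \<or> sorted_wrt (\<ge>) \<epsilon>"
    and w: "w \<in> elems (tensor_word B \<epsilon>)" "pairs_top \<epsilon> w" and hw: "\<And>i. eop (tensor_word B \<epsilon>) i w = None"
  shows "w = map U \<epsilon>"
proof -
  have lw: "length w = length \<epsilon>" using w(1) tensor_list_length by (fastforce simp: tensor_word_def)
  have "take k w = map U (take k \<epsilon>)" if "k \<le> length \<epsilon>" for k
    using that
  proof (induction k)
    case (Suc k)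
    then have k: "k < length \<epsilon>" and IH: "take k w = map U (take k \<epsilon>)" by auto
    define c y where "c = \<epsilon> ! k" and "y = w ! k"
    have c: "c \<in> nodes T" using \<epsilon> k by (auto simp: c_def)
    have tk: "set (take k \<epsilon>) \<subseteq> nodes T" using \<epsilon> set_take_subset by fastforce
    have y: "y \<in> elems (B c)" using w(1) k by (auto simp: tensor_word_def tensor_list_elems_iff y_def c_def)
    have E: "\<epsilon> = take k \<epsilon> @ [c] @ drop (Suc k) \<epsilon>" and W: "w = take k w @ [y] @ drop (Suc k) w"
      using k lw by (auto simp: c_def y_def id_take_nth_drop)
    have el: "take k w @ [y] \<in> elems (tensor_list (map B (take k \<epsilon> @ [c])))"
      "drop (Suc k) w \<in> elems (tensor_list (map B (drop (Suc k) \<epsilon>)))"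
      "take k w \<in> elems (tensor_list (map B (take k \<epsilon>)))" "[y] \<in> elems (tensor_list (map B [c]))"
      using w(1) k lw y unfolding tensor_word_def tensor_list_elems_iff
      by (auto simp: nth_append less_Suc_eq c_def y_def)
    have sn: "\<forall>C\<in>set (map B (take k \<epsilon> @ [c]) @ map B (drop (Suc k) \<epsilon>)). seminormal C"
      "\<forall>C\<in>set (map B (take k \<epsilon>) @ map B [c]). seminormal C"
      using seminormal_letters[OF \<epsilon>] tk c by (auto intro: seminormal_B dest: in_set_dropD in_set_takeD)
    have TW: "tensor_word B \<epsilon> = tensor_list (map B (take k \<epsilon> @ [c]) @ map B (drop (Suc k) \<epsilon>))"
      unfolding tensor_word_def map_append[symmetric] using E by simp
    have W': "w = (take k w @ [y]) @ drop (Suc k) w" using W by simp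
    \<comment> \<open>The \<epsilon>_i of a word bounds that of its prefixes, so it vanishes on the
      prefix extended by y; there it is \<epsilon>_i of the prefix plus the excess of
      \<epsilon>_i(y) over \<phi>_i of the prefix.\<close>
    have ep: "eps (B c) i y \<le> phi (tensor_word B (take k \<epsilon>)) i (take k w)" for i
    proof -
      have "eps (tensor_word B \<epsilon>) i w = 0" using seminormalD(1)[OF seminormal_word[OF \<epsilon>] w(1)] hw by blast
      then have "eps (tensor_list (map B (take k \<epsilon> @ [c]))) i (take k w @ [y]) = 0"
        using tensor_list_append[OF sn(1) el(1,2), of i, folded TW W'] by simp
      then have "eps (tensor_list (map B [c])) i [y] \<le> phi (tensor_list (map B (take k \<epsilon>))) i (take k w)"
        using tensor_list_append[OF sn(2) el(3,4), of i] by simp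
      moreover have "eps (tensor_list (map B [c])) i [y] = eps (B c) i y"
        using tensor_list_Cons(1)[of "B c" "[]" y "[]" i] seminormal_tensor_list[of "[]"] seminormal_B[OF c] y
        by (simp)
      ultimately show ?thesis by (simp add: tensor_word_def)
    qed
    \<comment> \<open>The prefix consists of highest weight elements, so its \<phi>_i equals its
      weight at i, which vanishes if i is not an earlier label.\<close>
    have e0: "eps (B c) i y = 0" if "i \<notin> set (take k \<epsilon>)" for i
    proof -
      have "int (phi (tensor_word B (take k \<epsilon>)) i (take k w)) = 0"
        using seminormalD(11)[OF seminormal_word[OF tk] map_U_elem[OF tk], of i] eps_map_U[OF tk] map_U_wt[OF tk]
          word_weight_notin[OF that] IH by simp
      then show ?thesis using ep[of i] by simp
    qed
    have "y = U c"
    proof (cases k)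
      \<comment> \<open>Without a predecessor all \<epsilon>_i(y) vanish, so no lowering operator
        can end in y.\<close>
      case 0
      obtain "is" where "is": "is \<in> lists (nodes T)" "fpath c is = Some y" using fpath_exists[OF c y] .
      show ?thesis
      proof (cases "is")
        case (Cons i js)
        then obtain b' where b': "fpath c js = Some b'" "fop (B c) i b' = Some y" using "is"(2) by (auto simp: bind_eq_Some_conv)
        have "b' \<in> elems (B c)" using fpath_props[OF c _ b'(1)] "is"(1) Cons by auto
        then show ?thesis using seminormalD(10)[OF seminormal_B[OF c] _ b'(2)] e0[of i] 0 by simp
      qed (use "is" in simp)
    next
      case (Suc l)
      define a where "a = \<epsilon> ! l"
      have a: "a \<in> nodes T" using \<epsilon> k Suc by (auto simp: a_def)
      have "w ! l = U a"
      proof -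
        have "take k w ! l = map U (take k \<epsilon>) ! l" using IH by simp
        then show ?thesis using Suc k lw by (simp add: a_def)
      qed
      then have "[U a, y] \<in> top_component B [a, c]"
        using w(2) k Suc unfolding pairs_top_def by (auto simp: a_def c_def y_def)
      then have "same_component (tensor_word B [a, c]) [U a, U c] [U a, y]"
        using top_component_iff[of "[a, c]"] a c by simp
      then have sc: "same_component (tensor_word B [a, c]) [U a, y] [U a, U c]" by (rule same_component_sym)
      obtain "is" where "is": "is \<in> lists (nodes T)" "fpath c is = Some y" using fpath_exists[OF c y] .
      have n: "wt (B c) y = wsub T (fund_weight c) (\<lambda>i. int (count_list is i))" using fpath_props[OF c "is"] by blast
      \<comment> \<open>By monotonicity the label just before y is, among the earlier labels, the
        one closest to c, so none of them lies strictly beyond it on the side of c.\<close>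
      have side: "a \<le> c \<and> (\<forall>i>a. i \<notin> set (take k \<epsilon>)) \<or> c \<le> a \<and> (\<forall>i<a. i \<notin> set (take k \<epsilon>))"
      proof -
        have in_take: "\<exists>j\<le>l. i = \<epsilon> ! j" if "i \<in> set (take k \<epsilon>)" for i
          using that Suc k by (auto simp: in_set_conv_nth less_Suc_eq_le)
        have lk: "l < k" "l < length \<epsilon>" using Suc k by auto
        from mono show ?thesis
        proof
          assume s: "sorted_wrt (\<le>) \<epsilon>"
          have "a \<le> c" using sorted_wrt_nth_less[OF s lk(1) k] by (simp add: a_def c_def)
          moreover have "i \<le> a" if "i \<in> set (take k \<epsilon>)" for i
            using in_take[OF that] sorted_wrt_nth_less[OF s _ lk(2)] by (auto simp: a_def le_less)
          ultimately show ?thesis by fastforce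
        next
          assume s: "sorted_wrt (\<ge>) \<epsilon>"
          have "c \<le> a" using sorted_wrt_nth_less[OF s lk(1) k] by (simp add: a_def c_def)
          moreover have "a \<le> i" if "i \<in> set (take k \<epsilon>)" for i
            using in_take[OF that] sorted_wrt_nth_less[OF s _ lk(2)] by (auto simp: a_def le_less)
          ultimately show ?thesis by fastforce
        qed
      qed
      show ?thesis
        by (rule levi_highest_weight[OF a c y n top_pair[OF a c y n sc]]) (use side e0 in blast)
    qed
    then show ?case using IH k lw by (simp add: take_Suc_conv_app_nth c_def y_def)
  qed simp
  from this[of "length \<epsilon>"] show ?thesis using lw by simp
qed

text \<open>Raising preserves the pair condition and lowers the height of w below the highest
  weight. It must stop at a highest weight word, which \<open>highest_weight_word\<close>
  identifies.\<close>

theorem top_component_pairs: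
  assumes \<epsilon>: "set \<epsilon> \<subseteq> nodes T" and mono: "sorted_wrt (\<le>) \<epsilon> \<or> sorted_wrt (\<ge>) \<epsilon>"
    and w: "w \<in> elems (tensor_word B \<epsilon>)"
  shows "w \<in> top_component B \<epsilon> \<longleftrightarrow> pairs_top \<epsilon> w"
proof
  assume "w \<in> top_component B \<epsilon>"
  then have "same_component (tensor_word B \<epsilon>) (map U \<epsilon>) w" using top_component_iff[OF \<epsilon>] by simp
  moreover have "pairs_top \<epsilon> (map U \<epsilon>)"
    unfolding pairs_top_def
  proof (intro allI impI)
    fix k assume "Suc k < length \<epsilon>"
    then show "[map U \<epsilon> ! k, map U \<epsilon> ! Suc k] \<in> top_component B [\<epsilon> ! k, \<epsilon> ! Suc k]"
      using map_U_top[of "[\<epsilon> ! k, \<epsilon> ! Suc k]"] \<epsilon> by (auto simp: subset_iff)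
  qed
  ultimately show "pairs_top \<epsilon> w" using pairs_top_same_component[OF \<epsilon>] by blast
next
  assume p: "pairs_top \<epsilon> w"
  have "same_component (tensor_word B \<epsilon>) (map U \<epsilon>) w"
    if "w \<in> elems (tensor_word B \<epsilon>)" "pairs_top \<epsilon> w" "wt (tensor_word B \<epsilon>) w = wsub T (word_weight \<epsilon>) n"
      "\<forall>i\<in>nodes T. n i \<ge> 0" "nat (\<Sum>i\<in>nodes T. n i) = N" for w n N
    using that
  proof (induction N arbitrary: w n rule: less_induct)
    case (less N)
    show ?case
    proof (cases "\<forall>i. eop (tensor_word B \<epsilon>) i w = None")
      case True
      then have "w = map U \<epsilon>" using highest_weight_word[OF \<epsilon> mono less.prems(1,2)] by blast
      then show ?thesis by (simp add: same_component_def)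
    next
      case False
      then obtain i w' where w': "eop (tensor_word B \<epsilon>) i w = Some w'" by auto
      have el: "w' \<in> elems (tensor_word B \<epsilon>)" by (rule seminormalD(3)[OF seminormal_word[OF \<epsilon>] less.prems(1) w'])
      have p': "pairs_top \<epsilon> w'" using pairs_top_step[OF \<epsilon> less.prems(1) disjI1[OF w']] less.prems(2) by blast
      have i: "i \<in> nodes T" and wt: "wt (tensor_word B \<epsilon>) w' = wsub T (word_weight \<epsilon>) (n(i := n i - 1))"
        using word_wt_step[OF \<epsilon> less.prems(1) w'] less.prems(3) wshift_wsub[of i T 1] by auto
      \<comment> \<open>The coefficients of w' are nonnegative again and sum to one less, which
        makes the induction on the height work.\<close>
      obtain n' where n': "\<forall>i\<in>nodes T. n' i \<ge> 0" "wt (tensor_word B \<epsilon>) w' = wsub T (word_weight \<epsilon>) n'"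
        using word_content[OF \<epsilon> el] by blast
      have eq: "n' j = (n(i := n i - 1)) j" if "j \<in> nodes T" for j
        using wsub_inj[OF valid _ that] n'(2) wt by metis
      have "(\<Sum>j\<in>nodes T. n' j) = (\<Sum>j\<in>nodes T. (n(i := n i - 1)) j)" by (intro sum.cong) (auto simp: eq)
      also have "\<dots> = (\<Sum>j\<in>nodes T. n j) - 1"
        using i by (simp add: sum.remove[of _ i])
      finally have sum: "(\<Sum>j\<in>nodes T. n' j) = (\<Sum>j\<in>nodes T. n j) - 1" .
      have "(\<Sum>j\<in>nodes T. n' j) \<ge> 0" using n'(1) by (intro sum_nonneg) auto
      then have "nat (\<Sum>j\<in>nodes T. n' j) < N" using sum less.prems(5) by linarith
      then have "same_component (tensor_word B \<epsilon>) (map U \<epsilon>) w'"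
        using less.IH[OF _ el p' n'(2,1) refl] by blast
      moreover have "crystal_edge (tensor_word B \<epsilon>) w' w" using w' el less.prems(1) by (auto simp: crystal_edge_def)
      ultimately show ?thesis unfolding same_component_def by (rule rtranclp.rtrancl_into_rtrancl)
    qed
  qed
  then show "w \<in> top_component B \<epsilon>" using word_content[OF \<epsilon> w] w p top_component_iff[OF \<epsilon>] by blast
qed

end

section \<open>Projections in the linear category\<close>

text \<open>All maps in the theorem are diagonal in the basis of words. In this form composition and
  tensor product become conjunctions of predicates.\<close>

definition select :: "('b \<Rightarrow> bool) \<Rightarrow> ('b \<Rightarrow>\<^sub>0 'k::field) \<Rightarrow> ('b \<Rightarrow>\<^sub>0 'k)" where
  "select P x = (\<Sum>w\<in>Poly_Mapping.keys x. if P w then Poly_Mapping.single w (Poly_Mapping.lookup x w) else 0)"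

lemma lookup_select: "Poly_Mapping.lookup (select P x) w = (if P w then Poly_Mapping.lookup x w else 0)"
proof -
  have "Poly_Mapping.lookup (select P x) w =
      (\<Sum>v\<in>Poly_Mapping.keys x. if v = w then (if P w then Poly_Mapping.lookup x w else 0) else 0)"
    unfolding select_def lookup_sum by (intro sum.cong) (auto simp: lookup_single when_def)
  then show ?thesis by (simp add: in_keys_iff)
qed

lemma select_cong: "(\<And>w. w \<in> Poly_Mapping.keys x \<Longrightarrow> P w \<longleftrightarrow> Q w) \<Longrightarrow> select P x = select Q x"
  unfolding select_def by (intro sum.cong) auto

lemma select_True: "select (\<lambda>_. True) = id"
  by (auto intro!: poly_mapping_eqI simp: lookup_select)

lemma select_compose: "select P \<circ> select Q = select (\<lambda>w. P w \<and> Q w)"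
  by (auto intro!: poly_mapping_eqI simp: lookup_select)

lemma select_foldr: "foldr (\<circ>) (map (\<lambda>k. select (P k)) ks) id = select (\<lambda>w. \<forall>k\<in>set ks. P k w)"
proof (induction ks)
  case Nil
  then show ?case by (simp add: select_True)
next
  case (Cons k ks)
  show ?case
    by (subst list.map, subst foldr_Cons, subst comp_apply) (simp only: Cons.IH select_compose list.set ball_simps)
qed

lemma jones_wenzl_select: "jones_wenzl B \<epsilon> = select (\<lambda>w. w \<in> top_component B \<epsilon>)"
  unfolding jones_wenzl_def linearize_def select_def top_projection_def
  by (intro ext sum.cong) auto

lemma select_single: "select P (Poly_Mapping.single v a) = (if P v then Poly_Mapping.single v a else 0)"
  by (auto intro!: poly_mapping_eqI simp: lookup_select lookup_single when_def)

lemma tensor_vec_single: "tensor_vec (Poly_Mapping.single v a) (Poly_Mapping.single w 1) = Poly_Mapping.single (v @ w) a"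
  by (cases "a = 0") (simp_all add: tensor_vec_def)

lemma tensor_vec_0 [simp]: "tensor_vec 0 y = 0" "tensor_vec x 0 = 0"
  by (simp_all add: tensor_vec_def)

lemma tensor_hom_select:
  "tensor_hom p (select P) (select Q) = select (\<lambda>w. P (take p w) \<and> Q (drop p w))"
  unfolding tensor_hom_def select_def[of "\<lambda>w. P (take p w) \<and> Q (drop p w)"]
  by (intro ext sum.cong) (auto simp: select_single tensor_vec_single)

lemma tensor_hom_select_id:
  "tensor_hom p (select P) id = select (\<lambda>w. P (take p w))"
  "tensor_hom p id (select P) = select (\<lambda>w. P (drop p w))"
  using tensor_hom_select[of p P "\<lambda>_. True"] tensor_hom_select[of p "\<lambda>_. True" P]
  by (simp_all add: select_True)

lemma jones_wenzl_adj_select: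
  "jones_wenzl_adj B \<epsilon> k = select (\<lambda>w. take 2 (drop (k - 1) w) \<in> top_component B [\<epsilon> ! (k - 1), \<epsilon> ! k])"
  unfolding jones_wenzl_adj_def jones_wenzl_select tensor_hom_select_id ..

lemma same_on_select:
  assumes "\<And>w. w \<in> elems C \<Longrightarrow> P w \<longleftrightarrow> Q w"
  shows "same_on C (select P) (select Q)"
  unfolding same_on_def free_space_def using assms by (auto intro!: select_cong)

section \<open>The Jones--Wenzl recursion\<close>

text \<open>Only \<open>top_pair\<close> needs work: if \<alpha>_a occurred, \<open>reach\<close>
  would hold at the start of the path and, by induction along it, at the top, against
  \<open>reach_top\<close>.\<close>

lemma fundamental_words_of_highest_weight_crystals:
  fixes B :: "nat \<Rightarrow> ('v::ab_group_add) set crystal"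
  assumes "valid_type T" "\<And>i. i \<in> nodes T \<Longrightarrow> is_highest_weight_crystal T (fund_weight i) (B i)"
  shows "\<exists>U. fundamental_words T B U"
proof -
  have w: "fund_weight i \<in> weights T" if "i \<in> nodes T" for i
    using that by (auto simp: fund_weight_def weights_def)
  have "\<forall>i\<in>nodes T. \<exists>(M :: 'v uq_rep) u. hw_crystal T M (fund_weight i) u \<and> B i = hw_crystal.C T M u"
  proof
    fix i assume i: "i \<in> nodes T"
    obtain M :: "'v uq_rep" and u where "irreducible_hw_module T M (fund_weight i) u"
      "crystal_base T M (hw_lattice T M u) (hw_basis T M u)"
      "B i = crystal_of_base T M (hw_lattice T M u) (hw_basis T M u)"
      using assms(2)[OF i] unfolding is_highest_weight_crystal_def by (elim exE conjE)
    moreover from this have h: "hw_crystal T M (fund_weight i) u"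
      using w[OF i] assms(1) by (intro hw_crystal.intro)
    ultimately show "\<exists>(M :: 'v uq_rep) u. hw_crystal T M (fund_weight i) u \<and> B i = hw_crystal.C T M u"
      using hw_crystal.C_def[OF h] by metis
  qed
  then obtain M :: "nat \<Rightarrow> 'v uq_rep" and u where h: "\<And>i. i \<in> nodes T \<Longrightarrow> hw_crystal T (M i) (fund_weight i) (u i)"
    "\<And>i. i \<in> nodes T \<Longrightarrow> B i = hw_crystal.C T (M i) (u i)" by metis
  define U where "U = (\<lambda>i. coset (M i) (hw_crystal.L T (M i) (u i)) (u i))"
  have "fundamental_words T B U"
  proof
    show "valid_type T" by fact
    show gen: "generated_crystal T (fund_weight c) (B c) (U c)" if "c \<in> nodes T" for c
      using hw_crystal.generated_C[OF h(1)[OF that]] h(2)[OF that] by (simp add: U_def)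
    fix a c y and n :: "nat \<Rightarrow> int"
    assume a: "a \<in> nodes T" and c: "c \<in> nodes T" and y: "y \<in> elems (B c)"
      and n: "wt (B c) y = wsub T (fund_weight c) n"
      and sc: "same_component (tensor_word B [a, c]) [U a, y] [U a, U c]"
    interpret hw_pair T "M a" "fund_weight a" "u a" "M c" "fund_weight c" "u c"
      by (intro hw_pair.intro h(1) a c)
    have sn: "seminormal (B c)" using gen[OF c] by (simp add: generated_crystal_def)
    have word: "seminormal (tensor_word B [a, c])"
      unfolding tensor_word_def using gen[OF a] gen[OF c]
      by (intro seminormal_tensor_list) (auto simp: generated_crystal_def)
    have ops: "eop (tensor_word B [a, c]) i [b, b'] = map_option (\<lambda>(b, b'). [b, b']) (eop (tensor (B a) (B c)) i (b, b'))"
      "fop (tensor_word B [a, c]) i [b, b'] = map_option (\<lambda>(b, b'). [b, b']) (fop (tensor (B a) (B c)) i (b, b'))"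
      if "b' \<in> elems (B c)" for i b b'
      using tensor_list_Cons[OF sn seminormal_tensor_list[of "[]"] that, of "[]" i] seminormalD(1,2)[OF sn that, of i]
      by (auto simp: tensor_word_def tensor_list_Cons_ops tensor_sel option.map_comp comp_def)
    have reach_word: "\<exists>b1 b1'. w' = [b1, b1'] \<and> reach a (b1, b1')"
      if w: "w = [b, b']" "reach a (b, b')" and e: "eop (tensor_word B [a, c]) i w = Some w' \<or> fop (tensor_word B [a, c]) i w = Some w'"
      for w w' b b' i
    proof -
      have "b' \<in> elems (B c)" using w(2) by (auto simp: reach_def represents_def h(2)[OF c])
      note o = ops[OF this, of i b]
      obtain p where p: "eop (tensor (B a) (B c)) i (b, b') = Some p \<or> fop (tensor (B a) (B c)) i (b, b') = Some p"
        "w' = [fst p, snd p]" using e unfolding w(1) o by (auto split: prod.splits)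
      have "reach a p" using reach_step[OF a refl w(2)] p(1) unfolding h(2)[OF a] h(2)[OF c] by blast
      then show ?thesis using p(2) by (cases p) auto
    qed
    show "n a \<le> 0"
    proof (rule ccontr)
      assume "\<not> n a \<le> 0"
      then have "reach a (U a, y)"
        using reach_start[OF a, of y n] y n h(2)[OF c] by (simp add: U_def)
      from sc have "\<exists>b b'. [U a, U c] = [b, b'] \<and> reach a (b, b')"
        unfolding same_component_def
      proof (induction rule: rtranclp_induct)
        case base
        then show ?case using \<open>reach a (U a, y)\<close> by blast
      next
        case (step w w')
        then obtain i where i: "w \<in> elems (tensor_word B [a, c])" "w' \<in> elems (tensor_word B [a, c])"
          "eop (tensor_word B [a, c]) i w = Some w' \<or> fop (tensor_word B [a, c]) i w = Some w' \<or>
           eop (tensor_word B [a, c]) i w' = Some w \<or> fop (tensor_word B [a, c]) i w' = Some w"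
          unfolding crystal_edge_def by blast
        \<comment> \<open>An edge may be given by an operator applied to either end; as e_i and f_i
          are partial inverses, it can be read in the direction of the path.\<close>
        then have "eop (tensor_word B [a, c]) i w = Some w' \<or> fop (tensor_word B [a, c]) i w = Some w'"
          using seminormalD(4,8)[OF word i(2)] by blast
        with step.IH show ?case using reach_word by blast
      qed
      then show False using reach_top[OF a] by (simp add: U_def)
    qed
  qed
  then show ?thesis by blast
qed

text \<open>Every map involved is a \<open>select\<close>, so each identity reduces to an
  equivalence of predicates on words, supplied by \<open>top_component_pairs\<close> for the word
  and its prefix.\<close>

theorem theorem3p1p3:
  fixes T :: cartan_type
    and B :: "nat \<Rightarrow> ('v::ab_group_add) set crystal"
    and \<epsilon> :: "nat list"
  defines "m \<equiv> length \<epsilon>"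
  defines "j \<equiv> (jones_wenzl B :: nat list \<Rightarrow> ('v set list, 'k::field) lin_endo)"
  assumes "valid_type T"
    and "\<And>i. i \<in> nodes T \<Longrightarrow> is_highest_weight_crystal T (fund_weight i) (B i)"
    and "set \<epsilon> \<subseteq> nodes T"
    and "sorted_wrt (\<le>) \<epsilon> \<or> sorted_wrt (\<ge>) \<epsilon>"
  shows "same_on (tensor_word B \<epsilon>)
           (j \<epsilon>)
           (foldr (\<circ>) (map (jones_wenzl_adj B \<epsilon>) [1..<m]) id)
       \<and> (m \<ge> 2 \<longrightarrow>
            same_on (tensor_word B \<epsilon>)
              (j \<epsilon>)
              (tensor_hom (m - 1) (j (take (m - 1) \<epsilon>)) id \<circ> tensor_hom (m - 2) id (j (drop (m - 2) \<epsilon>)))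
          \<and> same_on (tensor_word B \<epsilon>)
              (j \<epsilon>)
              (tensor_hom (m - 2) id (j (drop (m - 2) \<epsilon>)) \<circ> tensor_hom (m - 1) (j (take (m - 1) \<epsilon>)) id))"
proof -
  obtain U where "fundamental_words T B U"
    using fundamental_words_of_highest_weight_crystals[of T B] assms(3,4) by blast
  then interpret fundamental_words T B U .
  note top = top_component_pairs[OF assms(5,6)]
  have len: "length w = m" if "w \<in> elems (tensor_word B \<epsilon>)" for w
    using tensor_list_length that by (fastforce simp: tensor_word_def m_def)
  have pair: "take 2 (drop k w) = [w ! k, w ! Suc k]" if "Suc k < length w" for k and w :: "'c list"
    using that by (simp add: take_Suc_conv_app_nth numeral_2_eq_2 Cons_nth_drop_Suc[symmetric] hd_drop_conv_nth)
  have 1: "same_on (tensor_word B \<epsilon>) (j \<epsilon>) (foldr (\<circ>) (map (jones_wenzl_adj B \<epsilon>) [1..<m]) id)"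
    unfolding j_def jones_wenzl_select jones_wenzl_adj_select[abs_def] select_foldr
  proof (rule same_on_select)
    fix w assume w: "w \<in> elems (tensor_word B \<epsilon>)"
    have "pairs_top \<epsilon> w \<longleftrightarrow> (\<forall>k\<in>set [1..<m]. take 2 (drop (k - 1) w) \<in> top_component B [\<epsilon> ! (k - 1), \<epsilon> ! k])"
      unfolding pairs_top_def
    proof (intro iffI ballI allI impI)
      fix k assume p: "\<forall>k. Suc k < length \<epsilon> \<longrightarrow> [w ! k, w ! Suc k] \<in> top_component B [\<epsilon> ! k, \<epsilon> ! Suc k]" and "k \<in> set [1..<m]"
      then have "Suc (k - 1) = k" "k < length \<epsilon>" by (auto simp: m_def)
      then show "take 2 (drop (k - 1) w) \<in> top_component B [\<epsilon> ! (k - 1), \<epsilon> ! k]"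
        using spec[OF p, of "k - 1"] pair[of "k - 1" w] len[OF w] by (simp add: m_def)
    next
      fix k assume p: "\<forall>k\<in>set [1..<m]. take 2 (drop (k - 1) w) \<in> top_component B [\<epsilon> ! (k - 1), \<epsilon> ! k]" and k: "Suc k < length \<epsilon>"
      then show "[w ! k, w ! Suc k] \<in> top_component B [\<epsilon> ! k, \<epsilon> ! Suc k]"
        using bspec[OF p, of "Suc k"] pair[of k w] len[OF w] by (simp add: m_def)
    qed
    then show "w \<in> top_component B \<epsilon> \<longleftrightarrow> (\<forall>k\<in>set [1..<m]. take 2 (drop (k - 1) w) \<in> top_component B [\<epsilon> ! (k - 1), \<epsilon> ! k])"
      using top[OF w] by simp
  qed
  \<comment> \<open>The adjacent pairs of the word are those of its first m - 1 letters together
    with the last pair. The first m - 1 labels are again monotone, so the pair criterion applies to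
    them.\<close>
  have 2: "w \<in> top_component B \<epsilon> \<longleftrightarrow> take (m - 1) w \<in> top_component B (take (m - 1) \<epsilon>) \<and>
      drop (m - 2) w \<in> top_component B (drop (m - 2) \<epsilon>)"
    if m2: "m \<ge> 2" and w: "w \<in> elems (tensor_word B \<epsilon>)" for w
  proof -
    have sub: "set (take (m - 1) \<epsilon>) \<subseteq> nodes T" using assms(5) set_take_subset by fastforce
    have mono: "sorted_wrt (\<le>) (take (m - 1) \<epsilon>) \<or> sorted_wrt (\<ge>) (take (m - 1) \<epsilon>)"
      using assms(6) sorted_wrt_take by blast
    have tw: "take (m - 1) w \<in> elems (tensor_word B (take (m - 1) \<epsilon>))"
      using w by (auto simp: tensor_word_def tensor_list_elems_iff)
    have last: "drop (m - 2) xs = [xs ! (m - 2), xs ! (m - 1)]" if "length xs = m" for xs :: "'c list"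
    proof -
      have "Suc (m - 2) = m - 1" "m - 2 < m" "m - 1 < m" using m2 by auto
      then show ?thesis using that m2 Cons_nth_drop_Suc[of "m - 2" xs] Cons_nth_drop_Suc[of "m - 1" xs] by simp
    qed
    have "pairs_top \<epsilon> w \<longleftrightarrow> pairs_top (take (m - 1) \<epsilon>) (take (m - 1) w) \<and>
        [w ! (m - 2), w ! (m - 1)] \<in> top_component B [\<epsilon> ! (m - 2), \<epsilon> ! (m - 1)]" (is "_ \<longleftrightarrow> _ \<and> ?l")
    proof -
      define Q where "Q = (\<lambda>k. [w ! k, w ! Suc k] \<in> top_component B [\<epsilon> ! k, \<epsilon> ! Suc k])"
      have "pairs_top \<epsilon> w \<longleftrightarrow> (\<forall>k. Suc k < m \<longrightarrow> Q k)" by (simp add: pairs_top_def Q_def m_def)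
      also have "\<dots> \<longleftrightarrow> (\<forall>k. Suc k < m - 1 \<longrightarrow> Q k) \<and> Q (m - 2)"
      proof (intro iffI conjI allI impI)
        fix k assume h: "(\<forall>k. Suc k < m - 1 \<longrightarrow> Q k) \<and> Q (m - 2)" and k: "Suc k < m"
        show "Q k"
        proof (cases "Suc k < m - 1")
          case False
          then have "k = m - 2" using k by auto
          then show ?thesis using h by simp
        qed (use h in blast)
      qed (use m2 in auto)
      also have "(\<forall>k. Suc k < m - 1 \<longrightarrow> Q k) \<longleftrightarrow> pairs_top (take (m - 1) \<epsilon>) (take (m - 1) w)"
        unfolding pairs_top_def Q_def by (auto simp: m_def)
      also have "Q (m - 2) \<longleftrightarrow> ?l"
      proof -
        have "Suc (m - 2) = m - 1" using m2 by simp
        then show ?thesis by (simp add: Q_def)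
      qed
      finally show ?thesis .
    qed
    then show ?thesis
      using top[OF w] top_component_pairs[OF sub mono tw] last[OF len[OF w]] last[of \<epsilon>] by (simp add: m_def)
  qed
  have 3: "same_on (tensor_word B \<epsilon>) (j \<epsilon>)
      (tensor_hom (m - 1) (j (take (m - 1) \<epsilon>)) id \<circ> tensor_hom (m - 2) id (j (drop (m - 2) \<epsilon>)))" if "m \<ge> 2"
    unfolding j_def jones_wenzl_select tensor_hom_select_id select_compose
    by (rule same_on_select) (use 2[OF that] in blast)
  have 4: "same_on (tensor_word B \<epsilon>) (j \<epsilon>)
      (tensor_hom (m - 2) id (j (drop (m - 2) \<epsilon>)) \<circ> tensor_hom (m - 1) (j (take (m - 1) \<epsilon>)) id)" if "m \<ge> 2"
    unfolding j_def jones_wenzl_select tensor_hom_select_id select_compose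
    by (rule same_on_select) (use 2[OF that] in blast)
  show ?thesis using 1 3 4 by blast
qed

end
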